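(* Fix $\mu\ge0$. Assume that $R^L>0$, $R^R>0$ and $\mathcal Q=\operatorname{diag}(Q_\mu,Q)=D'D\ge0$ for some matrix $D$; that $(\operatorname{diag}(A,A),\mathcal Q^{1/2})$ is observable and $(A,C)$ is detectable; and that $(A,Q_\omega)$ is stabilizable. Then the system $$x_{k+1}=Ax_k+BU_k+B^L\tilde u_k^L+\omega_k$$ is bounded in the mean-square sense if and only if there exist solutions $Z,X,S$ to the algebraic Riccati equations $$Z=A'ZA+Q_\mu-K'\Upsilon K,\quad X=A'\Theta A+Q_\mu-L'\Lambda^{-1}L,\quad S=A'SA-\mu Q+K'\Upsilon K-N'M^{-1}N$$ such that $Z>0$, $Z+S>0$, $\Theta>0$ and $\sqrt p\,|\lambda_{\max}(A-B^L\Lambda^{-1}L)|<1$. In this case, the optimal stabilizing controllers, i.e. those which make the system bounded in the mean-square sense and minimize $\bar J_\infty(\mu)$, are $$U_k^*=-K\hat x^{R*}_{k|k}-\bar K\,\mathbb E\hat x^{R*}_{k|k},\qquad \tilde u_k^{L*}=-\Lambda^{-1}L\big(\hat x^{L*}_{k|k}-\hat x^{R*}_{k|k}\big),$$ where $\hat x^{L*}_{k|k},\hat x^{R*}_{k|k}$ are the local and remote estimates of the corresponding optimal state.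
   Context: Prime denotes transpose; $>0$ ($\ge 0$) means positive (semi-)definite; $\lambda_{\max}(\cdot)$ is an eigenvalue of largest absolute value. System: $x_{k+1}=Ax_k+B^Lu_k^L+B^Ru_k^R+\omega_k$, $k\ge0$, $x_k\in\mathbb R^n$, $u_k^L\in\mathbb R^{m_1}$ (local control), $u_k^R\in\mathbb R^{m_2}$ (remote control). $x_0$ is Gaussian with mean $\bar x_0$ and covariance $\Sigma_{init}$; $\{\omega_k\}$ is i.i.d. Gaussian with mean $0$ and covariance $Q_\omega$. Observations: $y_k^L=Cx_k+v_k\in\mathbb R^n$, $y_k^R=\eta_k\hat x^L_{k|k}$, with $\{v_k\}$ i.i.d. Gaussian with mean $0$ and covariance $Q_v$, and $\{\eta_k\}$ i.i.d. Bernoulli, $\mathbb P(\eta_k=0)=p$, $\mathbb P(\eta_k=1)=1-p$; $x_0,\{\omega_k\},\{v_k\},\{\eta_k\}$ are mutually independent. Information: $\mathcal F^L_k=\sigma(y^L_0,\dots,y^L_k,y^R_0,\dots,y^R_k)$, $\mathcal F^R_k=\sigma(y^R_0,\dots,y^R_k)$; $\hat x^L_{k|k}=\mathbb E[x_k\mid\mathcal F^L_k]$, $\hat x^R_{k|k}=\mathbb E[x_k\mid\mathcal F^R_k]$. Decomposition: $u_k^L$ is $\mathcal F_k^L$-measurable, $u_k^R$ is $\mathcal F^R_k$-measurable, $\hat u_k^L=\mathbb E[u_k^L\mid\mathcal F^R_k]$, $\tilde u_k^L=u_k^L-\hat u_k^L$ (so $\mathbb E[\tilde u^L_k\mid\mathcal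 F^R_k]=0$), $U_k=\begin{bmatrix}\hat u_k^L\\ u_k^R\end{bmatrix}$, $B=[B^L\ B^R]$, $R=\operatorname{diag}(R^L,R^R)$. With these the system takes the form in the claim. The system is called bounded in the mean-square sense if there exist an $\mathcal F^R_k$-measurable $U_k$ and an $\mathcal F^L_k$-measurable $\tilde u^L_k$ (as in the decomposition) such that, for any Gaussian initial state, $\limsup_{k\to\infty}\mathbb E[x_k'x_k]<\infty$. Cost: $Q\ge0$, $Q_\mu=Q+\mu Q$, and $$\bar J_\infty(\mu)=\lim_{N\to\infty}\frac1N\,\mathbb E\Big\{\sum_{k=0}^N x_k'Q_\mu x_k-\mu\,\mathbb Ex_k'\,Q\,\mathbb Ex_k+U_k'RU_k+(\tilde u_k^L)'R^L\tilde u_k^L\Big\}.$$ Notation for the algebraic Riccati equations: $\Upsilon=B'ZB+R$, $K=\Upsilon^{-1}B'ZA$, $M=B'ZB+B'SB+R$, $N=B'ZA+B'SA$ (the matrix $N$, distinct from the horizon in the cost), $\bar K=M^{-1}N-\Upsilon^{-1}B'ZA$, $\Theta=(1-p)Z+pX$, $\Lambda=(B^L)'\Theta B^L+R^L$, $L=(B^L)'\Theta A$. *)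

theory Defs
  imports "HOL-Probability.Probability"
begin

section \<open>Matrices\<close>

definition psd :: "real^'n^'n \<Rightarrow> bool" where
  "psd W \<longleftrightarrow> transpose W = W \<and> (\<forall>x. 0 \<le> x \<bullet> (W *v x))"

definition pos_def :: "real^'n^'n \<Rightarrow> bool" where
  "pos_def W \<longleftrightarrow> transpose W = W \<and> (\<forall>x. x \<noteq> 0 \<longrightarrow> 0 < x \<bullet> (W *v x))"

definition psd_sqrt :: "real^'n^'n \<Rightarrow> real^'n^'n" where
  "psd_sqrt W = (THE V. psd V \<and> V ** V = W)"

definition block_diag :: "real^'a^'a \<Rightarrow> real^'b^'b \<Rightarrow> real^('a + 'b)^('a + 'b)" where
  "block_diag F G = (\<chi> i j. case (i, j) of
       (Inl a, Inl a') \<Rightarrow> F $ a $ a'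
     | (Inr b, Inr b') \<Rightarrow> G $ b $ b'
     | _ \<Rightarrow> 0)"

definition hcat :: "real^'a^'n \<Rightarrow> real^'b^'n \<Rightarrow> real^('a + 'b)^'n" where
  "hcat F G = (\<chi> i j. case j of Inl a \<Rightarrow> F $ i $ a | Inr b \<Rightarrow> G $ i $ b)"

text \<open>Eigenvalues of a real matrix are its complex eigenvalues.\<close>

definition eigenvalue_of :: "real^'n^'n \<Rightarrow> complex \<Rightarrow> bool" where
  "eigenvalue_of W l \<longleftrightarrow>
     (\<exists>z::complex^'n. z \<noteq> 0 \<and> (\<chi> i j. complex_of_real (W $ i $ j)) *v z = l *s z)"

definition lambda_max :: "real^'n^'n \<Rightarrow> complex" where
  "lambda_max W = (SOME l. eigenvalue_of W l \<and> (\<forall>l'. eigenvalue_of W l' \<longrightarrow> cmod l' \<le> cmod l))"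

definition schur_stable :: "real^'n^'n \<Rightarrow> bool" where
  "schur_stable W \<longleftrightarrow> (\<forall>l. eigenvalue_of W l \<longrightarrow> cmod l < 1)"

definition stabilizable :: "real^'n^'n \<Rightarrow> real^'m^'n \<Rightarrow> bool" where
  "stabilizable F G \<longleftrightarrow> (\<exists>E. schur_stable (F + G ** E))"

definition detectable :: "real^'n^'n \<Rightarrow> real^'n^'m \<Rightarrow> bool" where
  "detectable F H \<longleftrightarrow> (\<exists>E. schur_stable (F + E ** H))"

text \<open>The initial state of \<open>x\<^sub>k\<^sub>+\<^sub>1 = F x\<^sub>k\<close> is determined by the outputs \<open>H x\<^sub>k\<close>.\<close>

definition observable :: "real^'n^'n \<Rightarrow> real^'n^'m \<Rightarrow> bool" where
  "observable F H \<longleftrightarrow>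
     (\<forall>x y. (\<forall>k. H *v (((*v) F ^^ k) x) = H *v (((*v) F ^^ k) y)) \<longrightarrow> x = y)"

section \<open>Riccati equations\<close>

definition Q_mu :: "real \<Rightarrow> real^'n^'n \<Rightarrow> real^'n^'n" where
  "Q_mu \<mu> Q = Q + \<mu> *\<^sub>R Q"

definition Upsilon_mat :: "real^'m^'n \<Rightarrow> real^'m^'m \<Rightarrow> real^'n^'n \<Rightarrow> real^'m^'m" where
  "Upsilon_mat B R Z = transpose B ** Z ** B + R"

definition K_gain :: "real^'n^'n \<Rightarrow> real^'m^'n \<Rightarrow> real^'m^'m \<Rightarrow> real^'n^'n \<Rightarrow> real^'n^'m" where
  "K_gain A B R Z = matrix_inv (Upsilon_mat B R Z) ** transpose B ** Z ** A"

definition M_mat :: "real^'m^'n \<Rightarrow> real^'m^'m \<Rightarrow> real^'n^'n \<Rightarrow> real^'n^'n \<Rightarrow> real^'m^'m" where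
  "M_mat B R Z S = transpose B ** Z ** B + transpose B ** S ** B + R"

definition N_mat :: "real^'n^'n \<Rightarrow> real^'m^'n \<Rightarrow> real^'n^'n \<Rightarrow> real^'n^'n \<Rightarrow> real^'n^'m" where
  "N_mat A B Z S = transpose B ** Z ** A + transpose B ** S ** A"

definition Kbar_gain ::
    "real^'n^'n \<Rightarrow> real^'m^'n \<Rightarrow> real^'m^'m \<Rightarrow> real^'n^'n \<Rightarrow> real^'n^'n \<Rightarrow> real^'n^'m" where
  "Kbar_gain A B R Z S =
     matrix_inv (M_mat B R Z S) ** N_mat A B Z S
       - matrix_inv (Upsilon_mat B R Z) ** transpose B ** Z ** A"

definition Theta_mat :: "real \<Rightarrow> real^'n^'n \<Rightarrow> real^'n^'n \<Rightarrow> real^'n^'n" where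
  "Theta_mat p Z X = (1 - p) *\<^sub>R Z + p *\<^sub>R X"

definition Lambda_mat :: "real^'m^'n \<Rightarrow> real^'m^'m \<Rightarrow> real^'n^'n \<Rightarrow> real^'m^'m" where
  "Lambda_mat BL RL Theta = transpose BL ** Theta ** BL + RL"

definition L_mat :: "real^'n^'n \<Rightarrow> real^'m^'n \<Rightarrow> real^'n^'n \<Rightarrow> real^'n^'m" where
  "L_mat A BL Theta = transpose BL ** Theta ** A"

definition riccati_solution ::
    "real^'n^'n \<Rightarrow> real^'m1^'n \<Rightarrow> real^'m2^'n \<Rightarrow> real^'n^'n \<Rightarrow> real^'m1^'m1 \<Rightarrow> real^'m2^'m2
       \<Rightarrow> real \<Rightarrow> real \<Rightarrow> real^'n^'n \<Rightarrow> real^'n^'n \<Rightarrow> real^'n^'n \<Rightarrow> bool" where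
  "riccati_solution A BL BR Q RL RR \<mu> p Z X S \<longleftrightarrow>
     (let B = hcat BL BR; R = block_diag RL RR;
          Upsilon = Upsilon_mat B R Z; K = K_gain A B R Z;
          MM = M_mat B R Z S; NN = N_mat A B Z S;
          Theta = Theta_mat p Z X; Lambda = Lambda_mat BL RL Theta; L = L_mat A BL Theta
      in Z = transpose A ** Z ** A + Q_mu \<mu> Q - transpose K ** Upsilon ** K
       \<and> X = transpose A ** Theta ** A + Q_mu \<mu> Q - transpose L ** matrix_inv Lambda ** L
       \<and> S = transpose A ** S ** A - \<mu> *\<^sub>R Q + transpose K ** Upsilon ** K
             - transpose NN ** matrix_inv MM ** NN)"

definition stabilizing_solution ::
    "real^'n^'n \<Rightarrow> real^'m1^'n \<Rightarrow> real^'m2^'n \<Rightarrow> real^'n^'n \<Rightarrow> real^'m1^'m1 \<Rightarrow> real^'m2^'m2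
       \<Rightarrow> real \<Rightarrow> real \<Rightarrow> real^'n^'n \<Rightarrow> real^'n^'n \<Rightarrow> real^'n^'n \<Rightarrow> bool" where
  "stabilizing_solution A BL BR Q RL RR \<mu> p Z X S \<longleftrightarrow>
     riccati_solution A BL BR Q RL RR \<mu> p Z X S \<and>
     pos_def Z \<and> pos_def (Z + S) \<and> pos_def (Theta_mat p Z X) \<and>
     (let Theta = Theta_mat p Z X
      in sqrt p * cmod (lambda_max
           (A - BL ** matrix_inv (Lambda_mat BL RL Theta) ** L_mat A BL Theta)) < 1)"

section \<open>Probability\<close>

text \<open>A law is Gaussian if all its one-dimensional projections are; the covariance may be
  singular, in which case some projections are point masses.\<close>

definition gaussian_law :: "(real^'n) measure \<Rightarrow> real^'n \<Rightarrow> real^'n^'n \<Rightarrow> bool" where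
  "gaussian_law \<nu> m W \<longleftrightarrow>
     prob_space \<nu> \<and> sets \<nu> = sets borel \<and> psd W \<and>
     (\<forall>a. distr \<nu> borel (\<lambda>x. a \<bullet> x) =
        (if a \<bullet> (W *v a) = 0 then return borel (a \<bullet> m)
         else density lborel (normal_density (a \<bullet> m) (sqrt (a \<bullet> (W *v a))))))"

definition gaussian_rv :: "'s measure \<Rightarrow> ('s \<Rightarrow> real^'n) \<Rightarrow> real^'n \<Rightarrow> real^'n^'n \<Rightarrow> bool" where
  "gaussian_rv P f m W \<longleftrightarrow> f \<in> borel_measurable P \<and> gaussian_law (distr P borel f) m W"

definition generated_by :: "'s measure \<Rightarrow> ('s \<Rightarrow> real^'n) set \<Rightarrow> 's measure" where
  "generated_by P fs = sigma (space P) (\<Union>f\<in>fs. {f -` E \<inter> space P | E. E \<in> sets borel})"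

definition vec_cond_exp :: "'s measure \<Rightarrow> 's measure \<Rightarrow> ('s \<Rightarrow> real^'n) \<Rightarrow> 's \<Rightarrow> real^'n" where
  "vec_cond_exp P F f s = (\<chi> i. real_cond_exp P F (\<lambda>s. f s $ i) s)"

datatype noise_index = Proc nat | Obs nat | Chan nat

text \<open>The space \<open>M\<close> carries the noises \<open>w\<close>, \<open>v\<close> and the channel variables \<open>eta\<close>; the
  initial state is adjoined below as an independent factor.\<close>

locale ncs_noise = prob_space M for M :: "'w measure" +
  fixes p :: real and Qw Qv :: "real^'n^'n"
    and w v :: "nat \<Rightarrow> 'w \<Rightarrow> real^'n" and eta :: "nat \<Rightarrow> 'w \<Rightarrow> real"
  assumes w_gaussian: "\<And>k. gaussian_rv M (w k) 0 Qw"
    and v_gaussian: "\<And>k. gaussian_rv M (v k) 0 Qv"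
    and eta_measurable: "\<And>k. eta k \<in> borel_measurable M"
    and eta_0: "\<And>k. prob {s \<in> space M. eta k s = 0} = p"
    and eta_1: "\<And>k. prob {s \<in> space M. eta k s = 1} = 1 - p"
    and noise_indep:
      "indep_sets (\<lambda>i. case i of
           Proc k \<Rightarrow> {w k -` E \<inter> space M | E. E \<in> sets borel}
         | Obs k \<Rightarrow> {v k -` E \<inter> space M | E. E \<in> sets borel}
         | Chan k \<Rightarrow> {eta k -` E \<inter> space M | E. E \<in> sets borel}) UNIV"

section \<open>The controlled system\<close>

text \<open>Below, \<open>\<mu>0\<close> is the law of the initial state, and a point of the sample space is a pair
  of an initial state and a noise outcome.  The processes \<open>U\<close> and \<open>ut\<close> are
  \<open>U\<^sub>k = (E[u\<^sub>k\<^sup>L | F\<^sub>k\<^sup>R], u\<^sub>k\<^sup>R)\<close> and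
  \<open>u\<^sub>k\<^sup>L - E[u\<^sub>k\<^sup>L | F\<^sub>k\<^sup>R]\<close>.\<close>

locale ncs =
  fixes A :: "real^'n^'n" and BL :: "real^'m1^'n" and BR :: "real^'m2^'n" and C :: "real^'n^'n"
    and M :: "'w measure"
    and w v :: "nat \<Rightarrow> 'w \<Rightarrow> real^'n" and eta :: "nat \<Rightarrow> 'w \<Rightarrow> real"
begin

definition Prob :: "(real^'n) measure \<Rightarrow> ((real^'n) \<times> 'w) measure" where
  "Prob \<mu>0 = \<mu>0 \<Otimes>\<^sub>M M"

primrec state ::
    "(nat \<Rightarrow> (real^'n) \<times> 'w \<Rightarrow> real^('m1 + 'm2)) \<Rightarrow> (nat \<Rightarrow> (real^'n) \<times> 'w \<Rightarrow> real^'m1)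
       \<Rightarrow> nat \<Rightarrow> (real^'n) \<times> 'w \<Rightarrow> real^'n" where
  "state U ut 0 = fst"
| "state U ut (Suc k) =
     (\<lambda>s. A *v state U ut k s + hcat BL BR *v U k s + BL *v ut k s + w k (snd s))"

definition yL where
  "yL U ut k s = C *v state U ut k s + v k (snd s)"

text \<open>Since \<open>y\<^sub>k\<^sup>R\<close> is itself part of the local information at time \<open>k\<close>, the equations
  \<open>y\<^sub>k\<^sup>R = \<eta>\<^sub>k E[x\<^sub>k | F\<^sub>k\<^sup>L]\<close> are circular, and read as a fixed-point condition they
  also have non-causal solutions.  The estimate put on the channel is therefore the one formed
  from \<open>y\<^sub>0\<^sup>L, \<dots>, y\<^sub>k\<^sup>L, y\<^sub>0\<^sup>R, \<dots>, y\<^sub>k\<^sub>-\<^sub>1\<^sup>R\<close>; it agrees almost surely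
  with \<open>E[x\<^sub>k | F\<^sub>k\<^sup>L]\<close>, because \<open>\<eta>\<^sub>k\<close> is independent of that information and of
  \<open>x\<^sub>k\<close>.\<close>

fun yR ::
    "(real^'n) measure \<Rightarrow> (nat \<Rightarrow> (real^'n) \<times> 'w \<Rightarrow> real^('m1 + 'm2))
       \<Rightarrow> (nat \<Rightarrow> (real^'n) \<times> 'w \<Rightarrow> real^'m1) \<Rightarrow> nat \<Rightarrow> (real^'n) \<times> 'w \<Rightarrow> real^'n" where
  "yR \<mu>0 U ut k = (\<lambda>s. eta k (snd s) *\<^sub>R
     vec_cond_exp (Prob \<mu>0)
       (generated_by (Prob \<mu>0)
          ((\<lambda>j. yL U ut j) ` {..k} \<union> (\<lambda>j. yR \<mu>0 U ut j) ` {..<k}))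
       (state U ut k) s)"

declare yR.simps [simp del]

definition FL where
  "FL \<mu>0 U ut k =
     generated_by (Prob \<mu>0) ((\<lambda>j. yL U ut j) ` {..k} \<union> (\<lambda>j. yR \<mu>0 U ut j) ` {..k})"

definition FR where
  "FR \<mu>0 U ut k = generated_by (Prob \<mu>0) ((\<lambda>j. yR \<mu>0 U ut j) ` {..k})"

definition xhatL where
  "xhatL \<mu>0 U ut k = vec_cond_exp (Prob \<mu>0) (FL \<mu>0 U ut k) (state U ut k)"

definition xhatR where
  "xhatR \<mu>0 U ut k = vec_cond_exp (Prob \<mu>0) (FR \<mu>0 U ut k) (state U ut k)"

definition admissible where
  "admissible \<mu>0 U ut \<longleftrightarrow>
     (\<forall>k. U k \<in> borel_measurable (FR \<mu>0 U ut k) \<and> integrable (Prob \<mu>0) (U k)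
        \<and> ut k \<in> borel_measurable (FL \<mu>0 U ut k) \<and> integrable (Prob \<mu>0) (ut k)
        \<and> (AE s in Prob \<mu>0. vec_cond_exp (Prob \<mu>0) (FR \<mu>0 U ut k) (ut k) s = 0))"

text \<open>A strategy assigns control processes to every initial law: the controllers know the law
  of the initial state, on which the estimates they use depend.\<close>

definition stabilizing where
  "stabilizing U ut \<longleftrightarrow>
     (\<forall>\<mu>0 m W. gaussian_law \<mu>0 m W \<longrightarrow>
        admissible \<mu>0 (U \<mu>0) (ut \<mu>0) \<and>
        limsup (\<lambda>k. \<integral>\<^sup>+ s. ennreal (state (U \<mu>0) (ut \<mu>0) k s \<bullet> state (U \<mu>0) (ut \<mu>0) k s)
                     \<partial>Prob \<mu>0) < \<infinity>)"

definition ms_bounded :: bool where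
  "ms_bounded \<longleftrightarrow> (\<exists>U ut. stabilizing U ut)"

text \<open>The nonnegative part of the cost is an integral in the extended nonnegative reals, so
  controls with infinite second moment have infinite cost.\<close>

definition average_cost where
  "average_cost Q RL RR \<mu> \<mu>0 U ut N =
     ereal (1 / real N) *
       (enn2ereal (\<integral>\<^sup>+ s. ennreal (\<Sum>k\<le>N.
            state U ut k s \<bullet> (Q_mu \<mu> Q *v state U ut k s)
            + U k s \<bullet> (block_diag RL RR *v U k s)
            + ut k s \<bullet> (RL *v ut k s)) \<partial>Prob \<mu>0)
        - ereal (\<Sum>k\<le>N. \<mu> * (integral\<^sup>L (Prob \<mu>0) (state U ut k)
                               \<bullet> (Q *v integral\<^sup>L (Prob \<mu>0) (state U ut k)))))"

text \<open>The cost is the limit of \<open>average_cost\<close>; competitors are those stabilizing strategies for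
  which the limit exists, possibly infinite.\<close>

definition optimal_stabilizing where
  "optimal_stabilizing Q RL RR \<mu> U ut \<longleftrightarrow>
     stabilizing U ut \<and>
     (\<forall>\<mu>0 m W. gaussian_law \<mu>0 m W \<longrightarrow>
        (\<exists>J::real. average_cost Q RL RR \<mu> \<mu>0 (U \<mu>0) (ut \<mu>0) \<longlonglongrightarrow> ereal J \<and>
           (\<forall>U' ut' J'. stabilizing U' ut' \<and>
                average_cost Q RL RR \<mu> \<mu>0 (U' \<mu>0) (ut' \<mu>0) \<longlonglongrightarrow> J'
              \<longrightarrow> ereal J \<le> J')))"

definition feedback_law where
  "feedback_law K Kbar G U ut \<longleftrightarrow>
     (\<forall>\<mu>0 m W. gaussian_law \<mu>0 m W \<longrightarrow>
        (\<forall>k. \<forall>s \<in> space (Prob \<mu>0).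
           U \<mu>0 k s = - (K *v xhatR \<mu>0 (U \<mu>0) (ut \<mu>0) k s)
                      - Kbar *v integral\<^sup>L (Prob \<mu>0) (xhatR \<mu>0 (U \<mu>0) (ut \<mu>0) k) \<and>
           ut \<mu>0 k s = - (G *v (xhatL \<mu>0 (U \<mu>0) (ut \<mu>0) k s - xhatR \<mu>0 (U \<mu>0) (ut \<mu>0) k s))))"

end

end

theory Submission
 imports Defs "HOL-Computational_Algebra.Fundamental_Theorem_Algebra"
begin

text \<open>Write \<open>P = Z + S\<close>. The state is the sum of its mean \<open>m\<close>, of \<open>xR - m\<close>, of \<open>xL - xR\<close> and of the
 filter error, and these parts are orthogonal. Completing squares in the three Riccati equations
 (the one of \<open>P\<close> has weight \<open>Q\<close>, those of \<open>Z\<close> and \<open>X\<close> have weight \<open>Q_mu\<close>) shows that the stage cost plus the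
 increment of \<open>V = m'Pm + E|xR - m|\<^sup>2\<^sub>Z + E|xL - xR|\<^sup>2\<^sub>X\<close> is at least a number that depends only on the
 filter covariances, with equality for the stated feedback. The lower bound uses that with
 probability \<open>p\<close> nothing is received, so the error of any remote estimate keeps the fraction \<open>p\<close> of the
 energy of the prediction error. Equality uses that a received zero estimate is almost surely
 predicted to be zero, as a nondegenerate Gaussian law has no atoms.

 Necessity: a bounded state bounds the trace of \<open>W\<^sub>j Qw\<close> along the value iterations \<open>W\<^sub>j\<close> of the Riccati
 equations; stabilizability of \<open>(A, Qw)\<close> then bounds \<open>W\<^sub>j\<close> itself, so these monotone sequences converge.

 The average cost converges although, for singular \<open>Qv\<close>, the filter covariance may oscillate for ever:
 its entries are limits of ratios of exponential polynomials, and bounded ratios of this kind have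
 Cesaro means because a trigonometric polynomial is small only on a set of small density.\<close>

text \<open>Controls may be nonlinear functions of the received data, so the closed-loop state need
  not be Gaussian. By linearity it is a free Gaussian state plus a control part known from past
  information, and all estimation is done on the free plant. The field used there contains the free
  observations up to a time and every channel variable, past and future: it is large enough for any
  controller, and a centred Gaussian error uncorrelated with those observations is still independent
  of it. Orthogonality is then phrased as "integrates to zero over each set of the field".

  The mean carries the weight \<open>Q\<close> because \<open>Q_mu - \<mu> Q = Q\<close>. Writing
  \<open>Theta = Z + p (X - Z)\<close> reduces the effect of a packet to an inequality weighted by
  \<open>X - Z\<close>, so \<open>Z <= X\<close> has to be derived; it comes from stability of
  \<open>A - BL G\<close> scaled by \<open>sqrt p\<close>.

  A singular innovation covariance rules out the usual closed formula for the filter. The covariance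
  is therefore perturbed by \<open>ep\<close>, which gives ratios of polynomials in
  \<open>ep\<close>, and the limit \<open>ep -> 0\<close> is read off from their
  coefficients.\<close>

abbreviation qf :: "real^'n^'n \<Rightarrow> real^'n \<Rightarrow> real" where "qf W x \<equiv> x \<bullet> (W *v x)"

abbreviation bm :: "'a measure \<Rightarrow> ('a \<Rightarrow> 'b::topological_space) set" where "bm \<equiv> borel_measurable"

abbreviation EV :: "'a measure \<Rightarrow> ('a \<Rightarrow> 'b::{banach, second_countable_topology}) \<Rightarrow> 'b"
 where "EV \<equiv> integral\<^sup>L"

lemmas EV_cong = Bochner_Integration.integral_cong[OF refl]

abbreviation seq_lim :: "(nat \<Rightarrow> 'a::topological_space) \<Rightarrow> 'a \<Rightarrow> bool" (infix "---->" 60)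
 where "X ----> L \<equiv> X \<longlonglongrightarrow> L"

abbreviation tp :: "real^'n^'m \<Rightarrow> real^'m^'n" where "tp \<equiv> transpose"

abbreviation pre :: "'a measure \<Rightarrow> ('a \<Rightarrow> 'b::topological_space) \<Rightarrow> 'a set set" where
 "pre M f \<equiv> {f -` E \<inter> space M |E. E \<in> sets borel}"

abbreviation eventually_nat :: "(nat \<Rightarrow> bool) \<Rightarrow> bool" (binder "EVT " 10) where
 "eventually_nat P \<equiv> eventually P sequentially"

lemmas mv_scaleR = scaleR_matrix_vector_assoc[symmetric]
 and mv_mult = matrix_vector_mul_assoc[symmetric]
 and mv_assoc = matrix_vector_mul_assoc
 and mv_diff = matrix_vector_mult_diff_distrib
 and mv_add = matrix_vector_right_distrib
 and mv_rdiff = matrix_vector_mult_diff_rdistrib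
 and lim_cong = Lim_transform_eventually
 and mm_assoc = matrix_mul_assoc
 and mv_def = matrix_vector_mult_def
 and ev_gt = eventually_gt_at_top
 and bm_add = borel_measurable_add
 and bm_diff = borel_measurable_diff
 and pow2 = power2_eq_square
 and sum_dl = sum_distrib_left

section \<open>Exponential polynomials and Cesaro means\<close>

text \<open>Frequency 0 is excluded and equality holds only for large \<open>k\<close>: the
  nilpotent part of a recurrence dies out after finitely many steps and is absorbed this way. The
  set \<open>L\<close> is explicit because later arguments put several sequences over one common
  spectrum.\<close>

definition expoly_on :: "complex set => (nat => complex) => bool" where "expoly_on L f \<longleftrightarrow> finite L & 0 ~: L &
  (EX q. EVT k. f k = (SUM l:L. poly (q l) (of_nat k)*l^k))"

definition expoly :: "(nat => complex) => bool" where "expoly f \<longleftrightarrow> (EX L. expoly_on L f)"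

lemma expoly_on_mono: assumes "expoly_on L f" "L \<subseteq> L'" "finite L'" "0 ~: L'" shows "expoly_on L' f" proof -
 obtain q where q: "EVT k. f k = (SUM l:L. poly (q l) (of_nat k)*l^k)" using assms(1) unfolding expoly_on_def by blast
 have "(SUM l:L. poly (q l) (of_nat k)*l^k) = (SUM l:L'. poly (if l : L then q l else 0) (of_nat k)*l^k)" for k
  by (rule sum.mono_neutral_cong_left) (use assms in auto)
 thus ?thesis using q assms(3,4) unfolding expoly_on_def by (auto intro!: exI[of _ "%l. if l : L then q l else 0"])
qed

lemma expoly_cong: assumes "expoly f" "EVT k. f k = g k" shows "expoly g" proof - obtain L q where L: "finite L" "0 ~: L"
  and q: "EVT k. f k = (SUM l:L. poly (q l) (of_nat k)*l^k)" using assms(1) unfolding expoly_def expoly_on_def by blast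
 have "EVT k. g k = (SUM l:L. poly (q l) (of_nat k)*l^k)" using q assms(2) by eventually_elim simp
 thus ?thesis using L unfolding expoly_def expoly_on_def by blast
qed

lemma expoly_term: assumes "l ~= 0" shows "expoly (%k. poly p (of_nat k)*l^k)" unfolding expoly_def expoly_on_def
 by (rule exI[of _ "{l}"]) (use assms in \<open>auto intro!: exI[of _ "%_. p"]\<close>)

lemma expoly_zero: "expoly (%_. 0)" unfolding expoly_def expoly_on_def by (rule exI[of _ "{}"]) auto

lemma expoly_const: "expoly (%_. c)" using expoly_term[of 1 "[:c:]"] by simp

lemma expoly_add: assumes "expoly f" "expoly g" shows "expoly (%k. f k+g k)" proof -
 obtain L L' where "expoly_on L f" "expoly_on L' g" using assms unfolding expoly_def by blast
 hence f: "expoly_on (L Un L') f" and g: "expoly_on (L Un L') g" by (auto intro: expoly_on_mono dest: expoly_on_def[THEN iffD1])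
 then obtain q q' where "EVT k. f k = (SUM l:L Un L'. poly (q l) (of_nat k)*l^k)"
  "EVT k. g k = (SUM l:L Un L'. poly (q' l) (of_nat k)*l^k)" unfolding expoly_on_def by blast
 hence "EVT k. f k+g k = (SUM l:L Un L'. poly (q l+q' l) (of_nat k)*l^k)" by eventually_elim (simp add: sum.distrib algebra_simps)
 hence "expoly_on (L Un L') (%k. f k+g k)" using f unfolding expoly_on_def by (auto intro: exI[of _ "%l. q l+q' l"])
 thus ?thesis unfolding expoly_def by blast
qed

lemma expoly_sum: assumes "!!i. i : I ==> expoly (f i)" shows "expoly (%k. SUM i:I. f i k)"
 using assms by (induction I rule: infinite_finite_induct) (auto intro: expoly_zero expoly_add)

lemma expoly_mult: assumes "expoly f" "expoly g" shows "expoly (%k. f k*g k)" proof -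
 obtain L q L' q' where L: "finite L" "0 ~: L" "finite L'" "0 ~: L'" and
  q: "EVT k. f k = (SUM l:L. poly (q l) (of_nat k)*l^k)" "EVT k. g k = (SUM l:L'. poly (q' l) (of_nat k)*l^k)"
  using assms unfolding expoly_def expoly_on_def by blast
 have "expoly (%k. SUM l:L. SUM l':L'. poly (q l*q' l') (of_nat k)*(l*l')^k)" by (intro expoly_sum expoly_term) (use L in auto)
 moreover have "EVT k. (SUM l:L. SUM l':L'. poly (q l*q' l') (of_nat k)*(l*l')^k) = f k*g k" using q proof eventually_elim
  case (elim k) show ?case unfolding elim sum_product by (intro sum.cong refl) (simp add: power_mult_distrib mult_ac)
 qed ultimately show ?thesis by (rule expoly_cong)
qed

lemma expoly_cmult: "expoly f ==> expoly (%k. c*f k)" by (rule expoly_mult[OF expoly_const])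

lemma expoly_diff: "expoly f ==> expoly g ==> expoly (%k. f k-g k)" using expoly_add[OF _ expoly_cmult[of g "-1"]] by simp

lemma binomial_poly: "EX p::complex poly. ALL k. of_nat (k choose m) = poly p (of_nat k)" proof (induction m) case 0
 show ?case by (rule exI[of _ 1]) simp
next case (Suc m) then obtain p where p: "ALL k. of_nat (k choose m) = poly (p::complex poly) (of_nat k)" by blast
 have "of_nat (k choose Suc m) = poly (smult (1/of_nat (Suc m)) ([:- of_nat m, 1:]*p)) (of_nat k :: complex)" for k proof -
  have "of_nat (Suc m) * of_nat (k choose Suc m) = (of_nat k-of_nat m)*(of_nat (k choose m) :: complex)" proof (cases "m <= k")
   case True have "Suc m*(k choose Suc m) = (k-m)*(k choose m)"
    by (metis binomial_absorb_comp binomial_absorption diff_Suc_1' mult.commute)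
   hence "of_nat (Suc m*(k choose Suc m)) = (of_nat ((k-m)*(k choose m)) :: complex)" by (rule arg_cong)
   thus ?thesis using True by (simp only: of_nat_mult of_nat_diff)
  next case False thus ?thesis by (simp add: binomial_eq_0)
  qed thus ?thesis using p by (simp add: field_simps del: of_nat_Suc)
 qed thus ?case by blast
qed

text \<open>In the binomial basis the shift is triangular by Pascal's rule, which is what the
  resolvent lemma exploits. Multiplication by \<open>k\<close> acts through
  \<open>k binom(k,m) = (m+1) binom(k,m+1) + m binom(k,m)\<close>, and this drives the induction
  over the coefficients.\<close>

lemma poly_binomial_basis: "EX a n. ALL k. poly p (of_nat k :: complex) = (SUM m<=n. a m * of_nat (k choose m))"
proof (induction p) case 0 show ?case by (rule exI[of _ "%_. 0"]) simp
next case (pCons c p) then obtain a n where a: "!!k. poly p (of_nat k) = (SUM m<=n. a m * of_nat (k choose m))" by blast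
 define a' where "a' = (%m. if m <= n then a m else 0)"
 have a': "poly p (of_nat k) = (SUM m<=n. a' m * of_nat (k choose m))" for k unfolding a a'_def by (rule sum.cong) auto
 define b where "b m = (if m = 0 then c else of_nat m*a' m + of_nat m*a' (m-1))" for m
 have step: "of_nat k * of_nat (k choose m) =
   (of_nat (Suc m) * of_nat (k choose Suc m) + of_nat m * of_nat (k choose m) :: complex)" for k m proof -
  have "Suc m*(k choose Suc m)+m*(k choose m) = k*(k choose m)" proof (cases "m <= k")
   case True have "Suc m*(k choose Suc m) = (k-m)*(k choose m)"
    by (metis binomial_absorb_comp binomial_absorption diff_Suc_1' mult.commute)
   thus ?thesis using True by (simp add: add_mult_distrib[symmetric] del: binomial_Suc_Suc mult_Suc)
  qed (simp add: binomial_eq_0)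
  hence "of_nat (k*(k choose m)) = (of_nat (Suc m*(k choose Suc m)+m*(k choose m)) :: complex)" by simp
  thus ?thesis by (simp del: of_nat_Suc mult_Suc)
 qed have "poly (pCons c p) (of_nat k) = (SUM m<=Suc n. b m * of_nat (k choose m))" for k proof -
  have "poly (pCons c p) (of_nat k) = c+(SUM m<=n. a' m*(of_nat k * of_nat (k choose m)))" by (simp add: a' sum_dl mult_ac)
  also have "... = c+((SUM m<=n. of_nat (Suc m)*a' m * of_nat (k choose Suc m))
   +(SUM m<=n. of_nat m*a' m * of_nat (k choose m)))" by (simp only: step distrib_left sum.distrib mult_ac)
  also have "(SUM m<=n. of_nat m*a' m * of_nat (k choose m)) =
    (SUM m<=Suc n. of_nat m*a' m * of_nat (k choose m))" by (simp add: a'_def)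
  also have "... = (SUM m<=n. of_nat (Suc m)*a' (Suc m) * of_nat (k choose Suc m))" by (subst sum.atMost_Suc_shift) simp
  also have "c+((SUM m<=n. of_nat (Suc m)*a' m * of_nat (k choose Suc m))+...) = (SUM m<=Suc n. b m * of_nat (k choose m))"
   by (subst sum.atMost_Suc_shift) (simp add: b_def sum.distrib[symmetric] algebra_simps)
  finally show ?thesis .
 qed thus ?case by blast
qed

text \<open>In the resonant case \<open>\<mu> = l\<close>, Pascal's rule makes
  \<open>binom(k,m+1) l^k / l\<close> a solution. Otherwise the solution is built by induction on
  \<open>m\<close>, starting from the geometric one \<open>\<mu>^k / (\<mu> - l)\<close>.\<close>

lemma expoly_resolvent_binomial: assumes "\<mu> ~= 0"
 shows "EX z. expoly z & (ALL k. z (Suc k)-l*z k = of_nat (k choose m)*\<mu> ^ k)" proof (cases "\<mu> = l")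
 case True obtain p :: "complex poly" where p: "!!k. of_nat (k choose Suc m) = poly p (of_nat k)" using binomial_poly by blast
 define z where "z k = of_nat (k choose Suc m)*l^k/l" for k
 have "expoly z" using expoly_cmult[OF expoly_term[OF assms, of p], of "1/l"] unfolding z_def p True by simp
 moreover have "z (Suc k)-l*z k = of_nat (k choose m)*\<mu> ^ k" for k using assms True by (simp add: z_def field_simps)
 ultimately show ?thesis by blast
next case False hence nz: "\<mu> - l ~= 0" by simp
 show ?thesis proof (induction m) case 0 have "(1/(\<mu> - l))*\<mu> ^ Suc k-l*((1/(\<mu> - l))*\<mu> ^ k) = \<mu> ^ k" for k
  proof - have "(1/(\<mu> - l))*\<mu> ^ Suc k-l*((1/(\<mu> - l))*\<mu> ^ k) = (1/(\<mu> - l))*(\<mu> - l)*\<mu> ^ k"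
    by (simp only: power_Suc left_diff_distrib right_diff_distrib mult_ac)
   thus ?thesis using nz by simp
  qed thus ?case using expoly_cmult[OF expoly_term[OF assms, of 1], of "1/(\<mu> - l)"]
   by (intro exI[of _ "%k. (1/(\<mu> - l))*\<mu> ^ k"]) simp
 next case (Suc m) then obtain z where z: "expoly z" "!!k. z (Suc k)-l*z k = of_nat (k choose m)*\<mu> ^ k" by blast
  obtain p :: "complex poly" where p: "!!k. of_nat (k choose Suc m) = poly p (of_nat k)" using binomial_poly by blast
  \<comment> \<open>Shifting \<open>binom(k,m+1)\<close> also produces \<open>binom(k,m)\<close>;
    the correction by \<open>\<mu> z k\<close> cancels exactly that term.\<close>
  define y where "y k = (of_nat (k choose Suc m)*\<mu> ^ k-\<mu> * z k)/(\<mu> - l)" for k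
  have "expoly y" using expoly_cmult[OF expoly_diff[OF expoly_term[OF assms, of p] expoly_cmult[OF z(1), of \<mu>]],
     of "1/(\<mu> - l)"] unfolding y_def p by simp
  moreover have "y (Suc k)-l*y k = of_nat (k choose Suc m)*\<mu> ^ k" for k proof -
   have zS: "z (Suc k) = l*z k + of_nat (k choose m)*\<mu> ^ k" using z(2)[of k] by (simp add: algebra_simps)
   have "(\<mu> - l)*(y (Suc k)-l*y k) = (of_nat (Suc k choose Suc m)*\<mu> ^ Suc k-\<mu> * z (Suc k))
    -l*(of_nat (k choose Suc m)*\<mu> ^ k-\<mu> * z k)" proof -
    have yk: "(\<mu> - l)*y j = of_nat (j choose Suc m)*\<mu> ^ j-\<mu> * z j" for j using nz by (simp add: y_def)
    have "(\<mu> - l)*(y (Suc k)-l*y k) = (\<mu> - l)*y (Suc k)-l*((\<mu> - l)*y k)"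
     by (simp only: right_diff_distrib mult.left_commute)
    thus ?thesis by (simp only: yk)
   qed also have "... = (\<mu> - l)*(of_nat (k choose Suc m)*\<mu> ^ k)" by (simp add: zS algebra_simps)
   finally show ?thesis using nz by (simp del: binomial_Suc_Suc)
  qed ultimately show ?case by blast
 qed qed

text \<open>Particular solutions for the single frequencies of \<open>y\<close> are added up. Their
  difference from \<open>x\<close> eventually satisfies the homogeneous recurrence, so it is a
  multiple of \<open>l^k\<close> from some index on.\<close>

lemma expoly_resolvent: assumes y: "expoly y" and x: "!!k. x (Suc k)-l*x k = y k" shows "expoly x" proof -
 obtain L q K where L: "finite L" "0 ~: L" and K: "!!k. K <= k ==> y k = (SUM l:L. poly (q l) (of_nat k)*l^k)"
  using y unfolding expoly_def expoly_on_def eventually_sequentially by blast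
 have "EX z. expoly z & (ALL k. z (Suc k)-l*z k = poly (q \<mu>) (of_nat k)*\<mu> ^ k)" if "\<mu> : L" for \<mu> proof -
  have nz: "\<mu> ~= 0" using that L by auto
  obtain a n where a: "!!k. poly (q \<mu>) (of_nat k) = (SUM m<=n. a m * of_nat (k choose m))" using poly_binomial_basis by blast
  obtain z where z: "!!m. expoly (z m)" "!!m k. z m (Suc k)-l*z m k = of_nat (k choose m)*\<mu> ^ k"
   using expoly_resolvent_binomial[OF nz, of l] by metis
  have "(SUM m<=n. a m*z m (Suc k))-l*(SUM m<=n. a m*z m k) = poly (q \<mu>) (of_nat k)*\<mu> ^ k" for k proof -
   have "(SUM m<=n. a m*z m (Suc k))-l*(SUM m<=n. a m*z m k) = (SUM m<=n. a m*(z m (Suc k)-l*z m k))"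
    by (simp add: sum_dl sum_subtractf[symmetric] algebra_simps)
   thus ?thesis by (simp add: z(2) a sum_distrib_right mult.assoc)
  qed thus ?thesis using expoly_sum[of "{..n}" "%m k. a m*z m k"] z(1) expoly_cmult
   by (intro exI[of _ "%k. SUM m<=n. a m*z m k"]) auto
 qed then obtain z where z: "!!\<mu>. \<mu> : L ==> expoly (z \<mu>)"
  "!!\<mu> k. \<mu> : L ==> z \<mu> (Suc k)-l*z \<mu> k = poly (q \<mu>) (of_nat k)*\<mu> ^ k" by metis
 define s where "s k = (SUM \<mu>:L. z \<mu> k)" for k
 define h where "h k = x k-s k" for k
 have s: "expoly s" unfolding s_def by (rule expoly_sum) (rule z)
 have hS: "h (Suc k) = l*h k" if "K <= k" for k proof -
  have "s (Suc k)-l * s k = y k" by (simp add: s_def K[OF that] sum_dl sum_subtractf[symmetric] z(2))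
  thus ?thesis using x[of k] by (simp add: h_def algebra_simps)
 qed have hK: "h (K+n) = l^n*h K" for n by (induction n) (simp_all add: hS)
 have "expoly h" proof (cases "l = 0")
  \<comment> \<open>For \<open>l = 0\<close> the homogeneous part vanishes from index
    \<open>Suc K\<close> on; at \<open>K\<close> itself it may still be nonzero.\<close>
  case True have "EVT k. 0 = h k" unfolding eventually_sequentially proof (intro exI[of _ "Suc K"] allI impI)
   fix k assume "Suc K <= k"
   thus "0 = h k" using hK[of "k-K"] True by simp
  qed thus ?thesis using expoly_cong[OF expoly_zero] by simp
 next case False have "EVT k. (h K/l^K)*(poly 1 (of_nat k)*l^k) = h k" unfolding eventually_sequentially
  proof (intro exI[of _ K] allI impI)
   fix k assume "K <= k"
   thus "(h K/l^K)*(poly 1 (of_nat k)*l^k) = h k" using hK[of "k-K"] False by (simp add: power_diff)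
  qed thus ?thesis by (rule expoly_cong[OF expoly_cmult[OF expoly_term[OF False]]])
 qed hence "expoly (%k. h k+s k)" using s by (rule expoly_add)
 thus ?thesis by (simp add: h_def)
qed

lemma expoly_partial_sums: assumes "expoly y" shows "expoly (%k. SUM j<k. y j)" by (rule expoly_resolvent[OF assms, of _ 1]) simp

text \<open>A root \<open>l\<close> of the characteristic polynomial is split off: the sequence
  \<open>x (Suc k) - l x k\<close> satisfies the recurrence of the quotient polynomial, and
  \<open>expoly_resolvent\<close> leads back to \<open>x\<close>.\<close>

lemma expoly_linear_recurrence: assumes "p ~= 0" "!!k. (SUM i<=degree p. coeff p i*x (k+i)) = 0" shows "expoly x" using assms
proof (induction "degree p" arbitrary: p x) case 0
 hence "x k = 0" for k using leading_coeff_0_iff[of p] by (metis (no_types, lifting) add_0_right atMost_0 empty_iff finite.emptyI mult_eq_0_iff sum.empty sum.insert add.right_neutral)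
 hence "x = (%_. 0)" by blast
 thus ?case using expoly_zero by simp
next case (Suc n) have "~ constant (poly p)" using Suc.hyps(2) by (simp add: constant_degree)
 then obtain l where "poly p l = 0" using fundamental_theorem_of_algebra by blast
 then obtain r where r: "p = [:- l, 1:]*r" unfolding poly_eq_0_iff_dvd by (auto elim: dvdE)
 have r0: "r ~= 0" using Suc.prems(1) r by auto
 have deg: "degree p = Suc (degree r)" unfolding r using r0 by (subst degree_mult_eq) auto
 define y where "y k = x (Suc k)-l*x k" for k
 have "(SUM i<=degree r. coeff r i*y (k+i)) = 0" for k proof -
  have c: "coeff p i = (if i = 0 then 0 else coeff r (i-1))-l*coeff r i" for i
   unfolding r by (cases i) (auto simp: coeff_pCons mult_pCons_left)
  have "0 = (SUM i<=Suc (degree r). coeff p i*x (k+i))" using Suc.prems(2)[of k] deg by simp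
  also have "... = (SUM i<=Suc (degree r). (if i = 0 then 0 else coeff r (i-1))*x (k+i))
   -(SUM i<=Suc (degree r). l*coeff r i*x (k+i))" by (simp add: c sum_subtractf[symmetric] algebra_simps del: sum.atMost_Suc)
  also have "(SUM i<=Suc (degree r). (if i = 0 then 0 else coeff r (i-1))*x (k+i)) =
    (SUM i<=degree r. coeff r i*x (Suc (k+i)))" by (subst sum.atMost_Suc_shift) simp
  also have "(SUM i<=Suc (degree r). l*coeff r i*x (k+i)) = (SUM i<=degree r. l*coeff r i*x (k+i))" by (simp add: coeff_eq_0)
  finally show ?thesis by (simp add: y_def sum_subtractf algebra_simps)
 qed hence "expoly y" using Suc.hyps(1)[of r y] deg Suc.hyps(2) r0 by simp
 thus ?case by (rule expoly_resolvent[of _ _ l]) (simp add: y_def)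
qed

section \<open>Trigonometric polynomials, small values and Cesaro means\<close>

inductive trigpoly :: "(nat => complex) => bool" where
 trigpoly_term: "cmod u = 1 ==> trigpoly (%k. c*u^k)"
| trigpoly_add: "trigpoly f ==> trigpoly g ==> trigpoly (%k. f k+g k)"

text \<open>The usual nondegeneracy of linear recurrences: for nonzero frequencies, no quotient of
  two distinct ones is a root of unity. It guarantees that the factors \<open>u^h - v^h\<close>
  below are nonzero.\<close>

definition nondegenerate :: "complex set => bool" where
 "nondegenerate W \<longleftrightarrow> (ALL u:W. ALL u':W. ALL j>=1. u^j = u'^j --> u = u')"

lemma trigpoly_const: "trigpoly (%k. c)" using trigpoly_term[of 1 c] by simp

lemma trigpoly_sum: assumes "!!i. i : I ==> trigpoly (f i)" shows "trigpoly (%k. SUM i:I. f i k)"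
 using assms by (induction I rule: infinite_finite_induct) (auto intro: trigpoly_const trigpoly_add)

lemma trigpoly_mult: "trigpoly f ==> trigpoly g ==> trigpoly (%k. f k*g k)" proof (induction rule: trigpoly.induct)
 case (trigpoly_term u c) from trigpoly_term(2) show ?case proof induction
  case (trigpoly_term u' c')
  have "(%k. c*u^k*(c'*u'^k)) = (%k. c*c'*(u*u')^k)" by (simp add: power_mult_distrib fun_eq_iff mult_ac)
  moreover have "cmod (u*u') = 1" using trigpoly_term(1) \<open>cmod u = 1\<close> by (simp add: norm_mult)
  ultimately show ?case by (simp only: trigpoly.trigpoly_term)
 qed (simp add: distrib_left trigpoly_add)
qed (simp add: distrib_right trigpoly_add)

lemma trigpoly_cnj: "trigpoly f ==> trigpoly (%k. cnj (f k))"
 by (induction rule: trigpoly.induct) (simp_all add: trigpoly_term trigpoly_add)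

lemma trigpoly_power: "trigpoly f ==> trigpoly (%k. f k^n)" by (induction n) (auto intro: trigpoly_const trigpoly_mult)

lemma trigpoly_bounded: "trigpoly f ==> EX M>0. ALL k. cmod (f k) <= M" proof (induction rule: trigpoly.induct)
 case (trigpoly_term u c) thus ?case by (intro exI[of _ "cmod c+1"]) (simp add: norm_mult norm_power add_nonneg_pos)
next case (trigpoly_add f g) then obtain M M' where "0 < M" "0 < M'" "!!k. cmod (f k) <= M" "!!k. cmod (g k) <= M'" by blast
 thus ?case by (intro exI[of _ "M+M'"]) (auto intro: norm_triangle_mono)
qed

definition cesaro :: "(nat => 'a::real_normed_vector) => bool" where
 "cesaro f \<longleftrightarrow> convergent (%N. (SUM k<N. f k) /\<^sub>R real N)"

lemma cesaro_add: "cesaro f ==> cesaro g ==> cesaro (%k. f k+g k)"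
 unfolding cesaro_def by (drule (1) convergent_add) (simp add: sum.distrib scaleR_right_distrib)

lemma cesaro_linear: assumes "bounded_linear h" "cesaro f" shows "cesaro (%k. h (f k))" proof - interpret bounded_linear h by fact
 have "convergent (%N. h ((SUM k<N. f k) /\<^sub>R real N))" using assms(2) tendsto unfolding cesaro_def convergent_def by blast
 thus ?thesis by (simp add: cesaro_def sum scaleR)
qed

lemma cesaro_sum: assumes "!!i. i : I ==> cesaro (f i)" shows "cesaro (%k. SUM i:I. f i k)" using assms
proof (induction I rule: infinite_finite_induct) case (insert i I) thus ?case by (simp add: cesaro_add)
qed (auto simp: cesaro_def convergent_const)

lemma cesaro_unit_power: assumes "cmod u = 1" shows "cesaro (%k. u^k)" proof (cases "u = 1")
 case True have "EVT N. (1::complex) = (SUM k<N. u^k) /\<^sub>R real N"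
  using ev_gt[of 0] by eventually_elim (simp add: True scaleR_conv_of_real)
 hence "(%N. (SUM k<N. u^k) /\<^sub>R real N) ----> 1" by (rule lim_cong[OF tendsto_const])
 thus ?thesis unfolding cesaro_def convergent_def by blast
next case False have "((SUM k<N. u^k) /\<^sub>R real N) = (u^N-1)/(u-1) /\<^sub>R real N" for N
  by (simp add: geometric_sum[OF False])
 moreover have "(%N. (u^N-1)/(u-1) /\<^sub>R real N) ----> 0" proof (rule Lim_null_comparison)
  have "cmod (u^N-1) <= 2" for N using norm_triangle_ineq4[of "u^N" 1] assms by (simp add: norm_power)
  hence "cmod (u^N-1)/cmod (u-1)*(1/real N) <= (2/cmod (u-1))*(1/real N)" for N by (intro mult_right_mono divide_right_mono) auto
  hence "cmod ((u^N-1)/(u-1) /\<^sub>R real N) <= (2/cmod (u-1))*(1/real N)" for N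
   by (simp only: norm_scaleR norm_divide) (simp add: divide_inverse mult_ac)
  thus "EVT N. norm ((u^N-1)/(u-1) /\<^sub>R real N) <= (2/cmod (u-1))*(1/real N)" by simp
  show "(%N. (2/cmod (u-1))*(1/real N)) ----> 0" by (rule tendsto_mult_right_zero[OF lim_1_over_n])
 qed ultimately show ?thesis unfolding cesaro_def convergent_def by (intro exI[of _ 0]) (simp only:)
qed

lemma cesaro_trigpoly: "trigpoly f ==> cesaro f" by (induction rule: trigpoly.induct)
  (intro cesaro_linear[OF bounded_linear_mult_right] cesaro_unit_power cesaro_add; assumption)+

lemma cesaro_null: fixes f :: "nat => 'a::real_normed_vector" assumes "f ----> 0"
 shows "(%N. (SUM k<N. norm (f k))/real N) ----> 0" proof (rule LIMSEQ_I)
 fix e :: real assume e: "0 < e"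
 obtain K where K: "!!k. K <= k ==> norm (f k) < e/2" using LIMSEQ_D[OF assms, of "e/2"] e by auto
 define S where "S = (SUM k<K. norm (f k))"
 obtain N0 where N0: "real N0 > 2*S/e" using reals_Archimedean2 by blast
 show "EX no. ALL N>=no. norm ((SUM k<N. norm (f k))/real N-0) < e" proof (intro exI[of _ "Suc (max N0 K)"] allI impI)
  fix N assume N: "Suc (max N0 K) <= N"
  have "(SUM k<N. norm (f k)) = S+(SUM k:{K..<N}. norm (f k))"
   unfolding S_def using N sum.atLeastLessThan_concat[of 0 K N "%k. norm (f k)"] by (simp add: atLeast0LessThan)
  also have "(SUM k:{K..<N}. norm (f k)) <= (SUM k:{K..<N}. e/2)" by (rule sum_mono) (use K less_imp_le in auto)
  also have "... <= real N*(e/2)" using e by (simp add: mult_right_mono)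
  finally have le: "(SUM k<N. norm (f k)) <= S+real N*(e/2)" by simp
  have "2*S/e < real N" using N0 N by simp
  hence "S < real N*(e/2)" using e by (simp add: field_simps)
  hence "(SUM k<N. norm (f k)) < real N*e" using le by simp
  moreover have "0 < real N" using N by simp
  moreover have "0 <= (SUM k<N. norm (f k))" by (simp add: sum_nonneg)
  ultimately show "norm ((SUM k<N. norm (f k))/real N-0) < e" by (simp add: divide_simps mult.commute)
 qed qed

text \<open>The averages of \<open>f\<close> and \<open>g\<close> differ by at most the averaged
  error, so the Cauchy property passes from the averages of \<open>g\<close> to those of
  \<open>f\<close> up to an arbitrary \<open>e\<close>.\<close>

lemma cesaro_approx: fixes f :: "nat => 'a::banach" assumes "!!e. 0 < e ==> EX g. cesaro g &
   (EVT N. (SUM k<N. norm (f k-g k)) <= e*real N)" shows "cesaro f" proof -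
 define A where "A f N = (SUM k<N. f k) /\<^sub>R real N" for f :: "nat => 'a" and N
 have "Cauchy (A f)" proof (rule metric_CauchyI)
  fix e :: real assume e: "0 < e"
  obtain g where g: "cesaro g" and ev: "EVT N. (SUM k<N. norm (f k-g k)) <= (e/4)*real N" using assms[of "e/4"] e by auto
  obtain N1 where N1: "!!N. N1 <= N ==> (SUM k<N. norm (f k-g k)) <= (e/4)*real N"
   using ev unfolding eventually_sequentially by blast
  have "Cauchy (A g)" using g convergent_Cauchy unfolding cesaro_def A_def by blast
  then obtain N2 where N2: "!!m n. N2 <= m ==> N2 <= n ==> dist (A g m) (A g n) < e/4"
   using metric_CauchyD[of "A g" "e/4"] e by auto
  have fg: "dist (A f N) (A g N) <= e/4" if "N1 <= N" for N proof (cases "N = 0")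
   case False have "dist (A f N) (A g N) = norm (SUM k<N. f k-g k)/real N"
    by (simp add: A_def dist_norm sum_subtractf scaleR_diff_right[symmetric] divide_inverse_commute)
   also have "... <= ((e/4)*real N)/real N" by (intro divide_right_mono order_trans[OF norm_sum] N1 that) simp
   finally show ?thesis using False by simp
  qed (use e in "simp add: A_def")
  show "EX M. ALL m>=M. ALL n>=M. dist (A f m) (A f n) < e" proof (intro exI[of _ "max N1 N2"] allI impI)
   fix m n assume "max N1 N2 <= m" "max N1 N2 <= n"
   hence "dist (A f m) (A g m) <= e/4" "dist (A f n) (A g n) <= e/4" "dist (A g m) (A g n) < e/4" using fg N2 by auto
   moreover have "dist (A f m) (A f n) <= dist (A f m) (A g m)+dist (A g m) (A g n)+dist (A g n) (A f n)"
    using dist_triangle[of "A f m" "A f n" "A g m"] dist_triangle[of "A g m" "A f n" "A g n"] by simp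
   ultimately show "dist (A f m) (A f n) < e" using e by (simp add: dist_commute)
  qed qed thus ?thesis unfolding cesaro_def A_def by (simp add: Cauchy_convergent_iff)
qed

text \<open>In each block of length \<open>H\<close> at most one element of \<open>E\<close> has no successor in "E"
 at distance below \<open>H\<close>.\<close>

abbreviation trig :: "complex set => (complex => complex) => nat => complex" where "trig W c k \<equiv> SUM u:W. c u*u^k"

abbreviation small :: "(nat => complex) => real => nat => nat set" where "small f d N \<equiv> {k:{..<N}. cmod (f k) < d}"

lemma card_gaps: fixes E :: "nat set" assumes E: "E \<subseteq> {..<N}" and H: "0 < H"
 shows "card E <= N div H+1+(SUM h=1..<H. card {k:E. k+h : E})" proof - have fin: "finite E" using E finite_subset by blast
 define G where "G = (UN h:{1..<H}. {k:E. k+h : E})"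
 have "card G <= (SUM h=1..<H. card {k:E. k+h : E})" unfolding G_def by (rule card_UN_le) simp
 moreover have "card (E-G) <= card {..N div H}" proof (rule card_inj_on_le[where f = "%k. k div H"])
  have *: "k = k'" if "k : E-G" "k' : E-G" "k div H = k' div H" "k <= k'" for k k' proof (rule ccontr)
   assume "k ~= k'"
   hence h: "1 <= k'-k" using that by simp
   have "k'-k < H" proof - have "k' < H+H*(k' div H)" by (rule dividend_less_times_div[OF H])
    moreover have "H*(k' div H) <= k" unfolding that(3)[symmetric] by (rule times_div_less_eq_dividend)
    ultimately have "k' < H+k" by (rule order.strict_trans2[OF _ add_left_mono])
    thus ?thesis using that(4) by (simp add: less_diff_conv2)
   qed moreover have "k+(k'-k) : E" using that by simp
   ultimately have "k : G" using that h unfolding G_def by (intro UN_I[of "k'-k"]) auto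
   thus False using that by simp
  qed show "inj_on (%k. k div H) (E-G)" by (rule inj_onI) (metis * nle_le)
  show "(%k. k div H) ` (E-G) \<subseteq> {..N div H}" using E by (blast intro: div_le_mono less_imp_le)
 qed simp
 moreover have "card E <= card (E-G)+card G" proof - have "G \<subseteq> E" unfolding G_def by auto
  hence "E = (E-G) Un G" by blast
  thus ?thesis using card_Un_le[of "E-G" G] by simp
 qed ultimately show ?thesis by simp
qed

text \<open>Induction on the set of frequencies. The combination
  \<open>\<beta> (k+h) - v^h \<beta> k\<close> loses the frequency \<open>v\<close> and, by
  nondegeneracy, keeps all the others. Where \<open>\<beta>\<close> is small both at
  \<open>k\<close> and at \<open>k+h\<close>, this shorter polynomial is small at \<open>k\<close>,
  which is rare by the induction hypothesis. So indices with small \<open>\<beta>\<close> seldom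
  have near neighbours of the same kind, and \<open>card_gaps\<close> bounds their number.\<close>

lemma trigpoly_small_density: assumes "finite W" "W ~= {}" "ALL u:W. cmod u = 1" "nondegenerate W" "ALL u:W. c u ~= 0" "0 < e"
 shows "EX d>0. EVT N. real (card (small (trig W c) d N)) <= e*real N" using assms
proof (induction W arbitrary: c e rule: finite_ne_induct) case (singleton u)
 have *: "~ cmod (SUM u':{u}. c u'*u'^k) < cmod (c u)" for k using singleton by (simp add: norm_mult norm_power)
 have "real (card {k:{..<N}. cmod (SUM u':{u}. c u'*u'^k) < cmod (c u)}) <= e*real N" for N proof -
  have "{k:{..<N}. cmod (SUM u':{u}. c u'*u'^k) < cmod (c u)} = {}" using * by blast
  thus ?thesis using singleton by (simp only: card.empty) simp
 qed moreover have "cmod (c u) > 0" using singleton by simp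
 ultimately show ?case by (intro exI[of _ "cmod (c u)"] conjI always_eventually allI)
next case (insert v W) define \<beta> where "\<beta> k = (trig (insert v W) c k)" for k
 \<comment> \<open>Budget: blocks of length \<open>H\<close> contribute density at most
   \<open>1/H <= e/4\<close>; the fewer than \<open>H\<close> shifts contribute
   \<open>e' = e/(2H)\<close> each, together \<open>e/2\<close>; the additive 1 of
   \<open>card_gaps\<close> is at most \<open>e N / 4\<close> once \<open>N >= N1\<close>.\<close>
 obtain H :: nat where H: "real H > 4/e" using reals_Archimedean2 by blast
 hence H0: "0 < H" using \<open>0 < e\<close> by (metis divide_pos_pos gr0I less_asym of_nat_0 zero_less_numeral)
 define c' where "c' h u = c u*(u^h-v^h)" for h u
 have \<beta>h: "\<beta> (k+h)-v^h*\<beta> k = (trig W (c' h) k)" for k h using insert.hyps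
  by (simp add: \<beta>_def c'_def sum_dl sum_subtractf[symmetric] power_add algebra_simps)
 have nz: "c' h u ~= 0" if "u : W" "1 <= h" for h u using insert.prems insert.hyps that unfolding c'_def nondegenerate_def by auto
 have ndW: "nondegenerate W" using insert.prems unfolding nondegenerate_def by blast
 define e' where "e' = e/(2*real H)"
 have e': "0 < e'" using \<open>0 < e\<close> H0 by (simp add: e'_def)
 define good where "good h d \<longleftrightarrow> 0 < d & (EVT N. real (card (small (trig W (c' h)) d N)) <= e'*real N)" for h d
 have "EX d. good h d" if "h : {1..<H}" for h proof - have "ALL u:W. cmod u = 1" using insert.prems(1) by blast
  moreover have "ALL u:W. c' h u ~= 0" using nz[of _ h] that by simp
  ultimately show ?thesis using insert.IH[of "c' h" e', OF _ ndW _ e'] unfolding good_def by blast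
 qed hence "EX d. ALL h:{1..<H}. good h (d h)" by (intro bchoice ballI)
 then obtain d where good: "ALL h:{1..<H}. good h (d h)" by blast
 hence d: "!!h. h : {1..<H} ==> 0 < d h" "!!h. h : {1..<H} ==> EVT N. real (card (small (trig W (c' h)) (d h) N)) <= e'*real N"
  unfolding good_def by blast+
 define d0 where "d0 = Min (insert 1 (d ` {1..<H}))/2"
 have d0: "0 < d0" unfolding d0_def using d(1) by (subst half_gt_zero_iff, subst Min_gr_iff) auto
 have d0le: "2*d0 <= d h" if "h : {1..<H}" for h proof -
  have "Min (insert 1 (d ` {1..<H})) <= d h" by (rule Min_le) (use that in auto)
  thus ?thesis by (simp add: d0_def)
 qed have ev: "EVT N. ALL h:{1..<H}. real (card (small (trig W (c' h)) (d h) N)) <= e'*real N"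
  by (rule eventually_ball_finite) (use d(2) in auto)
 obtain N1 :: nat where N1: "real N1 > 4/e" using reals_Archimedean2 by blast
 have "EVT N. real (card (small \<beta> d0 N)) <= e*real N" using ev eventually_ge_at_top[of N1] proof eventually_elim
  case (elim N) define E where "E = small \<beta> d0 N"
  have sub: "{k:E. k+h : E} \<subseteq> small (trig W (c' h)) (d h) N"
   if "h : {1..<H}" for h proof
   fix k assume "k : {k:E. k+h : E}"
   hence k: "k < N" "cmod (\<beta> k) < d0" "cmod (\<beta> (k+h)) < d0" by (auto simp: E_def)
   have "cmod (\<beta> (k+h)-v^h*\<beta> k) <= cmod (\<beta> (k+h))+cmod (v^h*\<beta> k)" by (rule norm_triangle_ineq4)
   also have "... < 2*d0" using k insert.prems(1) by (simp add: norm_mult norm_power)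
   finally show "k : small (trig W (c' h)) (d h) N" using k d0le[OF that] by (simp add: \<beta>h)
  qed have "real (card E) <= real (N div H+1+(SUM h=1..<H. card {k:E. k+h : E}))"
   by (intro of_nat_mono card_gaps H0) (auto simp: E_def)
  also have "... = real (N div H)+1+(SUM h=1..<H. real (card {k:E. k+h : E}))" by simp
  also have "(SUM h=1..<H. real (card {k:E. k+h : E})) <= (SUM h=1..<H. e'*real N)" proof (rule sum_mono)
   fix h assume h: "h : {1..<H}"
   have "card {k:E. k+h : E} <= card (small (trig W (c' h)) (d h) N)" by (rule card_mono[OF _ sub[OF h]]) simp
   thus "real (card {k:E. k+h : E}) <= e'*real N" using bspec[OF elim(1) h] by linarith
  qed also have "... <= real H*(e'*real N)" using e' by (simp add: mult_right_mono)
  also have "real H*(e'*real N) = e/2*real N" using H0 by (simp add: e'_def)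
  also have "real (N div H)+1+e/2*real N <= e*real N" proof -
   have "real (N div H) <= real N/real H" by (rule of_nat_div_le_of_nat)
   also have "... = (1/real H)*real N" by simp
   also have "... <= (e/4)*real N" by (rule mult_right_mono) (use H H0 \<open>0 < e\<close> in "auto simp: field_simps")
   finally have "real (N div H) <= (e/4)*real N" .
   moreover have "1 <= (e/4)*real N" proof - have "4/e < real N" using N1 elim(2) by linarith
    thus ?thesis using \<open>0 < e\<close> by (simp add: field_simps)
   qed ultimately show ?thesis by simp
  qed finally show ?case by (simp add: E_def)
 qed thus ?case using d0 unfolding \<beta>_def by blast
qed

text \<open>Heuristically \<open>s = a / b\<close>. With \<open>t = |b|^2 / M\<close>, which lies in
  [0,1], the truncated Neumann series of \<open>1/t\<close> replaces the division, so that the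
  approximation \<open>g\<close> is again a trigonometric polynomial. The error
  \<open>s (1 - t)^n\<close> is small except where \<open>b\<close> is small, and this happens only
  on a set of small density.\<close>

lemma cesaro_ratio_trigpoly: fixes s :: "nat => complex" assumes B: "!!k. cmod (s k) <= B"
  and W: "finite W" "W ~= {}" "ALL u:W. cmod u = 1" "nondegenerate W" "ALL u:W. c u ~= 0"
  and a: "trigpoly a" and lim: "(%k. s k*(trig W c k)-a k) ----> 0" shows "cesaro s" proof (rule cesaro_approx)
 fix e :: real assume e: "0 < e"
 define b where "b k = trig W c k" for k
 have tb: "trigpoly b" unfolding b_def using W by (intro trigpoly_sum trigpoly_term) blast
 obtain M0 where M0: "0 < M0" "!!k. cmod (b k) <= M0" using trigpoly_bounded[OF tb] by blast
 define M where "M = M0\<^sup>2"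
 have M: "0 < M" using M0 by (simp add: M_def)
 define t where "t k = (cmod (b k))\<^sup>2/M" for k
 have t01: "0 <= t k" "t k <= 1" for k using M0 M by (auto simp: t_def M_def power_mono)
 have B0: "0 <= B" using B[of 0] norm_ge_zero order_trans by blast
 \<comment> \<open>The constant gives \<open>2 B e' <= e/2\<close>: one \<open>e'\<close> bounds the
   power \<open>(1 - t)^n\<close> where \<open>|b| >= d\<close>, the other bounds the density of the
   set where \<open>|b| < d\<close>.\<close>
 define e' where "e' = e/(4*(B+1))"
 have e': "0 < e'" using e B0 by (simp add: e'_def)
 obtain d where d: "0 < d" "EVT N. real (card (small b d N)) <= e'*real N"
  using trigpoly_small_density[OF W e'] unfolding b_def by blast
 define r where "r = max 0 (1-d\<^sup>2/M)"
 have r: "0 <= r" "r < 1" using d M by (auto simp: r_def)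
 obtain n where n: "r^n < e'" using real_arch_pow_inv[OF e' r(2)] by blast
 define g where "g k = a k*cnj (b k)/of_real M*(SUM j<n. (1-b k*cnj (b k)/of_real M)^j)" for k
 have tg: "trigpoly g" proof - have "trigpoly (%k. 1+(- 1/of_real M)*(b k*cnj (b k)))"
   by (intro trigpoly_add trigpoly_const trigpoly_mult tb trigpoly_cnj)
  hence "trigpoly (%k. 1-b k*cnj (b k)/of_real M)" by simp
  hence "trigpoly (%k. (1/of_real M)*(a k*cnj (b k))*(SUM j<n. (1-b k*cnj (b k)/of_real M)^j))"
   by (intro trigpoly_mult trigpoly_const trigpoly_sum trigpoly_power a tb trigpoly_cnj)
  moreover have "g = (%k. (1/of_real M)*(a k*cnj (b k))*(SUM j<n. (1-b k*cnj (b k)/of_real M)^j))" by (simp add: g_def fun_eq_iff)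
  ultimately show ?thesis by simp
 qed have tk: "b k*cnj (b k)/of_real M = of_real (t k)" for k unfolding t_def of_real_divide complex_norm_square by (rule refl)
 define h where "h k = s k*b k-a k" for k
 have h0: "h ----> 0" using lim unfolding h_def b_def .
 define G where "G = M0/M*real n"
 have key: "cmod (s k-g k) <= G*cmod (h k)+B*(1-t k)^n" for k proof -
  have geo: "of_real (t k)*(SUM j<n. (1-of_real (t k))^j) = (1-(1-of_real (t k))^n :: complex)" proof (cases "t k = 0")
   case False hence "(1-of_real (t k) :: complex) ~= 1" by simp
   from geometric_sum[OF this, of n] show ?thesis using False by (simp add: field_simps)
  qed simp
  have "a k*cnj (b k)/of_real M = s k * of_real (t k)-h k*cnj (b k)/of_real M"
   unfolding tk[symmetric] h_def by (simp add: algebra_simps diff_divide_distrib)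
  hence "s k-g k = s k-s k*(of_real (t k)*(SUM j<n. (1-of_real (t k))^j)) +h k*cnj (b k)/of_real M*(SUM j<n. (1-of_real (t k))^j)"
  proof - assume X: "a k*cnj (b k)/of_real M = s k * of_real (t k)-h k*cnj (b k)/of_real M"
   have "s k-(s k*x-y)*S = s k-s k*(x*S)+y*S" for x y S :: complex by (simp add: algebra_simps)
   thus ?thesis unfolding g_def tk X .
  qed also have "... = s k*(1-of_real (t k))^n+h k*cnj (b k)/of_real M*(SUM j<n. (1-of_real (t k))^j)"
   unfolding geo by (simp add: algebra_simps)
  finally have eq: "s k-g k = s k * of_real ((1-t k)^n) + h k*cnj (b k)/of_real M * of_real (SUM j<n. (1-t k)^j)" by simp
  have "cmod (s k-g k) <= cmod (s k)*(1-t k)^n+cmod (h k)*cmod (b k)/M*(SUM j<n. (1-t k)^j)"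
   unfolding eq by (rule order_trans[OF norm_triangle_ineq])
    (use M t01 in "simp add: norm_mult norm_divide norm_power sum_nonneg del: of_real_power of_real_sum")
  also have "... <= B*(1-t k)^n+cmod (h k)*M0/M*real n" proof (intro add_mono mult_mono divide_right_mono order_refl)
   have "(SUM j<n. (1-t k)^j) <= (SUM j<n. 1)" by (rule sum_mono) (use t01[of k] in "auto intro!: power_le_one")
   thus "(SUM j<n. (1-t k)^j) <= real n" by simp
  qed (use B M0 M t01[of k] B0 in "auto intro: sum_nonneg")
  finally show ?thesis by (simp add: G_def algebra_simps)
 qed have G0: "0 <= G" using M0 M by (simp add: G_def)
 have "(%N. G*((SUM k<N. cmod (h k))/real N)) ----> G*0" by (intro tendsto_mult tendsto_const cesaro_null h0)
 hence ev2: "EVT N. G*((SUM k<N. cmod (h k))/real N) < e/2" using e by (intro order_tendstoD(2)) auto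
 have "EVT N. (SUM k<N. cmod (s k-g k)) <= e*real N" using d(2) ev2 ev_gt[of 0] proof eventually_elim
  case (elim N) have pw: "(1-t k)^n <= e'+(if cmod (b k) < d then 1 else 0)" for k proof (cases "cmod (b k) < d")
   case True have "(1-t k)^n <= 1" using t01[of k] by (intro power_le_one) auto
   thus ?thesis using True e' by simp
  next case False hence "d\<^sup>2/M <= t k" unfolding t_def using d M by (intro divide_right_mono power_mono) auto
   hence "1-t k <= r" by (simp add: r_def)
   hence "(1-t k)^n <= r^n" using t01[of k] by (intro power_mono) auto
   thus ?thesis using n False by simp
  qed have "(SUM k<N. (1-t k)^n) <= (SUM k<N. e'+(if cmod (b k) < d then 1 else 0))" by (rule sum_mono) (rule pw)
  also have "... = real N*e'+real (card (small b d N))" by (simp add: sum.distrib sum.If_cases Int_def)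
  also have "... <= 2*(e'*real N)" using elim(1) by (simp add: mult.commute)
  finally have 1: "B*(SUM k<N. (1-t k)^n) <= B*(2*(e'*real N))" using B0 by (rule mult_left_mono)
  have "B*(2*(e'*real N)) <= e/2*real N" proof - have "B*(2*e') <= e/2" using B0 e by (simp add: e'_def field_simps)
   hence "B*(2*e')*real N <= e/2*real N" by (rule mult_right_mono) simp
   thus ?thesis by (simp add: mult_ac)
  qed moreover have "G*(SUM k<N. cmod (h k)) <= e/2*real N" using elim(2,3) by (simp add: divide_simps)
  moreover have "(SUM k<N. cmod (s k-g k)) <= (SUM k<N. G*cmod (h k)+B*(1-t k)^n)" by (rule sum_mono) (rule key)
  moreover have "(SUM k<N. G*cmod (h k)+B*(1-t k)^n) =
    G*(SUM k<N. cmod (h k))+B*(SUM k<N. (1-t k)^n)" by (simp add: sum.distrib sum_dl)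
  ultimately show ?case using 1 by linarith
 qed thus "EX g. cesaro g & (EVT N. (SUM k<N. norm (s k-g k)) <= e*real N)" using cesaro_trigpoly[OF tg] by blast
qed

text \<open>A null sequence stays below any \<open>d\<close> from some index on, which contradicts
  the density bound already for \<open>e = 1/4\<close>.\<close>

lemma trigpoly_not_null: assumes W: "finite W" "W ~= {}" "ALL u:W. cmod u = 1" "nondegenerate W" "ALL u:W. c u ~= 0"
 shows "~ (%k. SUM u:W. c u*u^k) ----> 0" proof
 assume lim: "(%k. SUM u:W. c u*u^k) ----> 0"
 have "0 < (1/4 :: real)" by simp
 from trigpoly_small_density[OF W this] obtain d where d: "0 < d" "EVT N.
   real (card (small (trig W c) d N)) <= (1/4)*real N" by blast
 obtain K where K: "!!k. K <= k ==> cmod (trig W c k) < d" using LIMSEQ_D[OF lim d(1)] by auto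
 obtain N where N: "2*K+1 <= N" "real (card (small (trig W c) d N)) <= (1/4)*real N"
  using eventually_happens[OF eventually_conj[OF d(2) eventually_ge_at_top[of "2*K+1"]]] by auto
 have "card {K..<N} <= card (small (trig W c) d N)" by (rule card_mono) (use K in auto)
 hence "real (N-K) <= (1/4)*real N" using N(2) by simp
 thus False using N(1) by (simp add: of_nat_diff)
qed

lemma poly_over_power_tendsto: fixes p :: "complex poly" assumes "degree p <= d"
 shows "(%k. poly p (of_nat k)/of_nat k^d) ----> coeff p d" proof -
 have tm: "(%k. coeff p i*(of_nat k^i/of_nat k^d)) ----> (if i = d then coeff p d else 0)"
  if "i <= d" for i proof (cases "i = d")
  case True have "EVT k. coeff p d = coeff p i*(of_nat k^i/of_nat k^d)" using ev_gt[of 0] by eventually_elim (simp add: True)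
  thus ?thesis using True by (simp add: tendsto_eventually eventually_mono lim_cong[OF tendsto_const])
 next case False hence lt: "0 < d-i" using that by simp
  have "(%k. (1/of_nat k :: complex)^(d-i)) ----> 0^(d-i)" by (intro tendsto_power lim_1_over_n)
  hence "(%k. coeff p i*(1/of_nat k)^(d-i)) ----> 0" using lt by (intro tendsto_mult_right_zero) (simp add: power_0_left)
  moreover have "EVT k. coeff p i*(1/of_nat k)^(d-i) = coeff p i*(of_nat k^i/of_nat k^d)" using ev_gt[of 0] proof eventually_elim
   case (elim k) have "of_nat k^d = of_nat k^i*(of_nat k :: complex)^(d-i)" using that by (simp add: power_add[symmetric])
   thus ?case using elim by (simp add: power_divide)
  qed ultimately show ?thesis using False lim_cong by force
 qed have "(%k. SUM i<=d. coeff p i*(of_nat k^i/of_nat k^d)) ----> (SUM i<=d. if i = d then coeff p d else 0)"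
  by (rule tendsto_sum) (use tm in auto)
 moreover have "poly p (of_nat k)/of_nat k^d = (SUM i<=d. coeff p i*(of_nat k^i/of_nat k^d))" for k proof -
  have "poly p x = (SUM i<=d. coeff p i*x^i)" for x
   unfolding poly_altdef by (rule sum.mono_neutral_left) (use assms in "auto intro: le_degree")
  thus ?thesis by (simp add: sum_divide_distrib)
 qed ultimately show ?thesis by simp
qed

lemma polynomial_times_power_null: fixes x :: complex assumes "cmod x < 1" shows "(%k. of_nat k^n*x^k) ----> 0" proof -
 have "(%k. of_nat k^n*y^k) ----> 0" if y: "0 <= y" "y < 1" for y :: real proof (cases "n = 0")
  case True thus ?thesis using y by (simp add: LIMSEQ_power_zero)
 next case False define z where "z = root n y"
  have z: "0 <= z" "z < 1" "z^n = y" using y False by (auto simp: z_def real_root_pow_pos2)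
  have "(%k. of_nat k*z^k) ----> 0" using z by (intro powser_times_n_limit_0) auto
  hence "(%k. (of_nat k*z^k)^n) ----> 0^n" by (rule tendsto_power)
  moreover have "(of_nat k*z^k)^n = of_nat k^n*y^k" for k
   by (simp add: power_mult_distrib z(3)[symmetric] power_mult[symmetric] mult.commute)
  ultimately show ?thesis using False by (simp add: power_0_left)
 qed from this[of "cmod x"] have "(%k. norm (of_nat k^n*x^k)) ----> 0" using assms by (simp add: norm_mult norm_power)
 thus ?thesis by (rule tendsto_norm_zero_cancel)
qed

definition growth :: "real => nat => nat => complex" where "growth r d k = of_real r^k * of_nat k^d"

lemma growth_ratio_null: assumes "0 < r" "0 < r'" "r < r' | (r = r' & d < d')"
 shows "(%k. growth r d k/growth r' d' k) ----> 0" using assms(3) proof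
 assume lt: "r < r'"
 define x :: complex where "x = of_real r/of_real r'"
 have x: "cmod x < 1" using assms lt by (simp add: x_def norm_divide)
 show ?thesis proof (rule Lim_null_comparison)
  show "(%k. cmod (of_nat k^d*x^k)) ----> 0" by (rule tendsto_norm_zero) (rule polynomial_times_power_null[OF x])
  show "EVT k. norm (growth r d k/growth r' d' k) <= cmod (of_nat k^d*x^k)" using ev_gt[of 0] proof eventually_elim
   case (elim k) have "growth r d k/growth r' d' k = (of_nat k^d*x^k)/of_nat k^d'" by (simp add: growth_def x_def power_divide)
   moreover have "1 <= cmod (of_nat k^d')" using elim by (simp add: norm_power)
   ultimately show ?case by (simp add: norm_divide divide_le_eq mult_le_cancel_left1)
  qed qed next assume *: "r = r' & d < d'"
 have "(%k. (1/of_nat k :: complex)^(d'-d)) ----> 0^(d'-d)" by (intro tendsto_power lim_1_over_n)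
 moreover have "EVT k. (1/of_nat k :: complex)^(d'-d) = growth r d k/growth r' d' k" using ev_gt[of 0] proof eventually_elim
  case (elim k) have "of_nat k^d' = of_nat k^d*(of_nat k :: complex)^(d'-d)" using * by (simp add: power_add[symmetric])
  thus ?case using elim * assms by (simp add: power_divide growth_def)
 qed ultimately show ?thesis using * by (simp add: power_0_left lim_cong)
qed

text \<open>Among the terms that really occur, \<open>L1\<close> collects those of largest modulus
  \<open>r\<close>, and \<open>L2\<close> those of largest degree \<open>d\<close> within
  \<open>L1\<close>. Division by \<open>r^k k^d\<close> leaves the unimodular frequencies
  \<open>l/r\<close> of \<open>L2\<close>, weighted by leading coefficients, and a null
  sequence.\<close>

lemma expoly_leading_term: assumes L: "finite L" "0 ~: L" "nondegenerate L"
  and f: "EVT k. f k = (SUM l:L. poly (q l) (of_nat k)*l^k)" shows "(EVT k. f k = 0) |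
  (EX r d W c. 0 < r & finite W & W ~= {} & (ALL u:W. cmod u = 1) & nondegenerate W &
   (ALL u:W. c u ~= 0) & (%k. f k/growth r d k-trig W c k) ----> 0)" proof (cases "ALL l:L. q l = 0")
 case True hence "EVT k. f k = 0" using f by simp
 thus ?thesis by blast
next case False define L' where "L' = {l:L. q l ~= 0}"
 have L': "finite L'" "L' ~= {}" using L False by (auto simp: L'_def)
 define r where "r = Max (cmod ` L')"
 have r_mem: "r : cmod ` L'" unfolding r_def using L' by (intro Max_in) auto
 have r_ge: "cmod l <= r" if "l : L'" for l unfolding r_def using L' that by simp
 have r: "0 < r" using r_mem L(2) by (auto simp: L'_def)
 define L1 where "L1 = {l:L'. cmod l = r}"
 have L1: "finite L1" "L1 ~= {}" using L' r_mem by (auto simp: L1_def)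
 define d where "d = Max ((%l. degree (q l)) ` L1)"
 have d_mem: "d : (%l. degree (q l)) ` L1" unfolding d_def using L1 by (intro Max_in) auto
 have d_ge: "degree (q l) <= d" if "l : L1" for l unfolding d_def using L1 that by simp
 define L2 where "L2 = {l:L1. degree (q l) = d}"
 have L2: "finite L2" "L2 ~= {}" using L1 d_mem by (auto simp: L2_def)
 have sub: "L2 \<subseteq> L1" "L1 \<subseteq> L'" "L' \<subseteq> L" by (auto simp: L2_def L1_def L'_def)
 define \<rho> :: complex where "\<rho> = of_real r"
 have \<rho>: "\<rho> ~= 0" "cmod \<rho> = r" using r by (auto simp: \<rho>_def)
 define W where "W = (%l. l/\<rho>) ` L2"
 define c where "c u = coeff (q (u*\<rho>)) d" for u
 have inj: "inj_on (%l. l/\<rho>) L2" using \<rho> by (auto simp: inj_on_def)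
 have W1: "finite W" "W ~= {}" "ALL u:W. cmod u = 1" using L2 sub r by (auto simp: W_def L2_def L1_def \<rho>_def norm_divide)
 have W2: "nondegenerate W" unfolding nondegenerate_def W_def proof (intro ballI allI impI)
  fix u u' j assume u: "u : (%l. l/\<rho>) ` L2" "u' : (%l. l/\<rho>) ` L2" "1 <= (j::nat)" "u^j = u'^j"
  then obtain l l' where l: "l : L2" "l' : L2" "u = l/\<rho>" "u' = l'/\<rho>" by auto
  hence "l^j = l'^j" using u(4) \<rho> by (simp add: power_divide)
  hence "l = l'" using L(3) l sub u(3) unfolding nondegenerate_def by blast
  thus "u = u'" using l by simp
 qed have W3: "ALL u:W. c u ~= 0" using \<rho> sub leading_coeff_0_iff by (auto simp: W_def c_def L2_def L1_def L'_def)
 have lim1: "(%k. poly (q l) (of_nat k)*l^k/growth r d k -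
   (if l : L2 then coeff (q l) d*(l/\<rho>)^k else 0)) ----> 0" if l: "l : L'" for l proof (cases "l : L1")
  case True have "(%k. poly (q l) (of_nat k)/of_nat k^d-coeff (q l) d) ----> coeff (q l) d-coeff (q l) d"
   by (intro tendsto_diff tendsto_const poly_over_power_tendsto d_ge True)
  hence "(%k. cmod (poly (q l) (of_nat k)/of_nat k^d-coeff (q l) d)) ----> 0" by (simp add: tendsto_norm_zero)
  moreover have "cmod ((poly (q l) (of_nat k)/of_nat k^d-coeff (q l) d)*(l/\<rho>)^k) =
    cmod (poly (q l) (of_nat k)/of_nat k^d-coeff (q l) d)" for k
   using True \<rho> r by (simp add: norm_mult norm_power norm_divide L1_def)
  ultimately have null: "(%k. (poly (q l) (of_nat k)/of_nat k^d-coeff (q l) d)*(l/\<rho>)^k) ----> 0"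
   by (intro tendsto_norm_zero_cancel[where f = "%k. (poly (q l) (of_nat k)/of_nat k^d-coeff (q l) d)*(l/\<rho>)^k"]) simp
  have "coeff (q l) d = (if l : L2 then coeff (q l) d else 0)" using True d_ge[OF True] by (auto simp: L2_def intro: coeff_eq_0)
  hence "(if l : L2 then coeff (q l) d*(l/\<rho>)^k else 0) = coeff (q l) d*(l/\<rho>)^k" for k by (auto split: if_splits)
  moreover have "poly (q l) (of_nat k)*l^k/growth r d k = poly (q l) (of_nat k)/of_nat k^d*(l/\<rho>)^k" for k
   by (simp add: growth_def \<rho>_def[symmetric] power_divide)
  ultimately have "poly (q l) (of_nat k)*l^k/growth r d k-(if l : L2 then coeff (q l) d*(l/\<rho>)^k else 0)
    = (poly (q l) (of_nat k)/of_nat k^d-coeff (q l) d)*(l/\<rho>)^k" for k by (simp only: left_diff_distrib)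
  thus ?thesis using null by simp
 next case False hence lt: "cmod l < r" using r_ge[OF l] l by (auto simp: L1_def)
  define D where "D = degree (q l)"
  have "(%k. poly (q l) (of_nat k)/of_nat k^D*(of_nat k^D*(l/\<rho>)^k)) ----> coeff (q l) D*0"
   by (intro tendsto_mult poly_over_power_tendsto polynomial_times_power_null)
    (use lt \<rho> r in "auto simp: D_def norm_divide")
  hence "(%k. cmod (poly (q l) (of_nat k)/of_nat k^D*(of_nat k^D*(l/\<rho>)^k))) ----> 0" by (simp add: tendsto_norm_zero)
  moreover have "EVT k. norm (poly (q l) (of_nat k)*l^k/growth r d k) <=
    cmod (poly (q l) (of_nat k)/of_nat k^D*(of_nat k^D*(l/\<rho>)^k))" using ev_gt[of 0] proof eventually_elim
   case (elim k) have eq: "poly (q l) (of_nat k)/of_nat k^D*(of_nat k^D*(l/\<rho>)^k) = poly (q l) (of_nat k)*(l/\<rho>)^k"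
    using elim by simp
   have eq2: "poly (q l) (of_nat k)*l^k/growth r d k = poly (q l) (of_nat k)*(l/\<rho>)^k/of_nat k^d"
    by (simp add: growth_def \<rho>_def power_divide)
   have "1 <= real k^d" using elim by simp
   hence "x/real k^d <= x" if "0 <= x" for x using that mult_left_mono[of 1 "real k^d" x] elim by (simp add: divide_le_eq)
   thus ?case unfolding eq eq2 by (subst norm_divide) (simp add: norm_power)
  qed ultimately have "(%k. poly (q l) (of_nat k)*l^k/growth r d k) ----> 0" by (rule Lim_null_comparison[rotated])
  moreover have "l ~: L2" using False sub by blast
  ultimately show ?thesis by simp
 qed have "(%k. SUM l:L'. poly (q l) (of_nat k)*l^k/growth r d k -
   (if l : L2 then coeff (q l) d*(l/\<rho>)^k else 0)) ----> (SUM l:L'. 0)" by (rule tendsto_sum) (rule lim1)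
 moreover have "EVT k. (SUM l:L'. poly (q l) (of_nat k)*l^k/growth r d k -
   (if l : L2 then coeff (q l) d*(l/\<rho>)^k else 0)) = f k/growth r d k-trig W c k" using f proof eventually_elim
  case (elim k) have "f k = (SUM l:L'. poly (q l) (of_nat k)*l^k)" unfolding elim
   by (rule sum.mono_neutral_right) (use L in "auto simp: L'_def")
  moreover have "(trig W c k) = (SUM l:L2. coeff (q l) d*(l/\<rho>)^k)"
   unfolding W_def sum.reindex[OF inj] c_def using \<rho> by simp
  moreover have "... = (SUM l:L'. if l : L2 then coeff (q l) d*(l/\<rho>)^k else 0)"
   by (rule sum.mono_neutral_cong_left) (use L' sub in auto)
  ultimately show ?case by (simp add: sum_subtractf sum_divide_distrib)
 qed ultimately have "(%k. f k/growth r d k-trig W c k) ----> 0" by (simp add: lim_cong)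
 thus ?thesis using r W1 W2 W3 by blast
qed

text \<open>The growths of \<open>a\<close> and \<open>b\<close> are compared. If \<open>a\<close>
  grew faster, boundedness of \<open>s\<close> would turn the leading trigonometric polynomial of
  \<open>a\<close> into a null sequence. If \<open>a\<close> grows more slowly, it is null on the
  scale of \<open>b\<close>. If the growths agree, the leading polynomials form the ratio treated in
  \<open>cesaro_ratio_trigpoly\<close>.\<close>

lemma cesaro_ratio_expoly_on: fixes s :: "nat => complex"
 assumes B: "!!k. cmod (s k) <= B" and L: "nondegenerate L" and a: "expoly_on L a" and b: "expoly_on L b"
  and b0: "~ (EVT k. b k = 0)" and eq: "EVT k. s k*b k = a k" shows "cesaro s" proof - obtain q q' where L': "finite L" "0 ~: L"
  and q: "EVT k. a k = (SUM l:L. poly (q l) (of_nat k)*l^k)" and q': "EVT k. b k = (SUM l:L. poly (q' l) (of_nat k)*l^k)"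
  using a b unfolding expoly_on_def by blast
 obtain r d W c where r: "0 < r" and W: "finite W" "W ~= {}" "ALL u:W. cmod u = 1" "nondegenerate W" "ALL u:W. c u ~= 0"
  and lim: "(%k. b k/growth r d k-trig W c k) ----> 0" using expoly_leading_term[OF L' L q'] b0 by blast
 define \<beta> where "\<beta> k = trig W c k" for k
 have s_null: "(%k. s k*z k) ----> 0" if "z ----> 0" for z proof (rule Lim_null_comparison)
  show "EVT k. norm (s k*z k) <= B*cmod (z k)" by (simp add: norm_mult mult_right_mono B)
  show "(%k. B*cmod (z k)) ----> 0" using that by (intro tendsto_mult_right_zero tendsto_norm_zero)
 qed have lim1: "(%k. s k*(b k/growth r d k-\<beta> k)) ----> 0" using lim unfolding \<beta>_def by (rule s_null)
 have lim2: "(%k. a k/growth r d k-s k*\<beta> k) ----> 0" by (rule lim_cong[OF lim1])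
   (use eq in "eventually_elim, simp add: right_diff_distrib")
 have bb: "EX G>0. ALL k. cmod (\<beta> k) <= G"
  unfolding \<beta>_def by (intro trigpoly_bounded trigpoly_sum trigpoly_term) (use W in blast)
 have concl: "cesaro s" if "trigpoly \<alpha>" "(%k. a k/growth r d k-\<alpha> k) ----> 0" for \<alpha>
 proof (rule cesaro_ratio_trigpoly[OF B W that(1)])
  have "(%k. (a k/growth r d k-\<alpha> k)-(a k/growth r d k-s k*\<beta> k)) ----> 0-0" by (intro tendsto_diff that(2) lim2)
  thus "(%k. s k*(trig W c k)-\<alpha> k) ----> 0" by (simp add: \<beta>_def)
 qed from expoly_leading_term[OF L' L q] show ?thesis proof
  assume "EVT k. a k = 0"
  hence "EVT k. 0 = a k/growth r d k-0" by eventually_elim simp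
  hence "(%k. a k/growth r d k-0) ----> 0" by (rule lim_cong[OF tendsto_const])
  thus ?thesis by (intro concl[OF trigpoly_const])
 next assume "EX r d W c. 0 < r & finite W & W ~= {} & (ALL u:W. cmod u = 1) & nondegenerate W &
   (ALL u:W. c u ~= 0) & (%k. a k/growth r d k-trig W c k) ----> 0"
  then obtain r' d' W' c' where r': "0 < r'"
   and W': "finite W'" "W' ~= {}" "ALL u:W'. cmod u = 1" "nondegenerate W'" "ALL u:W'. c' u ~= 0"
   and lim': "(%k. a k/growth r' d' k-trig W' c' k) ----> 0" by blast
  define \<alpha> where "\<alpha> k = trig W' c' k" for k
  have t\<alpha>: "trigpoly \<alpha>" unfolding \<alpha>_def using W' by (intro trigpoly_sum trigpoly_term) blast
  have g0: "growth r d k ~= 0" "growth r' d' k ~= 0" if "0 < k" for k using r r' that by (auto simp: growth_def)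
  have bdd_null: "(%k. x k*z k) ----> 0" if "z ----> 0" "(%k. x k-y k) ----> 0" "!!k. cmod (y k) <= G"
   for x y z :: "nat => complex" and G proof - have "(%k. y k*z k) ----> 0" proof (rule Lim_null_comparison)
    show "EVT k. norm (y k*z k) <= G*cmod (z k)" by (simp add: norm_mult mult_right_mono that)
    show "(%k. G*cmod (z k)) ----> 0" using that(1) by (intro tendsto_mult_right_zero tendsto_norm_zero)
   qed moreover have "(%k. (x k-y k)*z k) ----> 0*0" by (intro tendsto_mult that)
   ultimately have "(%k. (x k-y k)*z k+y k*z k) ----> 0+0" by (intro tendsto_add) simp_all
   thus ?thesis by (simp add: algebra_simps)
  qed consider "r < r' | (r = r' & d < d')" | "r' < r | (r' = r & d' < d)" | "r = r' & d = d'" by linarith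
  thus ?thesis proof cases
   case 1 note gr = growth_ratio_null[OF r r' 1]
   obtain G where G: "!!k. cmod (\<beta> k) <= G" using bb by blast
   have "cmod (s k*\<beta> k) <= B*G" for k using mult_mono[OF B G] order_trans[OF norm_ge_zero B] by (simp add: norm_mult)
   hence "(%k. a k/growth r d k*(growth r d k/growth r' d' k)) ----> 0" by (rule bdd_null[OF gr lim2])
   moreover have "EVT k. a k/growth r d k*(growth r d k/growth r' d' k) = a k/growth r' d' k"
    using ev_gt[of 0] by eventually_elim (simp add: g0)
   ultimately have "(%k. a k/growth r' d' k) ----> 0" by (rule lim_cong)
   from tendsto_diff[OF this lim'] have "(%k. SUM u:W'. c' u*u^k) ----> 0" by simp
   thus ?thesis using trigpoly_not_null[OF W'] by blast
  next case 2 note gr = growth_ratio_null[OF r' r 2]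
   obtain G where "!!k. cmod (\<alpha> k) <= G" using trigpoly_bounded[OF t\<alpha>] by blast
   hence "(%k. a k/growth r' d' k*(growth r' d' k/growth r d k)) ----> 0" by (rule bdd_null[OF gr lim'[folded \<alpha>_def]])
   moreover have "EVT k. a k/growth r' d' k*(growth r' d' k/growth r d k) = a k/growth r d k-0"
    using ev_gt[of 0] by eventually_elim (simp add: g0)
   ultimately have "(%k. a k/growth r d k-0) ----> 0" by (rule lim_cong)
   thus ?thesis by (intro concl[OF trigpoly_const])
  next case 3 thus ?thesis using concl[OF t\<alpha>] lim' by (simp add: \<alpha>_def)
  qed qed qed

text \<open>On a progression of step \<open>m\<close> the frequency \<open>l\<close> becomes
  \<open>l^m\<close>. Different frequencies may merge, so the coefficient polynomials over each new
  frequency are summed.\<close>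

lemma expoly_on_residue: assumes f: "expoly_on L f" and m: "1 <= m" shows "expoly_on ((%l. l^m) ` L) (%k. f (m*k+t))" proof -
 obtain q where L: "finite L" "0 ~: L" and q: "EVT k. f k = (SUM l:L. poly (q l) (of_nat k)*l^k)"
  using f unfolding expoly_on_def by blast
 define p where "p l = smult (l^t) (pcompose (q l) [:of_nat t, of_nat m:])" for l
 have p: "poly (q l) (of_nat (m*k+t))*l^(m*k+t) = poly (p l) (of_nat k)*(l^m)^k" for l k proof -
  have "l^(m*k+t) = l^t*(l^m)^k" by (simp only: power_add power_mult) (rule mult.commute)
  thus ?thesis by (simp add: p_def poly_pcompose mult_ac add_ac)
 qed have "filterlim (%k. m*k+t) sequentially sequentially" proof (rule filterlim_at_top_mono[OF filterlim_ident])
  show "EVT k. k <= m*k+t" proof (intro always_eventually allI)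
   fix k have "1*k <= m*k" using m by (intro mult_right_mono) auto
   thus "k <= m*k+t" unfolding mult_1 by (rule trans_le_add1)
  qed qed from eventually_compose_filterlim[OF q this]
 have "EVT k. f (m*k+t) = (SUM u:(%l. l^m) ` L. poly (SUM l:{l:L. l^m = u}. p l) (of_nat k)*u^k)" proof eventually_elim
  case (elim k) have "f (m*k+t) = (SUM l:L. poly (p l) (of_nat k)*(l^m)^k)" unfolding elim by (intro sum.cong refl p)
  also have "... = (SUM u:(%l. l^m) ` L. SUM l:{l:L. l^m = u}. poly (p l) (of_nat k)*(l^m)^k)" by (rule sum.image_gen[OF L(1)])
  also have "... = (SUM u:(%l. l^m) ` L. poly (SUM l:{l:L. l^m = u}. p l) (of_nat k)*u^k)"
   by (intro sum.cong refl) (simp add: poly_sum sum_distrib_right)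
  finally show ?case .
 qed moreover have "finite ((%l. l^m) ` L)" "0 ~: (%l. l^m) ` L" using L m by auto
 ultimately show ?thesis unfolding expoly_on_def by (intro conjI exI[of _ "%u. SUM l:{l:L. l^m = u}. p l"])
qed

text \<open>For each pair of frequencies with some equal powers, one exponent witnessing this is
  chosen, and 1 for every other pair; \<open>m\<close> is the product. If powers of
  \<open>l^m\<close> and \<open>l'^m\<close> agree, then so do powers of \<open>l\<close> and
  \<open>l'\<close>, and the chosen exponent divides \<open>m\<close>.\<close>

lemma nondegenerate_power: assumes "finite L" shows "EX m>=1. nondegenerate ((%l. l^m) ` L)" proof -
 define j where "j = (%(l, l'). if EX j>=1::nat. l^j = (l' :: complex)^j then SOME j. 1 <= j & l^j = l'^j else 1)"
 have j: "1 <= j (l, l')" "(EX i>=1. l^i = l'^i) ==> l^j (l, l') = l'^j (l, l')" for l l' proof -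
  have "1 <= j (l, l') & l^j (l, l') = l'^j (l, l')" if ex: "EX i>=1. l^i = l'^i" proof -
   have "j (l, l') = (SOME j. 1 <= j & l^j = l'^j)" using ex by (simp add: j_def)
   thus ?thesis using someI_ex[of "%j. 1 <= j & l^j = l'^j"] ex by simp
  qed moreover have "j (l, l') = 1" if "~ (EX i>=1. l^i = l'^i)" unfolding j_def using that by auto
  ultimately show "1 <= j (l, l')" "(EX i>=1. l^i = l'^i) ==> l^j (l, l') = l'^j (l, l')" by (metis order_refl)+
 qed define m where "m = prod j (L \<times> L)"
 have "m ~= 0" unfolding m_def using j(1) assms by (auto simp: prod_zero_iff Suc_le_eq)
 moreover have "nondegenerate ((%l. l^m) ` L)" unfolding nondegenerate_def proof (intro ballI allI impI)
  fix u u' i assume "u : (%l. l^m) ` L" "u' : (%l. l^m) ` L" and i: "1 <= (i::nat)" "u^i = u'^i"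
  then obtain l l' where l: "l : L" "l' : L" "u = l^m" "u' = l'^m" by auto
  have "l^(m*i) = l'^(m*i)" using i(2) l by (simp add: power_mult)
  moreover have "1 <= m*i" using i(1) \<open>m \<noteq> 0\<close> by (cases m; cases i) auto
  ultimately have "l^j (l, l') = l'^j (l, l')" using j(2) by blast
  moreover have "j (l, l') dvd m" unfolding m_def by (rule dvd_prodI) (use assms l in auto)
  ultimately show "u = u'" using l by (auto elim!: dvdE simp: power_mult)
 qed ultimately show ?thesis by (intro exI[of _ m]) auto
qed

text \<open>Complete blocks of \<open>m\<close> terms average to the sum of the residue means, with
  \<open>(N div m)/N\<close> tending to \<open>1/m\<close>; the incomplete last block consists of
  fewer than \<open>m\<close> bounded terms.\<close>

lemma cesaro_residues: fixes s :: "nat => 'a::real_normed_vector" assumes B: "!!k. norm (s k) <= B" and m: "1 <= m"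
  and c: "!!t. t < m ==> cesaro (%k. s (m*k+t))" shows "cesaro s" proof -
 have block: "(SUM k<m*n. s k) = (SUM k<n. SUM t<m. s (m*k+t))" for n proof (induction n) case (Suc n)
  have "(SUM k<m*Suc n. s k) = (SUM k<m*n. s k)+(SUM k:{m*n..<m*n+m}. s k)"
   using sum.atLeastLessThan_concat[of 0 "m*n" "m*n+m" s] by (simp add: atLeast0LessThan add.commute)
  also have "(SUM k:{m*n..<m*n+m}. s k) = (SUM t<m. s (m*n+t))"
   using sum.shift_bounds_nat_ivl[of s 0 "m*n" m] by (simp add: atLeast0LessThan add.commute)
  finally show ?case using Suc by simp
 qed simp
 have "cesaro (%k. SUM t<m. s (m*k+t))" by (rule cesaro_sum) (use c in auto)
 then obtain l where "(%n. (SUM k<m*n. s k) /\<^sub>R real n) ----> l"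
  unfolding cesaro_def convergent_def block[symmetric] by blast
 moreover have fl: "filterlim (%N. N div m) sequentially sequentially" proof (subst filterlim_at_top, intro allI)
  fix Z show "EVT N. Z <= N div m" using eventually_ge_at_top[of "Z*m"]
   by eventually_elim (use m in "simp add: less_eq_div_iff_mult_less_eq")
 qed ultimately have lim1: "(%N. (SUM k<m*(N div m). s k) /\<^sub>R real (N div m)) ----> l"
  by (rule filterlim_compose[of _ _ _ "%N. N div m"])
 have ratio: "(%N. real (N div m)/real N) ----> 1/real m" proof (rule tendsto_sandwich)
  have *: "real (N div m) = (real N-real (N mod m))/real m" for N proof - have "real N = real (m*(N div m)+N mod m)" by simp
   hence "real N = real m*real (N div m)+real (N mod m)" by (simp only: of_nat_add of_nat_mult)
   thus ?thesis using m by simp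
  qed show "EVT N. 1/real m-1/real N <= real (N div m)/real N" using ev_gt[of 0] proof eventually_elim
   case (elim N) have "real (N mod m) <= real m" using m by (simp add: less_imp_le)
   hence "(real N-real m)/real m <= real (N div m)" unfolding * using m by (intro divide_right_mono) auto
   hence "((real N-real m)/real m)/real N <= real (N div m)/real N" by (rule divide_right_mono) simp
   moreover have "((real N-real m)/real m)/real N = 1/real m-1/real N" using elim m by (simp add: field_simps)
   ultimately show ?case by simp
  qed show "EVT N. real (N div m)/real N <= 1/real m" using ev_gt[of 0] proof eventually_elim
   case (elim N) have "real (N div m) <= real N/real m" by (rule of_nat_div_le_of_nat)
   thus ?case using elim m by (simp add: field_simps)
  qed show "(%N. 1/real m-1/real N) ----> 1/real m" using tendsto_diff[OF tendsto_const lim_1_over_n, of "1/real m"] by simp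
 qed simp
 have "(%N. (real (N div m)/real N) *\<^sub>R ((SUM k<m*(N div m). s k) /\<^sub>R real (N div m))) ----> (1/real m) *\<^sub>R l"
  by (rule tendsto_scaleR[OF ratio lim1])
 moreover have "(%N. (SUM k:{m*(N div m)..<N}. s k) /\<^sub>R real N) ----> 0" proof (rule Lim_null_comparison)
  have "norm (SUM k:{m*(N div m)..<N}. s k) <= real m*B" for N proof -
   have "norm (SUM k:{m*(N div m)..<N}. s k) <= (SUM k:{m*(N div m)..<N}. B)"
    by (rule order_trans[OF norm_sum]) (rule sum_mono, rule B)
   also have "... = real (N mod m)*B" by (simp add: minus_mult_div_eq_mod)
   also have "... <= real m*B" using m order_trans[OF norm_ge_zero B] by (intro mult_right_mono) (auto simp: less_imp_le)
   finally show ?thesis .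
  qed hence "norm ((SUM k:{m*(N div m)..<N}. s k) /\<^sub>R real N) <= (real m*B)*(1/real N)" for N
   by (simp add: divide_right_mono flip: divide_inverse_commute)
  thus "EVT N. norm ((SUM k:{m*(N div m)..<N}. s k) /\<^sub>R real N) <= (real m*B)*(1/real N)" by simp
  show "(%N. (real m*B)*(1/real N)) ----> 0" by (rule tendsto_mult_right_zero[OF lim_1_over_n])
 qed ultimately have "(%N. (real (N div m)/real N) *\<^sub>R ((SUM k<m*(N div m). s k) /\<^sub>R real (N div m)) +
   (SUM k:{m*(N div m)..<N}. s k) /\<^sub>R real N) ----> (1/real m) *\<^sub>R l+0" by (rule tendsto_add)
 moreover have "EVT N. (real (N div m)/real N) *\<^sub>R ((SUM k<m*(N div m). s k) /\<^sub>R real (N div m)) +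
   (SUM k:{m*(N div m)..<N}. s k) /\<^sub>R real N = (SUM k<N. s k) /\<^sub>R real N" using eventually_ge_at_top[of m]
 proof eventually_elim
  case (elim N) hence "0 < N div m" using m by (simp add: div_greater_zero_iff)
  hence "(real (N div m)/real N) *\<^sub>R ((SUM k<m*(N div m). s k) /\<^sub>R real (N div m)) =
    (SUM k<m*(N div m). s k) /\<^sub>R real N" by (simp add: divide_inverse)
  moreover have "(SUM k<N. s k) = (SUM k<m*(N div m). s k)+(SUM k:{m*(N div m)..<N}. s k)"
   using sum.atLeastLessThan_concat[of 0 "m*(N div m)" N s] by (simp add: atLeast0LessThan)
  ultimately show ?case by (simp add: scaleR_right_distrib)
 qed ultimately have "(%N. (SUM k<N. s k) /\<^sub>R real N) ----> (1/real m) *\<^sub>R l+0" by (rule lim_cong)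
 thus ?thesis unfolding cesaro_def convergent_def by blast
qed

lemma low_order_coefficient_limit: assumes "!!j. j < i ==> c j = 0" "i <= D"
 shows "((%ep. (SUM j<=D. c j * of_real ep ^ j)/of_real ep ^ i) \<longlongrightarrow> (c i :: complex)) (at_right (0::real))"
proof -
 have tm: "((%ep. c j*(of_real ep ^ j/of_real ep ^ i)) \<longlongrightarrow> (if j = i then c i else 0)) (at_right (0::real))" for j
 proof - consider "j < i" | "j = i" | "i < j" by linarith
  thus ?thesis proof cases
   case 2 have "\<forall>\<^sub>F ep in at_right (0::real). c i = c j*(of_real ep ^ j/of_real ep ^ i)"
    using eventually_at_right_less[of "0::real"] by eventually_elim (simp add: 2)
   from lim_cong[OF tendsto_const this] show ?thesis using 2 by simp
  next case 3 have "((%ep::real. c j * of_real ep ^ (j-i)) \<longlongrightarrow> c j * of_real 0^(j-i)) (at_right 0)"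
    by (intro tendsto_intros)
   moreover have "\<forall>\<^sub>F ep in at_right (0::real). c j * of_real ep ^ (j-i) = c j*(of_real ep ^ j/of_real ep ^ i)"
    using eventually_at_right_less[of "0::real"] by eventually_elim (use 3 in "simp add: power_diff less_imp_le")
   ultimately have "((%ep. c j*(of_real ep ^ j/of_real ep ^ i)) \<longlongrightarrow> c j * of_real 0^(j-i)) (at_right (0::real))"
    by (rule lim_cong)
   thus ?thesis using 3 by (simp add: power_0_left)
  qed (simp add: assms)
 qed
 have "((%ep. SUM j<=D. c j*(of_real ep ^ j/of_real ep ^ i)) \<longlongrightarrow> (SUM j<=D. if j = i then c i else 0)) (at_right (0::real))"
  by (rule tendsto_sum) (rule tm)
 thus ?thesis using assms(2) by (simp add: sum_divide_distrib)
qed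

text \<open>The values of \<open>s\<close> are the limits of rational functions of \<open>ep\<close> whose coefficients are
 exponential polynomials; on a residue class the lowest-order denominator coefficient that does
 not vanish identically decides the limit.\<close>

theorem cesaro_limit_of_ratios: fixes s :: "nat => complex" assumes B: "!!k. cmod (s k) <= B"
  and n: "!!i. i <= D ==> expoly (n i)" and d: "!!i. i <= D ==> expoly (d i)"
  and lim: "!!k. EX r. (r \<longlongrightarrow> s k) (at_right (0::real)) & (ALL ep>0. (SUM i<=D. d i k * of_real ep ^ i) ~= 0 &
    r ep * (SUM i<=D. d i k * of_real ep ^ i) = (SUM i<=D. n i k * of_real ep ^ i))" shows "cesaro s" proof -
 have "EX L. finite L & 0 ~: L & (ALL i<=D. expoly_on L (n i) & expoly_on L (d i))" proof -
  have "ALL i:{..D}. EX L. expoly_on L (n i)" "ALL i:{..D}. EX L. expoly_on L (d i)" using n d unfolding expoly_def by auto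
  then obtain Ln Ld where Ln: "ALL i:{..D}. expoly_on (Ln i) (n i)" and Ld: "ALL i:{..D}. expoly_on (Ld i) (d i)"
   by (auto dest!: bchoice)
  define L where "L = (UN i:{..D}. Ln i Un Ld i)"
  have L: "finite L" "0 ~: L" using Ln Ld unfolding L_def expoly_on_def by auto
  have "expoly_on L (n i) & expoly_on L (d i)" if "i <= D" for i
   using Ln Ld that by (intro conjI expoly_on_mono[OF _ _ L]) (auto simp: L_def)
  thus ?thesis using L by blast
 qed then obtain L where L: "finite L" "!!i. i <= D ==> expoly_on L (n i)" "!!i. i <= D ==> expoly_on L (d i)" by blast
 obtain m where m: "1 <= m" "nondegenerate ((%l. l^m) ` L)" using nondegenerate_power[OF L(1)] by blast
 show ?thesis proof (rule cesaro_residues[OF B m(1)])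
  fix t assume "t < m"
  define s' where "s' k = s (m*k+t)" for k
  define n' where "n' i k = n i (m*k+t)" for i k
  define d' where "d' i k = d i (m*k+t)" for i k
  have lim': "EX r. (r \<longlongrightarrow> s' k) (at_right (0::real)) & (ALL ep>0. (SUM i<=D. d' i k * of_real ep ^ i) ~= 0 &
    r ep * (SUM i<=D. d' i k * of_real ep ^ i) = (SUM i<=D. n' i k * of_real ep ^ i))" for k
   unfolding s'_def n'_def d'_def by (rule lim)
  define P where "P i \<longleftrightarrow> i <= D & ~ (EVT k. d' i k = 0)" for i
  have "EX i. P i" proof (rule ccontr)
   assume "~ (EX i. P i)"
   hence "EVT k. ALL i:{..D}. d' i k = 0" unfolding P_def by (intro eventually_ball_finite) auto
   then obtain k where k: "ALL i:{..D}. d' i k = 0" using eventually_happens by fastforce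
   obtain r where "ALL ep>0. (SUM i<=D. d' i k * of_real ep ^ i) ~= 0" using lim'[of k] by blast
   thus False using k by (auto dest: spec[of _ "1::real"])
  qed hence P: "P (LEAST i. P i)" by (rule LeastI_ex)
  define j where "j = (LEAST i. P i)"
  have j: "j <= D" "~ (EVT k. d' j k = 0)" using P by (auto simp: P_def j_def)
  have "EVT k. ALL i:{..<j}. d' i k = 0" proof (rule eventually_ball_finite)
   show "ALL i:{..<j}. EVT k. d' i k = 0" proof
    fix i assume i: "i : {..<j}"
    hence "~ P i" unfolding j_def by (intro not_less_Least) simp
    thus "EVT k. d' i k = 0" using i j(1) unfolding P_def by simp
   qed qed simp
  hence eq: "EVT k. s' k*d' j k = n' j k" proof eventually_elim
   case (elim k) obtain r where r: "(r \<longlongrightarrow> s' k) (at_right (0::real))"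
    "!!ep. ep > 0 ==> r ep * (SUM i<=D. d' i k * of_real ep ^ i) = (SUM i<=D. n' i k * of_real ep ^ i)" using lim'[of k] by blast
   \<comment> \<open>Dividing by \<open>ep^i\<close> exposes coefficient \<open>i\<close> on both
     sides, provided all lower ones vanish. For the denominator they do by the choice of
     \<open>j\<close>; for the numerator this is the induction hypothesis, which there reads
     \<open>n' = s' * 0\<close>.\<close>
   have "n' i k = s' k*d' i k" if "i <= j" for i using that proof (induction i rule: less_induct) case (less i)
    have z: "d' i' k = 0" "n' i' k = 0" if "i' < i" for i' using less that elim by auto
    have "((%ep. r ep * ((SUM i<=D. d' i k * of_real ep ^ i)/of_real ep ^ i)) \<longlongrightarrow> s' k*d' i k) (at_right 0)"
     by (intro tendsto_mult r(1) low_order_coefficient_limit) (use z less j in auto)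
    moreover have "\<forall>\<^sub>F ep in at_right 0. r ep * ((SUM i<=D. d' i k * of_real ep ^ i)/of_real ep ^ i)
      = (SUM i<=D. n' i k * of_real ep ^ i)/of_real ep ^ i"
     using eventually_at_right_less[of "0::real"] by eventually_elim (simp add: r(2))
    ultimately have "((%ep. (SUM i<=D. n' i k * of_real ep ^ i)/of_real ep ^ i) \<longlongrightarrow> s' k*d' i k) (at_right 0)"
     by (rule lim_cong)
    moreover have "((%ep. (SUM i<=D. n' i k * of_real ep ^ i)/of_real ep ^ i) \<longlongrightarrow> n' i k) (at_right (0::real))"
     by (rule low_order_coefficient_limit) (use z less j in auto)
    ultimately show ?case by (intro tendsto_unique[OF trivial_limit_at_right_real])
   qed thus ?case by simp
  qed show "cesaro (%k. s (m*k+t))" proof (rule cesaro_ratio_expoly_on[OF B m(2)])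
   show "expoly_on ((%l. l^m) ` L) (n' j)" "expoly_on ((%l. l^m) ` L) (d' j)"
    unfolding n'_def d'_def using L j m by (auto intro: expoly_on_residue)
   show "EVT k. s (m*k+t)*d' j k = n' j k" using eq by (simp add: s'_def)
  qed (use j in auto)
 qed qed

section \<open>Quadratic forms and positive semidefinite matrices\<close>

lemma inner_tr: "x \<bullet> (A *v y) = (tp A *v x) \<bullet> (y :: real^'n)" for A :: "real^'n^'m"
 by (metis dot_lmul_matrix vector_transpose_matrix transpose_transpose)

lemma inner_transpose_matrix: "x \<bullet> (tp A *v y) = (A *v x) \<bullet> y" for A :: "real^'n^'m"
 using inner_tr[of x "tp A" y] by simp

lemma axis_inner_matrix: "axis i 1 \<bullet> (W *v axis j 1) = W $ i $ j" for W :: "real^'n^'m"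
 by (simp add: inner_axis' matrix_vector_mult_basis column_def)

lemma matrix_eq_inner: "W = V \<longleftrightarrow> (ALL x y. x \<bullet> (W *v y) = x \<bullet> (V *v y))" for W V :: "real^'n^'m"
 by (metis axis_inner_matrix vec_eq_iff)

lemma symmetric_inner: "tp W = W ==> x \<bullet> (W *v y) = y \<bullet> (W *v x)" for W :: "real^'n^'n"
 by (metis inner_commute inner_tr)

lemma quad_add: fixes W :: "real^'n^'n" assumes "tp W = W" shows "qf W (x+y) = qf W x+2*(x \<bullet> (W *v y))+qf W y"
 using symmetric_inner[OF assms, of x y] by (simp add: mv_add inner_add_left inner_add_right)

lemma quad_eq_imp_eq: fixes W V :: "real^'n^'n" assumes "tp W = W" "tp V = V" "!!x. qf W x = qf V x" shows "W = V"
 unfolding matrix_eq_inner proof (intro allI)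
 fix x y show "x \<bullet> (W *v y) = x \<bullet> (V *v y)"
  using quad_add[OF assms(1), of x y] quad_add[OF assms(2), of x y] assms(3) by simp
qed

lemma transpose_add: "tp (A+B) = tp A+tp B" by (simp add: transpose_def vec_eq_iff)

lemma transpose_diff: "tp (A-B) = tp A-tp (B :: real^'n^'m)" by (simp add: transpose_def vec_eq_iff)

lemma transpose_scaleR: "tp (c *\<^sub>R A) = c *\<^sub>R tp (A :: real^'n^'m)" by (simp add: transpose_def vec_eq_iff)

lemma transpose_zero: "tp (0 :: real^'n^'m) = 0" by (simp add: transpose_def vec_eq_iff)

lemma mv_plus: "(A+B) *v x = A *v x+B *v (x :: real^'n)" for A :: "real^'n^'m" by (simp add: matrix_vector_mult_add_rdistrib)

lemma mv_minus: "(A-B) *v x = A *v x-B *v (x :: real^'n)" for A :: "real^'n^'m" by (simp add: mv_rdiff)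

lemma psd_sym: "psd W ==> tp W = W" by (simp add: psd_def)

lemma psd_quad: "psd W ==> 0 <= qf W x" by (simp add: psd_def)

lemma pd_psd: "pos_def W ==> psd W" unfolding pos_def_def psd_def by (metis inner_zero_left less_imp_le order_refl)

lemma psd_add: "psd W ==> psd V ==> psd (W+V)" by (simp add: psd_def transpose_add mv_plus inner_add_right)

lemma psd_scaleR: "0 <= c ==> psd W ==> psd (c *\<^sub>R W)" by (simp add: psd_def transpose_scaleR mv_scaleR)

lemma psd_zero: "psd (0 :: real^'n^'n)" by (simp add: psd_def transpose_zero)

lemma psd_mat_1: "psd (mat 1 :: real^'n^'n)" by (simp add: psd_def)

lemma quad_congruence: "qf (tp G**W**G) x = qf W (G *v x)"
 for G :: "real^'n^'m" unfolding mv_mult by (rule inner_transpose_matrix)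

lemma psd_congruence: "psd W ==> psd (tp G**W**G)" for G :: "real^'n^'m"
 by (simp add: psd_def quad_congruence matrix_transpose_mul mm_assoc)

text \<open>The form is nonnegative at \<open>s x - t y\<close>. For \<open>c > 0\<close> take
  \<open>s = c\<close> and \<open>t = b\<close>. For \<open>c = 0\<close> and \<open>b\<close>
  nonzero, \<open>s = 1\<close> and \<open>t = (a+1)/b\<close> would give the negative value
  \<open>- a - 2\<close>.\<close>

lemma psd_cauchy_schwarz: fixes W :: "real^'n^'n" assumes "psd W" shows "(x \<bullet> (W *v y))\<^sup>2 <= qf W x*qf W y" proof -
 define a b c where "a = qf W x" and "b = x \<bullet> (W *v y)" and "c = qf W y"
 have s: "y \<bullet> (W *v x) = b" using symmetric_inner[OF psd_sym[OF assms], of y x] by (simp add: b_def)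
 have ineq: "0 <= a * s * s-2*b * s*t+c*t*t" for s t proof -
  have "0 <= qf W (s *\<^sub>R x-t *\<^sub>R y)" by (rule psd_quad[OF assms])
  also have "... = a * s * s-2*b * s*t+c*t*t" by (simp add: mv_diff inner_diff_left inner_diff_right s
     matrix_vector_mult_scaleR algebra_simps flip: a_def b_def c_def)
  finally show ?thesis .
 qed have a: "0 <= a" and c: "0 <= c" using psd_quad[OF assms] by (simp_all add: a_def c_def)
 have "b\<^sup>2 <= a*c" proof (cases "c = 0")
  case True have "b = 0" proof (rule ccontr)
   assume "b ~= 0"
   hence "2*b*((a+1)/b) = 2*(a+1)" by simp
   thus False using ineq[of 1 "(a+1)/b"] True a by simp
  qed thus ?thesis using True by simp
 next case False hence "0 < c" using c by simp
  have "0 <= c*(a*c-b*b)" using ineq[of c b] by (simp add: algebra_simps)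
  hence "0 <= a*c-b*b" using \<open>0 < c\<close> by (simp add: zero_le_mult_iff)
  thus ?thesis by (simp add: pow2)
 qed thus ?thesis by (simp add: a_def b_def c_def)
qed

lemma psd_quad_zero: fixes W :: "real^'n^'n" assumes "psd W" "qf W x = 0" shows "W *v x = 0" proof -
 have "((W *v x) \<bullet> (W *v x))\<^sup>2 <= qf W (W *v x)*qf W x" by (rule psd_cauchy_schwarz[OF assms(1)])
 thus ?thesis using assms(2) by simp
qed

lemma pos_def_invertible: fixes W :: "real^'n^'n" assumes "pos_def W" shows "invertible W" proof -
 have "W *v x = 0 ==> x = 0" for x using assms unfolding pos_def_def by (metis inner_zero_right less_irrefl)
 thus ?thesis by (simp add: invertible_left_inverse matrix_left_invertible_ker)
qed

lemma matrix_inv_right: "invertible A ==> A**matrix_inv A = mat 1"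
 and matrix_inv_left: "invertible A ==> matrix_inv A**A = mat 1" for A :: "real^'n^'n"
 unfolding invertible_def matrix_inv_def by (metis (mono_tags, lifting) someI_ex)+

lemma pos_def_matrix_inv: fixes W :: "real^'n^'n" assumes "pos_def W" shows "W**matrix_inv W = mat 1" "matrix_inv W**W = mat 1"
 using pos_def_invertible[OF assms] by (simp_all add: matrix_inv_left matrix_inv_right)

lemma symmetric_matrix_inv: fixes W :: "real^'n^'n" assumes "tp W = W" "invertible W" shows "tp (matrix_inv W) = matrix_inv W"
proof - have "tp (matrix_inv W)**W = mat 1" by (metis assms matrix_inv_right matrix_transpose_mul transpose_mat)
 thus ?thesis by (metis assms(2) matrix_inv_right mm_assoc matrix_mul_lid matrix_mul_rid)
qed

lemma psd_add_pos_def: "psd W ==> pos_def V ==> pos_def (W+V)"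
 unfolding psd_def pos_def_def by (simp add: transpose_add mv_plus inner_add_right add_nonneg_pos)

lemma pos_def_lower_bound: fixes W :: "real^'n^'n" assumes "pos_def W" shows "EX c>0. ALL x. c*(x \<bullet> x) <= qf W x" proof -
 have cont: "continuous_on (sphere 0 1) (%x::real^'n. qf W x)"
  by (intro continuous_intros matrix_vector_mult_linear_continuous_on)
 obtain x0 :: "real^'n" where x0: "x0 : sphere 0 1" "!!x. x : sphere 0 1 ==> qf W x0 <= qf W x"
  using continuous_attains_inf[OF compact_sphere _ cont] by (metis equals0D mem_sphere_0 norm_axis_1)
 define c where "c = qf W x0"
 have "x0 ~= 0" using x0(1) by auto
 hence "0 < c" using assms unfolding pos_def_def c_def by blast
 moreover have "c*(x \<bullet> x) <= qf W x" for x proof (cases "x = 0")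
  case False have "c <= qf W (x /\<^sub>R norm x)" unfolding c_def by (rule x0(2)) (use False in simp)
  also have "... = qf W x/(x \<bullet> x)" by (simp add: matrix_vector_mult_scaleR dot_square_norm pow2 divide_inverse)
  finally show ?thesis using False by (simp add: field_simps)
 qed simp
 ultimately show ?thesis by blast
qed

lemma quad_upper_bound: fixes W :: "real^'n^'n" shows "EX c>=0. ALL x. \<bar>x \<bullet> (W *v x)\<bar> <= c*(x \<bullet> x)"
proof - define c where "c = onorm ((*v) W)"
 have bl: "bounded_linear ((*v) W)" by (simp add: linear_linear)
 have "\<bar>x \<bullet> (W *v x)\<bar> <= c*(x \<bullet> x)" for x proof -
  have "\<bar>x \<bullet> (W *v x)\<bar> <= norm x*norm (W *v x)" by (rule Cauchy_Schwarz_ineq2)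
  also have "... <= norm x*(c*norm x)" unfolding c_def by (intro mult_left_mono onorm bl) simp
  finally show ?thesis by (simp add: dot_square_norm pow2 mult_ac)
 qed thus ?thesis using onorm_pos_le[OF bl] c_def by blast
qed

section \<open>Matrix powers and spectra\<close>

primrec matpow :: "real^'n^'n => nat => real^'n^'n" where "matpow F 0 = mat 1"
| "matpow F (Suc k) = F**matpow F k"

lemma matpow_add: "matpow F (i+k) = matpow F i**matpow F k" by (induction i) (simp_all add: mm_assoc)

lemma matpow_funpow: "matpow F k *v x = ((*v) F ^^ k) x" by (induction k) (simp_all flip: mv_assoc)

text \<open>There are more powers than the dimension of the matrix space, so they are linearly
  dependent. Repeated powers form a separate case because \<open>dependent\<close> speaks of the set
  of powers and not of the indexed family.\<close>

lemma matrix_annihilating_polynomial: fixes F :: "real^'n^'n"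
 shows "EX p::real poly. p ~= 0 & (SUM i<=degree p. coeff p i *\<^sub>R matpow F i) = 0" proof -
 define N where "N = DIM(real^'n^'n)"
 have "EX a. (EX i<=N. a i ~= (0::real)) & (SUM i<=N. a i *\<^sub>R matpow F i) = 0" proof (cases "inj_on (matpow F) {..N}")
  case True hence "card (matpow F ` {..N}) = Suc N" by (simp add: card_image)
  hence "dependent (matpow F ` {..N})" by (intro dependent_biggerset) (auto simp: N_def)
  then obtain u v where u: "(SUM v:matpow F ` {..N}. u v *\<^sub>R v) = 0" "v : matpow F ` {..N}" "u v ~= 0"
   using dependent_finite[of "matpow F ` {..N}"] by auto
  show ?thesis by (rule exI[of _ "%i. u (matpow F i)"]) (use u True in "auto simp: sum.reindex")
 next case False then obtain i j where ij: "i <= N" "j <= N" "i ~= j" "matpow F i = matpow F j" unfolding inj_on_def by auto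
  define a where "a k = (if k = i then 1 else 0)-(if k = j then 1 else (0::real))" for k
  have "(SUM k<=N. a k *\<^sub>R matpow F k) =
    (SUM k<=N. if k = i then matpow F k else 0)-(SUM k<=N. if k = j then matpow F k else 0)"
   unfolding sum_subtractf[symmetric] a_def by (intro sum.cong) (auto simp: scaleR_left_diff_distrib)
  also have "... = 0" using ij by simp
  finally show ?thesis using ij by (intro exI[of _ a]) (auto simp: a_def)
 qed then obtain a where a: "EX i<=N. a i ~= (0::real)" "(SUM i<=N. a i *\<^sub>R matpow F i) = 0" by blast
 define p where "p = (SUM i<=N. monom (a i) i)"
 have c: "coeff p i = (if i <= N then a i else 0)" for i by (simp add: p_def coeff_sum if_distrib cong: if_cong)
 have "p ~= 0" using a(1) c by (metis coeff_0)
 moreover have "degree p <= N" by (rule degree_le) (simp add: c)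
 hence "(SUM i<=degree p. coeff p i *\<^sub>R matpow F i) = (SUM i<=N. coeff p i *\<^sub>R matpow F i)"
  by (intro sum.mono_neutral_left) (auto intro: le_degree)
 hence "(SUM i<=degree p. coeff p i *\<^sub>R matpow F i) = 0" using a(2) by (simp add: c)
 ultimately show ?thesis by blast
qed

lemma mm_rplus: "(A+B)**C = A**C+B**C" for A B :: "real^'n^'m"
 by (simp add: matrix_matrix_mult_def vec_eq_iff distrib_right sum.distrib)

lemma matrix_diff_rdistrib: "(A-B)**C = A**C-B**C" for A B :: "real^'n^'m"
 by (simp add: matrix_matrix_mult_def vec_eq_iff left_diff_distrib sum_subtractf)

lemma matrix_diff_ldistrib: "C**(A-B) = C**A-C**B" for A B :: "real^'n^'m"
 by (simp add: matrix_matrix_mult_def vec_eq_iff right_diff_distrib sum_subtractf)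

lemma matrix_matrix_mult_sum: "A**(SUM i:I. f i) = (SUM i:I. A**f i)" for A :: "real^'n^'m"
 by (induction I rule: infinite_finite_induct) (simp_all add: matrix_add_ldistrib)

lemma matrix_mult_scaleR: "A**(c *\<^sub>R B) = c *\<^sub>R (A**B)" "(c *\<^sub>R A)**B = c *\<^sub>R (A**B)"
 for A :: "real^'n^'m" by (simp_all add: matrix_scalar_ac scalar_matrix_assoc)

lemma matpow_recurrence: fixes F :: "real^'n^'n" shows "EX p::complex poly. p ~= 0 &
  (ALL k i j. (SUM m<=degree p. coeff p m * of_real (matpow F (k+m) $ i $ j)) = 0)" proof -
 obtain q where q: "q ~= 0" "(SUM i<=degree q. coeff q i *\<^sub>R matpow F i) = 0"
  using matrix_annihilating_polynomial[of F] by blast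
 define p where "p = map_poly complex_of_real q"
 have p: "coeff p i = of_real (coeff q i)" "degree p = degree q" for i by (simp_all add: p_def coeff_map_poly degree_map_poly)
 have "(SUM m<=degree q. coeff q m*(matpow F (k+m) $ i $ j)) = 0" for k i j proof -
  have "(SUM m<=degree q. coeff q m *\<^sub>R matpow F (k+m)) = matpow F k**(SUM m<=degree q. coeff q m *\<^sub>R matpow F m)"
   by (simp add: matpow_add matrix_matrix_mult_sum matrix_mult_scaleR)
  hence "(SUM m<=degree q. coeff q m *\<^sub>R matpow F (k+m)) $ i $ j = 0" by (simp add: q(2))
  thus ?thesis by simp
 qed hence "(SUM m<=degree p. coeff p m * of_real (matpow F (k+m) $ i $ j)) = 0" for k i j
  unfolding p by (simp flip: of_real_mult of_real_sum)
 moreover have "p ~= 0" using q(1) p(1) by (metis coeff_0 leading_coeff_0_iff of_real_eq_0_iff)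
 ultimately show ?thesis by blast
qed

lemma expoly_matpow: "expoly (%k. of_real (matpow F k $ i $ j))" proof - obtain p :: "complex poly" where "p ~= 0"
  "ALL k i j. (SUM m<=degree p. coeff p m * of_real (matpow F (k+m) $ i $ j)) = 0" using matpow_recurrence[of F] by blast
 thus ?thesis by (intro expoly_linear_recurrence[of p]) auto
qed

section \<open>Complex eigenvectors of real matrices\<close>

definition cmat :: "real^'n^'n => complex^'n^'n" where "cmat F = (\<chi> i j. complex_of_real (F $ i $ j))"

definition cvec :: "real^'n => complex^'n" where "cvec x = (\<chi> i. complex_of_real (x $ i))"

definition revec :: "complex^'n => real^'n" where "revec z = (\<chi> i. Re (z $ i))"

definition imvec :: "complex^'n => real^'n" where "imvec z = (\<chi> i. Im (z $ i))"

abbreviation cpow :: "real^'n^'n => nat => complex^'n => complex^'n" where "cpow F k \<equiv> (*v) (cmat F) ^^ k"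

lemma eigenvalue_of_cmat: "eigenvalue_of W l \<longleftrightarrow> (EX z. z ~= 0 & cmat W *v z = l *s z)"
 by (simp add: eigenvalue_of_def cmat_def)

lemma cmat_vector_scaleR: "cmat F *v (r *\<^sub>R z) = r *\<^sub>R (cmat F *v z)"
 by (simp add: mv_def vec_eq_iff scaleR_sum_right)

lemma cmat_cvec: "cmat F *v cvec x = cvec (F *v x)" by (simp add: cmat_def cvec_def mv_def vec_eq_iff)

lemma revec_cmat: "revec (cmat F *v z) = F *v revec z" by (simp add: cmat_def revec_def mv_def vec_eq_iff)

lemma imvec_cmat: "imvec (cmat F *v z) = F *v imvec z" by (simp add: cmat_def imvec_def mv_def vec_eq_iff)

lemma revec_imvec_zero: "revec z = 0 ==> imvec z = 0 ==> z = 0" by (simp add: revec_def imvec_def vec_eq_iff complex_eq_iff)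

lemma revec_scale: "revec (l *s z) = Re l *\<^sub>R revec z-Im l *\<^sub>R imvec z"
 and imvec_scale: "imvec (l *s z) = Re l *\<^sub>R imvec z+Im l *\<^sub>R revec z"
 by (simp_all add: revec_def imvec_def vec_eq_iff)

lemma norm_smult_complex: "norm (c *s z) = cmod c*norm (z :: complex^'n)"
 by (simp add: norm_vec_def norm_mult L2_set_right_distrib)

lemma cmat_matpow: "cpow F k z = cmat (matpow F k) *v z" for F :: "real^'n^'n" proof (induction k) case 0
 have "cmat (mat 1 :: real^'n^'n) = mat 1" by (simp add: cmat_def mat_def vec_eq_iff)
 thus ?case by simp
next case (Suc k)
 have "cmat F**cmat (matpow F k) = cmat (F**matpow F k)" by (simp add: cmat_def matrix_matrix_mult_def vec_eq_iff)
 thus ?case using Suc by (simp add: mv_assoc)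
qed

lemma complex_recurrence_shift: fixes x :: "nat => complex^'n" assumes p: "p = [:- l, 1:]*r" and r0: "r ~= 0"
  and rec: "!!k. (SUM i<=degree p. coeff p i *s x (k+i)) = 0"
 shows "(SUM i<=degree r. coeff r i *s (x (Suc (k+i))-l *s x (k+i))) = 0" proof -
 have deg: "degree p = Suc (degree r)" unfolding p using r0 by (subst degree_mult_eq) auto
 have c: "coeff p i = (if i = 0 then 0 else coeff r (i-1))-l*coeff r i" for i
  unfolding p by (cases i) (auto simp: coeff_pCons mult_pCons_left)
 have "0 = (SUM i<=Suc (degree r). coeff p i *s x (k+i))" using rec[of k] deg by simp
 also have "... = (SUM i<=Suc (degree r). (if i = 0 then 0 else coeff r (i-1)) *s x (k+i))
  -(SUM i<=Suc (degree r). (l*coeff r i) *s x (k+i))" by (simp only: c vector_sub_rdistrib sum_subtractf)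
 also have "(SUM i<=Suc (degree r). (if i = 0 then 0 else coeff r (i-1)) *s x (k+i)) =
   (SUM i<=degree r. coeff r i *s x (Suc (k+i)))" by (subst sum.atMost_Suc_shift) simp
 also have "(SUM i<=Suc (degree r). (l*coeff r i) *s x (k+i)) =
   (SUM i<=degree r. (l*coeff r i) *s x (k+i))" by (simp add: coeff_eq_0)
 also have "(SUM i<=degree r. coeff r i *s x (Suc (k+i)))-(SUM i<=degree r. (l*coeff r i) *s x (k+i)) =
   (SUM i<=degree r. coeff r i *s (x (Suc (k+i))-l *s x (k+i)))"
  by (simp add: sum_subtractf[symmetric] vector_ssub_ldistrib vector_smult_assoc mult.commute)
 finally show ?thesis by simp
qed

lemma eigenvalue_of_powers: assumes "eigenvalue_of F l"
 shows "EX z. z ~= 0 & cmat F *v z = l *s z & (ALL k. cpow F k z = l^k *s z)" proof -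
 obtain z where z: "z ~= 0" "cmat F *v z = l *s z" using assms unfolding eigenvalue_of_cmat by (elim exE conjE)
 have "cpow F k z = l^k *s z" for k proof (induction k) case (Suc k)
  have "cpow F (Suc k) z = l^k *s (cmat F *v z)" by (simp add: Suc vector_scalar_commute)
  also have "... = l^Suc k *s z" by (simp only: z(2) vector_smult_assoc power_Suc2)
  finally show ?case .
 qed simp
 with z show ?thesis by (intro exI[of _ z] conjI allI)
qed

lemma eigenvalue_ofI: "z ~= 0 ==> cmat F *v z = l *s z ==> eigenvalue_of F l" unfolding eigenvalue_of_cmat by (intro exI conjI)

lemma cmat_recurrence: "EX p. p ~= 0 & (ALL z k. (SUM i<=degree p. coeff p i *s cpow F (k+i) z) = 0)" proof -
 obtain p :: "complex poly" where p: "p ~= 0" "!!k i j. (SUM m<=degree p. coeff p m * of_real (matpow F (k+m) $ i $ j)) = 0"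
  using matpow_recurrence[of F] by blast
 have "(SUM i<=degree p. coeff p i *s cpow F (k+i) z) = 0" for z k proof -
  have "(SUM i<=degree p. coeff p i*(SUM j:UNIV. of_real (matpow F (k+i) $ a $ j)*z $ j)) =
    (SUM j:UNIV. (SUM i<=degree p. coeff p i * of_real (matpow F (k+i) $ a $ j))*z $ j)" for a
   by (simp add: sum_dl sum_distrib_right mult.assoc) (rule sum.swap)
  thus ?thesis by (simp add: vec_eq_iff cmat_matpow) (simp add: cmat_def mv_def p(2))
 qed thus ?thesis using p(1) by blast
qed

text \<open>For a root \<open>l\<close> of the recurrence polynomial, either
  \<open>w = (F - l) z\<close> vanishes and \<open>z\<close> is an eigenvector, or \<open>w\<close>
  is a nonzero vector whose orbit satisfies a shorter recurrence.\<close>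

lemma cmat_eigen_from_recurrence: assumes "p ~= 0" "z ~= 0" "!!k. (SUM i<=degree p. coeff p i *s cpow F (k+i) z) = 0"
 shows "EX l. eigenvalue_of F l" using assms proof (induction "degree p" arbitrary: p z) case 0
 hence "coeff p 0 *s z = 0" using "0.prems"(3)[of 0] by simp
 thus ?case using 0 leading_coeff_0_iff[of p] by simp
next case (Suc n) have "~ constant (poly p)" using Suc.hyps(2) by (simp add: constant_degree)
 then obtain l where "poly p l = 0" using fundamental_theorem_of_algebra by blast
 then obtain r where r: "p = [:- l, 1:]*r" unfolding poly_eq_0_iff_dvd by (auto elim: dvdE)
 have r0: "r ~= 0" using Suc.prems(1) r by auto
 have deg: "degree p = Suc (degree r)" unfolding r using r0 by (subst degree_mult_eq) auto
 define w where "w = cmat F *v z-l *s z"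
 have w: "cpow F k w = cpow F (Suc k) z-l *s cpow F k z" for k
  unfolding w_def by (simp add: cmat_matpow mv_diff vector_scalar_commute
    funpow_swap1) (metis cmat_matpow funpow_swap1)
 show ?case proof (cases "w = 0")
  case True hence "cmat F *v z = l *s z" by (simp add: w_def)
  thus ?thesis using eigenvalue_ofI[OF Suc.prems(2)] by blast
 next case False have "(SUM i<=degree r. coeff r i *s cpow F (k+i) w) = 0" for k
   unfolding w using complex_recurrence_shift[OF r r0 Suc.prems(3), of k] by simp
  thus ?thesis using Suc.hyps(1)[of r w] deg Suc.hyps(2) r0 False by simp
 qed qed

lemma eigenvalue_exists: "EX l. eigenvalue_of F l" for F :: "real^'n^'n" proof -
 obtain p where "p ~= 0" "ALL z k. (SUM i<=degree p. coeff p i *s cpow F (k+i) z) = 0" using cmat_recurrence[of F] by blast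
 thus ?thesis using cmat_eigen_from_recurrence[of p "axis undefined 1" F] by simp
qed

lemma finite_eigenvalues: "finite {l. eigenvalue_of F l}" proof -
 obtain p where p: "p ~= 0" "!!z k. (SUM i<=degree p. coeff p i *s cpow F (k+i) z) = 0" using cmat_recurrence[of F] by blast
 have "poly p l = 0" if ev: "eigenvalue_of F l" for l proof -
  obtain z where z: "z ~= 0" "cmat F *v z = l *s z" "ALL k. cpow F k z = l^k *s z"
   using eigenvalue_of_powers[OF ev] by (elim exE conjE)
  hence "(SUM i<=degree p. (coeff p i*l^i) *s z) = 0"
   using p(2)[of 0 z] by (simp only: z(3)[rule_format] vector_smult_assoc add_0)
  hence "poly p l *s z = 0" by (simp add: poly_altdef vec_eq_iff sum_distrib_right)
  thus ?thesis using z(1) by simp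
 qed hence "{l. eigenvalue_of F l} \<subseteq> {l. poly p l = 0}" by blast
 thus ?thesis using poly_roots_finite[OF p(1)] finite_subset by blast
qed

text \<open>The set of eigenvalues is finite and nonempty, so the choice made in
  \<open>lambda_max\<close> has a witness.\<close>

lemma lambda_max_eigenvalue: shows "eigenvalue_of F (lambda_max F)" "eigenvalue_of F l ==> cmod l <= cmod (lambda_max F)" proof -
 define E where "E = {l. eigenvalue_of F l}"
 have E: "finite E" "E ~= {}" using finite_eigenvalues eigenvalue_exists unfolding E_def by auto
 hence "Max (cmod ` E) : cmod ` E" by (intro Max_in) auto
 then obtain e where "e : E" "cmod e = Max (cmod ` E)" by auto
 hence "eigenvalue_of F e & (ALL l'. eigenvalue_of F l' --> cmod l' <= cmod e)" using E by (auto simp: E_def)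
 hence "eigenvalue_of F (lambda_max F) & (ALL l'. eigenvalue_of F l' --> cmod l' <= cmod (lambda_max F))"
  unfolding lambda_max_def by (rule someI)
 thus "eigenvalue_of F (lambda_max F)" "eigenvalue_of F l ==> cmod l <= cmod (lambda_max F)" by auto
qed

lemma cmat_scaleR: "cmat (c *\<^sub>R F) *v z = of_real c *s (cmat F *v z)"
 by (simp add: cmat_def mv_def vec_eq_iff sum_dl mult.assoc)

text \<open>With \<open>c = sqrt p\<close> this turns the spectral condition of the theorem into
  Schur stability of a scaled matrix. The case \<open>c = 0\<close> is separate, as eigenvalues are
  otherwise compared by dividing by \<open>c\<close>.\<close>

lemma schur_stable_scaled: assumes "0 <= c" shows "schur_stable (c *\<^sub>R F) \<longleftrightarrow> c*cmod (lambda_max F) < 1"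
proof
 assume st: "schur_stable (c *\<^sub>R F)"
 obtain z where z: "z ~= 0" "cmat F *v z = lambda_max F *s z" "ALL k. cpow F k z = lambda_max F^k *s z"
  using eigenvalue_of_powers[OF lambda_max_eigenvalue(1)[of F]] by (elim exE conjE)
 have "eigenvalue_of (c *\<^sub>R F) (of_real c*lambda_max F)"
  by (rule eigenvalue_ofI[OF z(1)]) (simp only: cmat_scaleR z(2) vector_smult_assoc)
 hence "cmod (of_real c*lambda_max F) < 1" using st unfolding schur_stable_def by blast
 thus "c*cmod (lambda_max F) < 1" using assms by (simp add: norm_mult)
next assume lt: "c*cmod (lambda_max F) < 1"
 show "schur_stable (c *\<^sub>R F)" unfolding schur_stable_def proof (intro allI impI)
  fix l assume ev: "eigenvalue_of (c *\<^sub>R F) l"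
  obtain z where zz: "z ~= 0" "cmat (c *\<^sub>R F) *v z = l *s z" "ALL k. cpow (c *\<^sub>R F) k z = l^k *s z"
   using eigenvalue_of_powers[OF ev] by (elim exE conjE)
  have z: "z ~= 0" "of_real c *s (cmat F *v z) = l *s z" by (rule zz(1)) (rule zz(2)[unfolded cmat_scaleR])
  show "cmod l < 1" proof (cases "c = 0")
   case True thus ?thesis using z by simp
  next case False have "cmat F *v z = (1/of_real c) *s (of_real c *s (cmat F *v z))" using False by (simp add: vector_smult_assoc)
   also have "... = (l/of_real c) *s z" unfolding z(2) by (simp add: vector_smult_assoc)
   finally have "eigenvalue_of F (l/of_real c)" by (rule eigenvalue_ofI[OF z(1)])
   hence "cmod (l/of_real c) <= cmod (lambda_max F)" by (rule lambda_max_eigenvalue)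
   hence "cmod l <= c*cmod (lambda_max F)" using False assms by (simp add: norm_divide divide_le_eq mult.commute)
   thus ?thesis using lt by simp
  qed qed qed

lemma summable_resolvent: fixes x y :: "nat => real"
 assumes "summable y" "!!k. 0 <= y k" "!!k. 0 <= x k" "0 <= c" "c < 1" "!!k. x (Suc k) <= c*x k+y k" shows "summable x"
proof (rule summableI_nonneg_bounded)
 fix n have "(1-c)*(SUM k<n. x k) <= x 0+(SUM k<n. y k)-x n" proof (induction n) case (Suc n)
  thus ?case using assms(6)[of n] by (simp add: algebra_simps)
 qed simp
 also have "... <= x 0+suminf y" using assms(1-3) sum_le_suminf[of y "{..<n}"] by (simp add: diff_le_eq add_increasing2 algebra_simps)
 finally show "(SUM k<n. x k) <= (x 0+suminf y)/(1-c)" using assms(5) by (simp add: pos_le_divide_eq mult.commute)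
qed (rule assms)

text \<open>Roots of an annihilating recurrence are peeled off one by one. If the root
  \<open>l\<close> is an eigenvalue, then \<open>|l| < 1\<close> and the orbit solves a contracting
  recursion with summable input. If it is not, \<open>F - l\<close> is injective, hence bounded
  below, and the orbit of \<open>z\<close> is dominated by that of
  \<open>w = (F - l) z\<close>.\<close>

lemma schur_summable_complex: fixes F :: "real^'n^'n" assumes st: "schur_stable F" and "p ~= 0"
  "!!k. (SUM i<=degree p. coeff p i *s cpow F (k+i) z) = 0" shows "summable (%k. norm (cpow F k z))" using assms(2-)
proof (induction "degree p" arbitrary: p z) case 0 have "coeff p 0 ~= 0" using 0 leading_coeff_0_iff[of p] by simp
 moreover have "coeff p 0 *s cpow F k z = 0" for k using "0.prems"(2)[of k] 0(1) by simp
 ultimately have "cpow F k z = 0" for k by simp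
 thus ?case by simp
next case (Suc n) have "~ constant (poly p)" using Suc.hyps(2) by (simp add: constant_degree)
 then obtain l where "poly p l = 0" using fundamental_theorem_of_algebra by blast
 then obtain r where r: "p = [:- l, 1:]*r" unfolding poly_eq_0_iff_dvd by (auto elim: dvdE)
 have r0: "r ~= 0" using Suc.prems(1) r by auto
 have deg: "degree p = Suc (degree r)" unfolding r using r0 by (subst degree_mult_eq) auto
 define w where "w = cmat F *v z-l *s z"
 have w: "cpow F k w = cpow F (Suc k) z-l *s cpow F k z" for k
  unfolding w_def by (simp add: cmat_matpow mv_diff vector_scalar_commute
    funpow_swap1) (metis cmat_matpow funpow_swap1)
 have "(SUM i<=degree r. coeff r i *s cpow F (k+i) w) = 0" for k
  unfolding w using complex_recurrence_shift[OF r r0 Suc.prems(2), of k] by simp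
 hence sw: "summable (%k. norm (cpow F k w))" using Suc.hyps(1)[of r w] deg Suc.hyps(2) r0 by simp
 show ?case proof (cases "eigenvalue_of F l")
  case True have "norm (cpow F (Suc k) z) <= cmod l*norm (cpow F k z)+norm (cpow F k w)" for k proof -
   have "cpow F (Suc k) z = l *s cpow F k z+cpow F k w" unfolding w by simp
   thus ?thesis by (metis norm_triangle_ineq norm_smult_complex)
  qed moreover have "cmod l < 1" using st True by (simp add: schur_stable_def)
  ultimately show ?thesis by (intro summable_resolvent[OF sw _ _ norm_ge_zero]) auto
 next case False define T where "T v = cmat F *v v-l *s v" for v
  have lin: "linear T" unfolding T_def by (intro linearI) (simp_all add: mv_add vector_add_ldistrib
     cmat_vector_scaleR scaleR_right_diff_distrib vec_eq_iff)
  have "T v = 0 ==> v = 0" for v using False unfolding T_def eigenvalue_of_cmat by auto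
  hence "inj T" using linear_injective_0[OF lin] by blast
  then obtain B where B: "0 < B" "!!v. B*norm v <= norm (T v)" using linear_inj_bounded_below_pos[OF lin] by blast
  have "summable (%k. (1/B)*norm (cpow F k w))" by (intro summable_mult sw)
  thus ?thesis proof (rule summable_comparison_test')
   fix k have "B*norm (cpow F k z) <= norm (cpow F k w)" using B(2)[of "cpow F k z"] unfolding w by (simp add: T_def)
   thus "norm (norm (cpow F k z)) <= (1/B)*norm (cpow F k w)" using B(1) by (simp add: field_simps)
  qed qed qed

lemma schur_summable: fixes F :: "real^'n^'n" assumes "schur_stable F" shows "summable (%k. norm (matpow F k *v x))" proof -
 obtain p where "p ~= 0" "!!z k. (SUM i<=degree p. coeff p i *s cpow F (k+i) z) = 0" using cmat_recurrence[of F] by blast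
 hence "summable (%k. norm (cpow F k (cvec x)))" by (intro schur_summable_complex[OF assms, of p]) auto
 moreover have "norm (cvec y) = norm y" for y :: "real^'n" by (simp add: cvec_def norm_vec_def L2_set_def)
 ultimately show ?thesis by (simp add: cmat_matpow cmat_cvec)
qed

text \<open>\<open>P\<close> is the sum of \<open>(F^k)' F^k\<close>, introduced as a convergent
  bilinear series \<open>b\<close> and converted to a matrix afterwards. Replacing \<open>x\<close>
  by \<open>F x\<close> drops the term of index 0, which is \<open>x . x\<close>.\<close>

lemma lyapunov_solution: fixes F :: "real^'n^'n" assumes "schur_stable F"
 shows "EX P. pos_def P & (ALL x. qf P (F *v x) = qf P x-x \<bullet> x)" proof -
 define b where "b x y = (\<Sum>k. (matpow F k *v x) \<bullet> (matpow F k *v y))" for x y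
 have sm: "summable (%k. (matpow F k *v x) \<bullet> (matpow F k *v y))" for x y proof -
  have "(%k. norm (matpow F k *v y)) ----> 0" by (rule summable_LIMSEQ_zero[OF schur_summable[OF assms]])
  hence "Bseq (%k. norm (matpow F k *v y))" by (rule convergent_imp_Bseq[OF convergentI])
  then obtain K where K: "!!k. norm (matpow F k *v y) <= K" unfolding Bseq_def by auto
  show ?thesis proof (rule summable_comparison_test')
   show "summable (%k. norm (matpow F k *v x)*K)" by (intro summable_mult2 schur_summable assms)
   show "norm ((matpow F k *v x) \<bullet> (matpow F k *v y)) <= norm (matpow F k *v x)*K" for k
    unfolding real_norm_def by (rule order_trans[OF Cauchy_Schwarz_ineq2]) (intro mult_left_mono K norm_ge_zero)
  qed qed have badd: "b (x+x') y = b x y+b x' y" for x x' y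
  unfolding b_def by (simp add: mv_add inner_add_left suminf_add[OF sm sm])
 have bscale: "b (c *\<^sub>R x) y = c*b x y" for c x y
  unfolding b_def by (simp add: matrix_vector_mult_scaleR suminf_mult[OF sm])
 have bsym: "b x y = b y x" for x y unfolding b_def by (simp add: inner_commute)
 define P where "P = matrix (%y. \<chi> i. b (axis i 1) y)"
 have lin: "linear (%y. \<chi> i. b (axis i 1) y)" by (rule linearI) (simp_all add: vec_eq_iff bsym[of "axis _ _"] badd bscale)
 have Py: "P *v y = (\<chi> i. b (axis i 1) y)" for y
  unfolding P_def by (rule matrix_works[OF lin[unfolded linear_matrix_vector_mul_eq[symmetric]]])
 have xPy: "x \<bullet> (P *v y) = b x y" for x y proof -
  have bs: "linear (%x. b x y)" by (rule linearI) (simp_all add: badd bscale)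
  have "b x y = b (SUM i:UNIV. (x $ i) *\<^sub>R axis i 1) y"
   using basis_expansion[of x, unfolded scalar_mult_eq_scaleR] by (simp only:)
  also have "... = (SUM i:UNIV. x $ i*b (axis i 1) y)"
   using linear_sum[OF bs, of "%i. (x $ i) *\<^sub>R axis i 1" UNIV] by (simp add: bscale)
  finally show ?thesis unfolding Py inner_vec_def by simp
 qed have step: "b (F *v x) (F *v x) = b x x-x \<bullet> x" for x proof -
  have "matpow F k *v (F *v x) = matpow F (Suc k) *v x" for k by (simp only: matpow_funpow funpow_Suc_right comp_apply)
  hence "b (F *v x) (F *v x) = (\<Sum>k. (matpow F (Suc k) *v x) \<bullet> (matpow F (Suc k) *v x))" by (simp add: b_def)
  also have "... = b x x-x \<bullet> x" unfolding b_def using suminf_split_head[OF sm[of x x]] by simp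
  finally show ?thesis .
 qed have ge: "x \<bullet> x <= b x x" for x proof -
  have "0 <= b (F *v x) (F *v x)" unfolding b_def by (rule suminf_nonneg[OF sm]) simp
  thus ?thesis using step by simp
 qed have "tp P = P" unfolding matrix_eq_inner inner_transpose_matrix proof (intro allI)
  fix x y show "(P *v x) \<bullet> y = x \<bullet> (P *v y)" unfolding inner_commute[of "P *v x"] xPy by (rule bsym)
 qed moreover have "0 < qf P x" if "x ~= 0" for x unfolding xPy by (rule less_le_trans[OF _ ge]) (simp add: that)
 ultimately have "pos_def P" by (simp add: pos_def_def)
 thus ?thesis using step by (intro exI[of _ P]) (simp add: xPy)
qed

text \<open>\<open>h V\<close> extends a real form to complex vectors as a Hermitian form. On an
  eigenvector the hypothesis reads \<open>|l|^2 h P z + h W z <= h P z\<close>. If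
  \<open>|l| >= 1\<close>, then \<open>h W\<close> vanishes on the whole orbit, and
  \<open>obs\<close> applied to real and imaginary parts forces \<open>z = 0\<close>.\<close>

lemma schur_from_lyapunov: fixes F P W :: "real^'n^'n" assumes P: "pos_def P" and W: "psd W"
  and le: "!!x. qf P (F *v x)+qf W x <= qf P x"
  and obs: "!!x. (ALL k. W *v (matpow F k *v x) = 0) ==> x = 0" shows "schur_stable F" unfolding schur_stable_def
proof (intro allI impI)
 fix l assume ev: "eigenvalue_of F l"
 obtain z where z: "z ~= 0" "cmat F *v z = l *s z" "ALL k. cpow F k z = l^k *s z"
  using eigenvalue_of_powers[OF ev] by (elim exE conjE)
 define h where "h V z = qf V (revec z)+qf V (imvec z)" for V :: "real^'n^'n" and z
 have hF: "h P (cmat F *v z)+h W z <= h P z" for z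
  using le[of "revec z"] le[of "imvec z"] by (simp add: h_def revec_cmat imvec_cmat)
 have hl: "h V (l *s z) = (cmod l)\<^sup>2*h V z" if "tp V = V" for V z
  unfolding h_def revec_scale imvec_scale cmod_power2 using symmetric_inner[OF that, of "imvec z" "revec z"]
  by (simp add: mv_add mv_diff matrix_vector_mult_scaleR
    inner_add_left inner_add_right inner_diff_left inner_diff_right pow2 algebra_simps)
 have hP: "0 < h P z" if "z ~= 0" for z proof - have "0 <= qf P x" for x using psd_quad[OF pd_psd[OF P]] .
  moreover have "revec z ~= 0 | imvec z ~= 0" using that revec_imvec_zero by blast
  ultimately show ?thesis using P unfolding h_def pos_def_def by (metis add_nonneg_pos add_pos_nonneg)
 qed have hW: "0 <= h W z" for z unfolding h_def by (simp add: psd_quad[OF W])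
 have symP: "tp P = P" using P by (simp add: pos_def_def)
 have ineq: "(cmod l)\<^sup>2*h P z+h W z <= h P z" using hF[of z] hl[OF symP] z(2) by simp
 show "cmod l < 1" proof (rule ccontr)
  assume "~ cmod l < 1"
  hence "1 <= (cmod l)\<^sup>2" by simp
  hence "h P z <= (cmod l)\<^sup>2*h P z" using hP[OF z(1)] by simp
  hence "h W z = 0" using ineq hW[of z] by simp
  hence hWk: "h W (l^k *s z) = 0" for k proof (induction k) case (Suc k)
   have "h W (l^Suc k *s z) = h W (l *s (l^k *s z))" by (simp add: vector_smult_assoc)
   thus ?case by (simp only: hl[OF psd_sym[OF W]] Suc mult_zero_right)
  qed simp
  have zk: "cmat (matpow F k) *v z = l^k *s z" for k unfolding cmat_matpow[symmetric] by (rule z(3)[rule_format])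
  have "W *v (matpow F k *v revec z) = 0 & W *v (matpow F k *v imvec z) = 0" for k proof -
   have "h W (cmat (matpow F k) *v z) = 0" unfolding zk by (rule hWk)
   hence "qf W (matpow F k *v revec z) + qf W (matpow F k *v imvec z) = 0" by (simp add: h_def revec_cmat imvec_cmat)
   thus ?thesis using psd_quad[OF W] psd_quad_zero[OF W] by (metis add_nonneg_eq_0_iff)
  qed hence "revec z = 0" "imvec z = 0" using obs by blast+
  thus False using z(1) revec_imvec_zero by blast
 qed qed

lemma tendsto_matrix_mult [tendsto_intros]: fixes f :: "_ => real^'n^'m" and g :: "_ => real^'k^'n"
 shows "(f \<longlongrightarrow> a) F ==> (g \<longlongrightarrow> b) F ==> ((%x. f x**g x) \<longlongrightarrow> a**b) F"
 unfolding matrix_matrix_mult_def by (intro tendsto_vec_lambda tendsto_sum tendsto_mult tendsto_vec_nth)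

lemma tendsto_matrix_vector_mult [tendsto_intros]: fixes f :: "_ => real^'n^'m" and g :: "_ => real^'n"
 shows "(f \<longlongrightarrow> a) F ==> (g \<longlongrightarrow> b) F ==> ((%x. f x *v g x) \<longlongrightarrow> a *v b) F"
 unfolding mv_def by (intro tendsto_vec_lambda tendsto_sum tendsto_mult tendsto_vec_nth)

lemma tendsto_transpose [tendsto_intros]: fixes f :: "_ => real^'n^'m"
 shows "(f \<longlongrightarrow> a) F ==> ((%x. tp (f x)) \<longlongrightarrow> tp a) F"
 unfolding transpose_def by (intro tendsto_vec_lambda tendsto_vec_nth)

text \<open>By polarization every entry is a combination of three values of the quadratic form, so
  convergence of the bounded monotone scalar sequences is enough.\<close>

lemma monotone_matrix_limit: fixes W :: "nat => real^'n^'n" assumes sym: "!!j. tp (W j) = W j"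
  and mono: "!!j x. qf (W j) x <= qf (W (Suc j)) x" and bdd: "!!x. EX c. ALL j. qf (W j) x <= c"
 shows "EX V. tp V = V & W ----> V & (ALL j x. qf (W j) x <= qf V x)" proof -
 have inc: "incseq (%j. qf (W j) x)" for x by (rule incseq_SucI) (rule mono)
 have cq: "convergent (%j. qf (W j) x)" for x proof - obtain c where "ALL j. qf (W j) x <= c" using bdd by blast
  then obtain L where "(%j. qf (W j) x) ----> L" by (rule incseq_convergent[OF inc])
  thus ?thesis unfolding convergent_def by blast
 qed have "convergent (%j. W j $ a $ b)" for a b proof - have "W j $ a $ b = (qf (W j) (axis a 1+axis b 1)
   -qf (W j) (axis a 1)-qf (W j) (axis b 1))/2" for j
   using quad_add[OF sym, of "axis a 1" "axis b 1" j] by (simp add: axis_inner_matrix)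
  moreover obtain L where "!!x. (%j. qf (W j) x) ----> L x" using cq unfolding convergent_def by metis
  ultimately have "(%j. W j $ a $ b) ---->
    (L (axis a 1+axis b 1)-L (axis a 1)-L (axis b 1))/2" by (simp only:) (intro tendsto_intros; simp)
  thus ?thesis by (rule convergentI)
 qed then obtain v where v: "!!a b. (%j. W j $ a $ b) ----> v a b" unfolding convergent_def by metis
 define V where "V = (\<chi> a b. v a b)"
 have lim: "W ----> V" by (intro vec_tendstoI) (simp add: V_def v)
 moreover have "tp V = V" using tendsto_transpose[OF lim] lim unfolding sym by (rule LIMSEQ_unique)
 moreover have "qf (W j) x <= qf V x" for j x by (rule incseq_le[OF inc]) (intro tendsto_intros lim)
 ultimately show ?thesis by blast
qed

section \<open>Square roots of positive semidefinite matrices\<close>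

text \<open>Polynomials in \<open>C\<close> with nonnegative coefficients. They are closed under
  products, semidefinite when \<open>C\<close> is, and commute with everything that commutes with
  \<open>C\<close>; the square root iteration stays inside this class.\<close>

inductive nonneg_poly :: "real^'n^'n => real^'n^'n => bool" for C where
 nonneg_poly_term: "0 <= a ==> nonneg_poly C (a *\<^sub>R matpow C i)"
| nonneg_poly_add: "nonneg_poly C V ==> nonneg_poly C W ==> nonneg_poly C (V+W)"

lemma nonneg_poly_scaleR: "nonneg_poly C V ==> 0 <= c ==> nonneg_poly C (c *\<^sub>R V)"
proof (induction rule: nonneg_poly.induct) case (nonneg_poly_term a i)
 thus ?case using nonneg_poly.nonneg_poly_term[of "c*a" C i] by simp
next case (nonneg_poly_add V W) thus ?case by (simp add: scaleR_right_distrib nonneg_poly.nonneg_poly_add)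
qed

lemma nonneg_poly_mult: assumes "nonneg_poly C V" "nonneg_poly C W" shows "nonneg_poly C (V**W)" using assms(1)
proof (induction rule: nonneg_poly.induct) case (nonneg_poly_term a i) show ?case using assms(2)
 proof (induction rule: nonneg_poly.induct) case (nonneg_poly_term b j)
  thus ?case using \<open>0 \<le> a\<close> nonneg_poly.nonneg_poly_term[of "b*a" C "i+j"]
   by (simp add: matrix_mult_scaleR matpow_add)
 next case (nonneg_poly_add V W) thus ?case by (simp add: matrix_add_ldistrib nonneg_poly.nonneg_poly_add)
 qed next case (nonneg_poly_add V W) thus ?case by (simp add: mm_rplus nonneg_poly.nonneg_poly_add)
qed

lemma matpow_commute: "C**U = U**C ==> matpow C i**U = U**matpow C i" by (induction i) (simp_all, metis mm_assoc)

lemma nonneg_poly_commute: "nonneg_poly C V ==> C**U = U**C ==> V**U = U**V" proof (induction rule: nonneg_poly.induct)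
 case (nonneg_poly_term a i) thus ?case by (simp add: matrix_mult_scaleR matpow_commute)
next case (nonneg_poly_add V W) thus ?case by (simp add: matrix_add_ldistrib mm_rplus)
qed

lemma psd_matpow: assumes "psd C" shows "psd (matpow C i)" proof (induction i rule: induct_nat_012) case 0
 thus ?case by (simp add: psd_mat_1)
next case 1 thus ?case using assms by simp
next case (ge2 n) have "matpow C (Suc (Suc n)) = tp C**matpow C n**C"
  using matpow_commute[of C C n] by (simp add: psd_sym[OF assms] mm_assoc)
   (metis mm_assoc)
 thus ?case using psd_congruence ge2 by metis
qed

lemma psd_nonneg_poly: "nonneg_poly C V ==> psd C ==> psd V"
 by (induction rule: nonneg_poly.induct) (auto intro: psd_scaleR psd_matpow psd_add)

lemma psd_contraction: assumes "psd C" "!!x. qf C x <= x \<bullet> x" shows "norm (C *v x) <= norm x" proof -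
 define y where "y = C *v x"
 have "(y \<bullet> (C *v x))\<^sup>2 <= qf C y*qf C x" by (rule psd_cauchy_schwarz[OF assms(1)])
 also have "... <= (y \<bullet> y)*(x \<bullet> x)" by (intro mult_mono assms(2) psd_quad[OF assms(1)]) simp
 finally have "(y \<bullet> y)*(y \<bullet> y) <= (y \<bullet> y)*(x \<bullet> x)" by (simp add: y_def pow2)
 hence "y \<bullet> y <= x \<bullet> x" by (cases "y = 0") (simp_all add: mult_le_cancel_left)
 thus ?thesis by (simp add: y_def norm_le)
qed

text \<open>With \<open>C = I - W\<close>, the matrix \<open>T = I - V\<close> squares to
  \<open>W\<close> exactly when \<open>V = (C + V^2)/2\<close>. Iterating this equation from 0
  produces increments that are nonnegative polynomials in \<open>C\<close>, so the iterates
  increase; they also remain contractions, hence converge.\<close>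

lemma contraction_sqrt_exists: fixes W :: "real^'n^'n" assumes W: "psd W" "!!x. qf W x <= x \<bullet> x"
 shows "EX V. psd V & V**V = W & (ALL U. W**U = U**W --> V**U = U**V)" proof - define C where "C = mat 1-W"
 have Csym: "tp C = C" by (simp add: C_def transpose_diff psd_sym[OF W(1)])
 have C: "psd C" using W(2) Csym by (simp add: psd_def C_def mv_minus inner_diff_right)
 have C1: "qf C x <= x \<bullet> x" for x using psd_quad[OF W(1)] by (simp add: C_def mv_minus inner_diff_right)
 define Y where "Y = rec_nat (0::real^'n^'n) (%_ V. (1/2) *\<^sub>R (C+V**V))"
 have Y0: "Y 0 = 0" and YS: "Y (Suc k) = (1/2) *\<^sub>R (C+Y k**Y k)" for k by (simp_all add: Y_def)
 have ppC: "nonneg_poly C C" using nonneg_poly_term[of 1 C 1] by simp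
 have pp: "nonneg_poly C (Y k)" for k proof (induction k) case 0 thus ?case using nonneg_poly_term[of 0 C 0] by (simp add: Y0)
 next case (Suc k) thus ?case unfolding YS by (intro nonneg_poly_scaleR nonneg_poly_add ppC nonneg_poly_mult) auto
 qed have comm: "Y k**U = U**Y k" if "W**U = U**W" for k U proof -
  have "C**U = U**C" using that by (simp add: C_def matrix_diff_rdistrib matrix_diff_ldistrib)
  thus ?thesis by (rule nonneg_poly_commute[OF pp])
 qed have YY: "Y j**Y k = Y k**Y j" for j k
  by (rule nonneg_poly_commute[OF pp]) (rule nonneg_poly_commute[OF pp, symmetric], simp)
 have pd: "nonneg_poly C (Y (Suc k)-Y k)" for k proof (induction k) case 0
  thus ?case unfolding YS Y0 using ppC by (simp add: nonneg_poly_scaleR)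
 next case (Suc k) have "Y (Suc (Suc k))-Y (Suc k) = (1/2) *\<^sub>R (C+Y (Suc k)**Y (Suc k))-(1/2) *\<^sub>R (C+Y k**Y k)"
   using YS[of "Suc k"] YS[of k] by simp
  also have "... = (1/2) *\<^sub>R (Y (Suc k)**Y (Suc k)-Y k**Y k)" by (simp add: scaleR_right_distrib scaleR_right_diff_distrib)
  also have "Y (Suc k)**Y (Suc k)-Y k**Y k = (Y (Suc k)-Y k)**(Y (Suc k)+Y k)"
   by (simp add: matrix_diff_rdistrib matrix_add_ldistrib YY[of "Suc k" k])
  finally show ?case using Suc pp by (auto intro!: nonneg_poly_scaleR nonneg_poly_mult nonneg_poly_add)
 qed have contr: "norm (Y k *v x) <= norm x" for k x proof (induction k arbitrary: x) case (Suc k)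
  have "norm (Y (Suc k) *v x) = norm (C *v x+Y k *v (Y k *v x))/2" by (simp add: YS mv_plus mv_scaleR mv_assoc)
  also have "... <= (norm (C *v x)+norm (Y k *v (Y k *v x)))/2" by (intro divide_right_mono norm_triangle_ineq) simp
  also have "... <= (norm x+norm x)/2" by (intro divide_right_mono add_mono psd_contraction[OF C C1] order_trans[OF Suc Suc]) simp
  finally show ?case by simp
 qed (simp add: Y0)
 have le: "qf (Y k) x <= x \<bullet> x" for k x
  using norm_cauchy_schwarz[of x "Y k *v x"] contr[of k x] mult_left_mono[OF contr[of k x] norm_ge_zero[of x]]
  by (simp add: dot_square_norm pow2)
 obtain V where V: "tp V = V" "Y ----> V" "!!j x. qf (Y j) x <= qf V x" proof - have "qf (Y j) x <= qf (Y (Suc j)) x" for j x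
   using psd_quad[OF psd_nonneg_poly[OF pd C], of x j] by (simp add: mv_minus inner_diff_right)
  hence "EX V. tp V = V & Y ----> V & (ALL j x. qf (Y j) x <= qf V x)"
   using le psd_sym[OF psd_nonneg_poly[OF pp C]] by (intro monotone_matrix_limit) blast+
  thus thesis using that by blast
 qed have "(%k. Y (Suc k)) ----> (1/2) *\<^sub>R (C+V**V)" unfolding YS by (intro tendsto_intros V)
 hence Vfix: "V = (1/2) *\<^sub>R (C+V**V)" using LIMSEQ_Suc[OF V(2)] LIMSEQ_unique by blast
 define T where "T = mat 1-V"
 have "V**V = V+V-C" using arg_cong[OF Vfix, of "%W. 2 *\<^sub>R W"] by (simp add: scaleR_2)
 hence TT: "T**T = W" by (simp add: T_def matrix_diff_rdistrib matrix_diff_ldistrib C_def)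
 have "qf V x <= x \<bullet> x" for x by (rule LIMSEQ_le_const2[of "%k. qf (Y k) x"]) (auto intro!: tendsto_intros V le)
 hence "psd T" by (simp add: psd_def T_def transpose_diff V(1) mv_minus inner_diff_right)
 moreover have "T**U = U**T" if "W**U = U**W" for U proof -
  have "(%k. Y k**U) ----> V**U" "(%k. U**Y k) ----> U**V" by (intro tendsto_intros V)+
  hence "V**U = U**V" unfolding comm[OF that] by (rule LIMSEQ_unique)
  thus ?thesis by (simp add: T_def matrix_diff_rdistrib matrix_diff_ldistrib)
 qed ultimately show ?thesis using TT by blast
qed

text \<open>For \<open>y = (V - U) x\<close>, commutation gives
  \<open>(V + U) y = (V^2 - U^2) x = 0\<close>. Both forms therefore vanish at \<open>y\<close>, so
  \<open>V y = U y = 0\<close>, and \<open>|y|^2 = x . (V - U) y = 0\<close>.\<close>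

lemma commuting_psd_sqrt_unique: fixes V U :: "real^'n^'n"
 assumes V: "psd V" and U: "psd U" and eq: "V**V = U**U" and comm: "V**U = U**V" shows "V = U" proof - have "(V-U) *v x = 0" for x
 proof - define y where "y = (V-U) *v x"
  have "(V+U) *v y = ((V+U)**(V-U)) *v x" by (simp add: y_def mv_assoc)
  also have "(V+U)**(V-U) = 0" by (simp add: matrix_diff_ldistrib mm_rplus eq comm)
  finally have "qf V y+qf U y = 0" by (simp add: mv_plus flip: inner_add_right)
  hence "qf V y = 0" "qf U y = 0" using psd_quad[OF V, of y] psd_quad[OF U, of y] by linarith+
  hence "(V-U) *v y = 0" using psd_quad_zero[OF V, of y] psd_quad_zero[OF U, of y] by (simp add: mv_minus)
  moreover have "y \<bullet> y = x \<bullet> ((V-U) *v y)"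
   unfolding y_def inner_tr[of x] by (simp add: transpose_diff psd_sym V U)
  ultimately show ?thesis by (simp add: y_def)
 qed hence "V *v x = U *v x" for x by (simp add: mv_minus)
 thus ?thesis by (simp add: matrix_eq)
qed

text \<open>\<open>psd_sqrt\<close> is a definite description, so uniqueness has to be shown
  together with existence. Any root \<open>U\<close> commutes with \<open>W = U U\<close>, hence
  with the constructed root, which commutes with everything that commutes with
  \<open>W\<close>.\<close>

lemma psd_sqrt_props: fixes W :: "real^'n^'n" assumes "psd W" shows "psd (psd_sqrt W)" "psd_sqrt W**psd_sqrt W = W" proof -
 obtain c where c: "0 <= c" "!!x. \<bar>x \<bullet> (W *v x)\<bar> <= c*(x \<bullet> x)" using quad_upper_bound[of W] by blast
 \<comment> \<open>Division by \<open>d\<close> brings the form below \<open>x . x\<close>, as the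
   iteration requires; the summand 1 keeps \<open>d\<close> positive even for
   \<open>c = 0\<close>.\<close>
 define d where "d = c+1"
 have d: "0 < d" using c by (simp add: d_def)
 define W' where "W' = (1/d) *\<^sub>R W"
 have "qf W' x <= x \<bullet> x" for x proof -
  have "qf W x <= d*(x \<bullet> x)" using c(2)[of x] by (simp add: d_def algebra_simps) (smt (verit) inner_ge_zero)
  thus ?thesis using d by (simp add: W'_def mv_scaleR divide_le_eq mult.commute)
 qed moreover have "psd W'" using assms d by (simp add: W'_def psd_scaleR)
 ultimately obtain V where V: "psd V" "V**V = W'" "!!U. W'**U = U**W' ==> V**U = U**V"
  using contraction_sqrt_exists[of W'] by blast
 define T where "T = sqrt d *\<^sub>R V"
 have T: "psd T" "T**T = W" using V(1,2) d by (simp_all add: T_def psd_scaleR matrix_mult_scaleR W'_def)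
 have uniq: "U = T" if U: "psd U" "U**U = W" for U proof - have "W**U = U**W" unfolding U(2)[symmetric] by (simp add: mm_assoc)
  hence "W'**U = U**W'" by (simp add: W'_def matrix_mult_scaleR)
  hence "V**U = U**V" by (rule V(3))
  hence "T**U = U**T" by (simp add: T_def matrix_mult_scaleR)
  thus ?thesis using commuting_psd_sqrt_unique[OF U(1) T(1)] U(2) T(2) by simp
 qed have "psd_sqrt W = T" unfolding psd_sqrt_def proof (rule the_equality)
  show "psd T & T**T = W" by (intro conjI T)
  show "U = T" if "psd U & U**U = W" for U by (rule uniq[OF conjunct1[OF that] conjunct2[OF that]])
 qed thus "psd (psd_sqrt W)" "psd_sqrt W**psd_sqrt W = W" by (simp_all only: T)
qed

lemma sum_over_sum_type: fixes f :: "'a::finite+'b::finite => 'c::comm_monoid_add"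
 shows "(SUM j:UNIV. f j) = (SUM a:UNIV. f (Inl a))+(SUM b:UNIV. f (Inr b))" proof -
 have "(SUM j:UNIV <+> UNIV. f j) = (SUM a:UNIV. f (Inl a))+(SUM b:UNIV. f (Inr b))" by (subst sum.Plus) auto
 thus ?thesis by simp
qed

lemma block_diag_mult: "(block_diag F G *v z) $ Inl a = (F *v (\<chi> i. z $ Inl i)) $ a"
 "(block_diag F G *v z) $ Inr b = (G *v (\<chi> i. z $ Inr i)) $ b" by (simp_all add: block_diag_def mv_def sum_over_sum_type)

text \<open>Observability of the doubled system is applied to the initial states
  \<open>(0, x)\<close> and 0. The root \<open>H\<close> of the weight annihilates every vector that
  the weight annihilates, since \<open>|H y|^2 = y . H (H y)\<close>.\<close>

lemma observable_from_block: fixes A Q :: "real^'n^'n" assumes obs: "observable (block_diag A A) (psd_sqrt (block_diag Q1 Q))"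
  and psd: "psd (block_diag Q1 Q)" and zero: "!!k. Q *v (matpow A k *v x) = 0" shows "x = 0" proof -
 define z :: "real^('n+'n)" where "z = (\<chi> i. case i of Inl a => 0 | Inr b => x $ b)"
 define H where "H = psd_sqrt (block_diag Q1 Q)"
 have zk: "((*v) (block_diag A A) ^^ k) z = (\<chi> i. case i of Inl a => 0 | Inr b => (matpow A k *v x) $ b)" for k
 proof (induction k) case (Suc k) show ?case proof (rule iffD2[OF vec_eq_iff], rule allI)
   fix i show "((*v) (block_diag A A) ^^ Suc k) z $ i =
     (\<chi> i. case i of Inl a => 0 | Inr b => (matpow A (Suc k) *v x) $ b) $ i" proof (cases i)
    case (Inl a) have "(\<chi> i. 0) = (0 :: real^'n)" by (simp add: vec_eq_iff)
    thus ?thesis using Inl by (simp add: Suc block_diag_mult)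
   next case (Inr b) thus ?thesis by (simp add: Suc block_diag_mult flip: mv_assoc)
   qed qed qed (simp add: z_def vec_eq_iff split: sum.split)
 have Hz: "H *v (((*v) (block_diag A A) ^^ k) z) = 0" for k proof - define y where "y = ((*v) (block_diag A A) ^^ k) z"
  have "block_diag Q1 Q *v y = 0" proof (rule iffD2[OF vec_eq_iff], rule allI)
   fix i show "(block_diag Q1 Q *v y) $ i = 0 $ i" proof (cases i)
    case (Inl a) have "(\<chi> i. 0) = (0 :: real^'n)" by (simp add: vec_eq_iff)
    thus ?thesis using Inl by (simp add: y_def zk block_diag_mult)
   next case (Inr b) thus ?thesis using zero[of k] by (simp add: y_def zk block_diag_mult)
   qed qed hence "H *v (H *v y) = 0" using psd_sqrt_props(2)[OF psd] by (simp add: H_def mv_assoc)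
  moreover have "(H *v y) \<bullet> (H *v y) = y \<bullet> (H *v (H *v y))"
   using inner_tr[of y H "H *v y"] psd_sym[OF psd_sqrt_props(1)[OF psd]] by (simp only: H_def)
  ultimately show ?thesis by (simp add: y_def)
 qed have "((*v) (block_diag A A) ^^ k) 0 = 0" for k by (induction k) auto
 hence "z = 0" using obs Hz unfolding observable_def H_def by (metis matrix_vector_mult_0_right)
 thus ?thesis by (simp add: z_def vec_eq_iff) (metis sum.case(2))
qed

section \<open>Riccati maps, value iteration and stabilization\<close>

lemma matrix_vector_neg: "A *v (- x) = - (A *v x)" for A :: "real^'n^'m" using mv_diff[of A 0 x] by simp

text \<open>One-step cost of control \<open>u\<close> with terminal weight \<open>P\<close>.
  Minimizing it over \<open>u\<close> yields \<open>riccati_map\<close>, and all comparisons of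
  Riccati maps below are made by inserting candidate controls here.\<close>

definition stage_cost :: "real^'n^'n => real^'m^'n => real^'n^'n => real^'m^'m => real^'n^'n =>
  real^'n => real^'m => real" where "stage_cost A B Q R P z u = qf Q z+qf R u+qf P (A *v z+B *v u)"

definition riccati_map :: "real^'n^'n => real^'m^'n => real^'n^'n => real^'m^'m => real^'n^'n => real^'n^'n" where
 "riccati_map A B Q R P = tp A**P**A+Q -tp (K_gain A B R P)**Upsilon_mat B R P**K_gain A B R P"

lemma stage_cost_completion: fixes A P Q :: "real^'n^'n" and B :: "real^'m^'n" and R :: "real^'m^'m"
 assumes P: "tp P = P" and U: "pos_def (Upsilon_mat B R P)" shows "stage_cost A B Q R P z u = qf (riccati_map A B Q R P) z
 +qf (Upsilon_mat B R P) (u+K_gain A B R P *v z)" proof - define K Y where "K = K_gain A B R P" and "Y = Upsilon_mat B R P"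
 have Ysym: "tp Y = Y" using U by (simp add: Y_def pos_def_def)
 have "Y**K = tp B**P**A" unfolding K_def K_gain_def Y_def[symmetric] using pos_def_matrix_inv(1)[OF U[folded Y_def]]
  by (simp add: mm_assoc)
 hence YK: "Y *v (K *v x) = tp B *v (P *v (A *v x))" for x by (simp add: mv_assoc mm_assoc)
 have uY: "qf Y u = qf P (B *v u)+qf R u" by (simp add: Y_def Upsilon_mat_def mv_plus inner_add_right quad_congruence)
 have cross: "u \<bullet> (Y *v (K *v z)) = (B *v u) \<bullet> (P *v (A *v z))" unfolding YK by (rule inner_transpose_matrix)
 have ric: "qf (riccati_map A B Q R P) z = qf P (A *v z)+qf Q z-qf Y (K *v z)"
  by (simp add: riccati_map_def K_def[symmetric] Y_def[symmetric] mv_minus mv_plus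
    inner_diff_right inner_add_right quad_congruence)
 show ?thesis unfolding K_def[symmetric] Y_def[symmetric] stage_cost_def
   quad_add[OF Ysym, of u "K *v z"] quad_add[OF P, of "A *v z" "B *v u"] ric uY cross
  using symmetric_inner[OF P, of "A *v z" "B *v u"] by simp
qed

lemma Upsilon_pos_def: "psd P ==> pos_def R ==> pos_def (Upsilon_mat B R P)"
 unfolding Upsilon_mat_def by (intro psd_add_pos_def psd_congruence)

lemma riccati_map_value: fixes A P Q :: "real^'n^'n" and B :: "real^'m^'n" and R :: "real^'m^'m"
 assumes P: "tp P = P" and U: "pos_def (Upsilon_mat B R P)"
 shows "qf (riccati_map A B Q R P) z = stage_cost A B Q R P z (- (K_gain A B R P *v z))"
 using stage_cost_completion[OF P U, of A Q z "- (K_gain A B R P *v z)"] by simp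

lemma riccati_map_le: fixes A P Q :: "real^'n^'n" and B :: "real^'m^'n" and R :: "real^'m^'m"
 assumes P: "tp P = P" and U: "pos_def (Upsilon_mat B R P)" shows "qf (riccati_map A B Q R P) z <= stage_cost A B Q R P z u"
 using stage_cost_completion[OF P U, of A Q z u]
  psd_quad[OF pd_psd[OF U], of "u+K_gain A B R P *v z"] by simp

lemma riccati_map_symmetric: fixes A P Q :: "real^'n^'n" and R :: "real^'m^'m" assumes "tp P = P" "tp R = R" "tp Q = Q"
 shows "tp (riccati_map A B Q R P) = riccati_map A B Q R P" using assms
 by (simp add: riccati_map_def transpose_diff transpose_add matrix_transpose_mul mm_assoc Upsilon_mat_def)

lemma stage_cost_nonneg: "psd Q ==> psd R ==> psd P ==> 0 <= stage_cost A B Q R P z u"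
 unfolding stage_cost_def by (intro add_nonneg_nonneg psd_quad)

lemma riccati_map_psd: fixes A P Q :: "real^'n^'n" and B :: "real^'m^'n" and R :: "real^'m^'m"
 assumes Q: "psd Q" and R: "pos_def R" and P: "psd P" shows "psd (riccati_map A B Q R P)"
 unfolding psd_def[of "riccati_map A B Q R P"] proof (intro conjI allI)
 show "tp (riccati_map A B Q R P) = riccati_map A B Q R P" by (intro riccati_map_symmetric psd_sym pd_psd Q R P)
 show "0 <= qf (riccati_map A B Q R P) x" for x unfolding riccati_map_value[OF psd_sym[OF P] Upsilon_pos_def[OF P R]]
  by (intro stage_cost_nonneg pd_psd Q R P)
qed

text \<open>The minimizing control of the larger problem is a candidate in the smaller one.\<close>

lemma riccati_map_mono: fixes A P Q :: "real^'n^'n" and B :: "real^'m^'n" and R :: "real^'m^'m"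
 assumes "psd Q" "psd Q'" "pos_def R" "psd P" "psd P'" and "!!x. qf P x <= qf P' x" "!!x. qf Q x <= qf Q' x"
 shows "qf (riccati_map A B Q R P) z <= qf (riccati_map A B Q' R P') z" proof - define u where "u = - (K_gain A B R P' *v z)"
 have "qf (riccati_map A B Q R P) z <= stage_cost A B Q R P z u" by (intro riccati_map_le psd_sym Upsilon_pos_def assms)
 also have "... <= stage_cost A B Q' R P' z u" unfolding stage_cost_def by (intro add_mono assms order_refl)
 also have "... = qf (riccati_map A B Q' R P') z"
  unfolding u_def by (intro riccati_map_value[symmetric] psd_sym Upsilon_pos_def assms)
 finally show ?thesis .
qed

primrec value_iter :: "real^'n^'n => real^'m^'n => real^'n^'n => real^'m^'m => nat => real^'n^'n" where "value_iter A B Q R 0 = 0"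
| "value_iter A B Q R (Suc j) = riccati_map A B Q R (value_iter A B Q R j)"

lemma value_iter_psd: assumes "psd Q" "pos_def R" shows "psd (value_iter A B Q R j)"
 by (induction j) (simp_all add: psd_zero riccati_map_psd assms)

lemma value_iter_Suc_mono: assumes "psd Q" "pos_def R" shows "qf (value_iter A B Q R j) x <= qf (value_iter A B Q R (Suc j)) x"
proof (induction j arbitrary: x) case 0 thus ?case using psd_quad[OF value_iter_psd[OF assms, of A B 1]] by simp
next case (Suc j) thus ?case unfolding value_iter.simps(2)[of _ _ _ _ "Suc j"]
  by (subst value_iter.simps(2)) (intro riccati_map_mono value_iter_psd assms order_refl)
qed

lemma value_iter_mono: assumes "psd Q" "pos_def R" "i <= j" shows "qf (value_iter A B Q R i) x <= qf (value_iter A B Q R j) x"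
 by (rule lift_Suc_mono_le[of "%j. qf (value_iter A B Q R j) x"])
  (use value_iter_Suc_mono assms in auto)

lemma value_iter_weight_mono: assumes "psd Q" "psd Q'" "pos_def R" "!!x. qf Q x <= qf Q' x"
 shows "qf (value_iter A B Q R j) x <= qf (value_iter A B Q' R j) x" proof (induction j arbitrary: x) case (Suc j)
 thus ?case unfolding value_iter.simps by (intro riccati_map_mono value_iter_psd assms)
qed simp

text \<open>The common lower bound \<open>R\<close> makes all inverses bounded by
  \<open>1/c\<close>, and the difference of the inverses at \<open>x\<close> is \<open>inv Y\<close>
  applied to \<open>(V - Y) z\<close> with \<open>z = inv V x\<close>.\<close>

lemma matrix_inv_tendsto: fixes Y :: "nat => real^'m^'m"
 assumes R: "pos_def R" and Y: "!!j. pos_def (Y j)" "!!j x. qf R x <= qf (Y j) x" and V: "pos_def V" and lim: "Y ----> V"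
 shows "(%j. matrix_inv (Y j)) ----> matrix_inv V" proof -
 obtain c where c: "0 < c" "!!x. c*(x \<bullet> x) <= qf R x" using pos_def_lower_bound[OF R] by blast
 have bnd: "norm (matrix_inv (Y j) *v x) <= norm x/c" for j x proof - define y where "y = matrix_inv (Y j) *v x"
  have "Y j *v y = x" by (simp add: y_def mv_assoc pos_def_matrix_inv[OF Y(1)])
  hence "c*(y \<bullet> y) <= y \<bullet> x" using c(2)[of y] Y(2)[of y j] by simp
  also have "... <= norm y*norm x" by (rule norm_cauchy_schwarz)
  finally have "norm y*(c*norm y) <= norm y*norm x" by (simp add: dot_square_norm pow2 mult_ac)
  hence "c*norm y <= norm x" using c(1) by (cases "y = 0") (simp_all add: mult_le_cancel_left)
  thus ?thesis using c(1) by (simp add: y_def pos_le_divide_eq mult.commute)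
 qed have "(%j. matrix_inv (Y j) *v x) ----> matrix_inv V *v x" for x proof (rule LIM_zero_cancel, rule Lim_null_comparison)
  define z where "z = matrix_inv V *v x"
  have "(%j. norm ((V-Y j) *v z)/c) ----> norm ((V-V) *v z)/c" using c(1) by (intro tendsto_intros lim) auto
  thus "(%j. norm ((V-Y j) *v z)/c) ----> 0" by simp
  have "matrix_inv (Y j) *v x-z = matrix_inv (Y j) *v ((V-Y j) *v z)" for j proof -
   have "V *v z = x" by (simp add: z_def mv_assoc pos_def_matrix_inv[OF V])
   moreover have "matrix_inv (Y j) *v (Y j *v z) = z" by (simp add: mv_assoc pos_def_matrix_inv[OF Y(1)])
   ultimately show ?thesis by (simp add: mv_minus mv_diff)
  qed thus "EVT j. norm (matrix_inv (Y j) *v x-matrix_inv V *v x) <= norm ((V-Y j) *v z)/c" using bnd by (simp add: z_def)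
 qed hence "(%j. axis a 1 \<bullet> (matrix_inv (Y j) *v axis b 1)) ----> axis a 1 \<bullet> (matrix_inv V *v axis b 1)" for a b
  by (rule tendsto_inner[OF tendsto_const])
 thus ?thesis unfolding axis_inner_matrix by (intro vec_tendstoI)
qed

theorem value_iter_limit: fixes A Q :: "real^'n^'n" and B :: "real^'m^'n" and R :: "real^'m^'m"
 assumes Q: "psd Q" and R: "pos_def R" and bdd: "!!x. EX c. ALL j. qf (value_iter A B Q R j) x <= c"
 shows "EX Z. psd Z & riccati_map A B Q R Z = Z & (ALL j x. qf (value_iter A B Q R j) x <= qf Z x)" proof -
 let ?Z = "value_iter A B Q R"
 have psdZ: "psd (?Z j)" for j by (rule value_iter_psd[OF Q R])
 obtain Z where Z: "tp Z = Z" "?Z ----> Z" "!!j x. qf (?Z j) x <= qf Z x"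
  using monotone_matrix_limit[of ?Z] psd_sym[OF psdZ] value_iter_Suc_mono[OF Q R] bdd by blast
 have pZ: "psd Z" unfolding psd_def using Z(1) Z(3)[of _ 0] by simp
 have U: "(%j. Upsilon_mat B R (?Z j)) ----> Upsilon_mat B R Z" unfolding Upsilon_mat_def by (intro tendsto_intros Z)
 have "(%j. matrix_inv (Upsilon_mat B R (?Z j))) ----> matrix_inv (Upsilon_mat B R Z)"
 proof (rule matrix_inv_tendsto[OF R _ _ _ U])
  fix j x show "pos_def (Upsilon_mat B R (?Z j))" by (rule Upsilon_pos_def[OF psdZ R])
  show "qf R x <= qf (Upsilon_mat B R (?Z j)) x" using psd_quad[OF psd_congruence[OF psdZ, of B], of x j]
   by (simp add: Upsilon_mat_def mv_plus inner_add_right)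
 qed (rule Upsilon_pos_def[OF pZ R])
 hence "(%j. riccati_map A B Q R (?Z j)) ----> riccati_map A B Q R Z"
  unfolding riccati_map_def K_gain_def by (intro tendsto_intros Z U)
 hence "(%j. ?Z (Suc j)) ----> riccati_map A B Q R Z" by simp
 hence "riccati_map A B Q R Z = Z" using LIMSEQ_Suc[OF Z(2)] LIMSEQ_unique by blast
 thus ?thesis using pZ Z(3) by blast
qed

lemma sqrt_quad_triangle: assumes "psd W" shows "sqrt (qf W (x+y)) <= sqrt (qf W x)+sqrt (qf W y)" proof (rule real_le_lsqrt)
 define a b where "a = qf W x" and "b = qf W y"
 have ab: "0 <= a" "0 <= b" using psd_quad[OF assms] by (simp_all add: a_def b_def)
 have "x \<bullet> (W *v y) <= sqrt (a*b)"
  using psd_cauchy_schwarz[OF assms, of x y] unfolding a_def b_def by (rule real_le_rsqrt)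
 hence "a+2*(x \<bullet> (W *v y))+b <= a+2*(sqrt a * sqrt b)+b" by (simp add: real_sqrt_mult)
 also have "... = (sqrt a+sqrt b)\<^sup>2" using ab by (simp add: power2_sum)
 finally show "qf W (x+y) <= (sqrt (qf W x)+sqrt (qf W y))\<^sup>2" unfolding quad_add[OF psd_sym[OF assms]] a_def b_def .
 show "0 <= sqrt (qf W x)+sqrt (qf W y)" using ab by (simp add: a_def b_def)
qed

lemma sqrt_quad_sum: assumes "psd W" shows "sqrt (qf W (SUM i:I. f i)) <= (SUM i:I. sqrt (qf W (f i)))"
proof (induction I rule: infinite_finite_induct) case (insert i I)
 thus ?case using sqrt_quad_triangle[OF assms, of "f i" "SUM i:I. f i"] by simp
qed auto

text \<open>The square root of the value is a seminorm \<open>N j\<close>, bounded uniformly in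
  \<open>j\<close> on the range of \<open>G\<close>. Taking control 0 and writing
  \<open>A x = F x - G (E x)\<close> gives \<open>N (Suc j) x <= a |x| + N j (F x)\<close>, and the
  norms along the orbit of the stable \<open>F\<close> are summable. In the application
  \<open>G\<close> is \<open>Qw\<close>.\<close>

lemma value_iter_bounded: fixes A Q :: "real^'n^'n" and B :: "real^'m^'n" and R :: "real^'m^'m" and G :: "real^'k^'n"
 assumes Q: "psd Q" and R: "pos_def R" and st: "schur_stable (A+G**E)"
  and G: "!!v. EX c. ALL j. qf (value_iter A B Q R j) (G *v v) <= c" shows "EX c. ALL j. qf (value_iter A B Q R j) x <= c" proof -
 let ?Z = "value_iter A B Q R"
 define F where "F = A+G**E"
 define N where "N j x = sqrt (qf (?Z j) x)" for j x
 have psdZ: "psd (?Z j)" for j by (rule value_iter_psd[OF Q R])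
 obtain c where c: "!!i j. N j (G *v axis i 1) <= c i" proof - have "EX c. ALL j. N j (G *v axis i 1) <= c" for i proof -
   obtain d where "ALL j. qf (?Z j) (G *v axis i 1) <= d" using G by blast
   hence "ALL j. N j (G *v axis i 1) <= sqrt d" by (simp add: N_def)
   thus ?thesis by blast
  qed thus thesis using that by metis
 qed define g where "g = (SUM i:UNIV. \<bar>c i\<bar>)"
 have Nscale: "N j (a *\<^sub>R x) = \<bar>a\<bar> * N j x" for j a x
  by (simp add: N_def matrix_vector_mult_scaleR real_sqrt_mult flip: mult.assoc)
 have NG: "N j (G *v v) <= g*norm v" for j v proof -
  have "G *v v = (SUM i:UNIV. (v $ i) *\<^sub>R (G *v axis i 1))" unfolding matrix_vector_mult_basis
   by (simp add: vec_eq_iff column_def mv_def mult.commute)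
  hence "N j (G *v v) <= (SUM i:UNIV. N j ((v $ i) *\<^sub>R (G *v axis i 1)))"
   unfolding N_def by (simp only: sqrt_quad_sum[OF psdZ])
  also have "... <= (SUM i:UNIV. norm v * \<bar>c i\<bar>)" unfolding Nscale
   by (intro sum_mono mult_mono component_le_norm_cart order_trans[OF c abs_ge_self])
    (simp_all add: N_def psd_quad[OF psdZ])
  also have "... = g*norm v" by (simp add: g_def sum_dl mult.commute)
  finally show ?thesis .
 qed obtain q where q: "0 <= q" "!!x. \<bar>x \<bullet> (Q *v x)\<bar> <= q*(x \<bullet> x)" using quad_upper_bound[of Q] by blast
 obtain e where e: "0 <= e" "!!x. norm (E *v x) <= e*norm x" proof -
  have bl: "bounded_linear ((*v) E)" by (simp add: linear_linear)
  show thesis using that[OF onorm_pos_le[OF bl]] onorm[OF bl] by blast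
 qed have g0: "0 <= g" by (simp add: g_def sum_nonneg)
 define a where "a = sqrt q+g*e"
 have step: "N (Suc j) x <= a*norm x+N j (F *v x)" for j x proof - have "qf (?Z (Suc j)) x <= stage_cost A B Q R (?Z j) x 0"
   unfolding value_iter.simps by (intro riccati_map_le psd_sym psdZ Upsilon_pos_def R)
  also have "... = qf Q x+qf (?Z j) (A *v x)" by (simp add: stage_cost_def)
  finally have "N (Suc j) x <= sqrt (qf Q x+qf (?Z j) (A *v x))" unfolding N_def by (rule real_sqrt_le_mono)
  also have "... <= sqrt (qf Q x)+N j (A *v x)" unfolding N_def by (rule sqrt_add_le_add_sqrt) (intro psd_quad psdZ Q)+
  also have "sqrt (qf Q x) <= sqrt (q*(x \<bullet> x))" using q(2)[of x] by (intro real_sqrt_le_mono) simp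
  also have "... = sqrt q*norm x" by (simp add: real_sqrt_mult norm_eq_sqrt_inner)
  also have "A *v x = F *v x+(- 1) *\<^sub>R (G *v (E *v x))" by (simp add: F_def mv_plus mv_assoc)
  also have "N j (F *v x+(- 1) *\<^sub>R (G *v (E *v x))) <= N j (F *v x)+N j ((- 1) *\<^sub>R (G *v (E *v x)))"
   unfolding N_def by (rule sqrt_quad_triangle[OF psdZ])
  also have "N j ((- 1) *\<^sub>R (G *v (E *v x))) <= g*(e*norm x)"
   unfolding Nscale using order_trans[OF NG mult_left_mono[OF e(2) g0]] by simp
  finally show ?thesis by (simp add: a_def algebra_simps)
 qed have a0: "0 <= a" using q e g0 by (simp add: a_def)
 have "N j x <= a*(SUM i<j. norm (matpow F i *v x))" for j x proof (induction j arbitrary: x) case (Suc j)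
  have "matpow F i *v (F *v x) = matpow F (Suc i) *v x" for i by (simp only: matpow_funpow funpow_Suc_right comp_apply)
  hence "N j (F *v x) <= a*(SUM i<j. norm (matpow F (Suc i) *v x))" using Suc[of "F *v x"] by (simp only:)
  hence "N (Suc j) x <= a*norm x+a*(SUM i<j. norm (matpow F (Suc i) *v x))" using step[of j x] by linarith
  also have "... = a*(SUM i<Suc j. norm (matpow F i *v x))"
   by (subst sum.lessThan_Suc_shift) (simp add: distrib_left del: matpow.simps(2))
  finally show ?case .
 qed (simp add: N_def)
 moreover have "(SUM i<j. norm (matpow F i *v x)) <= (\<Sum>i. norm (matpow F i *v x))" for j
  by (rule sum_le_suminf) (use schur_summable[OF st[folded F_def]] in auto)
 ultimately have "N j x <= a*(\<Sum>i. norm (matpow F i *v x))" for j using mult_left_mono[OF _ a0] order_trans by blast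
 hence "qf (?Z j) x <= (a*(\<Sum>i. norm (matpow F i *v x)))\<^sup>2" for j unfolding N_def by (rule sqrt_le_D)
 thus ?thesis by blast
qed

text \<open>The fixed point equation is the closed-loop Lyapunov equation with weight
  \<open>W = Q + K' R K\<close>. If \<open>W\<close> vanishes along a closed-loop orbit, then
  \<open>K\<close> does too, so the orbit coincides with the open-loop one and the observability
  hypothesis on \<open>Q\<close> applies.\<close>

lemma riccati_stabilizing: fixes A Q Z :: "real^'n^'n" and B :: "real^'m^'n" and R :: "real^'m^'m"
 assumes Q: "psd Q" and R: "pos_def R" and Z: "psd Z" and fp: "riccati_map A B Q R Z = Z"
  and obs: "!!x. (!!k. Q *v (matpow A k *v x) = 0) ==> x = 0" shows "pos_def Z" "schur_stable (A-B**K_gain A B R Z)" proof -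
 define K where "K = K_gain A B R Z"
 define F where "F = A-B**K"
 define W where "W = Q+tp K**R**K"
 have W: "psd W" unfolding W_def by (intro psd_add Q psd_congruence pd_psd[OF R])
 have lyap: "qf Z x = qf W x+qf Z (F *v x)" for x proof - have "qf Z x = stage_cost A B Q R Z x (- (K *v x))"
   using riccati_map_value[OF psd_sym[OF Z] Upsilon_pos_def[OF Z R], where z = x and A = A and Q = Q and B = B] by (simp add: fp K_def)
  moreover have "A *v x+B *v (- (K *v x)) = F *v x" by (simp add: F_def mv_minus matrix_vector_neg flip: mv_assoc)
  moreover have "R *v (- (K *v x)) = - (R *v (K *v x))" by (rule matrix_vector_neg)
  ultimately show ?thesis by (simp add: stage_cost_def W_def mv_plus inner_add_right quad_congruence)
 qed have Wzero: "Q *v x = 0 & K *v x = 0" if "W *v x = 0" for x proof - have "qf Q x+qf R (K *v x) = 0" proof -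
   have "qf W x = qf Q x+qf R (K *v x)" by (simp add: W_def mv_plus inner_add_right quad_congruence)
   thus ?thesis using that by simp
  qed hence "qf Q x = 0" "qf R (K *v x) = 0" using psd_quad[OF Q, of x] psd_quad[OF pd_psd[OF R], of "K *v x"] by linarith+
  thus ?thesis using psd_quad_zero[OF Q] R unfolding pos_def_def by (metis less_irrefl)
 qed have obsW: "x = 0" if "ALL k. W *v (matpow F k *v x) = 0" for x proof - have "matpow F k *v x = matpow A k *v x" for k
  proof (induction k) case (Suc k) have "K *v (matpow F k *v x) = 0" using Wzero that by blast
   hence "F *v (matpow F k *v x) = A *v (matpow F k *v x)" by (simp add: F_def mv_minus flip: mv_assoc)
   thus ?case using Suc by (simp flip: mv_assoc)
  qed simp
  thus ?thesis using obs Wzero that by metis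
 qed have Zzero: "x = 0" if "qf Z x = 0" for x proof (rule obsW, rule allI)
  have zk: "qf Z (matpow F k *v x) = 0" for k proof (induction k) case (Suc k)
   thus ?case using lyap[of "matpow F k *v x"] psd_quad[OF W, of "matpow F k *v x"]
     psd_quad[OF Z, of "F *v (matpow F k *v x)"] by (simp add: mv_assoc)
  qed (simp add: that)
  show "W *v (matpow F k *v x) = 0" for k using zk[of k] lyap[of "matpow F k *v x"] psd_quad[OF W, of "matpow F k *v x"]
    psd_quad[OF Z, of "F *v (matpow F k *v x)"] by (intro psd_quad_zero[OF W]) linarith
 qed show pZ: "pos_def Z" unfolding pos_def_def using psd_sym[OF Z] psd_quad[OF Z] Zzero by (metis order_le_less)
 show "schur_stable (A-B**K_gain A B R Z)" unfolding K_def[symmetric] F_def[symmetric] proof (rule schur_from_lyapunov[OF pZ W])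
  show "qf Z (F *v x)+qf W x <= qf Z x" for x using lyap[of x] by linarith
 qed (rule obsW)
qed

section \<open>Block controls and the coupled Riccati equations\<close>

definition inl_part :: "real^('a::finite+'b::finite) => real^'a" where "inl_part z = (\<chi> i. z $ Inl i)"

definition inr_part :: "real^('a::finite+'b::finite) => real^'b" where "inr_part z = (\<chi> i. z $ Inr i)"

definition embed_inl :: "real^'a => real^('a::finite+'b::finite)" where
 "embed_inl x = (\<chi> i. case i of Inl a => x $ a | Inr b => 0)"

lemma embed_inl_parts [simp]: "inl_part (embed_inl x) = x" "inr_part (embed_inl x) = 0"
 by (simp_all add: inl_part_def inr_part_def embed_inl_def vec_eq_iff)

lemma parts_zero: "inl_part z = 0 ==> inr_part z = 0 ==> z = 0" unfolding vec_eq_iff proof (intro allI)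
 fix i assume "ALL i. inl_part z $ i = 0 $ i" "ALL i. inr_part z $ i = 0 $ i"
 thus "z $ i = 0 $ i" by (cases i) (simp_all add: inl_part_def inr_part_def)
qed

lemma hcat_mult: "hcat F G *v z = F *v inl_part z+G *v inr_part z"
 by (simp add: hcat_def mv_def vec_eq_iff sum_over_sum_type inl_part_def inr_part_def)

lemma block_diag_quad: "qf (block_diag F G) z = qf F (inl_part z)+qf G (inr_part z)"
 unfolding inner_vec_def sum_over_sum_type block_diag_mult
 by (simp add: inl_part_def[symmetric] inr_part_def[symmetric]) (simp add: inl_part_def inr_part_def)

lemma block_diag_symmetric: assumes "tp F = F" "tp G = G" shows "tp (block_diag F G) = block_diag F G" proof -
 have "F $ a $ b = F $ b $ a" "G $ c $ d = G $ d $ c" for a b c d using assms by (simp_all add: transpose_def vec_eq_iff)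
 thus ?thesis by (auto simp: transpose_def block_diag_def vec_eq_iff split: sum.split)
qed

lemma pos_def_block_diag: assumes "pos_def F" "pos_def G" shows "pos_def (block_diag F G)" unfolding pos_def_def
proof (intro conjI allI impI)
 show "tp (block_diag F G) = block_diag F G" using assms by (intro block_diag_symmetric) (auto simp: pos_def_def)
 fix z :: "real^('a+'b)" assume "z ~= 0"
 hence "inl_part z ~= 0 | inr_part z ~= 0" using parts_zero by blast
 thus "0 < qf (block_diag F G) z" unfolding block_diag_quad using assms psd_quad[OF pd_psd] unfolding pos_def_def
  by (metis add_nonneg_pos add_pos_nonneg assms)
qed

lemma Q_mu_eq: "Q_mu \<mu> Q = (1+\<mu>) *\<^sub>R Q" by (simp add: Q_mu_def scaleR_left_distrib)

lemma Q_mu_psd: "0 <= \<mu> ==> psd Q ==> psd (Q_mu \<mu> Q)" unfolding Q_mu_eq by (rule psd_scaleR) simp_all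

lemma Q_mu_ge: assumes "0 <= \<mu>" "psd Q" shows "qf Q x <= qf (Q_mu \<mu> Q) x"
 using psd_quad[OF assms(2), of x] assms(1) by (simp add: Q_mu_eq mv_scaleR distrib_right)

lemma Q_mu_ker: "0 <= \<mu> ==> Q_mu \<mu> Q *v x = 0 \<longleftrightarrow> Q *v x = 0" by (simp add: Q_mu_eq mv_scaleR)

text \<open>Reconciles the two shapes of the quadratic term: through the gain, as in the equation of
  \<open>Z\<close>, and through the inverse, as in those of \<open>X\<close> and
  \<open>S\<close>.\<close>

lemma gain_quadratic: fixes A P :: "real^'n^'n" and B :: "real^'m^'n" assumes P: "tp P = P" and U: "pos_def (Upsilon_mat B R P)"
 shows "tp (K_gain A B R P)**Upsilon_mat B R P**K_gain A B R P = tp (tp B**P**A)**matrix_inv (Upsilon_mat B R P)**(tp B**P**A)"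
proof - define Y where "Y = Upsilon_mat B R P"
 have inv: "tp (matrix_inv Y) = matrix_inv Y"
  using U pos_def_invertible[OF U] by (intro symmetric_matrix_inv) (auto simp: Y_def pos_def_def)
 have K: "K_gain A B R P = matrix_inv Y**(tp B**P**A)" by (simp add: K_gain_def Y_def mm_assoc)
 have "tp (matrix_inv Y**N)**Y**(matrix_inv Y**N) = tp N**matrix_inv Y**N" for N :: "real^'n^'m" proof -
  have "tp (matrix_inv Y**N)**Y**(matrix_inv Y**N) = tp N**tp (matrix_inv Y)**(Y**matrix_inv Y)**N"
   by (simp add: matrix_transpose_mul mm_assoc)
  thus ?thesis using pos_def_matrix_inv(1)[OF U[folded Y_def]] inv by simp
 qed thus ?thesis unfolding K Y_def[symmetric] .
qed

text \<open>Adding the equations of \<open>Z\<close> and \<open>S\<close> cancels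
  \<open>\<mu> Q\<close> and the term \<open>K' Upsilon K\<close>. What remains is one Riccati
  equation for \<open>Z + S\<close> with weight \<open>Q\<close>, whose matrices
  \<open>Upsilon\<close> and \<open>B' P A\<close> are the given \<open>M\<close> and
  \<open>N\<close>.\<close>

lemma stabilizing_solution_iff: fixes A Q Z X S :: "real^'n^'n" and BL :: "real^'m1^'n" and BR :: "real^'m2^'n"
  and RL :: "real^'m1^'m1" and RR :: "real^'m2^'m2" assumes R: "pos_def RL" "pos_def RR" and Q: "psd Q" and p: "0 <= p"
 defines "B \<equiv> hcat BL BR" and "R \<equiv> block_diag RL RR" and "\<Theta> \<equiv> Theta_mat p Z X"
 shows "stabilizing_solution A BL BR Q RL RR \<mu> p Z X S \<longleftrightarrow> pos_def Z & pos_def (Z+S) & pos_def \<Theta> &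
  riccati_map A B (Q_mu \<mu> Q) R Z = Z & riccati_map A B Q R (Z+S) = Z+S & X = riccati_map A BL (Q_mu \<mu> Q) RL \<Theta> &
  schur_stable (sqrt p *\<^sub>R (A-BL**K_gain A BL RL \<Theta>))" proof (cases "pos_def Z & pos_def (Z+S) & pos_def \<Theta>")
 case True hence Z: "pos_def Z" and P: "pos_def (Z+S)" and T: "pos_def \<Theta>" by auto
 have RB: "pos_def R" unfolding R_def by (rule pos_def_block_diag[OF R])
 have M: "M_mat B R Z S = Upsilon_mat B R (Z+S)" by (simp add: M_mat_def Upsilon_mat_def matrix_add_ldistrib mm_rplus)
 have N: "N_mat A B Z S = tp B**(Z+S)**A" by (simp add: N_mat_def matrix_add_ldistrib mm_rplus)
 have UP: "pos_def (Upsilon_mat B R (Z+S))" by (rule Upsilon_pos_def[OF pd_psd[OF P] RB])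
 have UT: "pos_def (Upsilon_mat BL RL \<Theta>)" by (rule Upsilon_pos_def[OF pd_psd[OF T] R(1)])
 have sP: "tp (Z+S) = Z+S" and sT: "tp \<Theta> = \<Theta>" using P T by (auto simp: pos_def_def)
 have L: "L_mat A BL \<Theta> = tp BL**\<Theta> ** A" "Lambda_mat BL RL \<Theta> = Upsilon_mat BL RL \<Theta>"
  by (simp_all add: L_mat_def Lambda_mat_def Upsilon_mat_def)
 have G: "matrix_inv (Lambda_mat BL RL \<Theta>)**L_mat A BL \<Theta> = K_gain A BL RL \<Theta>"
  by (simp add: L K_gain_def mm_assoc)
 have e1: "riccati_map A B (Q_mu \<mu> Q) R Z = tp A**Z**A+Q_mu \<mu> Q
  -tp (K_gain A B R Z)**Upsilon_mat B R Z**K_gain A B R Z" by (simp add: riccati_map_def)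
 have e2: "riccati_map A BL (Q_mu \<mu> Q) RL \<Theta> = tp A**\<Theta> ** A+Q_mu \<mu> Q
  -tp (L_mat A BL \<Theta>)**matrix_inv (Lambda_mat BL RL \<Theta>)**L_mat A BL \<Theta>"
  unfolding riccati_map_def gain_quadratic[OF sT UT] L ..
 have e3: "riccati_map A B Q R (Z+S) = tp A**(Z+S)**A+Q -tp (N_mat A B Z S)**matrix_inv (M_mat B R Z S)**N_mat A B Z S"
  unfolding riccati_map_def gain_quadratic[OF sP UP] M N ..
 have split: "tp A**(Z+S)**A = tp A**Z**A+tp A**S**A" by (simp add: matrix_add_ldistrib mm_rplus)
 have aux: "(z = a+(q+mq)-k & x = y & s = b-mq+k-n) \<longleftrightarrow> (a+(q+mq)-k = z & (a+b)+q-n = z+s & x = y)"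
  for z a q mq k s b n x y :: "real^'n^'n" proof - have "(a+b)+q-n-((a+(q+mq)-k)+s) = (b-mq+k-n)-s" by simp
  hence "(a+b)+q-n = (a+(q+mq)-k)+s \<longleftrightarrow> b-mq+k-n = s" by (metis eq_iff_diff_eq_0)
  thus ?thesis by auto
 qed have ric: "riccati_solution A BL BR Q RL RR \<mu> p Z X S \<longleftrightarrow>
   riccati_map A B (Q_mu \<mu> Q) R Z = Z & riccati_map A B Q R (Z+S) = Z+S & X = riccati_map A BL (Q_mu \<mu> Q) RL \<Theta>"
  unfolding riccati_solution_def Let_def B_def[symmetric] R_def[symmetric] \<Theta>_def[symmetric]
  unfolding e1 e2 e3 split unfolding Q_mu_def by (rule aux)
 have "BL**matrix_inv (Lambda_mat BL RL \<Theta>)**L_mat A BL \<Theta> = BL**K_gain A BL RL \<Theta>"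
  unfolding G[symmetric] by (rule mm_assoc[symmetric])
 thus ?thesis using True unfolding stabilizing_solution_def ric Let_def \<Theta>_def[symmetric]
   schur_stable_scaled[OF real_sqrt_ge_zero[OF p]] by simp
qed (auto simp: stabilizing_solution_def \<Theta>_def)

lemma matpow_scaleR: "matpow (c *\<^sub>R F) k = c^k *\<^sub>R matpow F k" by (induction k) (simp_all add: matrix_mult_scaleR)

lemma matrix_inv_scaleR: fixes Y :: "real^'n^'n" assumes "invertible Y" "c ~= 0"
 shows "matrix_inv (c *\<^sub>R Y) = (1/c) *\<^sub>R matrix_inv Y" proof -
 have "(c *\<^sub>R Y)**((1/c) *\<^sub>R matrix_inv Y) = mat 1" using assms by (simp add: matrix_mult_scaleR matrix_inv_right)
 moreover have "invertible (c *\<^sub>R Y)" using calculation invertible_right_inverse by blast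
 ultimately show ?thesis by (metis matrix_inv_left mm_assoc matrix_mul_lid matrix_mul_rid)
qed

text \<open>\<open>Z\<close> and \<open>P\<close> are limits of value iterations, and
  \<open>S = P - Z\<close>. The equation \<open>Theta = (1-p) Z + p Ric(Theta)\<close> is itself a
  Riccati equation, for the data \<open>sqrt p A\<close>, \<open>sqrt p BL\<close>,
  \<open>p RL\<close> and the weight \<open>(1-p) Z + p Q_mu\<close>. Its gain is the one wanted,
  and its closed loop is the wanted one times \<open>sqrt p\<close>.\<close>

theorem stabilizing_solution_exists: fixes A Q Qw :: "real^'n^'n" and BL :: "real^'m1^'n" and BR :: "real^'m2^'n"
  and RL :: "real^'m1^'m1" and RR :: "real^'m2^'m2"
 assumes R: "pos_def RL" "pos_def RR" and Q: "psd Q" and p: "0 <= p" "p <= 1" and \<mu>: "0 <= \<mu>"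
  and obs: "!!x. (!!k. Q *v (matpow A k *v x) = 0) ==> x = 0" and stab: "stabilizable A Qw"
  and bZ: "!!v. EX c. ALL j. (Qw *v v) \<bullet>
   (value_iter A (hcat BL BR) (Q_mu \<mu> Q) (block_diag RL RR) j *v (Qw *v v)) <= c"
  and bT: "!!Z v. psd Z ==> 0 < p ==> EX c. ALL j. (Qw *v v) \<bullet>
   (value_iter (sqrt p *\<^sub>R A) (sqrt p *\<^sub>R BL) ((1-p) *\<^sub>R Z+p *\<^sub>R Q_mu \<mu> Q) (p *\<^sub>R RL) j *v (Qw *v v)) <= c"
 shows "EX Z X S. stabilizing_solution A BL BR Q RL RR \<mu> p Z X S" proof -
 define B R where "B = hcat BL BR" and "R = block_diag RL RR"
 have RB: "pos_def R" unfolding R_def by (rule pos_def_block_diag[OF R])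
 have Qm: "psd (Q_mu \<mu> Q)" by (rule Q_mu_psd[OF \<mu> Q])
 obtain E where E: "schur_stable (A+Qw**E)" using stab by (auto simp: stabilizable_def)
 have bZ': "EX c. ALL j. qf (value_iter A B (Q_mu \<mu> Q) R j) x <= c" for x
  by (rule value_iter_bounded[OF Qm RB E]) (use bZ in "simp add: B_def R_def")
 obtain Z where Z: "psd Z" "riccati_map A B (Q_mu \<mu> Q) R Z = Z" using value_iter_limit[OF Qm RB bZ'] by blast
 have obsm: "x = 0" if "!!k. Q_mu \<mu> Q *v (matpow A k *v x) = 0" for x using that obs by (simp add: Q_mu_ker[OF \<mu>])
 have pZ: "pos_def Z" by (rule riccati_stabilizing(1)[OF Qm RB Z obsm])
 have bP: "EX c. ALL j. qf (value_iter A B Q R j) x <= c" for x proof -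
  obtain c where c: "!!j. qf (value_iter A B (Q_mu \<mu> Q) R j) x <= c" using bZ' by blast
  have "qf (value_iter A B Q R j) x <= c" for j by (rule order_trans[OF value_iter_weight_mono[OF Q Qm RB Q_mu_ge[OF \<mu> Q]] c])
  thus ?thesis by blast
 qed obtain P where P: "psd P" "riccati_map A B Q R P = P" using value_iter_limit[OF Q RB bP] by blast
 have pP: "pos_def P" by (rule riccati_stabilizing(1)[OF Q RB P obs])
 have "\<exists>\<Theta>. pos_def \<Theta> & \<Theta> = (1-p) *\<^sub>R Z+p *\<^sub>R riccati_map A BL (Q_mu \<mu> Q) RL \<Theta> &
   schur_stable (sqrt p *\<^sub>R (A-BL**K_gain A BL RL \<Theta>))" proof (cases "p = 0")
  \<comment> \<open>For \<open>p = 0\<close> the scaled control weight \<open>p RL\<close> would not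
    be positive definite; here \<open>Theta = Z\<close> solves the equation and the scaled closed
    loop is the zero matrix.\<close>
  case True have "schur_stable (0 *\<^sub>R (A-BL**K_gain A BL RL Z))" using schur_stable_scaled[of 0] by simp
  thus ?thesis using True pZ by (intro exI[of _ Z]) simp
 next case False hence p0: "0 < p" using p by simp
  define A' BL' W where "A' = sqrt p *\<^sub>R A" and "BL' = sqrt p *\<^sub>R BL"
   and "W = (1-p) *\<^sub>R Z+p *\<^sub>R Q_mu \<mu> Q"
  have W: "psd W" unfolding W_def using p by (intro psd_add psd_scaleR Z Qm) auto
  have RL': "pos_def (p *\<^sub>R RL)" using R(1) p0 unfolding pos_def_def by (simp add: transpose_scaleR mv_scaleR)
  have E': "schur_stable (A'+Qw**(sqrt p *\<^sub>R E))" proof -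
   have eq: "A'+Qw**(sqrt p *\<^sub>R E) = sqrt p *\<^sub>R (A+Qw**E)"
    by (simp add: A'_def matrix_mult_scaleR scaleR_right_distrib)
   have "1*cmod (lambda_max (A+Qw**E)) < 1" using schur_stable_scaled[of 1 "A+Qw**E"] E by simp
   moreover have "sqrt p*cmod (lambda_max (A+Qw**E)) <= 1*cmod (lambda_max (A+Qw**E))" using p by (intro mult_right_mono) auto
   ultimately have "sqrt p*cmod (lambda_max (A+Qw**E)) < 1" by simp
   thus ?thesis unfolding eq schur_stable_scaled[OF real_sqrt_ge_zero[OF p(1)]] .
  qed have bT': "EX c. ALL j. qf (value_iter A' BL' W (p *\<^sub>R RL) j) x <= c" for x
   by (rule value_iter_bounded[OF W RL' E']) (use bT[OF Z(1) p0] in "simp add: A'_def BL'_def W_def")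
  obtain \<Theta> where T: "psd \<Theta>" "riccati_map A' BL' W (p *\<^sub>R RL) \<Theta> = \<Theta>"
   using value_iter_limit[OF W RL' bT'] by blast
  \<comment> \<open>\<open>W\<close> dominates \<open>p Q_mu\<close>, and powers of
    \<open>sqrt p A\<close> are nonzero multiples of powers of \<open>A\<close>, so observability
    carries over to the scaled data.\<close>
  have obsW: "x = 0" if z: "!!k. W *v (matpow A' k *v x) = 0" for x proof (rule obsm)
   fix k define y where "y = matpow A' k *v x"
   have "(1-p)*qf Z y+p*qf (Q_mu \<mu> Q) y = qf W y" by (simp add: W_def mv_plus inner_add_right mv_scaleR)
   also have "... = 0" using z[of k] by (simp add: y_def)
   moreover have "0 <= (1-p)*qf Z y" "0 <= p*qf (Q_mu \<mu> Q) y" using p psd_quad[OF Z(1)] psd_quad[OF Qm] by simp_all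
   ultimately have "p*qf (Q_mu \<mu> Q) y = 0" by linarith
   hence "Q_mu \<mu> Q *v y = 0" using p0 psd_quad_zero[OF Qm] by simp
   thus "Q_mu \<mu> Q *v (matpow A k *v x) = 0"
    using p0 by (simp add: y_def A'_def matpow_scaleR mv_scaleR matrix_vector_mult_scaleR)
  qed have pT: "pos_def \<Theta>" and st: "schur_stable (A'-BL'**K_gain A' BL' (p *\<^sub>R RL) \<Theta>)"
   using riccati_stabilizing[OF W RL' T obsW] by auto
  define Y where "Y = Upsilon_mat BL RL \<Theta>"
  have pY: "pos_def Y" unfolding Y_def by (rule Upsilon_pos_def[OF T(1) R(1)])
  have sp: "sqrt p * sqrt p = p" using p by simp
  have UY: "Upsilon_mat BL' (p *\<^sub>R RL) \<Theta> = p *\<^sub>R Y"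
   by (simp add: Upsilon_mat_def BL'_def Y_def transpose_scaleR matrix_mult_scaleR sp p(1) scaleR_right_distrib)
  have KK: "K_gain A' BL' (p *\<^sub>R RL) \<Theta> = K_gain A BL RL \<Theta>"
   unfolding K_gain_def UY Y_def[symmetric] matrix_inv_scaleR[OF pos_def_invertible[OF pY] False]
   using False by (simp add: A'_def BL'_def transpose_scaleR matrix_mult_scaleR sp p(1))
  have "riccati_map A' BL' W (p *\<^sub>R RL) \<Theta> = (1-p) *\<^sub>R Z+p *\<^sub>R riccati_map A BL (Q_mu \<mu> Q) RL \<Theta>"
   unfolding riccati_map_def[of A'] KK UY
   by (simp add: riccati_map_def A'_def W_def transpose_scaleR matrix_mult_scaleR sp p(1) Y_def
     scaleR_right_distrib scaleR_right_diff_distrib)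
  moreover have "A'-BL'**K_gain A BL RL \<Theta> = sqrt p *\<^sub>R (A-BL**K_gain A BL RL \<Theta>)"
   by (simp add: A'_def BL'_def matrix_mult_scaleR scaleR_right_diff_distrib)
  ultimately show ?thesis using pT st T(2) KK by (intro exI[of _ \<Theta>]) simp
 qed
 then obtain \<Theta> where T: "pos_def \<Theta>" "\<Theta> = (1-p) *\<^sub>R Z+p *\<^sub>R riccati_map A BL (Q_mu \<mu> Q) RL \<Theta>"
  "schur_stable (sqrt p *\<^sub>R (A-BL**K_gain A BL RL \<Theta>))" by blast
 define X where "X = riccati_map A BL (Q_mu \<mu> Q) RL \<Theta>"
 have TX: "Theta_mat p Z X = \<Theta>" unfolding Theta_mat_def X_def using T(2) by (rule sym)
 have "stabilizing_solution A BL BR Q RL RR \<mu> p Z X (P-Z)" unfolding stabilizing_solution_iff[OF R Q p(1)] TX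
  using pZ pP T P Z by (simp add: B_def R_def X_def)
 thus ?thesis by blast
qed

text \<open>For \<open>Z <= X\<close>: the minimizing local control in the equation of
  \<open>X\<close>, combined with remote control 0, is a candidate in the equation of
  \<open>Z\<close>. Comparing the two costs gives \<open>p D (F x) <= D x\<close> for the form
  \<open>D\<close> of \<open>X - Z\<close>. Iterated along the stable matrix
  \<open>sqrt p F\<close>, the left side tends to 0.\<close>

theorem stabilizing_solution_facts: fixes A Q Z X S :: "real^'n^'n" and BL :: "real^'m1^'n" and BR :: "real^'m2^'n"
  and RL :: "real^'m1^'m1" and RR :: "real^'m2^'m2"
 assumes R: "pos_def RL" "pos_def RR" and Q: "psd Q" and p: "0 <= p" "p <= 1" and \<mu>: "0 <= \<mu>"
  and obs: "!!x. (!!k. Q *v (matpow A k *v x) = 0) ==> x = 0" and sol: "stabilizing_solution A BL BR Q RL RR \<mu> p Z X S"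
 defines "B \<equiv> hcat BL BR" and "R \<equiv> block_diag RL RR" and "\<Theta> \<equiv> Theta_mat p Z X"
 shows "schur_stable (A-B**K_gain A B R Z)" "schur_stable (A-B**K_gain A B R (Z+S))"
  "K_gain A B R (Z+S) = K_gain A B R Z+Kbar_gain A B R Z S" "tp X = X" "qf Z z <= qf X z" proof -
 have s: "pos_def Z" "pos_def (Z+S)" "pos_def \<Theta>" "riccati_map A B (Q_mu \<mu> Q) R Z = Z" "riccati_map A B Q R (Z+S) = Z+S"
  "X = riccati_map A BL (Q_mu \<mu> Q) RL \<Theta>" "schur_stable (sqrt p *\<^sub>R (A-BL**K_gain A BL RL \<Theta>))"
  using sol unfolding stabilizing_solution_iff[OF assms(1-4)] B_def R_def \<Theta>_def by blast+
 have RB: "pos_def R" unfolding R_def by (rule pos_def_block_diag[OF assms(1,2)])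
 have Qm: "psd (Q_mu \<mu> Q)" by (rule Q_mu_psd[OF \<mu> Q])
 show "schur_stable (A-B**K_gain A B R Z)" by (rule riccati_stabilizing(2)[OF Qm RB pd_psd[OF s(1)] s(4)])
   (use obs in \<open>simp add: Q_mu_ker[OF \<mu>]\<close>)
 show "schur_stable (A-B**K_gain A B R (Z+S))" by (rule riccati_stabilizing(2)[OF Q RB pd_psd[OF s(2)] s(5) obs])
 show "K_gain A B R (Z+S) = K_gain A B R Z+Kbar_gain A B R Z S"
  by (simp add: K_gain_def Kbar_gain_def M_mat_def N_mat_def Upsilon_mat_def matrix_add_ldistrib
    mm_rplus mm_assoc)
 show sX: "tp X = X" unfolding s(6) by (intro riccati_map_symmetric psd_sym Qm pd_psd s assms(1))
 define G where "G = K_gain A BL RL \<Theta>"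
 define F where "F = A-BL**G"
 define D where "D x = qf X x-qf Z x" for x
 have step: "p*D (F *v x) <= D x" for x proof - have F: "A *v x+BL *v (- (G *v x)) = F *v x"
   by (simp add: F_def mv_minus matrix_vector_neg flip: mv_assoc)
  have "qf X x = stage_cost A BL (Q_mu \<mu> Q) RL \<Theta> x (- (G *v x))"
   unfolding G_def by (subst s(6)) (intro riccati_map_value Upsilon_pos_def psd_sym pd_psd s assms(1))
  moreover have "qf Z x <= stage_cost A B (Q_mu \<mu> Q) R Z x (embed_inl (- (G *v x)))"
   by (subst (1) s(4)[symmetric]) (intro riccati_map_le Upsilon_pos_def psd_sym pd_psd s RB)
  moreover have "stage_cost A B (Q_mu \<mu> Q) R Z x (embed_inl (- (G *v x))) =
    stage_cost A BL (Q_mu \<mu> Q) RL Z x (- (G *v x))" by (simp add: stage_cost_def B_def R_def hcat_mult block_diag_quad)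
  moreover have "stage_cost A BL (Q_mu \<mu> Q) RL \<Theta> x (- (G *v x))-stage_cost A BL (Q_mu \<mu> Q) RL Z x (- (G *v x)) = p*D (F *v x)"
   unfolding stage_cost_def F D_def \<Theta>_def Theta_mat_def by (simp add: mv_plus inner_add_right mv_scaleR algebra_simps)
  ultimately show ?thesis by (simp add: D_def)
 qed have iter: "D (matpow (sqrt p *\<^sub>R F) k *v x) <= D x" for k x proof (induction k) case (Suc k)
  define y where "y = matpow (sqrt p *\<^sub>R F) k *v x"
  have "matpow (sqrt p *\<^sub>R F) (Suc k) *v x = sqrt p *\<^sub>R (F *v y)" by (simp add: y_def mv_scaleR flip: mv_assoc)
  hence "D (matpow (sqrt p *\<^sub>R F) (Suc k) *v x) = p*D (F *v y)"
   using p by (simp add: D_def matrix_vector_mult_scaleR right_diff_distrib flip: mult.assoc)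
  thus ?case using step[of y] Suc by (simp add: y_def)
 qed simp
 have "(%k. matpow (sqrt p *\<^sub>R F) k *v z) ----> 0"
  using summable_LIMSEQ_zero[OF schur_summable[OF s(7)]] tendsto_norm_zero_iff unfolding F_def G_def by blast
 hence "(%k. D (matpow (sqrt p *\<^sub>R F) k *v z)) ----> qf X 0-qf Z 0"
  unfolding D_def by (intro tendsto_diff tendsto_inner tendsto_matrix_vector_mult tendsto_const)
 hence "0 <= D z" using LIMSEQ_le_const2[of _ _ "D z"] iter by (metis (no_types, lifting) inner_zero_left diff_self)
 thus "qf Z z <= qf X z" by (simp add: D_def)
qed

declare transpose_matrix_vector [simp del]

section \<open>Kalman filter covariances with possibly singular noise\<close>

lemma symmetric_range_solution: fixes S :: "real^'m^'m" assumes S: "tp S = S" and b: "!!x. S *v x = 0 ==> b \<bullet> x = 0"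
 shows "EX y. S *v y = b" proof -
 obtain y z where yz: "y : span (range ((*v) S))" "!!w. w : span (range ((*v) S)) ==> orthogonal z w" "b = y+z"
  using orthogonal_subspace_decomp_exists[of "range ((*v) S)" b] by metis
 have "(S *v z) \<bullet> (S *v z) = z \<bullet> (S *v (S *v z))"
  using symmetric_inner[OF S, of z "S *v z"] by (simp add: inner_commute)
 also have "... = 0" using yz(2)[of "S *v (S *v z)"] by (simp add: orthogonal_def span_base)
 finally have "S *v z = 0" by simp
 hence "b \<bullet> z = 0" by (rule b)
 moreover have "y \<bullet> z = 0" using yz(2)[OF yz(1)] by (simp add: orthogonal_def inner_commute)
 ultimately have "z = 0" using yz(3) by (simp add: inner_add_left)
 moreover have "span (range ((*v) S)) = range ((*v) S)" by (simp add: linear_subspace_image span_eq_iff subspace_UNIV)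
 ultimately have "b : range ((*v) S)" using yz(1,3) by (metis add.right_neutral)
 thus ?thesis by auto
qed

text \<open>Row by row: each row of \<open>N\<close> is orthogonal to the kernel of the symmetric
  matrix \<open>S\<close>, hence lies in its range.\<close>

lemma matrix_left_solution: fixes S :: "real^'m^'m" and N :: "real^'m^'n"
 assumes S: "tp S = S" and N: "!!x. S *v x = 0 ==> N *v x = 0" shows "EX H. H**S = N" proof - have "EX y. S *v y = N $ i" for i
 proof (rule symmetric_range_solution[OF S])
  fix x assume "S *v x = 0"
  thus "N $ i \<bullet> x = 0" using N[of x] by (metis matrix_vector_mul_component zero_index)
 qed then obtain y where y: "!!i. S *v y i = N $ i" by metis
 define H where "H = (\<chi> i. y i)"
 have "axis i 1 \<bullet> ((H**S) *v x) = axis i 1 \<bullet> (N *v x)" for i x proof -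
  have "axis i 1 \<bullet> ((H**S) *v x) = y i \<bullet> (S *v x)"
   by (simp add: inner_axis' H_def matrix_vector_mul_component flip: mv_assoc)
  also have "... = (S *v y i) \<bullet> x" using inner_tr[of "y i" S x] S by simp
  also have "... = axis i 1 \<bullet> (N *v x)" by (simp add: y inner_axis' matrix_vector_mul_component)
  finally show ?thesis .
 qed hence "((H**S) *v x) $ i = (N *v x) $ i" for i x by (simp add: inner_axis')
 thus ?thesis by (intro exI[of _ H]) (simp add: matrix_eq vec_eq_iff)
qed

definition innov_cov :: "real^'n^'m => real^'m^'m => real^'n^'n => real^'m^'m" where "innov_cov C V P = C**P**tp C+V"

definition kalman_gain :: "real^'n^'m => real^'m^'m => real^'n^'n => real^'m^'n" where
 "kalman_gain C V P = (SOME H. H**innov_cov C V P = P**tp C)"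

text \<open>The Joseph form. It is semidefinite by its shape, whichever solution of the normal
  equation serves as gain.\<close>

definition posterior_cov :: "real^'n^'m => real^'m^'m => real^'n^'n => real^'n^'n" where
 "posterior_cov C V P = (mat 1-kalman_gain C V P**C)**P**tp (mat 1-kalman_gain C V P**C)
 +kalman_gain C V P**V**tp (kalman_gain C V P)"

lemma psd_congruence': "psd W ==> psd (G**W**tp G)" for G :: "real^'n^'m" using psd_congruence[of W "tp G"] by simp

lemma quad_congruence': "qf (G**W**tp G) x = qf W (tp G *v x)" for G :: "real^'n^'m" using quad_congruence[of x "tp G" W] by simp

lemma innov_cov_psd: "psd P ==> psd V ==> psd (innov_cov C V P)" unfolding innov_cov_def by (intro psd_add psd_congruence')

text \<open>The innovation covariance may be singular; its kernel is annihilated by \<open>P C'\<close>, so the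
 normal equation for the gain is still solvable.\<close>

lemma kalman_gain_eq: fixes P :: "real^'n^'n" assumes P: "psd P" and V: "psd V"
 shows "kalman_gain C V P**innov_cov C V P = P**tp C" proof - have "EX H. H**innov_cov C V P = P**tp C"
 proof (rule matrix_left_solution)
  show "tp (innov_cov C V P) = innov_cov C V P" by (rule psd_sym[OF innov_cov_psd[OF P V]])
  fix x assume "innov_cov C V P *v x = 0"
  hence "qf (innov_cov C V P) x = 0" by simp
  hence "qf P (tp C *v x)+qf V x = 0" unfolding innov_cov_def mv_plus inner_add_right quad_congruence' .
  hence "qf P (tp C *v x) = 0" using psd_quad[OF P, of "tp C *v x"] psd_quad[OF V, of x] by linarith
  from psd_quad_zero[OF P this] show "(P**tp C) *v x = 0" by (simp add: mv_assoc)
 qed thus ?thesis unfolding kalman_gain_def by (rule someI_ex)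
qed

text \<open>The left side is the error variance when \<open>a . x\<close> is estimated by
  \<open>u . y\<close> from \<open>y = C x + v\<close>. The posterior covariance is thus a minimum
  over \<open>u\<close>, and this is the source of its monotonicity and of all upper bounds.\<close>

lemma posterior_completion: fixes P :: "real^'n^'n" assumes P: "psd P" and V: "psd V" shows "qf P (a-tp C *v u)+qf V u =
  qf (posterior_cov C V P) a +qf (innov_cov C V P) (u-tp (kalman_gain C V P) *v a)" proof -
 define H S where "H = kalman_gain C V P" and "S = innov_cov C V P"
 define h where "h = tp H *v a"
 have sP: "tp P = P" and sS: "tp S = S" using psd_sym[OF P] psd_sym[OF innov_cov_psd[OF P V]] by (simp_all add: S_def)
 have Sh: "S *v h = C *v (P *v a)" proof - have "tp (H**S) = tp (P**tp C)" using kalman_gain_eq[OF P V] by (simp add: H_def S_def)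
  hence "S**tp H = C**P" by (simp add: matrix_transpose_mul sP sS)
  thus ?thesis by (simp add: h_def mv_assoc)
 qed have SS: "qf S x = qf P (tp C *v x)+qf V x" for x by (simp add: S_def innov_cov_def mv_plus inner_add_right quad_congruence')
 have diff: "qf W (x-y) = qf W x-2*(y \<bullet> (W *v x))+qf W y"
  if "tp W = W" for W :: "real^'k^'k" and x y using symmetric_inner[OF that, of x y]
  by (simp add: mv_diff inner_diff_left inner_diff_right)
 have cross: "(tp C *v x) \<bullet> (P *v a) = x \<bullet> (C *v (P *v a))" for x by (rule inner_tr[symmetric])
 have lhs: "qf P (a-tp C *v u)+qf V u = qf P a-2*(u \<bullet> (S *v h))+qf S u" for u
  unfolding diff[OF sP] SS[of u] cross Sh by simp
 have "tp (mat 1-H**C) *v a = a-tp C *v h" by (simp add: transpose_diff matrix_transpose_mul mv_minus h_def flip: mv_assoc)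
 hence post: "qf (posterior_cov C V P) a = qf P (a-tp C *v h)+qf V h"
  unfolding posterior_cov_def H_def[symmetric] mv_plus inner_add_right quad_congruence' by (simp add: h_def)
 have "qf (posterior_cov C V P) a = qf P a-qf S h" unfolding post lhs by simp
 moreover have "qf S (u-h) = qf S u-2*(u \<bullet> (S *v h))+qf S h"
  unfolding diff[OF sS] using symmetric_inner[OF sS, of h u] by simp
 ultimately show ?thesis unfolding lhs H_def[symmetric] S_def[symmetric] h_def[symmetric] by simp
qed

lemma posterior_cov_psd: "psd P ==> psd V ==> psd (posterior_cov C V P)"
 unfolding posterior_cov_def by (intro psd_add psd_congruence')

lemma posterior_cov_le: fixes P :: "real^'n^'n" assumes "psd P" "psd V"
 shows "qf (posterior_cov C V P) a <= qf P (a-tp C *v u)+qf V u" using posterior_completion[OF assms, of a C u]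
  psd_quad[OF innov_cov_psd[OF assms], of "u-tp (kalman_gain C V P) *v a" C] by simp

lemma posterior_cov_attained: fixes P :: "real^'n^'n" assumes "psd P" "psd V"
 shows "EX u. qf (posterior_cov C V P) a = qf P (a-tp C *v u)+qf V u"
 using posterior_completion[OF assms, of a C "tp (kalman_gain C V P) *v a"] by (metis add.right_neutral diff_self inner_zero_left)

lemma posterior_cov_mono: fixes P P' :: "real^'n^'n" assumes "psd P" "psd P'" "psd V" "!!x. qf P x <= qf P' x"
 shows "qf (posterior_cov C V P) a <= qf (posterior_cov C V P') a" proof - obtain u where u: "qf (posterior_cov C V P') a =
   qf P' (a-tp C *v u)+qf V u" using posterior_cov_attained[OF assms(2,3)] by blast
 show ?thesis unfolding u by (rule order_trans[OF posterior_cov_le[OF assms(1,3), of a C u]]) (simp add: assms(4))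
qed

definition predict_cov :: "real^'n^'n => real^'n^'n => real^'n^'n => real^'n^'n" where
 "predict_cov A W \<Sigma> = A**\<Sigma> ** tp A+W"

lemma predict_cov_psd: "psd \<Sigma> ==> psd W ==> psd (predict_cov A W \<Sigma>)"
 unfolding predict_cov_def by (intro psd_add psd_congruence')

lemma predict_cov_quad: "qf (predict_cov A W \<Sigma>) x = qf \<Sigma> (tp A *v x)+qf W x"
 by (simp add: predict_cov_def mv_plus inner_add_right quad_congruence')

lemma predict_cov_mono: assumes "!!x. qf \<Sigma> x <= qf \<Sigma>' x"
 shows "qf (predict_cov A W \<Sigma>) x <= qf (predict_cov A W \<Sigma>') x" unfolding predict_cov_quad by (simp add: assms)

text \<open>Index \<open>k\<close> refers to the state of knowledge after the observation of time
  \<open>k\<close>; \<open>P0\<close> is the covariance before the observation of time 0.\<close>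

primrec filter_cov where "filter_cov A C W V P0 0 = posterior_cov C V P0"
| "filter_cov A C W V P0 (Suc k) = posterior_cov C V (predict_cov A W (filter_cov A C W V P0 k))"

lemma filter_cov_psd: "psd P0 ==> psd W ==> psd V ==> psd (filter_cov A C W V P0 k)"
 by (induction k) (auto intro: posterior_cov_psd predict_cov_psd)

lemma matpow_transpose: "matpow (tp F) k = tp (matpow F k)" proof (induction k) case (Suc k)
 have "matpow F k**F = F**matpow F k" using matpow_commute[of F F k] by simp
 thus ?case using Suc by (simp flip: matrix_transpose_mul)
qed simp

text \<open>Transposition only permutes the entries of the powers, so summability is transferred
  entry by entry.\<close>

lemma schur_summable_transpose: fixes F :: "real^'n^'n" assumes "schur_stable F"
 shows "summable (%k. norm (matpow (tp F) k *v x))" proof (rule summable_comparison_test')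
 have entry: "summable (%k. \<bar>matpow F k $ i $ j\<bar>)" for i j
 proof (rule summable_comparison_test'[OF schur_summable[OF assms, of "axis j 1"]])
  fix k have "matpow F k $ i $ j = (matpow F k *v axis j 1) $ i" by (simp add: matrix_vector_mult_basis column_def)
  thus "norm \<bar>matpow F k $ i $ j\<bar> <= norm (matpow F k *v axis j 1)"
   using component_le_norm_cart[of "matpow F k *v axis j 1" i] by simp
 qed show "summable (%k. SUM i:UNIV. SUM j:UNIV. \<bar>matpow F k $ j $ i\<bar> * \<bar>x $ j\<bar>)"
  by (intro summable_sum summable_mult2 entry)
 fix k have "norm (matpow (tp F) k *v x) <= (SUM i:UNIV. \<bar>(tp (matpow F k) *v x) $ i\<bar>)"
  unfolding matpow_transpose by (rule norm_le_l1_cart)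
 also have "... <= (SUM i:UNIV. SUM j:UNIV. \<bar>matpow F k $ j $ i\<bar> * \<bar>x $ j\<bar>)" proof (rule sum_mono)
  fix i have "\<bar>(tp (matpow F k) *v x) $ i\<bar> = \<bar>SUM j:UNIV. matpow F k $ j $ i*x $ j\<bar>"
   by (simp add: mv_def transpose_def)
  also have "... <= (SUM j:UNIV. \<bar>matpow F k $ j $ i*x $ j\<bar>)" by (rule sum_abs)
  finally show "\<bar>(tp (matpow F k) *v x) $ i\<bar> <= (SUM j:UNIV. \<bar>matpow F k $ j $ i\<bar> * \<bar>x $ j\<bar>)"
   by (simp add: abs_mult)
 qed
 finally show "norm (norm (matpow (tp F) k *v x)) <= (SUM i:UNIV. SUM j:UNIV. \<bar>matpow F k $ j $ i\<bar> * \<bar>x $ j\<bar>)"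
  by simp
qed

context fixes A C W V :: "real^'n^'n" and E :: "real^'n^'n" assumes W: "psd W" and V: "psd V" and E: "schur_stable (A+E**C)"
begin

text \<open>Error dynamics and noise covariance of an observer with fixed gain. Its covariance
  recursion is affine and stable, and it bounds the filter from above.\<close>

definition "obsF = A+E**C"
definition "obsV = W+E**V**tp E"

lemma obsV_psd: "psd obsV" unfolding obsV_def by (intro psd_add psd_congruence' W V)

lemma predict_posterior_le: assumes "psd P" shows "qf (predict_cov A W (posterior_cov C V P)) x <= qf P (tp obsF *v x)+qf obsV x"
proof - have "tp A *v x-tp C *v (- (tp E *v x)) = tp obsF *v x"
  by (simp add: obsF_def transpose_add matrix_transpose_mul mv_plus matrix_vector_neg flip: mv_assoc)
 thus ?thesis using posterior_cov_le[OF assms V, of "tp A *v x" C "- (tp E *v x)"]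
  unfolding predict_cov_quad obsV_def mv_plus inner_add_right quad_congruence' by (simp add: matrix_vector_neg)
qed

primrec observer_cov :: "real^'n^'n => nat => real^'n^'n" where "observer_cov P0 0 = P0"
| "observer_cov P0 (Suc k) = obsF ** observer_cov P0 k**tp obsF + obsV"

lemma observer_cov_psd: "psd P0 ==> psd (observer_cov P0 k)" by (induction k) (auto intro: psd_add psd_congruence' obsV_psd)

text \<open>Unrolled, the recursion is an initial term plus a sum of \<open>obsV\<close>-values
  along the orbit of \<open>x\<close> under the transposed matrix, which is summable.\<close>

lemma observer_cov_bounded: assumes "psd P0" shows "EX c. ALL k. qf (observer_cov P0 k) x <= c" proof -
 define n where "n k = norm (matpow (tp obsF) k *v x)" for k
 have sn: "summable n" unfolding n_def by (rule schur_summable_transpose) (use E in "simp add: obsF_def")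
 have n0: "0 <= n k" for k by (simp add: n_def)
 obtain p where p: "0 <= p" "!!x. \<bar>x \<bullet> (P0 *v x)\<bar> <= p*(x \<bullet> x)" using quad_upper_bound[of P0] by blast
 obtain v where v: "0 <= v" "!!x. \<bar>x \<bullet> (obsV *v x)\<bar> <= v * (x \<bullet> x)" using quad_upper_bound[of obsV] by blast
 have form: "qf (observer_cov P0 k) x = qf P0 (matpow (tp obsF) k *v x) +(SUM i<k. qf obsV (matpow (tp obsF) i *v x))" for k x
 proof (induction k arbitrary: x) case (Suc k)
  have sh: "matpow (tp obsF) i *v (tp obsF *v x) = matpow (tp obsF) (Suc i) *v x" for i
   by (simp only: matpow_funpow funpow_Suc_right comp_apply)
  show ?case unfolding observer_cov.simps mv_plus inner_add_right quad_congruence' Suc sh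
   by (subst sum.lessThan_Suc_shift) (simp del: matpow.simps(2))
 qed simp
 have nle: "n k <= suminf n" for k using sum_le_suminf[OF sn, of "{k}"] n0 by simp
 have "qf (observer_cov P0 k) x <= p*(suminf n)\<^sup>2+v * (suminf n * suminf n)" for k proof -
  have "qf P0 (matpow (tp obsF) k *v x) <= p*(n k)\<^sup>2"
   using p(2)[of "matpow (tp obsF) k *v x"] by (simp add: n_def dot_square_norm)
  also have "... <= p*(suminf n)\<^sup>2" using p(1) n0 nle by (intro mult_left_mono power_mono) auto
  finally have 1: "qf P0 (matpow (tp obsF) k *v x) <= p*(suminf n)\<^sup>2" .
  have "(SUM i<k. qf obsV (matpow (tp obsF) i *v x)) <= (SUM i<k. v * (suminf n*n i))" proof (rule sum_mono)
   fix i have "qf obsV (matpow (tp obsF) i *v x) <= v * (n i*n i)"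
    using v(2)[of "matpow (tp obsF) i *v x"] by (simp add: n_def dot_square_norm pow2)
   also have "... <= v * (suminf n*n i)" using v(1) n0 nle by (intro mult_left_mono mult_right_mono)
   finally show "qf obsV (matpow (tp obsF) i *v x) <= v * (suminf n*n i)" .
  qed also have "... = v * (suminf n*(SUM i<k. n i))" by (simp add: sum_dl)
  also have "... <= v * (suminf n * suminf n)"
   using v(1) n0 sum_le_suminf[OF sn, of "{..<k}"] suminf_nonneg[OF sn n0] by (intro mult_left_mono) auto
  finally show ?thesis using 1 unfolding form[of x k] by linarith
 qed thus ?thesis by blast
qed

lemma filter_predict_le_observer: assumes "psd P0"
 shows "qf (predict_cov A W (filter_cov A C W V P0 k)) x <= qf (observer_cov P0 (Suc k)) x" proof (induction k arbitrary: x)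
 case 0 thus ?case using predict_posterior_le[OF assms, of x] by (simp add: mv_plus inner_add_right quad_congruence')
next case (Suc k) have "qf (predict_cov A W (filter_cov A C W V P0 (Suc k))) x <=
   qf (predict_cov A W (filter_cov A C W V P0 k)) (tp obsF *v x)+qf obsV x"
  unfolding filter_cov.simps by (rule predict_posterior_le) (intro predict_cov_psd filter_cov_psd assms W V)
 also have "... <= qf (observer_cov P0 (Suc k)) (tp obsF *v x)+qf obsV x" by (intro add_right_mono Suc)
 also have "... = qf (observer_cov P0 (Suc (Suc k))) x"
  by (subst (2) observer_cov.simps) (simp only: mv_plus inner_add_right quad_congruence')
 finally show ?case .
qed

lemma filter_cov_bounded: assumes "psd P0" shows "EX c. ALL k. qf (filter_cov A C W V P0 k) x <= c" proof -
 obtain c where c: "!!k. qf (observer_cov P0 k) x <= c" using observer_cov_bounded[OF assms] by blast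
 have "qf (filter_cov A C W V P0 (Suc k)) x <= c" for k proof -
  have "qf (filter_cov A C W V P0 (Suc k)) x <= qf (predict_cov A W (filter_cov A C W V P0 k)) x" proof -
   have "psd (predict_cov A W (filter_cov A C W V P0 k))" by (intro predict_cov_psd filter_cov_psd assms W V)
   from posterior_cov_le[OF this V, of x C 0] show ?thesis by simp
  qed also have "... <= c" by (rule order_trans[OF filter_predict_le_observer[OF assms] c])
  finally show ?thesis .
 qed hence "qf (filter_cov A C W V P0 k) x <= max c (qf (filter_cov A C W V P0 0) x)" for k
  by (cases k) (auto simp: le_max_iff_disj simp del: filter_cov.simps)
 thus ?thesis by blast
qed

text \<open>The stationary observer covariance \<open>T\<close> is a supersolution, so the filter
  map iterated from \<open>T\<close> decreases to a limit \<open>P\<close>. As the chosen gain may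
  jump at singular innovations, \<open>P\<close> is identified without continuity:
  \<open>\<phi> P <= P\<close> by monotonicity, and the converse by freezing the minimizing
  \<open>u\<close> for \<open>P\<close> and passing to the limit in the resulting upper
  bounds.\<close>

lemma filter_fixed_point: "EX P. psd P & predict_cov A W (posterior_cov C V P) = P" proof -
 have mono: "qf (observer_cov 0 k) x <= qf (observer_cov 0 (Suc k)) x" for k x proof (induction k arbitrary: x) case 0
  thus ?case using psd_quad[OF obsV_psd, of x] by (simp add: mv_plus)
 next case (Suc k) thus ?case by (subst (2) observer_cov.simps, subst (1) observer_cov.simps)
    (simp only: mv_plus inner_add_right quad_congruence' add_le_cancel_right)
 qed obtain T where T: "tp T = T" "observer_cov 0 ----> T" "!!j x. qf (observer_cov 0 j) x <= qf T x"
  using monotone_matrix_limit[of "observer_cov 0"] mono observer_cov_bounded[OF psd_zero]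
   psd_sym[OF observer_cov_psd[OF psd_zero]] by blast
 have pT: "psd T" unfolding psd_def using T(1) T(3)[of _ 0] by simp
 have "(%k. observer_cov 0 (Suc k)) ----> obsF**T**tp obsF + obsV" unfolding observer_cov.simps by (intro tendsto_intros T)
 hence Teq: "T = obsF**T**tp obsF + obsV" using LIMSEQ_Suc[OF T(2)] LIMSEQ_unique by blast
 define \<phi> where "\<phi> P = predict_cov A W (posterior_cov C V P)" for P
 have \<phi>psd: "psd P ==> psd (\<phi> P)" for P unfolding \<phi>_def by (intro predict_cov_psd posterior_cov_psd W V)
 have \<phi>mono: "qf (\<phi> P) x <= qf (\<phi> P') x"
  if "psd P" "psd P'" "!!x. qf P x <= qf P' x" for P P' x
  unfolding \<phi>_def by (intro predict_cov_mono posterior_cov_mono that V)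
 define Y where "Y k = (\<phi> ^^ k) T" for k
 have Ypsd: "psd (Y k)" for k by (induction k) (simp_all add: Y_def pT \<phi>psd)
 have dec: "qf (Y (Suc k)) x <= qf (Y k) x" for k x proof (induction k arbitrary: x) case 0
  have "qf T x = qf T (tp obsF *v x)+qf obsV x" by (subst Teq) (simp only: mv_plus inner_add_right quad_congruence')
  thus ?case using predict_posterior_le[OF pT, of x] by (simp add: Y_def \<phi>_def)
 next case (Suc k) have "Y (Suc (Suc k)) = \<phi> (Y (Suc k))" "Y (Suc k) = \<phi> (Y k)" by (simp_all add: Y_def)
  thus ?case using \<phi>mono[OF Ypsd Ypsd, of "Suc k" k x] Suc by metis
 qed have "EX D. tp D = D & (%k. T-Y k) ----> D & (ALL j x. qf (T-Y j) x <= qf D x)" proof (rule monotone_matrix_limit)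
  show "tp (T-Y j) = T-Y j" for j by (simp add: transpose_diff T(1) psd_sym[OF Ypsd])
  show "qf (T-Y j) x <= qf (T-Y (Suc j)) x" for j x using dec[of x j] by (simp add: mv_minus inner_diff_right)
  show "EX c. ALL j. qf (T-Y j) x <= c" for x
   using psd_quad[OF Ypsd, of x] by (intro exI[of _ "qf T x"]) (simp add: mv_minus inner_diff_right)
 qed then obtain D where D: "tp D = D" "(%k. T-Y k) ----> D" "!!j x. qf (T-Y j) x <= qf D x" by blast
 define P where "P = T-D"
 have "(%k. T-(T-Y k)) ----> T-D" by (intro tendsto_diff tendsto_const D)
 hence lim: "Y ----> P" by (simp add: P_def)
 have limq: "(%k. qf (Y k) x) ----> qf P x" for x by (intro tendsto_inner tendsto_const tendsto_matrix_vector_mult lim)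
 have PY: "qf P x <= qf (Y k) x" for x k using D(3)[of x k] by (simp add: P_def mv_minus inner_diff_right)
 have sP: "tp P = P" by (simp add: P_def transpose_diff T(1) D(1))
 have pP: "psd P" unfolding psd_def using sP LIMSEQ_le_const[OF limq] psd_quad[OF Ypsd] by blast
 have "\<phi> P = P" proof (rule quad_eq_imp_eq)
  show "tp (\<phi> P) = \<phi> P" by (rule psd_sym[OF \<phi>psd[OF pP]])
  show "tp P = P" by (rule sP)
  fix x have limq': "(%k. qf (\<phi> (Y k)) x) ----> qf P x" using LIMSEQ_Suc[OF limq[of x]] by (simp add: Y_def)
  have le: "qf (\<phi> P) x <= qf P x" by (rule LIMSEQ_le_const[OF limq']) (use \<phi>mono[OF pP Ypsd PY] in blast)
  obtain u where u: "qf (posterior_cov C V P) (tp A *v x) = qf P (tp A *v x-tp C *v u)+qf V u"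
   using posterior_cov_attained[OF pP V] by blast
  have "qf (\<phi> (Y k)) x <= qf (Y k) (tp A *v x-tp C *v u) +qf V u+qf W x" for k
   unfolding \<phi>_def predict_cov_quad using posterior_cov_le[OF Ypsd V] by simp
  moreover have "(%k. qf (Y k) (tp A *v x-tp C *v u) +qf V u+qf W x) ---->
    (tp A *v x-tp C *v u) \<bullet> (P *v (tp A *v x-tp C *v u)) +qf V u+qf W x" by (intro tendsto_add limq tendsto_const)
  ultimately have "qf P x <= qf P (tp A *v x-tp C *v u) +qf V u+qf W x" by (intro LIMSEQ_le[OF limq']) blast+
  also have "... = qf (\<phi> P) x" unfolding \<phi>_def predict_cov_quad u by simp
  finally show "qf (\<phi> P) x = qf P x" using le by simp
 qed thus ?thesis using pP unfolding \<phi>_def by blast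
qed

end

section \<open>Polynomials in \<open>ep\<close> whose coefficients are exponential polynomials in
  \<open>k\<close>\<close>

inductive bipoly :: "(nat => real => complex) => bool" where
 bipoly_monomial: "expoly f ==> bipoly (%k ep. f k * of_real ep ^ i)"
| bipoly_add: "bipoly f ==> bipoly g ==> bipoly (%k ep. f k ep+g k ep)"

text \<open>The expansion is stated for every degree above \<open>D\<close> so that a numerator and
  a denominator can be written with a common one.\<close>

lemma bipoly_coeffs: "bipoly g ==>
 EX n D. (ALL i. expoly (n i)) & (ALL D'>=D. ALL k ep. g k ep = (SUM i<=D'. n i k * of_real ep ^ i))"
proof (induction rule: bipoly.induct) case (bipoly_monomial f i)
 have "f k * of_real ep ^ i = (SUM j<=D. (if j = i then f else (%_. 0)) k * of_real ep ^ j)"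
  if "i <= D" for k ep D using that by (simp add: if_distrib[of "%h. h k * _"] cong: if_cong)
 with bipoly_monomial show ?case by (intro exI[of _ "%j. if j = i then f else (%_. 0)"] exI[of _ i]) (auto intro: expoly_zero)
next case (bipoly_add f g)
 then obtain n m D D' where n: "ALL i. expoly (n i)" "ALL d>=D. ALL k ep. f k ep = (SUM i<=d. n i k * of_real ep ^ i)"
  and m: "ALL i. expoly (m i)" "ALL d>=D'. ALL k ep. g k ep = (SUM i<=d. m i k * of_real ep ^ i)" by blast
 have "f k ep+g k ep = (SUM i<=d. (n i k+m i k) * of_real ep ^ i)" if "max D D' <= d" for d k ep
  using n(2)[rule_format, of d k ep] m(2)[rule_format, of d k ep] that by (simp add: sum.distrib distrib_right)
 thus ?case using n(1) m(1) by (intro exI[of _ "%i k. n i k+m i k"] exI[of _ "max D D'"]) (simp add: expoly_add)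
qed

lemma bipoly_expoly: "expoly f ==> bipoly (%k ep. f k)" using bipoly_monomial[of f 0] by simp

lemma bipoly_const: "bipoly (%k ep. c)" by (rule bipoly_expoly) (rule expoly_const)

lemma bipoly_eps: "bipoly (%k ep. of_real ep)" using bipoly_monomial[OF expoly_const, of 1 1] by simp

lemma bipoly_sum: assumes "!!i. i : I ==> bipoly (f i)" shows "bipoly (%k ep. SUM i:I. f i k ep)"
 using assms by (induction I rule: infinite_finite_induct) (auto intro: bipoly_const bipoly_add)

lemma bipoly_mult: "bipoly f ==> bipoly g ==> bipoly (%k ep. f k ep*g k ep)" proof (induction rule: bipoly.induct)
 case (bipoly_monomial f i) from bipoly_monomial(2) show ?case proof induction
  case (bipoly_monomial g j) have "(%k ep. f k * of_real ep ^ i*(g k * of_real ep ^ j)) = (%k ep. (f k*g k) * of_real ep ^ (i+j))"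
   by (simp add: power_add fun_eq_iff mult_ac)
  thus ?case using expoly_mult[OF \<open>expoly f\<close> bipoly_monomial] by (simp only: bipoly.bipoly_monomial)
 qed (simp add: distrib_left bipoly_add)
qed (simp add: distrib_right bipoly_add)

lemma bipoly_prod: assumes "!!i. i : I ==> bipoly (f i)" shows "bipoly (%k ep. PROD i:I. f i k ep)"
 using assms by (induction I rule: infinite_finite_induct) (auto intro: bipoly_const bipoly_mult)

definition bipoly_mat :: "(nat => real => real^'n^'m) => bool" where
 "bipoly_mat M \<longleftrightarrow> (ALL i j. bipoly (%k ep. of_real (M k ep $ i $ j)))"

lemma bipoly_mat_mult: "bipoly_mat M ==> bipoly_mat N ==> bipoly_mat (%k ep. M k ep ** N k ep)"
 unfolding bipoly_mat_def matrix_matrix_mult_def by (simp, intro allI bipoly_sum bipoly_mult) auto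

lemma bipoly_mat_add: "bipoly_mat M ==> bipoly_mat N ==> bipoly_mat (%k ep. M k ep + N k ep)"
 unfolding bipoly_mat_def by (simp add: bipoly_add)

lemma bipoly_mat_const: "bipoly_mat (%k ep. M)" unfolding bipoly_mat_def by (simp add: bipoly_const)

lemma bipoly_mat_transpose: "bipoly_mat M ==> bipoly_mat (%k ep. tp (M k ep))" unfolding bipoly_mat_def transpose_def by simp

lemma bipoly_mat_matpow: "bipoly_mat (%k ep. matpow F k)" unfolding bipoly_mat_def by (intro allI bipoly_expoly expoly_matpow)

lemma bipoly_mat_scale: "bipoly (%k ep. of_real (c k ep)) ==> bipoly_mat M ==> bipoly_mat (%k ep. c k ep *\<^sub>R M k ep)"
 unfolding bipoly_mat_def by (simp add: bipoly_mult)

lemma bipoly_det: assumes "bipoly_mat M" shows "bipoly (%k ep. of_real (det (M k ep)))"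
 unfolding det_def of_real_sum of_real_mult of_real_prod of_real_of_int_eq
 by (intro bipoly_sum bipoly_mult bipoly_prod bipoly_const) (use assms in "auto simp: bipoly_mat_def")

lemma bipoly_mat_replace_column: assumes "bipoly_mat M" "!!i. bipoly (%k ep. of_real (y k ep $ i))"
 shows "bipoly_mat (%k ep. \<chi> i j. if j = c then y k ep $ i else M k ep $ i $ j)" unfolding bipoly_mat_def proof (intro allI)
 fix i j show "bipoly (%k ep. of_real ((\<chi> i j. if j = c then y k ep $ i else M k ep $ i $ j) $ i $ j))"
  using assms unfolding bipoly_mat_def by (cases "j = c") auto
qed

lemma bipoly_partial_sums: "bipoly g ==> bipoly (%k ep. SUM j<k. g j ep)" by (induction rule: bipoly.induct)
  (simp_all add: sum_distrib_right[symmetric] sum.distrib bipoly_monomial expoly_partial_sums bipoly_add)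

lemma bipoly_mat_partial_sums: fixes M :: "nat => real => real^'n^'m" assumes "bipoly_mat M"
 shows "bipoly_mat (%k ep. SUM j<k. M j ep)" using assms unfolding bipoly_mat_def by (simp add: bipoly_partial_sums)

lemma cesaro_bipoly_ratio: fixes s :: "nat => real" assumes B: "!!k. \<bar>s k\<bar> <= B" and N: "bipoly N" and D: "bipoly D"
  and lim: "!!k. (r k \<longlongrightarrow> s k) (at_right (0::real))" and nz: "!!k ep. 0 < ep ==> D k ep ~= 0"
  and eq: "!!k ep. 0 < ep ==> of_real (r k ep)*D k ep = N k ep" shows "cesaro s" proof -
 obtain n d D1 D2 where n: "ALL i. expoly (n i)" "ALL m>=D1. ALL k ep. N k ep = (SUM i<=m. n i k * of_real ep ^ i)"
  and d: "ALL i. expoly (d i)" "ALL m>=D2. ALL k ep. D k ep = (SUM i<=m. d i k * of_real ep ^ i)"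
  using bipoly_coeffs[OF N] bipoly_coeffs[OF D] by blast
 let ?m = "max D1 D2"
 have "cesaro (%k. complex_of_real (s k))" proof (rule cesaro_limit_of_ratios[OF _ n(1)[rule_format] d(1)[rule_format]])
  show "cmod (complex_of_real (s k)) <= B" for k using B by simp
  show "EX r. (r \<longlongrightarrow> complex_of_real (s k)) (at_right 0) & (ALL ep>0. (SUM i<=?m. d i k * of_real ep ^ i) ~= 0 &
    r ep * (SUM i<=?m. d i k * of_real ep ^ i) = (SUM i<=?m. n i k * of_real ep ^ i))" for k
   using tendsto_of_real[OF lim[of k], where 'a = complex] nz eq
   unfolding n(2)[rule_format, OF max.cobounded1, symmetric] d(2)[rule_format, OF max.cobounded2, symmetric]
   by (intro exI[of _ "%ep. complex_of_real (r k ep)"]) blast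
 qed from cesaro_linear[OF bounded_linear_Re this] show ?thesis by simp
qed

section \<open>Cesaro convergence of the filter covariance\<close>

context fixes A C W V P :: "real^'n^'n"
 assumes W: "psd W" and V: "psd V" and P: "psd P" and fp: "predict_cov A W (posterior_cov C V P) = P"
begin

text \<open>The filter is studied relative to a fixed point \<open>P\<close>. \<open>fixS\<close>
  and \<open>fixY\<close> are the stationary posterior and innovation covariances,
  \<open>fixF\<close> is the stationary error dynamics, and \<open>outB\<close> maps a posterior
  error to its effect on the next observation.\<close>

definition "fixS = posterior_cov C V P"
definition "fixY = innov_cov C V P"
definition "fixF = (mat 1-kalman_gain C V P**C)**A"
definition "outB = C**A"
definition "regY ep = fixY+ep *\<^sub>R mat 1"

text \<open>The deviation from a fixed point obeys a Riccati recursion without a constant term,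
  which is why a closed form exists; \<open>ep\<close> makes the inverse in it legitimate.\<close>

definition reg_step :: "real => real^'n^'n => real^'n^'n" where "reg_step ep D = fixF**(D-D**tp outB **
  matrix_inv (regY ep + outB**D**tp outB) ** outB**D)**tp fixF"

lemma fixY_psd: "psd fixY" unfolding fixY_def by (rule innov_cov_psd[OF P V])

lemma fixS_psd: "psd fixS" unfolding fixS_def by (rule posterior_cov_psd[OF P V])

lemma eps_pos_def: "psd M ==> 0 < ep ==> pos_def (M+ep *\<^sub>R mat 1)" for M :: "real^'n^'n"
 by (rule psd_add_pos_def) (simp_all add: pos_def_def transpose_scaleR mv_scaleR)

lemma regY_pos_def: "0 < ep ==> pos_def (regY ep)" unfolding regY_def by (rule eps_pos_def[OF fixY_psd])

lemma reg_innov: "regY ep + outB**D**tp outB = innov_cov C V (predict_cov A W (fixS+D))+ep *\<^sub>R mat 1" proof -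
 have "predict_cov A W (fixS+D) = P+A**D**tp A"
  using fp by (simp add: fixS_def predict_cov_def matrix_add_ldistrib mm_rplus add_ac)
 thus ?thesis by (simp add: regY_def fixY_def innov_cov_def outB_def matrix_add_ldistrib mm_rplus
    matrix_transpose_mul mm_assoc add_ac)
qed

lemma reg_innov_pos_def: assumes "psd (fixS+D)" "0 < ep" shows "pos_def (regY ep + outB**D**tp outB)"
 unfolding reg_innov by (intro eps_pos_def innov_cov_psd predict_cov_psd assms W V)

text \<open>Shifting the variable of the minimization by the stationary choice,
  \<open>u = h + v\<close>, separates the stationary cost from the cost of the deviation.\<close>

lemma fix_cost: assumes D: "psd (fixS+D)" shows "qf (posterior_cov C V (predict_cov A W (fixS+D))) a <= qf fixS a+qf fixY v +
   qf D (tp fixF *v a-tp outB *v v)" "EX v. qf (posterior_cov C V (predict_cov A W (fixS+D))) a = qf fixS a+qf fixY v +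
   qf D (tp fixF *v a-tp outB *v v)" proof - define h where "h = tp (kalman_gain C V P) *v a"
 define P' where "P' = predict_cov A W (fixS+D)"
 have P': "psd P'" unfolding P'_def by (rule predict_cov_psd[OF D W])
 have P'eq: "P' = P+A**D**tp A" using fp by (simp add: P'_def fixS_def predict_cov_def matrix_add_ldistrib mm_rplus add_ac)
 have arg: "tp A *v (a-tp C *v (h+v)) = tp fixF *v a-tp outB *v v" for v
  by (simp add: fixF_def outB_def h_def matrix_transpose_mul transpose_diff mv_minus
    mv_diff mv_add matrix_diff_ldistrib flip: mv_assoc)
 have cost: "qf P' (a-tp C *v (h+v))+qf V (h+v) = qf fixS a+qf fixY v + qf D (tp fixF *v a-tp outB *v v)" for v
  using posterior_completion[OF P V, of a C "h+v"] unfolding P'eq mv_plus inner_add_right quad_congruence' arg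
  by (simp add: fixS_def fixY_def h_def)
 show "qf (posterior_cov C V (predict_cov A W (fixS+D))) a <= qf fixS a+qf fixY v + qf D (tp fixF *v a-tp outB *v v)"
  unfolding cost[symmetric] P'_def[symmetric] by (rule posterior_cov_le[OF P' V])
 obtain u where u: "qf (posterior_cov C V P') a = qf P' (a-tp C *v u)+qf V u" using posterior_cov_attained[OF P' V] by blast
 show "EX v. qf (posterior_cov C V (predict_cov A W (fixS+D))) a = qf fixS a+qf fixY v + qf D (tp fixF *v a-tp outB *v v)"
  using u cost[of "u-h"] unfolding P'_def[symmetric] by (intro exI[of _ "u-h"]) simp
qed

lemma reg_step_cost: assumes sD: "tp D = D" and pos: "pos_def (regY ep + outB**D**tp outB)"
 shows "qf (reg_step ep D) a <= qf (regY ep) v + qf D (tp fixF *v a-tp outB *v v)" "EX v. qf (reg_step ep D) a = qf (regY ep) v +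
   qf D (tp fixF *v a-tp outB *v v)" proof - define M where "M = regY ep + outB**D**tp outB"
 define b where "b = tp fixF *v a"
 define v0 where "v0 = matrix_inv M *v (outB *v (D *v b))"
 have sM: "tp M = M" using pos by (simp add: M_def pos_def_def)
 have Mv0: "M *v v0 = outB *v (D *v b)" proof - have "M *v (matrix_inv M *v z) = z" for z
   by (simp add: mv_assoc pos_def_matrix_inv(1)[OF pos[folded M_def]])
  thus ?thesis by (simp add: v0_def)
 qed have inner_D: "(tp outB *v x) \<bullet> (D *v y) = x \<bullet> (outB *v (D *v y))" for x y by (rule inner_tr[symmetric])
 have step: "qf (reg_step ep D) a = qf D b-qf M v0" proof -
  have "qf (reg_step ep D) a = qf (D-D**tp outB**matrix_inv M ** outB**D) b"
   unfolding reg_step_def M_def[symmetric] quad_congruence' b_def ..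
  also have "... = qf D b-b \<bullet> (D *v (tp outB *v v0))" by (simp add: mv_minus inner_diff_right v0_def mv_assoc mm_assoc)
  also have "b \<bullet> (D *v (tp outB *v v0)) = qf M v0"
   using symmetric_inner[OF sD, of b "tp outB *v v0"] inner_D[of v0 b] by (simp add: Mv0)
  finally show ?thesis .
 qed have cost: "qf (regY ep) v+qf D (b-tp outB *v v) = qf (reg_step ep D) a+qf M (v-v0)" for v proof -
  have diff: "qf U (x-y) = qf U x-2*(y \<bullet> (U *v x))+qf U y"
   if "tp U = U" for U :: "real^'n^'n" and x y using symmetric_inner[OF that, of x y]
   by (simp add: mv_diff inner_diff_left inner_diff_right)
  have "qf M v = qf (regY ep) v+qf D (tp outB *v v)" by (simp add: M_def mv_plus inner_add_right quad_congruence')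
  moreover have "v0 \<bullet> (M *v v) = (tp outB *v v) \<bullet> (D *v b)"
   unfolding inner_D Mv0[symmetric] by (rule symmetric_inner[OF sM])
  ultimately show ?thesis unfolding step diff[OF sD] diff[OF sM] by simp
 qed show "qf (reg_step ep D) a <= qf (regY ep) v + qf D (tp fixF *v a-tp outB *v v)"
  using cost[of v] psd_quad[OF pd_psd[OF pos[folded M_def]], of "v-v0"] by (simp add: b_def)
 show "EX v. qf (reg_step ep D) a = qf (regY ep) v + qf D (tp fixF *v a-tp outB *v v)"
  using cost[of v0] by (intro exI[of _ v0]) (simp add: b_def)
qed

lemma reg_step_symmetric: assumes "tp D = D" "pos_def (regY ep + outB**D**tp outB)" shows "tp (reg_step ep D) = reg_step ep D"
proof - have "tp (matrix_inv (regY ep + outB**D**tp outB)) = matrix_inv (regY ep + outB**D**tp outB)"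
  using assms(2) pos_def_invertible by (intro symmetric_matrix_inv) (auto simp: pos_def_def)
 thus ?thesis by (simp add: reg_step_def transpose_diff matrix_transpose_mul assms(1) mm_assoc
    matrix_diff_ldistrib matrix_diff_rdistrib)
qed

primrec reg_iter :: "real^'n^'n => real => nat => real^'n^'n" where "reg_iter S0 ep 0 = S0-fixS"
| "reg_iter S0 ep (Suc k) = reg_step ep (reg_iter S0 ep k)"

primrec cov_iter :: "real^'n^'n => nat => real^'n^'n" where "cov_iter S0 0 = S0"
| "cov_iter S0 (Suc k) = posterior_cov C V (predict_cov A W (cov_iter S0 k))"

lemma cov_iter_psd: "psd S0 ==> psd (cov_iter S0 k)" by (induction k) (auto intro: posterior_cov_psd predict_cov_psd W V)

text \<open>Regularization only adds cost, so the perturbed covariance dominates the true one. This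
  also keeps it semidefinite, and hence the next inverse meaningful.\<close>

lemma reg_iter_ge: assumes S0: "psd S0" and e: "0 < ep" shows "psd (fixS+reg_iter S0 ep k) &
  (ALL x. qf (cov_iter S0 k) x <= qf (fixS+reg_iter S0 ep k) x)" proof (induction k) case (Suc k)
 define D where "D = reg_iter S0 ep k"
 have D: "psd (fixS+D)" "!!x. qf (cov_iter S0 k) x <= qf (fixS+D) x" using Suc by (simp_all add: D_def)
 have sD: "tp D = D" using psd_sym[OF D(1)] psd_sym[OF fixS_psd] by (simp add: transpose_add)
 note pos = reg_innov_pos_def[OF D(1) e]
 have ge: "qf (cov_iter S0 (Suc k)) x <= qf (fixS+reg_step ep D) x" for x proof -
  obtain v where v: "qf (reg_step ep D) x = qf (regY ep) v + qf D (tp fixF *v x-tp outB *v v)"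
   using reg_step_cost(2)[OF sD pos] by blast
  have "qf fixY v <= qf (regY ep) v" using e by (simp add: regY_def mv_plus inner_add_right mv_scaleR)
  moreover have "qf (cov_iter S0 (Suc k)) x <= qf (posterior_cov C V (predict_cov A W (fixS+D))) x"
   unfolding cov_iter.simps by (intro posterior_cov_mono predict_cov_psd predict_cov_mono cov_iter_psd D S0 W V)
  ultimately show ?thesis using fix_cost(1)[OF D(1), of x v] v by (simp add: mv_plus inner_add_right)
 qed have "0 <= qf (fixS+reg_step ep D) x" for x by (rule order_trans[OF psd_quad[OF cov_iter_psd[OF S0]] ge])
 hence "psd (fixS+reg_step ep D)" by (simp add: psd_def transpose_add reg_step_symmetric[OF sD pos] psd_sym[OF fixS_psd])
 thus ?case using ge by (simp add: D_def)
qed (use S0 in simp)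

text \<open>A sandwich: the lower bound is the domination, and the upper bound inserts the
  minimizing \<open>v\<close> of the unperturbed step, which costs only \<open>ep (v . v)\<close>
  more.\<close>

lemma reg_iter_tendsto: assumes S0: "psd S0"
 shows "((%ep. qf (fixS+reg_iter S0 ep k) x) \<longlongrightarrow> x \<bullet> (cov_iter S0 k *v x)) (at_right 0)"
proof (induction k arbitrary: x) case (Suc k) define S where "S = cov_iter S0 k"
 have S: "psd (fixS+(S-fixS))" using cov_iter_psd[OF S0] by (simp add: S_def)
 obtain v where v: "qf (cov_iter S0 (Suc k)) x = qf fixS x+qf fixY v + qf (S-fixS) (tp fixF *v x-tp outB *v v)"
  using fix_cost(2)[OF S, of x] by (auto simp: S_def)
 define y where "y = tp fixF *v x-tp outB *v v"
 show ?case proof (rule tendsto_sandwich[OF _ _ tendsto_const])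
  show "\<forall>\<^sub>F ep in at_right 0. qf (cov_iter S0 (Suc k)) x <= qf (fixS+reg_iter S0 ep (Suc k)) x"
   using eventually_at_right_less[of "0::real"] by eventually_elim (use reg_iter_ge[OF S0] in blast)
  show "\<forall>\<^sub>F ep in at_right 0. qf (fixS+reg_iter S0 ep (Suc k)) x <=
    qf fixS x+(qf fixY v+ep * (v \<bullet> v))+(qf (fixS+reg_iter S0 ep k) y-qf fixS y)"
   using eventually_at_right_less[of "0::real"] proof eventually_elim
   case (elim ep) define D where "D = reg_iter S0 ep k"
   have D: "psd (fixS+D)" using reg_iter_ge[OF S0 elim] by (simp add: D_def)
   have sD: "tp D = D" using psd_sym[OF D] psd_sym[OF fixS_psd] by (simp add: transpose_add)
   have "qf (reg_step ep D) x <= qf (regY ep) v+qf D y"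
    unfolding y_def by (rule reg_step_cost(1)[OF sD reg_innov_pos_def[OF D elim]])
   thus ?case by (simp add: D_def[symmetric] mv_plus inner_add_right regY_def mv_scaleR)
  qed have "((%ep. qf fixS x+(qf fixY v+ep * (v \<bullet> v))+(qf (fixS+reg_iter S0 ep k) y-qf fixS y))
    \<longlongrightarrow> x \<bullet> (fixS *v x)+(qf fixY v+0*(v \<bullet> v))+(qf (cov_iter S0 k) y-qf fixS y)) (at_right 0)"
   by (intro tendsto_add tendsto_diff tendsto_mult tendsto_const Suc tendsto_ident_at)
  moreover have "qf fixS x+(qf fixY v+0*(v \<bullet> v))+(qf (cov_iter S0 k) y-qf fixS y) = qf (cov_iter S0 (Suc k)) x"
   unfolding v y_def[symmetric] S_def by (simp add: mv_minus inner_diff_right)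
  ultimately show "((%ep. qf fixS x+(qf fixY v+ep * (v \<bullet> v))+(qf (fixS+reg_iter S0 ep k) y-qf fixS y))
    \<longlongrightarrow> x \<bullet> (cov_iter S0 (Suc k) *v x)) (at_right 0)" by simp
 qed qed simp

lemma reg_iter_entry_tendsto: assumes S0: "psd S0"
 shows "((%ep. (fixS+reg_iter S0 ep k) $ i $ j) \<longlongrightarrow> cov_iter S0 k $ i $ j) (at_right 0)" proof -
 have pol: "M $ i $ j = (qf M (axis i 1+axis j 1) -qf M (axis i 1)-qf M (axis j 1))/2" if "tp M = M" for M :: "real^'n^'n"
  using quad_add[OF that, of "axis i 1" "axis j 1"] by (simp add: axis_inner_matrix)
 define q where "q M = (qf M (axis i 1+axis j 1) -qf M (axis i 1)-qf M (axis j 1))/2" for M :: "real^'n^'n"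
 have "((%ep. q (fixS+reg_iter S0 ep k)) \<longlongrightarrow> q (cov_iter S0 k)) (at_right 0)"
  unfolding q_def by (intro tendsto_divide tendsto_diff reg_iter_tendsto[OF S0] tendsto_const) simp
 moreover have "\<forall>\<^sub>F ep in at_right 0. q (fixS+reg_iter S0 ep k) = (fixS+reg_iter S0 ep k) $ i $ j"
  using eventually_at_right_less[of "0::real"] proof eventually_elim
  case (elim ep) have "psd (fixS+reg_iter S0 ep k)" using reg_iter_ge[OF S0 elim] by blast
  from pol[OF psd_sym[OF this]] show ?case unfolding q_def by (rule sym)
 qed moreover have "q (cov_iter S0 k) = cov_iter S0 k $ i $ j" using pol[OF psd_sym[OF cov_iter_psd[OF S0]]] by (simp add: q_def)
 ultimately show ?thesis by (simp only: lim_cong)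
qed

definition "infoO ep = tp outB**matrix_inv (regY ep) ** outB"
definition "infoX S0 ep k = mat 1+(SUM j<k. tp (matpow fixF j)**infoO ep ** matpow fixF j)**(S0-fixS)"

text \<open>Closed form of the regularised iteration, in the style of the information filter.\<close>

lemma reg_iter_closed: assumes S0: "psd S0" and e: "0 < ep"
 shows "invertible (infoX S0 ep k) & (EX Y. Y**infoX S0 ep k = matpow fixF k**(S0-fixS) &
   reg_iter S0 ep k = Y**tp (matpow fixF k))" proof (induction k) case 0
 have "invertible (mat 1 :: real^'n^'n)" by (simp add: invertible_def)
 thus ?case by (auto simp: infoX_def intro: exI[of _ "S0-fixS"])
next case (Suc k) define X X' D G N where "X = infoX S0 ep k" and "X' = infoX S0 ep (Suc k)" and "D = reg_iter S0 ep k"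
  and "G = matpow fixF k" and "N = matrix_inv (regY ep)"
 obtain Y where X: "invertible X" and Y: "Y**X = G**(S0-fixS)" "D = Y**tp G" using Suc by (auto simp: X_def D_def G_def)
 define M where "M = regY ep + outB**D**tp outB"
 have "psd (fixS+D)" using reg_iter_ge[OF S0 e] by (simp add: D_def)
 hence M: "pos_def M" unfolding M_def by (rule reg_innov_pos_def[OF _ e])
 have X': "X' = X+tp G**infoO ep ** G**(S0-fixS)" by (simp add: X'_def X_def infoX_def G_def mm_rplus add_ac)
 have X'2: "X' = (mat 1+tp G**infoO ep ** Y)**X" unfolding X' mm_rplus matrix_mul_lid mm_assoc[symmetric] Y(1) ..
 \<comment> \<open>\<open>Z\<close> is the measurement-updated deviation with its right factor
   \<open>tp G\<close> removed; \<open>key\<close> is the push-through identity that yields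
   \<open>Z (I + G' O Y) = Y\<close>, with \<open>O\<close> standing for
   \<open>infoO ep\<close>.\<close>
 define Z where "Z = Y-D**tp outB**matrix_inv M ** outB**Y"
 have key: "matrix_inv M**(mat 1 + outB**D**tp outB**N) = N" proof - have "mat 1 + outB**D**tp outB**N = M**N"
   using pos_def_matrix_inv(1)[OF regY_pos_def[OF e]] by (simp add: M_def mm_rplus N_def)
  thus ?thesis using pos_def_matrix_inv(2)[OF M] by (simp add: mm_assoc)
 qed have "Z**(mat 1+tp G**infoO ep ** Y) = Y" proof - have 1: "Y**(tp G**infoO ep ** Y) = D**tp outB**N ** outB**Y"
   by (simp add: infoO_def N_def[symmetric] Y(2) mm_assoc)
  have 2: "D**tp outB**matrix_inv M ** outB**(Y+D**tp outB**N ** outB**Y) =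
    D**tp outB**(matrix_inv M**(mat 1 + outB**D**tp outB**N)) ** outB**Y" by (simp add: matrix_add_ldistrib mm_rplus mm_assoc)
  have "Z**(mat 1+tp G**infoO ep ** Y) = (Y+Y**(tp G**infoO ep ** Y)) -
    D**tp outB**matrix_inv M ** outB**(Y+Y**(tp G**infoO ep ** Y))"
   by (simp add: Z_def matrix_diff_rdistrib matrix_add_ldistrib mm_assoc)
  also have "... = Y" unfolding 1 2 key by simp
  finally show ?thesis .
 qed hence ZX': "Z**X' = G**(S0-fixS)" unfolding X'2 by (simp add: mm_assoc Y(1))
 \<comment> \<open>By \<open>ZX'\<close> a kernel vector of \<open>X'\<close> is annihilated by
   \<open>G (S0 - fixS)\<close>, so the term added to \<open>X\<close> does not act on it and it
   lies in the kernel of \<open>X\<close>.\<close>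
 have "x = 0" if "X' *v x = 0" for x proof -
  have "(G**(S0-fixS)) *v x = 0" unfolding ZX'[symmetric] by (simp add: that flip: mv_assoc)
  hence "X *v x = 0" using that unfolding X' mv_plus mm_assoc[symmetric] by (simp flip: mv_assoc)
  thus ?thesis using X by (metis invertible_left_inverse matrix_left_invertible_ker)
 qed hence inv: "invertible X'" by (simp add: invertible_left_inverse matrix_left_invertible_ker)
 have "(fixF**Z)**X' = matpow fixF (Suc k)**(S0-fixS)" by (simp add: ZX' G_def flip: mm_assoc)
 moreover have "reg_iter S0 ep (Suc k) = (fixF**Z)**tp (matpow fixF (Suc k))" proof -
  have "D-D**tp outB**matrix_inv M ** outB**D = Z**tp G" by (simp add: Z_def matrix_diff_rdistrib Y(2) mm_assoc)
  thus ?thesis by (simp add: reg_step_def D_def[symmetric] M_def[symmetric] G_def[symmetric] matrix_transpose_mul mm_assoc)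
 qed ultimately show ?case using inv unfolding X'_def by blast
qed

lemma invertible_scaleR_nz: "invertible Y ==> c ~= 0 ==> invertible (c *\<^sub>R Y)" for Y :: "real^'n^'n"
 unfolding invertible_right_inverse
 by (metis divide_self_if matrix_mult_scaleR(1) matrix_mult_scaleR(2) nonzero_divide_eq_eq scaleR_one scaleR_scaleR)

text \<open>The adjugate of \<open>regY ep\<close> in the shape of Cramer's rule. Unlike the inverse
  it is polynomial in \<open>ep\<close>, so that \<open>polyX\<close>, the multiple of
  \<open>infoX\<close> by the determinant, is free of denominators.\<close>

definition "cofY ep = (\<chi> a b. det (\<chi> i j. if j = a then axis b 1 $ i else regY ep $ i $ j))"
definition "polyX S0 k ep = det (regY ep) *\<^sub>R mat 1 +
 (SUM j<k. tp (matpow fixF j)**(tp outB**cofY ep ** outB)**matpow fixF j)**(S0-fixS)"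

lemma cofY_inv: assumes "0 < ep" shows "cofY ep = det (regY ep) *\<^sub>R matrix_inv (regY ep)" proof -
 have "cofY ep $ a $ b = det (regY ep)*matrix_inv (regY ep) $ a $ b" for a b proof -
  define x where "x = matrix_inv (regY ep) *v axis b 1"
  have Yx: "regY ep *v x = axis b 1" by (simp add: x_def mv_assoc pos_def_matrix_inv(1)[OF regY_pos_def[OF assms]])
  have "x $ a = matrix_inv (regY ep) $ a $ b" by (simp add: x_def matrix_vector_mult_basis column_def)
  thus ?thesis using cramer_lemma[of a "regY ep" x, unfolded Yx] by (simp add: cofY_def mult.commute)
 qed thus ?thesis by (simp add: vec_eq_iff)
qed

lemma polyX_infoX: assumes "0 < ep" shows "polyX S0 k ep = det (regY ep) *\<^sub>R infoX S0 ep k"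
 by (simp add: polyX_def infoX_def infoO_def cofY_inv[OF assms] matrix_mult_scaleR scaleR_right_distrib
   flip: scaleR_sum_right)

lemma det_regY_nz: "0 < ep ==> det (regY ep) ~= 0" using pos_def_invertible[OF regY_pos_def] invertible_det_nz by blast

lemma bipoly_regY: "bipoly_mat (%k ep. regY ep)"
 unfolding regY_def by (intro bipoly_mat_add bipoly_mat_const bipoly_mat_scale bipoly_eps)

lemma bipoly_polyX: "bipoly_mat (%k ep. polyX S0 k ep)" proof -
 have "bipoly (%k ep. of_real (cofY ep $ a $ b))" for a b unfolding cofY_def vec_lambda_beta
  by (intro bipoly_det bipoly_mat_replace_column bipoly_regY bipoly_const)
 hence "bipoly_mat (%k ep. cofY ep)" unfolding bipoly_mat_def by blast
 thus ?thesis unfolding polyX_def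
  by (intro bipoly_mat_add bipoly_mat_scale bipoly_det bipoly_regY bipoly_mat_const bipoly_mat_mult
    bipoly_mat_partial_sums bipoly_mat_transpose bipoly_mat_matpow)
qed

text \<open>By the closed form, column \<open>j\<close> of the deviation is \<open>G k\<close>
  applied to the solution of a linear system with matrix \<open>polyX\<close>. Cramer's rule makes
  each entry a ratio of polynomials in \<open>ep\<close> with exponential-polynomial coefficients,
  to which \<open>cesaro_bipoly_ratio\<close> applies.\<close>

lemma cov_iter_cesaro: assumes S0: "psd S0" and bdd: "!!x. EX c. ALL k. qf (cov_iter S0 k) x <= c"
 shows "cesaro (%k. cov_iter S0 k $ i $ j)" proof -
 obtain ci where ci: "!!k. qf (cov_iter S0 k) (axis i 1) <= ci" using bdd by blast
 obtain cj where cj: "!!k. qf (cov_iter S0 k) (axis j 1) <= cj" using bdd by blast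
 define y where "y k ep = det (regY ep) *\<^sub>R (tp (matpow fixF k) *v axis j 1)" for k ep
 define R where "R a k ep = (\<chi> i j. if j = a then y k ep $ i else polyX S0 k ep $ i $ j)" for a k ep
 define G where "G k = matpow fixF k**(S0-fixS)" for k
 define D where "D k ep = complex_of_real (det (polyX S0 k ep))" for k ep
 define N where "N k ep = complex_of_real (fixS $ i $ j)*D k ep +
   (SUM a:UNIV. of_real (G k $ i $ a) * of_real (det (R a k ep)))" for k ep
 have bD: "bipoly D" unfolding D_def by (rule bipoly_det[OF bipoly_polyX])
 have bpy: "bipoly (%k ep. of_real (y k ep $ b))" for b proof -
  have "y k ep $ b = det (regY ep)*tp (matpow fixF k) $ b $ j" for k ep by (simp add: y_def matrix_vector_mult_basis column_def)
  moreover have "bipoly (%k ep. of_real (tp (matpow fixF k) $ b $ j))"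
   using bipoly_mat_transpose[OF bipoly_mat_matpow[of fixF]] unfolding bipoly_mat_def by blast
  ultimately show ?thesis using bipoly_mult[OF bipoly_det[OF bipoly_regY]] by simp
 qed have bR: "bipoly (%k ep. of_real (det (R a k ep)))" for a
  unfolding R_def by (intro bipoly_det bipoly_mat_replace_column bipoly_polyX bpy)
 have bG: "bipoly (%k ep. of_real (G k $ i $ a))" for a
  using bipoly_mat_mult[OF bipoly_mat_matpow[of fixF] bipoly_mat_const[of "S0-fixS"]] unfolding bipoly_mat_def G_def by blast
 have bN: "bipoly N" unfolding N_def by (intro bipoly_add bipoly_mult bipoly_const bD bipoly_sum bR bG)
 show ?thesis proof (rule cesaro_bipoly_ratio[OF _ bN bD])
  show "\<bar>cov_iter S0 k $ i $ j\<bar> <= max ci cj" for k proof - define M where "M = cov_iter S0 k"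
   have M: "psd M" unfolding M_def by (rule cov_iter_psd[OF S0])
   have "(M $ i $ j)\<^sup>2 <= M $ i $ i*M $ j $ j"
    using psd_cauchy_schwarz[OF M, of "axis i 1" "axis j 1"] by (simp add: axis_inner_matrix)
   also have "... <= max ci cj*max ci cj" proof (rule mult_mono)
    show "M $ i $ i <= max ci cj" "M $ j $ j <= max ci cj" using ci[of k] cj[of k] by (auto simp: axis_inner_matrix M_def)
    show "0 <= M $ j $ j" using psd_quad[OF M, of "axis j 1"] by (simp add: axis_inner_matrix)
    show "0 <= max ci cj" using psd_quad[OF M, of "axis j 1"] cj[of k] by (simp add: M_def)
   qed finally have "(M $ i $ j)\<^sup>2 <= (max ci cj)\<^sup>2" by (simp add: pow2)
   moreover have "0 <= max ci cj" using psd_quad[OF M, of "axis j 1"] cj[of k] by (simp add: M_def)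
   ultimately show ?thesis unfolding M_def[symmetric] using abs_le_square_iff[of "M $ i $ j" "max ci cj"] by simp
  qed show "((%ep. (fixS+reg_iter S0 ep k) $ i $ j) \<longlongrightarrow> cov_iter S0 k $ i $ j) (at_right 0)" for k
   by (rule reg_iter_entry_tendsto[OF S0])
  fix k :: nat and ep :: real assume e: "0 < ep"
  obtain Y where inv: "invertible (infoX S0 ep k)" and Y: "Y**infoX S0 ep k = G k" "reg_iter S0 ep k = Y**tp (matpow fixF k)"
   using reg_iter_closed[OF S0 e, of k] unfolding G_def by blast
  have "invertible (polyX S0 k ep)" unfolding polyX_infoX[OF e] using inv det_regY_nz[OF e] by (rule invertible_scaleR_nz)
  thus "D k ep ~= 0" by (simp add: D_def invertible_det_nz)
  define z where "z = tp (matpow fixF k) *v axis j 1"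
  define x where "x = matrix_inv (infoX S0 ep k) *v z"
  have Xx: "infoX S0 ep k *v x = z" by (simp add: x_def mv_assoc matrix_inv_right[OF inv])
  hence Xy: "polyX S0 k ep *v x = y k ep" by (simp add: polyX_infoX[OF e] y_def z_def mv_scaleR)
  have det: "det (R a k ep) = x $ a*det (polyX S0 k ep)" for a
   using cramer_lemma[of a "polyX S0 k ep" x, unfolded Xy] by (simp add: R_def)
  have "reg_iter S0 ep k $ i $ j = (reg_iter S0 ep k *v axis j 1) $ i" by (simp add: matrix_vector_mult_basis column_def)
  also have "reg_iter S0 ep k *v axis j 1 = G k *v x" unfolding Y(2) Y(1)[symmetric] by (simp add: Xx z_def flip: mv_assoc)
  finally have "reg_iter S0 ep k $ i $ j*det (polyX S0 k ep) = (SUM a:UNIV. G k $ i $ a*det (R a k ep))"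
   by (simp add: mv_def det sum_distrib_right mult.assoc)
  thus "of_real ((fixS+reg_iter S0 ep k) $ i $ j)*D k ep = N k ep"
   by (simp add: N_def D_def distrib_right flip: of_real_mult of_real_sum)
 qed qed

end

theorem filter_cov_cesaro: fixes A C W V P0 :: "real^'n^'n" assumes "psd W" "psd V" "psd P0" "detectable A C"
 shows "cesaro (%k. filter_cov A C W V P0 k $ i $ j)" "EX c. ALL k. qf (filter_cov A C W V P0 k) x <= c" proof -
 obtain E where E: "schur_stable (A+E**C)" using assms(4) by (auto simp: detectable_def)
 note ctx = assms(1,2) E
 show bdd: "EX c. ALL k. qf (filter_cov A C W V P0 k) x <= c" for x by (rule filter_cov_bounded[OF ctx assms(3)])
 obtain P where P: "psd P" "predict_cov A W (posterior_cov C V P) = P" using filter_fixed_point[OF ctx] by blast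
 define S0 where "S0 = posterior_cov C V P0"
 have eq: "cov_iter A C W V S0 k = filter_cov A C W V P0 k" for k
  by (induction k) (simp_all add: S0_def cov_iter.simps[OF assms(1,2) P])
 have "psd S0" unfolding S0_def by (rule posterior_cov_psd[OF assms(3,2)])
 from cov_iter_cesaro[OF assms(1,2) P this] bdd show "cesaro (%k. filter_cov A C W V P0 k $ i $ j)" unfolding eq by blast
qed

section \<open>Square-integrable functions and centring over a field\<close>

context prob_space begin

definition L2 :: "('a => 'b::euclidean_space) => bool" where
 "L2 f \<longleftrightarrow> f : bm M & integrable M (%s. f s \<bullet> f s)"

text \<open>This is \<open>E[f | F] = 0\<close> without a choice of version, when \<open>F\<close>
  is a subalgebra. It passes to smaller fields and through linear maps directly, for vector-valued
  functions as well.\<close>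

definition centred :: "'a measure => ('a => 'b::euclidean_space) => bool" where
 "centred F f \<longleftrightarrow> integrable M f & (ALL B:sets F. EV M (%s. indicator B s *\<^sub>R f s) = 0)"

lemma L2_measurable: "L2 f ==> f : bm M" by (simp add: L2_def)

lemma L2_bound: assumes "g : bm M" "integrable M h" "AE s in M. g s \<bullet> g s <= h s" shows "L2 g" unfolding L2_def proof
 show "integrable M (%s. g s \<bullet> g s)" by (rule Bochner_Integration.integrable_bound[OF assms(2)])
   (use assms in "auto elim!: eventually_mono")
qed (use assms in simp)

lemma L2_integrable: assumes "L2 f" shows "integrable M f"
proof (rule Bochner_Integration.integrable_bound[of M "%s. 1+f s \<bullet> f s"])
 show "integrable M (%s. 1+f s \<bullet> f s)" "f : bm M" using assms by (auto simp: L2_def)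
 have "norm x <= 1+x \<bullet> x" for x :: 'b proof - have "norm x <= 1+norm x*norm x"
   using sum_squares_bound[of "norm x" 1] norm_ge_zero[of x] unfolding pow2 by linarith
  thus ?thesis by (simp add: dot_square_norm pow2)
 qed thus "AE s in M. norm (f s) <= norm (1+f s \<bullet> f s)" by (simp add: order.trans[OF _ abs_ge_self])
qed

lemma inner_sum_bound: "\<bar>x \<bullet> y\<bar> <= x \<bullet> x+y \<bullet> (y::'b::euclidean_space)" proof -
 have "\<bar>x \<bullet> y\<bar> <= norm x*norm y" by (rule Cauchy_Schwarz_ineq2)
 also have "... <= norm x^2+norm y^2" using sum_squares_bound[of "norm x" "norm y"] zero_le_power2[of "norm x"]
   zero_le_power2[of "norm y"] mult_nonneg_nonneg[OF norm_ge_zero[of x] norm_ge_zero[of y]] by linarith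
 finally show ?thesis by (simp add: dot_square_norm)
qed

lemma L2_inner: assumes "L2 f" "L2 g" shows "integrable M (%s. f s \<bullet> g s)"
proof (rule Bochner_Integration.integrable_bound[of M "%s. f s \<bullet> f s+g s \<bullet> g s"])
 show "integrable M (%s. f s \<bullet> f s+g s \<bullet> g s)" "(%s. f s \<bullet> g s) : bm M" using assms by (auto simp: L2_def)
qed (use inner_sum_bound in "auto intro!: AE_I2 order.trans[OF _ abs_ge_self]")

lemma L2_add: assumes "L2 f" "L2 g" shows "L2 (%s. f s+g s)"
proof (rule L2_bound[of _ "%s. 2*(f s \<bullet> f s)+2*(g s \<bullet> g s)"])
 have "(x+y) \<bullet> (x+y) <= 2*(x \<bullet> x)+2*(y \<bullet> y)" for x y :: 'b
  using inner_ge_zero[of "x-y"] by (simp add: inner_add inner_diff inner_commute)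
 thus "AE s in M. (f s+g s) \<bullet> (f s+g s) <= 2*(f s \<bullet> f s)+2*(g s \<bullet> g s)" by simp
qed (use assms in "auto simp: L2_def")

lemma L2_linear: fixes f :: "'a => 'b::euclidean_space" and h :: "'b => 'c::euclidean_space"
 assumes "L2 f" "bounded_linear h" shows "L2 (%s. h (f s))" proof -
 obtain K where K: "!!x. norm (h x) <= norm x*K" using assms(2) bounded_linear.bounded by blast
 show ?thesis proof (rule L2_bound[of _ "%s. K^2*(f s \<bullet> f s)"])
  show "(%s. h (f s)) : bm M" by (rule measurable_compose[OF L2_measurable[OF assms(1)] borel_measurable_continuous_onI])
    (intro bounded_linear.continuous_on[OF assms(2)] continuous_intros)
  have "h x \<bullet> h x <= K^2*(x \<bullet> x)" for x
   using power_mono[OF K[of x], of 2] by (simp add: dot_square_norm power_mult_distrib mult.commute)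
  thus "AE s in M. h (f s) \<bullet> h (f s) <= K^2*(f s \<bullet> f s)" by simp
 qed (use assms in "auto simp: L2_def")
qed

lemma L2_const: "L2 (%_. c)" by (simp add: L2_def)

lemma L2_scaleR: "L2 f ==> L2 (%s. c *\<^sub>R f s)" by (rule L2_linear[OF _ bounded_linear_scaleR_right])

lemma L2_uminus: "L2 f ==> L2 (%s.-f s)" using L2_scaleR[of f "-1"] by simp

lemma L2_diff: "L2 f ==> L2 g ==> L2 (%s. f s-g s)" using L2_add[of f "%s.-g s"] L2_uminus[of g] by simp

lemma L2_matrix: "L2 f ==> L2 (%s. (W::real^'n^'m) *v f s)" by (rule L2_linear[OF _ matrix_vector_mul_bounded_linear])

lemma L2_comp: "L2 f ==> L2 (%s. f s \<bullet> c)" by (rule L2_linear[OF _ bounded_linear_inner_left])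

lemma L2_nth: "L2 f ==> L2 (%s. f s $ i)" by (rule L2_linear[OF _ bounded_linear_vec_nth])

lemma L2_sum: "(!!i. i : I ==> L2 (f i)) ==> L2 (%s. SUM i:I. f i s)"
 by (induction I rule: infinite_finite_induct) (auto intro: L2_const L2_add)

lemma L2_bounded_scale: assumes "L2 f" "c : bm M" "AE s in M. \<bar>c s\<bar> <= (1::real)" shows "L2 (%s. c s *\<^sub>R f s)"
proof (rule L2_bound[of _ "%s. f s \<bullet> f s"])
 show "AE s in M. (c s *\<^sub>R f s) \<bullet> (c s *\<^sub>R f s) <= f s \<bullet> f s" using assms(3) proof eventually_elim
  case (elim s) hence "c s*c s <= 1" by (metis abs_square_le_1 pow2)
  thus ?case using mult_right_mono[of "c s*c s" 1 "f s \<bullet> f s"] by simp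
 qed qed (use assms in "auto simp: L2_def")

lemma L2_cong_AE: assumes "L2 f" "g : bm M" "AE s in M. g s = f s" shows "L2 g"
 by (rule L2_bound[of _ "%s. f s \<bullet> f s"]) (use assms in "auto simp: L2_def")

lemma L2_quad: "L2 f ==> L2 g ==> integrable M (%s. f s \<bullet> ((W::real^'n^'m) *v g s))" by (intro L2_inner L2_matrix)

lemma L2_Basis: fixes f :: "'a => 'b::euclidean_space" assumes "!!b. b : Basis ==> L2 (%s. f s \<bullet> b)" shows "L2 f" proof -
 have "L2 (%s. SUM b:Basis. (f s \<bullet> b) *\<^sub>R b)" by (intro L2_sum L2_linear[OF assms bounded_linear_scaleR_left])
 thus ?thesis by (simp add: euclidean_representation)
qed

lemma L2_vec: "(!!i. L2 (%s. f s $ i)) ==> L2 (f :: 'a => real^'n)" by (rule L2_Basis) (auto simp: Basis_vec_def inner_axis)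

lemma centred_integrable: "centred F f ==> integrable M f" by (simp add: centred_def)

lemma centred_ind: fixes f :: "'a => 'b::{banach, second_countable_topology}"
 shows "subalgebra M F ==> integrable M f ==> B : sets F ==> integrable M (%s. indicator B s *\<^sub>R f s)"
 unfolding subalgebra_def by (erule conjE, drule (1) subsetD, rule integrable_mult_indicator)

lemma centred_add: assumes "subalgebra M F" "centred F f" "centred F g" shows "centred F (%s. f s+g s)"
 using assms centred_ind[OF assms(1), of f] centred_ind[OF assms(1), of g] by (auto simp: centred_def scaleR_add_right)

lemma centred_linear: assumes "subalgebra M F" "centred F f" "bounded_linear h" shows "centred F (%s. h (f s))"
 unfolding centred_def proof (intro conjI ballI)
 interpret h: bounded_linear h by fact
 show "integrable M (%s. h (f s))" using assms integrable_bounded_linear by (auto simp: centred_def)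
 fix B assume B: "B : sets F"
 have "EV M (%s. indicator B s *\<^sub>R h (f s)) = EV M (%s. h (indicator B s *\<^sub>R f s))" by (simp add: h.scaleR)
 also have "... = h (EV M (%s. indicator B s *\<^sub>R f s))"
  using assms centred_ind[OF assms(1) _ B] integral_bounded_linear by (auto simp: centred_def)
 finally show "EV M (%s. indicator B s *\<^sub>R h (f s)) = 0" using assms B by (simp add: centred_def h.zero)
qed

lemma centred_matrix: "subalgebra M F ==> centred F f ==> centred F (%s. (W::real^'n^'m) *v f s)"
 by (rule centred_linear[OF _ _ matrix_vector_mul_bounded_linear])

lemma centred_uminus: "subalgebra M F ==> centred F f ==> centred F (%s.-f s)"
 by (rule centred_linear[OF _ _ bounded_linear_minus[OF bounded_linear_ident]])

lemma centred_diff: "subalgebra M F ==> centred F f ==> centred F g ==> centred F (%s. f s-g s)"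
 using centred_add[of F f "%s.-g s"] centred_uminus[of F g] by simp

lemma centred_cong_AE: assumes "subalgebra M F" "centred F f" "g : bm M" "AE s in M. g s = f s"
 shows "centred F g" unfolding centred_def proof (intro conjI ballI)
 show "integrable M g" using assms by (subst integrable_cong_AE[of g M f]) (auto simp: centred_def)
 fix B assume B: "B : sets F"
 have [measurable]: "B : sets M" using assms(1) B by (auto simp: subalgebra_def)
 have "EV M (%s. indicator B s *\<^sub>R g s) = EV M (%s. indicator B s *\<^sub>R f s)"
  using assms by (intro integral_cong_AE) (auto simp: centred_def)
 thus "EV M (%s. indicator B s *\<^sub>R g s) = 0" using assms B by (simp add: centred_def)
qed

lemma centred_mono: "centred G f ==> sets F \<subseteq> sets G ==> centred F f" by (auto simp: centred_def)

lemma centred_Basis: assumes "subalgebra M F" "!!b. b : Basis ==> centred F (%s. f s \<bullet> b)"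
 shows "centred F (f :: 'a => 'b::euclidean_space)" proof -
 have "centred F (%s. SUM b:S. (f s \<bullet> b) *\<^sub>R b)" if "S \<subseteq> Basis" for S
  using finite_subset[OF that finite_Basis] that proof (induction S rule: finite_induct) case (insert b S)
  hence "centred F (%s. (f s \<bullet> b) *\<^sub>R b)" "centred F (%s. SUM b:S. (f s \<bullet> b) *\<^sub>R b)"
   using centred_linear[OF assms(1) assms(2)[of b] bounded_linear_scaleR_left] by auto
  thus ?case using centred_add[OF assms(1), of "%s. (f s \<bullet> b) *\<^sub>R b"] insert.hyps by simp
 qed (simp add: centred_def)
 from this[of Basis] show ?thesis by (simp add: euclidean_representation)
qed

lemma centred_nth: assumes "subalgebra M F" "!!i. centred F (%s. f s $ i)" shows "centred F (f :: 'a => real^'n)"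
 by (rule centred_Basis[OF assms(1)]) (use assms(2) in "auto simp: Basis_vec_def inner_axis")

lemma centred_expectation: assumes "subalgebra M F" "centred F f" shows "EV M (%s. f s) = 0" proof -
 have "space M : sets F" using assms(1) sets.top[of F] by (simp add: subalgebra_def)
 hence "EV M (%s. indicator (space M) s *\<^sub>R f s) = 0" using assms by (simp add: centred_def)
 moreover have "EV M (%s. indicator (space M) s *\<^sub>R f s) = EV M (%s. f s)" by (rule Bochner_Integration.integral_cong) auto
 ultimately show ?thesis by simp
qed

lemma subalgebra_sigma_finite: "subalgebra M F ==> sigma_finite_subalgebra M F"
 by (rule finite_measure_subalgebra_is_sigma_finite)
  (simp add: finite_measure_subalgebra_def finite_measure_subalgebra_axioms_def finite_measure_axioms)

lemma centred_real_cond_exp: fixes f :: "'a => real"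
 assumes "subalgebra M F" "centred F f" shows "AE s in M. real_cond_exp M F f s = 0" proof -
 note S = subalgebra_sigma_finite[OF assms(1)]
 show ?thesis by (rule sigma_finite_subalgebra.real_cond_exp_charact[OF S])
   (use assms in "auto simp: centred_def set_lebesgue_integral_def")
qed

lemma centred_mult: fixes f g :: "'a => real" assumes F: "subalgebra M F" and f: "centred F f" and g: "g : bm F"
  and "integrable M (%s. g s*f s)" shows "EV M (%s. g s*f s) = 0" proof - note S = subalgebra_sigma_finite[OF assms(1)]
 have "EV M (%s. g s*f s) = EV M (%s. g s*real_cond_exp M F f s)"
  using assms by (intro sigma_finite_subalgebra.real_cond_exp_intg(2)[OF S, symmetric]) (auto simp: centred_def)
 also have "... = EV M (%s. 0)" using centred_real_cond_exp[OF F f] measurable_from_subalg[OF F g]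
   borel_measurable_cond_exp2[of M F f] by (intro integral_cong_AE) (auto elim: eventually_mono)
 finally show ?thesis by simp
qed

lemma centred_orthogonal: fixes f g :: "'a => 'b::euclidean_space"
 assumes F: "subalgebra M F" and f: "centred F f" "L2 f" and g: "g : bm F" "L2 g" shows "EV M (%s. f s \<bullet> g s) = 0" proof -
 have I: "integrable M (%s. (g s \<bullet> b)*(f s \<bullet> b))" for b
  using L2_inner[OF L2_comp[OF g(2), of b] L2_comp[OF f(2), of b]] by simp
 have "EV M (%s. f s \<bullet> g s) = (SUM b:Basis. \<integral>s. (g s \<bullet> b)*(f s \<bullet> b) \<partial>M)"
  by (subst euclidean_inner) (use I in "simp add: mult.commute")
 also have "... = 0" using centred_linear[OF F f(1) bounded_linear_inner_left] g(1)
  by (intro sum.neutral ballI centred_mult[OF F _ _ I]) auto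
 finally show ?thesis .
qed

lemma centred_orthogonal_quad: fixes f :: "'a => real^'n" and g :: "'a => real^'m"
 assumes F: "subalgebra M F" and f: "centred F f" "L2 f" and g: "g : bm F" "L2 g" shows "EV M (%s. f s \<bullet> (W *v g s)) = 0"
proof - have "(%s. W *v g s) : bm F" by (rule measurable_compose[OF g(1) borel_measurable_continuous_onI])
   (simp add: matrix_vector_mult_linear_continuous_on)
 thus ?thesis by (rule centred_orthogonal[OF F f _ L2_matrix[OF g(2)]])
qed

lemma vec_cond_exp_measurable: fixes f :: "'a => real^'c" shows "vec_cond_exp M F f : bm F" unfolding vec_cond_exp_def
proof (subst borel_measurable_euclidean_space, intro ballI)
 fix b :: "real^'c" assume "b : Basis"
 then obtain i where b: "b = axis i 1" by (auto simp: Basis_vec_def)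
 show "(%s. (\<chi> i. real_cond_exp M F (%s. f s $ i) s) \<bullet> b) : bm F"
  unfolding b inner_axis vec_lambda_beta inner_real_def mult_1_right by (rule borel_measurable_cond_exp)
qed

lemma vec_cond_exp_measurable': "subalgebra M F ==> vec_cond_exp M F f : bm M"
 by (rule measurable_from_subalg[OF _ vec_cond_exp_measurable])

lemma vec_cond_exp_centred: assumes F: "subalgebra M F" and f: "integrable M f" shows "centred F (%s. f s-vec_cond_exp M F f s)"
proof (rule centred_nth[OF F])
 note S = subalgebra_sigma_finite[OF assms(1)]
 fix i have fi: "integrable M (%s. f s $ i)" by (rule integrable_bounded_linear[OF bounded_linear_vec_nth f])
 note ci = sigma_finite_subalgebra.real_cond_exp_int(1)[OF S fi]
 show "centred F (%s. (f s-vec_cond_exp M F f s) $ i)" unfolding centred_def vec_cond_exp_def proof (intro conjI ballI)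
  show "integrable M (%s. (f s-(\<chi> i. real_cond_exp M F (%s. f s $ i) s)) $ i)"
   unfolding vector_minus_component vec_lambda_beta by (rule Bochner_Integration.integrable_diff[OF fi ci])
  fix B assume B: "B : sets F"
  show "EV M (%s. indicator B s *\<^sub>R (f s-(\<chi> i. real_cond_exp M F (%s. f s $ i) s)) $ i) = 0"
   unfolding vector_minus_component vec_lambda_beta scaleR_diff_right
   using sigma_finite_subalgebra.real_cond_exp_intA[OF S fi B, unfolded set_lebesgue_integral_def]
    Bochner_Integration.integral_diff[OF centred_ind[OF F fi B]
     centred_ind[OF F ci B]] by linarith
 qed qed

lemma vec_cond_exp_integrable: assumes F: "subalgebra M F" and f: "integrable M f" shows "integrable M (vec_cond_exp M F f)"
proof - have "integrable M (%s. f s-(f s-vec_cond_exp M F f s))"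
  by (rule Bochner_Integration.integrable_diff[OF f centred_integrable[OF vec_cond_exp_centred[OF F f]]])
 thus ?thesis by simp
qed

lemma vec_cond_exp_eqI: fixes f g :: "'a => real^'n" assumes F: "subalgebra M F" and f: "integrable M f" and g: "g : bm F"
  and c: "centred F (%s. f s-g s)" shows "AE s in M. vec_cond_exp M F f s = g s" proof -
 note S = subalgebra_sigma_finite[OF assms(1)]
 have "AE s in M. real_cond_exp M F (%s. f s $ i) s = g s $ i" for i
 proof (rule sigma_finite_subalgebra.real_cond_exp_charact[OF S])
  show fi: "integrable M (%s. f s $ i)" by (rule integrable_bounded_linear[OF bounded_linear_vec_nth f])
  have ci: "centred F (%s. (f s-g s) $ i)" by (rule centred_linear[OF F c bounded_linear_vec_nth])
  have "integrable M (%s. f s $ i-(f s-g s) $ i)" by (rule Bochner_Integration.integrable_diff[OF fi centred_integrable[OF ci]])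
  thus gi: "integrable M (%s. g s $ i)" by simp
  show "(%s. g s $ i) : bm F" by (rule measurable_compose[OF g borel_measurable_continuous_onI]) (intro continuous_intros)
  fix B assume B: "B : sets F"
  have "EV M (%s. indicator B s *\<^sub>R (f s-g s) $ i) = 0" using ci B by (simp add: centred_def)
  thus "set_lebesgue_integral M B (%s. f s $ i) = set_lebesgue_integral M B (%s. g s $ i)"
   using centred_ind[OF F fi B] centred_ind[OF F gi B] by (simp add: set_lebesgue_integral_def right_diff_distrib)
 qed hence "AE s in M. ALL i:UNIV. real_cond_exp M F (%s. f s $ i) s = g s $ i" by (intro AE_finite_allI) auto
 thus ?thesis by eventually_elim (simp add: vec_cond_exp_def vec_eq_iff)
qed

text \<open>Conditional Jensen inequality for the square, in each component.\<close>

lemma vec_cond_exp_L2: assumes F: "subalgebra M F" and f: "L2 (f :: 'a => real^'n)" shows "L2 (vec_cond_exp M F f)"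
proof (rule L2_vec)
 note S = subalgebra_sigma_finite[OF assms(1)]
 fix i have fi: "L2 (%s. f s $ i)" by (rule L2_nth[OF f])
 have q: "integrable M (%s. (f s $ i)^2)" using fi unfolding L2_def pow2 inner_real_def by blast
 have "integrable M (%s. real_cond_exp M F (%s. f s $ i) s^2)"
  by (rule sigma_finite_subalgebra.integrable_convex_cond_exp[OF S L2_integrable[OF fi],
     where I=UNIV and q="%x. x^2"])
   (use q convex_power2 in "simp_all")
 thus "L2 (%s. vec_cond_exp M F f s $ i)" using borel_measurable_cond_exp2[of M F "%s. f s $ i"]
  unfolding L2_def vec_cond_exp_def pow2 inner_real_def vec_lambda_beta by blast
qed

lemma indep_expectation: fixes f g :: "'a => real"
 assumes F: "subalgebra M F" and G: "subalgebra M G" and FG: "indep_set (sets F) (sets G)"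
  and f: "f : bm F" "integrable M f" and g: "g : bm G" "integrable M g"
 shows "integrable M (%s. f s*g s)" "EV M (%s. f s*g s) = EV M (%s. f s)*EV M (%s. g s)" proof -
 have *: "sigma_sets (space M) (pre M h) \<subseteq> sets H"
  if "subalgebra M H" "h : bm H" for h :: "'a => real" and H proof - have "pre M h \<subseteq> sets H"
   using that measurable_sets[of h H borel] by (auto simp: subalgebra_def)
  hence "sigma_sets (space H) (pre M h) \<subseteq> sets H" by (rule sets.sigma_sets_subset)
  thus ?thesis using that by (simp add: subalgebra_def)
 qed have "indep_set (sigma_sets (space M) (pre M f)) (sigma_sets (space M) (pre M g))"
  (is "indep_set ?A ?B") unfolding indep_sets2_eq proof (intro conjI ballI)
  note A = *[OF F f(1)] and B = *[OF G g(1)]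
  show "?A \<subseteq> events" "?B \<subseteq> events"
   using A B F G unfolding subalgebra_def by (simp_all only: subset_trans[OF A] subset_trans[OF B])
  fix a b assume "a : ?A" "b : ?B"
  hence "a : sets F" "b : sets G" using A B by (simp_all only: subsetD[OF A] subsetD[OF B])
  thus "prob (a Int b) = prob a*prob b" using FG unfolding indep_sets2_eq by blast
 qed hence "indep_var borel f borel g" unfolding indep_var_eq using borel_measurable_integrable f(2) g(2) by blast
 thus "integrable M (%s. f s*g s)" "EV M (%s. f s*g s) = EV M (%s. f s)*EV M (%s. g s)"
  using indep_var_integrable[OF _ f(2) g(2)] indep_var_lebesgue_integral[OF _ f(2) g(2)] by blast+
qed

lemma indep_centred: assumes F: "subalgebra M F" and G: "subalgebra M G" and FG: "indep_set (sets F) (sets G)"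
  and g: "g : bm G" "integrable M g" "EV M (%s. g s) = 0" shows "centred F (g :: 'a => 'b::euclidean_space)"
proof (rule centred_Basis[OF F])
 fix b :: 'b
 show "centred F (%s. g s \<bullet> b)" unfolding centred_def proof (intro conjI ballI)
  show gb: "integrable M (%s. g s \<bullet> b)" using g by simp
  fix B assume B: "B : sets F"
  hence BM: "B : sets M" using F by (auto simp: subalgebra_def)
  have "EV M (%s. indicator B s*(g s \<bullet> b)) = EV M (%s. indicator B s)*EV M (%s. g s \<bullet> b)"
   by (rule indep_expectation(2)[OF F G FG])
    (use g B BM gb in "auto intro!: integrable_real_indicator simp: emeasure_eq_measure")
  thus "EV M (%s. indicator B s *\<^sub>R (g s \<bullet> b)) = 0" using g by simp
 qed qed

end

section \<open>Gaussian variables through characteristic functions\<close>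

context prob_space begin

definition gaussian1 :: "('a => real) => real => real => bool" where "gaussian1 f m V \<longleftrightarrow> f : bm M & 0 <= V &
  distr M borel f = (if V = 0 then return borel m else density lborel (normal_density m (sqrt V)))"

lemma gaussian1_distributed: assumes "gaussian1 f m V" "V ~= 0" shows "distributed M lborel f (normal_density m (sqrt V))"
 using assms distr_cong[of M M borel lborel f f] by (auto simp: gaussian1_def distributed_def)

lemma gaussian1_AE: assumes "gaussian1 f m 0" shows "AE s in M. f s = m" proof -
 have f: "f : bm M" using assms by (simp add: gaussian1_def)
 have d: "distr M borel f = return borel m" using assms by (simp add: gaussian1_def)
 have "AE x in distr M borel f. x = m" unfolding d using AE_return[of m borel "%x. x = m"] by (simp add: pred_def)
 thus ?thesis using f by (subst (asm) AE_distr_iff) auto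
qed

lemma gaussian1_moments: assumes "gaussian1 f m V" shows "L2 f" "EV M (%s. f s) = m" "EV M (%s. (f s-m)^2) = V" proof -
 have f: "f : bm M" and V: "0 <= V" using assms by (auto simp: gaussian1_def)
 have "L2 f & EV M (%s. f s) = m & EV M (%s. (f s-m)^2) = V" proof (cases "V = 0")
  case True hence ae: "AE s in M. f s = m" using gaussian1_AE assms by simp
  have "L2 f" by (rule L2_cong_AE[OF L2_const f ae])
  moreover have "EV M (%s. f s) = EV M (%s. m)" using f ae by (intro integral_cong_AE) auto
  moreover have "EV M (%s. (f s-m)^2) = EV M (%s. 0)" using f ae by (intro integral_cong_AE) (auto elim: eventually_mono)
  ultimately show ?thesis using True by (simp add: prob_space)
 next case False hence s: "0 < sqrt V" using V by simp
  note D = gaussian1_distributed[OF assms False]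
  have m: "EV M (%s. f s) = m" by (rule normal_distributed_expectation[OF s D])
  have "integrable M (%s. (f s-m)^2)"
   using distributed_integrable[OF D, of "%x. (x-m)^2"] integrable_normal_moment[OF s, of m 2] by simp
  hence "L2 (%s. f s-m)" using f by (simp add: L2_def pow2)
  from L2_add[OF this L2_const[of m]] have "L2 f" by simp
  thus ?thesis using normal_distributed_variance[OF s D] m V by simp
 qed thus "L2 f" "EV M (%s. f s) = m" "EV M (%s. (f s-m)^2) = V" by auto
qed

lemma gaussian1_char: assumes "gaussian1 f m V" shows "EV M (%s. iexp (t*f s)) = iexp (t*m)*exp (- (complex_of_real (t^2*V)/2))"
proof - have f[measurable]: "f : bm M" and V: "0 <= V" using assms by (auto simp: gaussian1_def)
 show ?thesis proof (cases "V = 0")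
  case True hence ae: "AE s in M. f s = m" using gaussian1_AE assms by simp
  have "EV M (%s. iexp (t*f s)) = EV M (%s. iexp (t*m))" using ae by (intro integral_cong_AE) (auto elim: eventually_mono)
  thus ?thesis using True by (simp add: prob_space)
 next case False hence s: "0 < sqrt V" using V by simp
  let ?g = "%s. (f s-m)/sqrt V"
  have "distributed M lborel ?g std_normal_density"
   using gaussian1_distributed[OF assms False] normal_standard_normal_convert[OF s] by simp
  hence d: "distr M borel ?g = std_normal_distribution" using distr_cong[of M M borel lborel ?g ?g] by (simp add: distributed_def)
  let ?u = "t * sqrt V"
  have "EV M (%s. iexp (?u*?g s)) = char (distr M borel ?g) ?u" unfolding char_def by (subst integral_distr) auto
  also have "... = complex_of_real (exp (- (t^2*V)/2))"
   using V by (simp only: d char_std_normal_distribution power_mult_distrib real_sqrt_pow2)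
  also have "... = exp (- (complex_of_real (t^2*V)/2))" by (simp add: exp_of_real[symmetric])
  finally have *: "EV M (%s. iexp (?u*?g s)) = exp (- (complex_of_real (t^2*V)/2))" .
  have "t*f s = t*m+?u*?g s" for s using s by (simp add: field_simps)
  hence "iexp (t*f s) = iexp (t*m)*iexp (?u*?g s)" for s
   by (simp only: exp_add[symmetric] distrib_left[symmetric] of_real_add[symmetric])
  thus ?thesis by (simp only: integral_mult_right_zero *)
 qed qed

lemma gaussian1_charI: assumes f[measurable]: "f : bm M" and V: "0 <= V"
  and ch: "!!t. EV M (%s. iexp (t*f s)) = iexp (t*m)*exp (- (complex_of_real (t^2*V)/2))" shows "gaussian1 f m V"
proof (cases "V = 0")
 case True have "distr M borel f = return borel m" proof (rule Levy_uniqueness)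
  show "real_distribution (distr M borel f)" by (simp add: real_distribution_def real_distribution_axioms_def prob_space_distr)
  show "real_distribution (return borel m)" by (simp add: real_distribution_def real_distribution_axioms_def prob_space_return)
  show "char (distr M borel f) = char (return borel m)"
   using ch True by (intro ext) (simp add: char_def integral_distr integral_return)
 qed thus ?thesis using True by (simp add: gaussian1_def)
next case False hence s: "0 < sqrt V" using V by simp
 let ?g = "%s. (f s-m)/sqrt V"
 have "distr M borel ?g = std_normal_distribution" proof (rule Levy_uniqueness)
  show "real_distribution (distr M borel ?g)" by (simp add: real_distribution_def real_distribution_axioms_def prob_space_distr)
  show "real_distribution std_normal_distribution" by (rule real_dist_normal_dist)
  show "char (distr M borel ?g) = char std_normal_distribution" proof
   fix t have "char (distr M borel ?g) t = EV M (%s. iexp (- t*m/sqrt V)*iexp (t/sqrt V*f s))"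
    unfolding char_def by (subst integral_distr, simp, simp, rule EV_cong)
     (simp add: exp_add[symmetric] diff_divide_distrib right_diff_distrib mult_ac)
   also have "... = iexp (- t*m/sqrt V)*(iexp (t/sqrt V*m)*exp (- (complex_of_real ((t/sqrt V)^2*V)/2)))"
    by (simp only: integral_mult_right_zero ch)
   also have "... = exp (- (complex_of_real (t^2)/2))" using s V by (simp add: exp_add[symmetric] power_divide)
   finally show "char (distr M borel ?g) t = char std_normal_distribution t"
    by (simp add: char_std_normal_distribution exp_of_real[symmetric] del: exp_of_real)
  qed qed hence "distributed M lborel ?g std_normal_density"
  using distr_cong[of M M borel lborel ?g ?g] by (simp add: distributed_def)
 hence "distributed M lborel f (normal_density m (sqrt V))" using normal_standard_normal_convert[OF s] by simp
 thus ?thesis using False V distr_cong[of M M borel lborel f f] by (simp add: gaussian1_def distributed_def)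
qed

lemma gaussian1_atomless: assumes "gaussian1 f m V" "V ~= 0" shows "AE x in distr M borel f. x ~= a" proof -
 have d: "distr M borel f = density lborel (normal_density m (sqrt V))" using assms by (simp add: gaussian1_def)
 have "AE x in lborel. x ~= a" by (rule AE_lborel_singleton)
 thus ?thesis unfolding d by (subst AE_density) (auto elim: eventually_mono)
qed

lemma gaussian_rv_gaussian1: assumes "gaussian_rv M X m W" shows "gaussian1 (%s. a \<bullet> X s) (a \<bullet> m) (qf W a)"
proof - have [measurable]: "X : bm M" using assms by (simp add: gaussian_rv_def)
 have "distr (distr M borel X) borel (%x. a \<bullet> x) = distr M borel (%s. a \<bullet> X s)"
  by (subst distr_distr) (auto simp: comp_def)
 thus ?thesis using assms by (simp add: gaussian_rv_def gaussian_law_def gaussian1_def psd_def)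
qed

text \<open>The function \<open>1 + \<Phi>/c\<close> is a probability density, its total mass coming
  from the hypothesis at \<open>t = 0\<close>. The tilted measure gives \<open>Y\<close> the same
  characteristic function, hence by uniqueness the same law, so \<open>\<Phi>\<close> integrates to
  0 over every event of \<open>Y\<close>.\<close>

lemma char_zero_real: assumes Y[measurable]: "Y : bm M" and P[measurable]: "\<Phi> : bm M"
  and c: "!!s. \<bar>\<Phi> s\<bar> <= c" "0 < c"
  and z: "!!t. EV M (%s. complex_of_real (\<Phi> s)*iexp (t*Y s)) = 0" and B[measurable]: "B : sets borel"
 shows "EV M (%s. \<Phi> s*indicator B (Y s)) = (0::real)" proof - define g where "g s = 1+\<Phi> s/c" for s
 have g[measurable]: "g : bm M" unfolding g_def by simp
 have g0: "0 <= g s" for s using abs_le_D2[OF c(1)[of s]] c(2) by (simp add: g_def field_simps)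
 have bP: "integrable M (%s. h s *\<^sub>R \<Phi> s)" if "h : bm M" "!!s. \<bar>h s\<bar> <= (1::real)" for h
  by (rule integrable_const_bound[of _ c]) (use that c mult_mono[OF that(2) c(1)] in "auto simp: abs_mult intro!: AE_I2")
 have bC: "integrable M (%s. complex_of_real (\<Phi> s)*iexp (t*Y s))" for t
  by (rule integrable_const_bound[of _ c]) (use c in "auto simp: norm_mult")
 have bI: "integrable M (%s. iexp (t*Y s))" for t by (rule integrable_const_bound[of _ 1]) auto
 have P0: "EV M (%s. \<Phi> s) = 0" proof - have "complex_of_real (EV M (%s. \<Phi> s)) = 0" using z[of 0] by simp
  thus ?thesis by simp
 qed have gI: "integrable M g" "EV M (%s. g s) = 1" using bP[of "%_. 1"] P0 unfolding g_def by (simp_all add: prob_space)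
 let ?N = "density M (%s. ennreal (g s))"
 have "emeasure ?N (space M) = ennreal (EV M (%s. g s))"
  by (subst emeasure_density, simp, simp, subst nn_integral_eq_integral[OF gI(1), symmetric])
   (auto simp: g0 intro!: nn_integral_cong)
 hence N: "prob_space ?N" using gI by (intro prob_spaceI) simp
 have eq: "distr ?N borel Y = distr M borel Y" proof (rule Levy_uniqueness)
  show "real_distribution (distr ?N borel Y)" using prob_space.prob_space_distr[OF N, of Y borel]
   by (simp add: real_distribution_def real_distribution_axioms_def)
  show "real_distribution (distr M borel Y)" by (simp add: real_distribution_def real_distribution_axioms_def prob_space_distr)
  show "char (distr ?N borel Y) = char (distr M borel Y)" proof
   fix t have "char (distr ?N borel Y) t = EV ?N (%s. iexp (t*Y s))" unfolding char_def by (subst integral_distr) auto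
   also have "... = EV M (%s. g s *\<^sub>R iexp (t*Y s))" by (rule integral_density) (auto simp: g0)
   also have "... = EV M (%s. iexp (t*Y s)+complex_of_real (inverse c)*(complex_of_real (\<Phi> s)*iexp (t*Y s)))"
    by (intro EV_cong) (simp add: g_def scaleR_conv_of_real field_simps)
   also have "... = EV M (%s. iexp (t*Y s))"
    using bI bC by (subst Bochner_Integration.integral_add) (auto simp: z[unfolded of_real_mult])
   also have "... = char (distr M borel Y) t" unfolding char_def by (subst integral_distr) auto
   finally show "char (distr ?N borel Y) t = char (distr M borel Y) t" .
  qed qed have i: "integrable M (%s. indicator B (Y s) :: real)" by (rule integrable_const_bound[of _ 1]) auto
 let ?h = "%s. indicator B (Y s) :: real"
 have "EV ?N (%s. ?h s) = EV (distr ?N borel Y) (%x. indicator B x)" by (subst integral_distr) auto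
 also have "... = EV M (%s. ?h s)" unfolding eq by (subst integral_distr) auto
 finally have e: "EV ?N (%s. ?h s) = EV M (%s. ?h s)" .
 have "EV ?N (%s. ?h s) = EV M (%s. g s *\<^sub>R ?h s)" by (rule integral_density) (auto simp: g0)
 also have "... = EV M (%s. ?h s+inverse c*(\<Phi> s*?h s))" by (intro EV_cong) (simp add: g_def field_simps)
 also have "... = EV M (%s. ?h s)+inverse c*EV M (%s. \<Phi> s*?h s)"
  using i bP[of ?h] by (subst Bochner_Integration.integral_add) (auto simp: mult.commute indicator_def)
 finally have "inverse c*EV M (%s. \<Phi> s*?h s) = 0" unfolding e by linarith
 thus ?thesis using c by simp
qed

lemma char_zero: assumes Y[measurable]: "Y : bm M" and P: "\<Phi> : bm M" and c: "!!s. cmod (\<Phi> s) <= c" "0 < c"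
  and z: "!!t. EV M (%s. \<Phi> s*iexp (t*Y s)) = 0" and B[measurable]: "B : sets borel"
 shows "EV M (%s. \<Phi> s*indicator B (Y s)) = 0" proof - have I: "integrable M (%s. \<Psi> s*h s)"
  if [measurable]: "\<Psi> : bm M" "h : bm M" and b: "!!s. cmod (\<Psi> s) <= c" "!!s. cmod (h s) <= 1" for \<Psi> h
  by (rule integrable_const_bound[of _ c])
   (use c mult_mono[OF b] in "auto simp: norm_mult intro!: AE_I2")
 have re: "EV M (%s. Re (\<Psi> s)*indicator B (Y s)) = 0"
  if [measurable]: "\<Psi> : bm M" and b: "!!s. cmod (\<Psi> s) <= c" and z: "!!t. EV M (%s. \<Psi> s*iexp (t*Y s)) = 0" for \<Psi>
 proof (rule char_zero_real[OF Y _ _ c(2) _ B])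
  fix t have Ie: "integrable M (%s. \<Psi> s*iexp (t*Y s))" for t by (rule I) (use b in auto)
  have "EV M (%s. cnj (\<Psi> s)*iexp (t*Y s)) = EV M (%s. cnj (\<Psi> s*iexp (- t*Y s)))" by (simp add: exp_cnj)
  also have "... = cnj (EV M (%s. \<Psi> s*iexp (- t*Y s)))" by (rule integral_bounded_linear[OF bounded_linear_cnj Ie])
  finally have cz: "EV M (%s. cnj (\<Psi> s)*iexp (t*Y s)) = 0" by (simp only: z complex_cnj_zero)
  have Ic: "integrable M (%s. cnj (\<Psi> s)*iexp (t*Y s))" using integrable_cnj[OF Ie[of "- t"]] by (simp add: exp_cnj)
  have "EV M (%s. complex_of_real (Re (\<Psi> s))*iexp (t*Y s))
    = EV M (%s. (\<Psi> s*iexp (t*Y s)+cnj (\<Psi> s)*iexp (t*Y s))/2)"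
   by (intro EV_cong) (simp add: complex_add_cnj distrib_right[symmetric])
  thus "EV M (%s. complex_of_real (Re (\<Psi> s))*iexp (t*Y s)) = 0"
   using Ic Ie by (simp add: z[unfolded of_real_mult] cz[unfolded of_real_mult])
  show "\<bar>Re (\<Psi> s)\<bar> <= c" for s by (rule order.trans[OF abs_Re_le_cmod b])
 qed auto
 have im: "EV M (%s. Im (\<Phi> s)*indicator B (Y s)) = 0" proof - have "EV M (%s. (- \<i>*\<Phi> s)*iexp (t*Y s)) = 0" for t
   unfolding mult.assoc integral_mult_right_zero z by simp
  thus ?thesis using re[of "%s. - \<i>*\<Phi> s"] P c by (simp add: norm_mult)
 qed let ?I = "%s. \<Phi> s*indicator B (Y s)"
 have iI: "integrable M ?I" by (rule I) (use P c in "auto simp: indicator_def")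
 have "Re (EV M (%s. ?I s)) = EV M (%s. Re (?I s))" "Im (EV M (%s. ?I s)) = EV M (%s. Im (?I s))"
  by (rule integral_Re[OF iI, symmetric] integral_Im[OF iI, symmetric])+
 moreover have "Re (?I s) = Re (\<Phi> s)*indicator B (Y s)" "Im (?I s) = Im (\<Phi> s)*indicator B (Y s)" for s
  by (auto simp: indicator_def)
 ultimately show ?thesis using re[OF P c(1) z] im by (simp add: complex_eq_iff)
qed

text \<open>Exponentials are exchanged for indicators one variable at a time, the remaining
  variables being kept inside the weight. Joint laws are thus handled by the one-dimensional
  uniqueness theorem.\<close>

lemma char_zero_finite: assumes "finite J" and Y: "!!j. j : J ==> Y j : bm M"
  and "\<Phi> : bm M" and "!!s. cmod (\<Phi> s) <= c" "0 < c"
  and "!!t. EV M (%s. \<Phi> s*iexp (SUM j:J. t j*Y j s)) = 0" and B: "!!j. j : J ==> B j : sets borel"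
 shows "EV M (%s. \<Phi> s*(PROD j:J. indicator (B j) (Y j s))) = 0" using assms
proof (induction J arbitrary: \<Phi> rule: finite_induct) case (insert j J)
 note [measurable] = insert.prems(1)[of j, simplified] insert.prems(2)
 have Bj[measurable]: "B j : sets borel" using insert.prems(6) by simp
 have YJ[measurable]: "(%s. SUM j:J. t j*Y j s) : bm M" for t
  using insert.prems(1) by (intro borel_measurable_sum borel_measurable_times) auto
 have [measurable]: "(%s. iexp (SUM j:J. t j*Y j s)) : bm M" for t by measurable
 have "EV M (%s. (\<Phi> s*indicator (B j) (Y j s))*(PROD j:J. indicator (B j) (Y j s))) = 0" proof (rule insert.IH)
  fix t have "EV M (%s. (\<Phi> s*iexp (SUM j:J. t j*Y j s))*indicator (B j) (Y j s)) = 0"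
  proof (rule char_zero[OF _ _ _ \<open>0 < c\<close> _ Bj])
   fix u have "EV M (%s. \<Phi> s*iexp (SUM i:insert j J. (t(j := u)) i*Y i s)) = 0" by (rule insert.prems)
   moreover have "(SUM i:insert j J. (t(j := u)) i*Y i s) = u*Y j s+(SUM j:J. t j*Y j s)" for s
    using insert.hyps by (auto intro: sum.cong)
   ultimately have "EV M (%s. \<Phi> s*iexp (u*Y j s+(SUM j:J. t j*Y j s))) = 0" by (simp only:)
   thus "EV M (%s. (\<Phi> s*iexp (SUM j:J. t j*Y j s))*iexp (u*Y j s)) = 0"
    unfolding of_real_add distrib_left exp_add by (simp only: mult_ac)
   show "(%s. \<Phi> s*iexp (SUM j:J. t j*Y j s)) : bm M" by measurable
   show "cmod (\<Phi> s*iexp (SUM j:J. t j*Y j s)) <= c" for s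
    using insert.prems(3)[of s] by (simp add: norm_mult del: of_real_sum)
  qed measurable
  thus "EV M (%s. (\<Phi> s*indicator (B j) (Y j s))*iexp (SUM j:J. t j*Y j s)) = 0" by (simp add: mult_ac)
 qed (use insert.prems in "auto simp: indicator_def norm_mult less_imp_le")
 thus ?case using insert.hyps by (simp add: mult_ac)
qed simp_all

end

lemma Int_stable_vimage: fixes f :: "'a => 'b::topological_space" shows "Int_stable {f -` E Int A | E. E : sets borel}"
proof (rule Int_stableI, safe)
 fix E F :: "'b set" assume "E : sets borel" "F : sets borel"
 thus "EX G. f -` E Int A Int (f -` F Int A) = f -` G Int A & G : sets borel" by (intro exI[of _ "E Int F"]) auto
qed

lemma (in prob_space) indep_set_mono: "indep_set A B ==> A' \<subseteq> A ==> B' \<subseteq> B ==> indep_set A' B'"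
 unfolding indep_sets2_eq by (meson subsetD subset_trans)

section \<open>Gaussian noises and the filter\<close>

text \<open>The index \<open>None\<close> stands for the initial state, so that one independence
  statement covers it together with all noises.\<close>

definition noise_field :: "'a measure => ('a => real^'n) => (nat => 'a => real^'n) => (nat => 'a => real^'n) =>
 (nat => 'a => real) => noise_index option => 'a set set" where
 "noise_field M x0 w v eta i = (case i of None => pre M x0 | Some (Proc k) => pre M (w k)
  | Some (Obs k) => pre M (v k) | Some (Chan k) => pre M (eta k))"

locale noises = prob_space M for M :: "'a measure" +
 fixes x0 :: "'a => real^'n" and w v :: "nat => 'a => real^'n" and eta :: "nat => 'a => real"
  and m0 :: "real^'n" and W0 Qw Qv :: "real^'n^'n" and p :: real assumes x0_gaussian: "gaussian_rv M x0 m0 W0"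
  and w_gaussian: "!!k. gaussian_rv M (w k) 0 Qw" and v_gaussian: "!!k. gaussian_rv M (v k) 0 Qv"
  and eta_measurable: "!!k. eta k : bm M" and eta_0: "!!k. prob {s : space M. eta k s = 0} = p"
  and eta_1: "!!k. prob {s : space M. eta k s = 1} = 1-p" and noise_indep: "indep_sets (noise_field M x0 w v eta) UNIV"
begin

abbreviation src where "src \<equiv> noise_field M x0 w v eta"

definition hist :: "noise_index option set => 'a measure" where "hist I = sigma (space M) (UN i:I. src i)"

lemma src_indep: "indep_sets src UNIV" by (rule noise_indep)

lemma src_events: "src i \<subseteq> events" using src_indep by (auto simp: indep_sets_def)

lemma src_subset: "(UN i:I. src i) \<subseteq> Pow (space M)" using src_events sets.sets_into_space by blast

lemma space_hist [simp]: "space (hist I) = space M" unfolding hist_def by (rule space_measure_of[OF src_subset])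

lemma sets_hist: "sets (hist I) = sigma_sets (space M) (UN i:I. src i)"
 unfolding hist_def by (rule sets_measure_of[OF src_subset])

lemma hist_subalgebra: "subalgebra M (hist I)" proof - have "(UN i:I. src i) \<subseteq> events" using src_events by auto
 hence "sigma_sets (space M) (UN i:I. src i) \<subseteq> events" by (rule sets.sigma_sets_subset)
 thus ?thesis by (simp add: subalgebra_def sets_hist)
qed

lemma hist_mono: "I \<subseteq> J ==> sets (hist I) \<subseteq> sets (hist J)"
 unfolding sets_hist by (rule sigma_sets_subseteq) auto

lemma hist_measurable_mono: "f : measurable (hist I) N ==> I \<subseteq> J ==> f : measurable (hist J) N"
 using measurable_mono[of N N "hist I" "hist J"] hist_mono[of I J] by auto

lemma src_measurable: assumes "src i = (pre M f)" "i : I" shows "f : bm (hist I)" proof (rule measurableI)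
 fix E assume "E : sets (borel :: 'b measure)"
 hence "f -` E Int space M : (UN i:I. src i)" using assms by blast
 thus "f -` E Int space (hist I) : sets (hist I)" unfolding sets_hist space_hist by (rule sigma_sets.Basic)
qed simp

lemma noise_hist: shows x0_hist: "None : I ==> x0 : bm (hist I)" and w_hist: "Some (Proc k) : I ==> w k : bm (hist I)"
  and v_hist: "Some (Obs k) : I ==> v k : bm (hist I)" and eta_hist: "Some (Chan k) : I ==> eta k : bm (hist I)"
 by (rule src_measurable; auto simp: noise_field_def)+

lemma hist_indep: assumes "I Int J = {}" shows "indep_set (sets (hist I)) (sets (hist J))" proof -
 have "indep_sets (%j. sigma_sets (space M) (UN i:case_bool I J j. src i)) UNIV" proof (rule indep_sets_collect_sigma)
  show "indep_sets src (UN j:UNIV. case_bool I J j)" by (rule indep_sets_mono_index[OF _ src_indep]) simp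
  show "Int_stable (src i)" for i by (auto simp: noise_field_def Int_stable_vimage split: option.split noise_index.split)
  show "disjoint_family_on (case_bool I J) UNIV" using assms by (auto simp: disjoint_family_on_def split: bool.splits)
 qed thus ?thesis unfolding indep_set_def sets_hist by (rule indep_sets_mono_sets) (auto split: bool.splits)
qed

lemma hist_centred: assumes "I Int J = {}" "f : bm (hist J)" "integrable M f" "EV M (%s. f s) = 0" shows "centred (hist I) f"
 by (rule indep_centred[OF hist_subalgebra hist_subalgebra hist_indep[OF assms(1)] assms(2-)])

lemma eta_AE: "AE s in M. eta k s = 0 | eta k s = 1" proof - note [measurable] = eta_measurable[of k]
 have "prob ({s : space M. eta k s = 0} Un {s : space M. eta k s = 1})
   = prob {s : space M. eta k s = 0}+prob {s : space M. eta k s = 1}" by (rule finite_measure_Union) auto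
 hence "prob {s : space M. eta k s = 0 | eta k s = 1} = 1"
  unfolding eta_0 eta_1 by (simp add: Collect_disj_eq[symmetric] conj_disj_distribL Un_def)
 thus ?thesis by (subst (asm) prob_Collect_eq_1) auto
qed

lemma p_range: "0 <= p" "p <= 1" using eta_0[of 0] measure_nonneg prob_le_1 by metis+

lemma psd_noise: "psd W0" "psd Qw" "psd Qv"
 using x0_gaussian w_gaussian[of 0] v_gaussian[of 0] by (auto simp: gaussian_rv_def gaussian_law_def)

definition gsrc :: "noise_index option => 'a => real^'n" where
 "gsrc i = (case i of None => x0 | Some (Proc k) => w k | Some (Obs k) => v k | Some (Chan k) => (%_. 0))"

text \<open>Affine functions of finitely many Gaussian sources. In \<open>gsrc\<close> the channel
  variables are replaced by 0, which keeps a single index type.\<close>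

definition lin :: "('a => real) => bool" where
 "lin f \<longleftrightarrow> (EX J a c. finite J & f = (%s. c+(SUM i:J. a i \<bullet> gsrc i s)))"

lemma gsrc_gaussian: "EX m V. gaussian1 (%s. a \<bullet> gsrc i s) m V" proof (cases "EX k. i = Some (Chan k)")
 case True hence "gaussian1 (%s. a \<bullet> gsrc i s) 0 0" by (auto simp: gsrc_def gaussian1_def distr_const)
 thus ?thesis by blast
next case False have "EX m V. gaussian1 (%s. a \<bullet> x0 s) m V" "EX m V. gaussian1 (%s. a \<bullet> w k s) m V"
  "EX m V. gaussian1 (%s. a \<bullet> v k s) m V" for k
  using gaussian_rv_gaussian1[OF x0_gaussian, of a] gaussian_rv_gaussian1[OF w_gaussian, of a k]
   gaussian_rv_gaussian1[OF v_gaussian, of a k] by blast+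
 with False show ?thesis by (auto simp: gsrc_def split: option.split noise_index.split)
qed

lemma gsrc_measurable: "gsrc i : bm M" using x0_gaussian w_gaussian v_gaussian
 by (auto simp: gsrc_def gaussian_rv_def split: option.split noise_index.split)

lemma gsrc_indep: "indep_vars (%_. borel) gsrc UNIV" unfolding indep_vars_def2 proof
 show "ALL i:UNIV. gsrc i : bm M" using gsrc_measurable by blast
 show "indep_sets (%i. pre M (gsrc i)) UNIV" proof (rule indep_sets_mono_sets[OF src_indep])
  \<comment> \<open>The zero source generates the trivial field, which lies inside that of the
    channel variable; independence is therefore inherited.\<close>
  fix i have "pre M (%_. 0::real^'n) \<subseteq> pre M (eta k)" for k proof safe
   fix A :: "(real^'n) set"
   show "EX E. (%_. 0) -` A Int space M = eta k -` E Int space M & E : sets borel"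
    by (rule exI[of _ "if 0 : A then UNIV else {}"]) auto
  qed thus "pre M (gsrc i) \<subseteq> src i" unfolding gsrc_def noise_field_def
   by (cases i; simp; rename_tac j; case_tac j; simp)
 qed qed

lemma lin_char: assumes "finite J" shows "EX m V. 0 <= V & (ALL t. EV M (%s. iexp (t*(SUM i:J. a i \<bullet> gsrc i s)))
   = iexp (t*m)*exp (- (complex_of_real (t^2*V)/2)))" proof - define m where "m i = EV M (%s. a i \<bullet> gsrc i s)" for i
 define V where "V i = variance (%s. a i \<bullet> gsrc i s)" for i
 have g: "gaussian1 (%s. a i \<bullet> gsrc i s) (m i) (V i)" for i
  using gsrc_gaussian[of "a i" i] gaussian1_moments unfolding m_def V_def by fastforce
 have "EV M (%s. iexp (t*(SUM i:J. a i \<bullet> gsrc i s)))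
   = iexp (t*(SUM i:J. m i))*exp (- (complex_of_real (t^2*(SUM i:J. V i))/2))" for t proof -
  have "EV M (%s. iexp (t*(SUM i:J. a i \<bullet> gsrc i s))) = EV M (%s. (PROD i:J. iexp (t*(a i \<bullet> gsrc i s))))"
   by (simp add: exp_sum[OF assms] sum_dl)
  also have "... = (PROD i:J. \<integral>s. iexp (t*(a i \<bullet> gsrc i s)) \<partial>M)"
  proof (rule indep_vars_lebesgue_integral[OF assms])
   show "indep_vars (%_. borel) (%i s. iexp (t*(a i \<bullet> gsrc i s))) J"
    by (rule indep_vars_compose2[OF indep_vars_subset[OF gsrc_indep subset_UNIV]]) measurable
   show "integrable M (%s. iexp (t*(a i \<bullet> gsrc i s)))" for i
    using gsrc_measurable[of i] by (intro integrable_const_bound[of _ 1]) auto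
  qed also have "... = (PROD i:J. iexp (t*m i)*exp (- (complex_of_real (t^2*V i)/2)))" by (simp only: gaussian1_char[OF g])
  also have "... = iexp (t*(SUM i:J. m i))*exp (- (complex_of_real (t^2*(SUM i:J. V i))/2))"
   by (simp add: prod.distrib exp_sum[OF assms, symmetric] sum_dl sum_divide_distrib sum_negf)
  finally show ?thesis .
 qed moreover have "0 <= (SUM i:J. V i)" using g by (intro sum_nonneg) (auto simp: gaussian1_def)
 ultimately show ?thesis by (intro exI conjI allI)
qed

lemma lin_gaussian: assumes "lin f" shows "L2 f" "gaussian1 f (EV M (%s. f s)) (variance f)" proof -
 obtain J a c where J: "finite J" and f: "f = (%s. c+(SUM i:J. a i \<bullet> gsrc i s))"
  using assms unfolding lin_def by (elim exE conjE)
 obtain m V where V: "0 <= V" and ch: "!!t. EV M (%s. iexp (t*(SUM i:J. a i \<bullet> gsrc i s)))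
   = iexp (t*m)*exp (- (complex_of_real (t^2*V)/2))" using lin_char[OF J, of a] by (elim exE conjE) blast
 have "gaussian1 f (c+m) V" proof (rule gaussian1_charI[OF _ V])
  show "f : bm M" unfolding f using gsrc_measurable by auto
  fix t have "EV M (%s. iexp (t*f s)) = EV M (%s. iexp (t*c)*iexp (t*(SUM i:J. a i \<bullet> gsrc i s)))"
   by (simp only: f exp_add[symmetric] distrib_left of_real_add)
  thus "EV M (%s. iexp (t*f s)) = iexp (t*(c+m))*exp (- (complex_of_real (t^2*V)/2))"
   by (simp only: integral_mult_right_zero ch distrib_left of_real_add exp_add mult.assoc)
 qed thus "L2 f" "gaussian1 f (EV M (%s. f s)) (variance f)" using gaussian1_moments[of f] by auto
qed

lemma lin_const: "lin (%_. c)" unfolding lin_def by (intro exI[of _ "{}"]) auto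

lemma lin_gsrc: "lin (%s. a \<bullet> gsrc i s)"
 unfolding lin_def by (rule exI[of _ "{i}"], rule exI[of _ "%_. a"], rule exI[of _ 0]) simp

lemma lin_add: assumes "lin f" "lin g" shows "lin (%s. f s+g s)" proof -
 obtain J a c where J: "finite J" and f: "f = (%s. c+(SUM i:J. a i \<bullet> gsrc i s))"
  using assms(1) unfolding lin_def by (elim exE conjE)
 obtain J' a' c' where J': "finite J'" and g: "g = (%s. c'+(SUM i:J'. a' i \<bullet> gsrc i s))"
  using assms(2) unfolding lin_def by (elim exE conjE)
 let ?a = "%i. (if i : J then a i else 0)+(if i : J' then a' i else 0)"
 have "(SUM i:J. a i \<bullet> gsrc i s) = (SUM i:J\<union>J'. (if i : J then a i else 0) \<bullet> gsrc i s)"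
  "(SUM i:J'. a' i \<bullet> gsrc i s) = (SUM i:J\<union>J'. (if i : J' then a' i else 0) \<bullet> gsrc i s)" for s
  using J J' by (intro sum.mono_neutral_cong_left; auto)+
 hence "(%s. f s+g s) = (%s. (c+c')+(SUM i:J\<union>J'. ?a i \<bullet> gsrc i s))"
  unfolding f g by (simp add: inner_add_left sum.distrib add_ac)
 with J J' show ?thesis unfolding lin_def by (intro exI[of _ "J Un J'"] exI[of _ ?a] exI[of _ "c+c'"] conjI finite_UnI)
qed

lemma lin_scale: assumes "lin f" shows "lin (%s. t*f s)" proof -
 obtain J a c where J: "finite J" and f: "f = (%s. c+(SUM i:J. a i \<bullet> gsrc i s))"
  using assms(1) unfolding lin_def by (elim exE conjE)
 have "(%s. t*f s) = (%s. t*c+(SUM i:J. (t *\<^sub>R a i) \<bullet> gsrc i s))" unfolding f by (simp add: distrib_left sum_dl)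
 with J show ?thesis unfolding lin_def by (intro exI conjI)
qed

lemma lin_sum: "(!!i. i : I ==> lin (f i)) ==> lin (%s. SUM i:I. f i s)"
 by (induction I rule: infinite_finite_induct) (auto intro: lin_const lin_add)

definition gauss_src :: "noise_index option set" where "gauss_src = - range (%k. Some (Chan k))"

definition chan_src :: "noise_index option set" where "chan_src = range (%k. Some (Chan k))"

lemma lin_hist: assumes "lin f" shows "f : bm (hist gauss_src)" proof -
 obtain J a c where J: "finite J" and f: "f = (%s. c+(SUM i:J. a i \<bullet> gsrc i s))"
  using assms(1) unfolding lin_def by (elim exE conjE)
 have "gsrc i : bm (hist gauss_src)" for i unfolding gsrc_def
  by (auto intro!: noise_hist split: option.split noise_index.split) (auto simp: gauss_src_def)
 thus ?thesis unfolding f by auto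
qed

text \<open>\<open>e + f\<close> is Gaussian again, and its variance is the sum of the variances
  because the covariance is 0.\<close>

lemma lin_char_product: assumes e: "lin e" and f: "lin f" and cov: "EV M (%s. (e s-EV M e)*f s) = 0"
 shows "EV M (%s. iexp (e s)*iexp (f s)) = EV M (%s. iexp (e s))*EV M (%s. iexp (f s))" proof -
 have c: "EV M (%s. iexp (g s)) = iexp (EV M g)*exp (- (complex_of_real (variance g)/2))"
  if "lin g" for g using gaussian1_char[OF lin_gaussian(2)[OF that], of 1] by simp
 note ef = lin_add[OF e f]
 note L = lin_gaussian(1)[OF e] lin_gaussian(1)[OF f]
 have i: "integrable M e" "integrable M f" "EV M (%s. e s+f s) = EV M e+EV M f"
  using L2_integrable[OF L(1)] L2_integrable[OF L(2)] by auto
 have sq: "integrable M (%s. (g s-EV M g)^2)" if "L2 g" for g :: "'a => real"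
  using L2_diff[OF that L2_const[of "EV M g"]] by (simp add: L2_def pow2 inner_real_def)
 have ip: "integrable M (%s. (e s-EV M e)*f s)" using L2_inner[OF L2_diff[OF L(1) L2_const[of "EV M e"]] L(2)] by simp
 have "variance (%s. e s+f s) = EV M (%s. (e s-EV M e)^2+(f s-EV M f)^2 +(2*((e s-EV M e)*f s)-2*EV M f*(e s-EV M e)))"
  unfolding i by (intro EV_cong) (simp add: pow2 algebra_simps)
 also have "... = variance e+variance f" using sq[OF L(1)] sq[OF L(2)] ip i cov by (simp add: prob_space)
 finally have v: "variance (%s. e s+f s) = variance e+variance f" .
 have "EV M (%s. iexp (e s)*iexp (f s)) = EV M (%s. iexp (e s+f s))" by (simp only: exp_add[symmetric] distrib_left of_real_add)
 also have "... = EV M (%s. iexp (e s))*EV M (%s. iexp (f s))" unfolding c[OF ef] c[OF e] c[OF f] v unfolding i(3)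
  by (simp add: exp_add[symmetric] algebra_simps add_divide_distrib)
 finally show ?thesis .
qed

abbreviation cyl :: "('j => 'a => real) => 'j set => ('j => real set) => 'a set" where
 "cyl Y T B \<equiv> {s : space M. ALL j:T. Y j s : B j}"

text \<open>Uncorrelated implies independent, for \<open>e\<close> against a whole finite family.
  For each exponential of \<open>e\<close>, the exponentials of the family are exchanged for the
  indicator of the cylinder; afterwards the exponential of \<open>e\<close> is exchanged for the
  indicator of \<open>E\<close>.\<close>

lemma lin_indep_prob: assumes e: "lin e" and T: "finite T" and Y: "ALL j:T. lin (Y j)"
  and cov: "ALL j:T. EV M (%s. (e s-EV M e)*Y j s) = 0" and B: "!!j. B j : sets borel" and E: "E : sets borel"
 shows "prob (cyl Y T B Int {s : space M. e s : E}) = prob (cyl Y T B)*prob {s : space M. e s : E}" proof -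
 let ?A = "cyl Y T B" and ?E = "{s : space M. e s : E}"
 note L2e = lin_gaussian(1)[OF e]
 have em[measurable]: "e : bm M" by (rule L2_measurable[OF L2e])
 have Ym: "ALL j:T. Y j : bm M" using Y lin_gaussian(1) L2_measurable by blast
 have A[measurable]: "?A : events" and EE[measurable]: "?E : events" using Ym B E T by (auto intro!: sets.sets_Collect_finite_All)
 have ind: "(PROD j:T. indicator (B j) (Y j s)) = (indicator ?A s :: complex)" if "s : space M" for s
  using T that by (auto simp: indicator_def prod_zero_iff)
 define \<phi> where "\<phi> t = EV M (%s. iexp (t*e s))" for t
 have Ie: "integrable M (%s. iexp (t*e s))" for t by (rule integrable_const_bound[of _ 1]) auto
 have \<phi>1: "cmod (\<phi> t) <= 1" for t
  using integral_norm_bound[of M "%s. iexp (t*e s)"] by (simp add: \<phi>_def prob_space)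
 have key: "EV M (%s. (iexp (t*e s)-\<phi> t)*indicator ?A s) = 0" for t proof -
  have "EV M (%s. (iexp (t*e s)-\<phi> t)*(PROD j:T. indicator (B j) (Y j s))) = 0" proof (rule char_zero_finite[OF T, of Y _ 2])
   fix u let ?f = "%s. SUM j:T. u j*Y j s"
   have f: "lin ?f" using Y by (intro lin_sum lin_scale) auto
   have fm[measurable]: "?f : bm M" by (rule L2_measurable[OF lin_gaussian(1)[OF f]])
   have "EV M (%s. (t*e s-EV M (%s. t*e s))*?f s) = EV M (%s. (SUM j:T. t*u j*((e s-EV M e)*Y j s)))"
    by (intro EV_cong) (simp add: sum_dl, intro sum.cong refl, simp add: algebra_simps)
   also have "... = (SUM j:T. \<integral>s. t*u j*((e s-EV M e)*Y j s) \<partial>M)"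
    using L2_inner[OF L2_diff[OF L2e L2_const[of "EV M e"]] lin_gaussian(1)] Y by (intro Bochner_Integration.integral_sum) auto
   finally have "EV M (%s. (t*e s-EV M (%s. t*e s))*?f s) = 0" using cov by simp
   from lin_char_product[OF lin_scale[OF e] f this]
   have p: "EV M (%s. iexp (t*e s)*iexp (?f s)) = \<phi> t*EV M (%s. iexp (?f s))" unfolding \<phi>_def .
   have "integrable M (%s. iexp (t*e s)*iexp (?f s))"
    by (rule integrable_const_bound[of _ 1], rule AE_I2, simp add: norm_mult del: of_real_sum, measurable)
   moreover have "integrable M (%s. iexp (?f s))"
    by (rule integrable_const_bound[of _ 1], rule AE_I2, simp del: of_real_sum, measurable)
   ultimately show "EV M (%s. (iexp (t*e s)-\<phi> t)*iexp (?f s)) = 0"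
    unfolding left_diff_distrib by (subst Bochner_Integration.integral_diff) (simp_all only: integrable_mult_right p integral_mult_right_zero diff_self simp_thms)
  next show "cmod (iexp (t*e s)-\<phi> t) <= 2" for s
    using norm_triangle_ineq4[of "iexp (t*e s)" "\<phi> t"] \<phi>1[of t] by simp
  qed (use Ym B in auto)
  also have "EV M (%s. (iexp (t*e s)-\<phi> t)*(PROD j:T. indicator (B j) (Y j s)))
    = EV M (%s. (iexp (t*e s)-\<phi> t)*indicator ?A s)" using ind by (intro EV_cong) simp
  finally show ?thesis .
 qed have IA: "integrable M (%s. iexp (t*e s)*indicator ?A s)" for t
  by (rule integrable_const_bound[of _ 1]) (auto simp: norm_mult indicator_def)
 have Ii: "integrable M (%s. indicator ?A s :: complex)" by (rule integrable_const_bound[of _ 1]) (auto simp: indicator_def)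
 have iA: "EV M (%s. indicator ?A s) = complex_of_real (prob ?A)" proof -
  have "EV M (%s. indicator ?A s) = EV M (%s. complex_of_real (indicator ?A s))" by (intro EV_cong) (simp add: indicator_def)
  also have "... = complex_of_real (EV M (%s. indicator ?A s))" by (rule integral_complex_of_real)
  finally show ?thesis using A by (simp add: Int_absorb2)
 qed have "EV M (%s. (indicator ?A s-complex_of_real (prob ?A))*indicator E (e s)) = 0"
 proof (rule char_zero[OF em _ _ _ _ E, of _ 2])
  fix t have "EV M (%s. iexp (t*e s)*indicator ?A s-\<phi> t*indicator ?A s) = 0"
   using key[of t] by (simp only: left_diff_distrib)
  hence "EV M (%s. iexp (t*e s)*indicator ?A s) = \<phi> t*complex_of_real (prob ?A)"
   using IA[of t] integrable_mult_right[OF Ii] by (subst (asm) Bochner_Integration.integral_diff) (auto simp: iA simp del: of_real_mult)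
  thus "EV M (%s. (indicator ?A s-complex_of_real (prob ?A))*iexp (t*e s)) = 0"
   using IA[of t] Ie[of t] by (simp only: left_diff_distrib mult.commute[of "iexp _"])
    (subst Bochner_Integration.integral_diff, auto simp: \<phi>_def mult.commute)
 next fix s have "cmod (indicator ?A s) <= 1" by (simp add: indicator_def)
  thus "cmod (indicator ?A s-complex_of_real (prob ?A)) <= 2"
   using norm_triangle_ineq4[of "indicator ?A s" "complex_of_real (prob ?A)"] prob_le_1[of ?A]
    measure_nonneg[of M ?A] unfolding norm_of_real by linarith
 qed auto
 hence "EV M (%s. complex_of_real (indicator (?A Int ?E) s-prob ?A*indicator ?E s)) = 0"
  by (rule trans[rotated]) (intro EV_cong, auto simp: indicator_def)
 hence "EV M (%s. indicator (?A Int ?E) s-prob ?A*indicator ?E s) = (0::real)"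
  by (simp only: integral_complex_of_real of_real_eq_0_iff)
 moreover have "EV M (%s. indicator (?A Int ?E) s-prob ?A*indicator ?E s) = prob (?A Int ?E)-prob ?A*prob ?E"
  by (subst Bochner_Integration.integral_diff) (auto simp: Int_absorb1 emeasure_eq_measure)
 ultimately show ?thesis by simp
qed

abbreviation obs_basis where
 "obs_basis Y T \<equiv> {cyl Y T B Int b | B b. (ALL j. B j : sets borel) & b : sets (hist chan_src)}"

text \<open>All channel variables enter, future ones included: being independent of the Gaussian
  sources they do no harm, and the field then contains whatever a controller may know. The
  generators are intersections so that they form a pi-system.\<close>

definition obs_field :: "('j => 'a => real) => 'j set => 'a measure" where "obs_field Y T = sigma (space M) (obs_basis Y T)"

lemma obs_field_basis: "obs_basis Y T \<subseteq> Pow (space M)" by auto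

lemma space_obs_field [simp]: "space (obs_field Y T) = space M"
 unfolding obs_field_def by (rule space_measure_of[OF obs_field_basis])

lemma sets_obs_field: "sets (obs_field Y T) = sigma_sets (space M) (obs_basis Y T)"
 unfolding obs_field_def by (rule sets_measure_of[OF obs_field_basis])

lemma obs_field_basis_events: assumes "finite T" "ALL j:T. Y j : bm M" "!!j. B j : sets borel" shows "cyl Y T B : events"
 using assms by (auto intro!: sets.sets_Collect_finite_All)

lemma obs_field_subalgebra: assumes "finite T" "ALL j:T. Y j : bm M" shows "subalgebra M (obs_field Y T)" proof -
 have "sets (hist chan_src) \<subseteq> events" using hist_subalgebra by (simp add: subalgebra_def)
 hence "obs_basis Y T \<subseteq> events" using obs_field_basis_events[of T Y] assms by (auto intro!: sets.Int)
 thus ?thesis unfolding subalgebra_def sets_obs_field by (simp add: sets.sigma_sets_subset)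
qed

lemma obs_field_measurable: assumes "j : T" shows "Y j : bm (obs_field Y T)" proof (rule measurableI)
 fix E :: "real set" assume E: "E : sets borel"
 let ?B = "%i. if i = j then E else UNIV"
 have "Y j -` E Int space M = {s : space M. ALL i:T. Y i s : ?B i} Int space M" using assms by auto
 moreover have "space M : sets (hist chan_src)" using sets.top[of "hist chan_src"] by simp
 ultimately show "Y j -` E Int space (obs_field Y T) : sets (obs_field Y T)" unfolding sets_obs_field space_obs_field
  by (intro sigma_sets.Basic CollectI exI[of _ ?B] exI[of _ "space M"]) (use E in auto)
qed simp

lemma obs_field_chan: "sets (hist chan_src) \<subseteq> sets (obs_field Y T)" proof
 fix b assume b: "b : sets (hist chan_src)"
 hence "b = {s : space M. ALL i:T. Y i s : UNIV} Int b" using sets.sets_into_space[OF b] by auto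
 thus "b : sets (obs_field Y T)" unfolding sets_obs_field
  by (intro sigma_sets.Basic CollectI exI[of _ "%_. UNIV"] exI[of _ b]) (use b in auto)
qed

text \<open>On the generating pi-system, Gaussian independence of \<open>e\<close> from the cylinder
  is combined with independence of the channel from all Gaussian sources.\<close>

lemma obs_field_indep: assumes e: "lin e" and T: "finite T" and Y: "ALL j:T. lin (Y j)"
  and cov: "ALL j:T. EV M (%s. (e s-EV M e)*Y j s) = 0" shows "indep_set (sets (obs_field Y T)) (sigma_sets (space M) (pre M e))"
 unfolding sets_obs_field proof (rule indep_set_sigma_sets)
 let ?G = "obs_basis Y T"
 show "Int_stable (pre M e)" by (rule Int_stable_vimage)
 show "Int_stable ?G" proof (rule Int_stableI, safe)
  fix B B' :: "'b => real set" and b b'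
  assume *: "ALL j. B j : sets borel" "b : sets (hist chan_src)" "ALL j. B' j : sets borel" "b' : sets (hist chan_src)"
  show "EX C c. cyl Y T B Int b Int ({s : space M. ALL j:T. Y j s : B' j} Int b')
    = {s : space M. ALL j:T. Y j s : C j} Int c & (ALL j. C j : sets borel) & c : sets (hist chan_src)"
   by (rule exI[of _ "%j. B j Int B' j"], rule exI[of _ "b Int b'"]) (use * in auto)
 qed have Ym: "ALL j:T. Y j : bm M" using Y lin_gaussian(1) L2_measurable by blast
 have em: "e : bm M" by (rule L2_measurable[OF lin_gaussian(1)[OF e]])
 have GM: "sets (hist chan_src) \<subseteq> events" using hist_subalgebra by (simp add: subalgebra_def)
 show "indep_set ?G (pre M e)" unfolding indep_sets2_eq proof (intro conjI ballI)
  show "?G \<subseteq> events" using obs_field_basis_events[OF T Ym] GM by (auto intro!: sets.Int)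
  show "pre M e \<subseteq> events" using em by (auto intro: measurable_sets)
  fix a d assume "a : ?G" "d : pre M e"
  then obtain B b E where *: "!!j. B j : sets borel" "b : sets (hist chan_src)" "E : sets borel"
   and a: "a = cyl Y T B Int b" and d: "d = {s : space M. e s : E}" by (auto simp: vimage_def Int_def conj_commute)
  let ?A = "cyl Y T B"
  have N: "{s : space M. f s : F} : sets (hist gauss_src)" if "lin f" "F : sets borel" for f F
   using measurable_sets[OF lin_hist[OF that(1)] that(2)] by (simp add: vimage_def Int_def conj_commute)
  have A: "?A : sets (hist gauss_src)"
   using sets.sets_Collect_finite_All[OF _ T, of "hist gauss_src" "%j s. Y j s : B j"] N[OF bspec[OF Y] *(1)]
   by (simp only: space_hist)
  have ind: "prob (x Int b) = prob x*prob b" if "x : sets (hist gauss_src)" for x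
   using hist_indep[of gauss_src chan_src] that *(2) unfolding indep_sets2_eq by (auto simp: gauss_src_def chan_src_def)
  have "prob (a Int d) = prob ((?A Int d) Int b)" unfolding a by (simp add: Int_ac)
  also have "... = prob (?A Int d)*prob b" using A N[OF e *(3)] unfolding d by (intro ind sets.Int)
  also have "... = prob a*prob d" unfolding d lin_indep_prob[OF e T Y cov *(1) *(3)] a ind[OF A] by simp
  finally show "prob (a Int d) = prob a*prob d" .
 qed qed

lemma obs_field_centred: assumes e: "lin e" "EV M e = 0" and T: "finite T" and Y: "ALL j:T. lin (Y j)"
  and cov: "ALL j:T. EV M (%s. e s*Y j s) = 0" shows "centred (obs_field Y T) e" proof -
 have em: "e : bm M" by (rule L2_measurable[OF lin_gaussian(1)[OF e(1)]])
 have Ym: "ALL j:T. Y j : bm M" using Y lin_gaussian(1) L2_measurable by blast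
 let ?G = "vimage_algebra (space M) e borel"
 have G: "sets ?G = sigma_sets (space M) (pre M e)" by (simp add: sets_vimage_algebra)
 show ?thesis proof (rule indep_centred[OF obs_field_subalgebra[OF T Ym], where G="?G"])
  show "indep_set (sets (obs_field Y T)) (sets ?G)" unfolding G using obs_field_indep[OF e(1) T Y] cov e by simp
  thus "subalgebra M ?G" unfolding indep_sets2_eq by (simp add: subalgebra_def)
  show "e : bm ?G" by (rule measurable_vimage_algebra1) simp
 qed (use e L2_integrable lin_gaussian in auto)
qed

text \<open>If \<open>e\<close> has positive variance, it is independent of \<open>r\<close> and its
  law has no atoms, so \<open>e + r = 0\<close> is a null event by integration over the product of
  the laws. If its variance is 0, then \<open>e = 0\<close> almost surely.\<close>

lemma obs_field_atom: assumes e: "lin e" "EV M e = 0" and T: "finite T" and Y: "ALL j:T. lin (Y j)"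
  and cov: "ALL j:T. EV M (%s. e s*Y j s) = 0" and r: "r : bm (obs_field Y T)" shows "AE s in M. e s+r s = 0 --> r s = 0"
proof (cases "variance e = 0")
 case True hence "AE s in M. e s = 0" using gaussian1_AE lin_gaussian(2)[OF e(1)] e(2) by simp
 thus ?thesis by eventually_elim simp
next case False have em[measurable]: "e : bm M" by (rule L2_measurable[OF lin_gaussian(1)[OF e(1)]])
 have Ym: "ALL j:T. Y j : bm M" using Y lin_gaussian(1) L2_measurable by blast
 note sub = obs_field_subalgebra[OF T Ym]
 have rm[measurable]: "r : bm M" by (rule measurable_from_subalg[OF sub r])
 have "indep_set (sigma_sets (space M) (pre M r)) (sigma_sets (space M) (pre M e))" proof -
  have "pre M r \<subseteq> sets (obs_field Y T)" using measurable_sets[OF r] by auto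
  hence "sigma_sets (space (obs_field Y T)) (pre M r) \<subseteq> sets (obs_field Y T)" by (rule sets.sigma_sets_subset)
  thus ?thesis using indep_set_mono[OF obs_field_indep[OF e(1) T Y]] cov e by simp
 qed hence "indep_var borel r borel e" unfolding indep_var_eq by simp
 hence d: "distr M borel r \<Otimes>\<^sub>M distr M borel e = distr M (borel \<Otimes>\<^sub>M borel) (%s. (r s, e s))"
  by (simp add: indep_var_distribution_eq)
 interpret R: prob_space "distr M borel r" by (rule prob_space_distr) simp
 interpret E: prob_space "distr M borel e" by (rule prob_space_distr) simp
 interpret RE: pair_sigma_finite "distr M borel r" "distr M borel e" ..
 have "AE z in distr M borel r \<Otimes>\<^sub>M distr M borel e. snd z+fst z ~= 0" proof (rule RE.AE_pair_measure)
  show "{z : space (distr M borel r \<Otimes>\<^sub>M distr M borel e). snd z+fst z ~= 0} : sets (distr M borel r \<Otimes>\<^sub>M distr M borel e)"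
   by measurable
  show "AE x in distr M borel r. AE y in distr M borel e. snd (x, y)+fst (x, y) ~= 0" proof (rule AE_I2)
   fix x show "AE y in distr M borel e. snd (x, y)+fst (x, y) ~= 0"
    using gaussian1_atomless[OF lin_gaussian(2)[OF e(1)] False, of "- x"] by eventually_elim (simp add: eq_neg_iff_add_eq_0)
  qed qed hence "AE s in M. e s+r s ~= 0" unfolding d by (subst (asm) AE_distr_iff) auto
 thus ?thesis by eventually_elim simp
qed

end

section \<open>Covariances and the filter of the uncontrolled plant\<close>

lemma bm_matrix: "f : bm F ==> (%s. (W::real^'n^'m) *v f s) : bm F"
 by (erule measurable_compose[OF _ borel_measurable_continuous_onI]) (simp add: matrix_vector_mult_linear_continuous_on)

lemma borel_measurable_comp: "f : bm F ==> (%s. a \<bullet> f s) : bm F" for f :: "'a => real^'n" by measurable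

context prob_space begin

text \<open>Second moments about 0; the function is a covariance for vectors of mean 0, the case in
  which it is applied.\<close>

definition has_cov :: "('a => real^'n) => real^'n^'n => bool" where
 "has_cov f P \<longleftrightarrow> L2 f & (ALL a b. EV M (%s. (a \<bullet> f s)*(b \<bullet> f s)) = a \<bullet> (P *v b))"

lemma L2_mult: "L2 f ==> L2 g ==> integrable M (%s. (a \<bullet> f s)*(b \<bullet> g s))"
 using L2_inner[OF L2_comp[of f a] L2_comp[of g b]] by (simp add: inner_commute)

lemma has_cov_matrix: assumes "has_cov f P" shows "has_cov (%s. (W::real^'n^'m) *v f s) (W**P**tp W)"
 using assms unfolding has_cov_def inner_tr[of _ W] mv_mult by (simp add: L2_matrix)

lemma has_cov_uminus: "has_cov f P ==> has_cov (%s.-f s) P" by (simp add: has_cov_def L2_uminus)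

lemma has_cov_add:
 assumes f: "has_cov f P" and g: "has_cov g R" and o: "!!a b. EV M (%s. (a \<bullet> f s)*(b \<bullet> g s)) = 0"
 shows "has_cov (%s. f s+g s) (P+R)" unfolding has_cov_def proof (intro conjI allI)
 have L: "L2 f" "L2 g" using f g by (auto simp: has_cov_def)
 show "L2 (%s. f s+g s)" by (rule L2_add[OF L])
 fix a b
 note I = L2_mult[OF L(1) L(1), of a b] L2_mult[OF L(1) L(2), of a b] L2_mult[OF L(1) L(2), of b a] L2_mult[OF L(2) L(2), of a b]
 have "EV M (%s. (a \<bullet> (f s+g s))*(b \<bullet> (f s+g s)))
  = EV M (%s. ((a \<bullet> f s)*(b \<bullet> f s)+(a \<bullet> g s)*(b \<bullet> g s))+((a \<bullet> f s)*(b \<bullet> g s)+(b \<bullet> f s)*(a \<bullet> g s)))"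
  by (simp add: inner_add_right algebra_simps)
 also have "... = a \<bullet> (P *v b)+a \<bullet> (R *v b)" using I o f g by (simp add: has_cov_def)
 finally show "EV M (%s. (a \<bullet> (f s+g s))*(b \<bullet> (f s+g s))) = a \<bullet> ((P+R) *v b)"
  by (simp add: matrix_vector_mult_add_rdistrib inner_add_right)
qed

lemma has_cov_gaussian: assumes "gaussian_rv M f m W" shows "has_cov (%s. f s-m) W" "L2 f" "EV M (%s. f s) = m" proof -
 have W: "tp W = W" using assms by (auto simp: gaussian_rv_def gaussian_law_def psd_def)
 note g = gaussian1_moments[OF gaussian_rv_gaussian1[OF assms]]
 show L: "L2 f" using g(1)[of "axis i 1" for i] by (intro L2_vec) (simp add: inner_axis')
 have "a \<bullet> EV M (%s. f s) = a \<bullet> m" for a using g(2)[of a] L2_integrable[OF L] by simp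
 thus "EV M (%s. f s) = m" using vector_eq_ldot by blast
 let ?f = "%s. f s-m"
 have Lf: "L2 ?f" by (rule L2_diff[OF L L2_const])
 have q: "EV M (%s. (a \<bullet> ?f s)^2) = qf W a" for a using g(3)[of a] by (simp add: inner_diff_right)
 show "has_cov ?f W" unfolding has_cov_def proof (intro conjI allI Lf)
  fix a b have I: "integrable M (%s. (a \<bullet> ?f s)^2)" for a using L2_mult[OF Lf Lf, of a a] by (simp add: pow2)
  have "EV M (%s. (a \<bullet> ?f s)*(b \<bullet> ?f s)) = EV M (%s. (((a+b) \<bullet> ?f s)^2-(a \<bullet> ?f s)^2-(b \<bullet> ?f s)^2)/2)"
   by (intro EV_cong) (simp add: inner_add_left pow2 algebra_simps)
  also have "... = (qf W (a+b)-qf W a-qf W b)/2" using I[of a] I[of b] I[of "a+b"] by (simp add: q)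
  also have "... = a \<bullet> (W *v b)" using symmetric_inner[OF W, of a b] by (simp add: mv_add inner_add)
  finally show "EV M (%s. (a \<bullet> ?f s)*(b \<bullet> ?f s)) = a \<bullet> (W *v b)" .
 qed qed

lemma centred_cross: fixes f :: "'a => real^'n" and g :: "'a => real^'m"
 assumes "subalgebra M F" "centred F f" "L2 f" "g : bm F" "L2 g" shows "EV M (%s. (a \<bullet> f s)*(b \<bullet> g s)) = 0"
proof - have c: "centred F (%s. a \<bullet> f s)" by (rule centred_linear[OF assms(1,2) bounded_linear_inner_right])
 have "EV M (%s. (b \<bullet> g s)*(a \<bullet> f s)) = 0"
  by (rule centred_mult[OF assms(1) c borel_measurable_comp[OF assms(4)] L2_mult[OF assms(5,3)]])
 thus ?thesis by (simp only: mult.commute)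
qed

end

context noises begin

definition vlin :: "('a => real^'m) => bool" where "vlin f \<longleftrightarrow> (ALL a. lin (%s. a \<bullet> f s))"

lemma vlin_add: "vlin f ==> vlin g ==> vlin (%s. f s+g s)" by (simp add: vlin_def inner_add_right lin_add)

lemma vlin_matrix: "vlin f ==> vlin (%s. (W::real^'k^'m) *v f s)" by (simp add: vlin_def inner_tr[of _ W])

lemma vlin_uminus: "vlin f ==> vlin (%s.-f s)" unfolding vlin_def using lin_scale[of "%s. a \<bullet> f s" "-1" for a] by auto

lemma vlin_diff: "vlin f ==> vlin g ==> vlin (%s. f s-g s)" using vlin_add[of f "%s.-g s"] vlin_uminus[of g] by simp

lemma vlin_const: "vlin (%_. c)" by (simp add: vlin_def lin_const)

lemma vlin_noise: "vlin x0" "vlin (w k)" "vlin (v k)"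
 using lin_gsrc[of _ None] lin_gsrc[of _ "Some (Proc k)"] lin_gsrc[of _ "Some (Obs k)"] by (auto simp: vlin_def gsrc_def)

lemma vlin_nth: "vlin f ==> lin (%s. f s $ i)" unfolding vlin_def by (drule spec[of _ "axis i 1"]) (simp add: inner_axis')

lemma vlin_L2: "vlin f ==> L2 f" by (intro L2_vec lin_gaussian(1) vlin_nth)

text \<open>Three separate bounds, because within one time step the observation noise, the channel
  variable and the process noise enter one after the other.\<close>

definition past :: "nat => nat => nat => noise_index option set" where
 "past k l m = insert None (Some ` (Proc ` {..<k} Un Obs ` {..<l} Un Chan ` {..<m}))"

abbreviation upto where "upto k \<equiv> past k (Suc k) (Suc k)"

lemma past_mono: "k <= k' ==> l <= l' ==> m <= m' ==> past k l m \<subseteq> past k' l' m'" by (auto simp: past_def)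

lemma hist_past_mono:
 "f : measurable (hist (past k l m)) N ==> k <= k' ==> l <= l' ==> m <= m' ==> f : measurable (hist (past k' l' m')) N"
 by (erule hist_measurable_mono) (rule past_mono)

lemma noise_L2: "L2 x0" "L2 (w k)" "L2 (v k)" using has_cov_gaussian(2) x0_gaussian w_gaussian v_gaussian by blast+

lemma noise_mean: "EV M (%s. x0 s) = m0" "EV M (%s. w k s) = 0" "EV M (%s. v k s) = 0"
 using has_cov_gaussian(3) x0_gaussian w_gaussian v_gaussian by blast+

lemma w_centred: "k <= j ==> centred (hist (past k l m)) (w j)" by (rule hist_centred[of _ "{Some (Proc j)}"])
  (auto simp: past_def noise_hist noise_mean L2_integrable[OF noise_L2(2)])

lemma v_centred: "l <= j ==> centred (hist (past k l m)) (v j)" by (rule hist_centred[of _ "{Some (Obs j)}"])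
  (auto simp: past_def noise_hist noise_mean L2_integrable[OF noise_L2(3)])

end

locale plant = noises M x0 w v eta m0 W0 Qw Qv p
 for M :: "'a measure" and x0 :: "'a => real^'n" and w v :: "nat => 'a => real^'n" and eta :: "nat => 'a => real"
  and m0 :: "real^'n" and W0 Qw Qv :: "real^'n^'n" and p :: real + fixes A C :: "real^'n^'n"
begin

primrec xf where "xf 0 = x0"
| "xf (Suc k) = (%s. A *v xf k s+w k s)"

definition yf where "yf k s = C *v xf k s+v k s"

definition pre_cov where "pre_cov k = (case k of 0 => W0 | Suc j => predict_cov A Qw (filter_cov A C Qw Qv W0 j))"

abbreviation "H k \<equiv> kalman_gain C Qv (pre_cov k)"

primrec est where "est 0 = (%s. m0+H 0 *v (yf 0 s-C *v m0))"
| "est (Suc k) = (%s. A *v est k s+H (Suc k) *v (yf (Suc k) s-C *v (A *v est k s)))"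

definition pre where "pre k = (case k of 0 => %_. m0 | Suc j => %s. A *v est j s)"

definition err where "err k s = xf k s-est k s"

definition perr where "perr k s = xf k s-pre k s"

abbreviation "gfield t \<equiv> obs_field (%(j, i) s. yf j s $ i) ({..<t} \<times> UNIV)"

text \<open>For such Gaussian vectors being uncorrelated amounts to independence from
  \<open>gfield t\<close>, channel variables included. The notion is linear and needs only
  covariances to be checked; \<open>perp_centred\<close> and \<open>perp_atom\<close> draw the
  probabilistic conclusions.\<close>

definition perp :: "nat => ('a => real^'n) => bool" where
 "perp t f \<longleftrightarrow> vlin f & EV M (%s. f s) = 0 & (ALL j<t. ALL a b. EV M (%s. (a \<bullet> f s)*(b \<bullet> yf j s)) = 0)"

lemma xf_vlin: "vlin (xf k)" by (induction k) (auto intro: vlin_noise vlin_add vlin_matrix)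

lemma yf_vlin: "vlin (yf k)" unfolding yf_def[abs_def] by (intro vlin_noise vlin_add vlin_matrix xf_vlin)

lemma xf_hist: "xf k : bm (hist (past k 0 0))" proof (induction k) case (Suc k)
 have "w k : bm (hist (past (Suc k) 0 0))" by (rule w_hist) (auto simp: past_def)
 moreover have "xf k : bm (hist (past (Suc k) 0 0))" by (rule hist_past_mono[OF Suc]) auto
 ultimately show ?case unfolding xf.simps by (intro bm_add bm_matrix)
qed (simp, rule x0_hist, simp add: past_def)

lemma yf_hist: "yf k : bm (hist (past k (Suc k) 0))" proof -
 have "v k : bm (hist (past k (Suc k) 0))" by (rule v_hist) (auto simp: past_def)
 moreover have "xf k : bm (hist (past k (Suc k) 0))" by (rule hist_past_mono[OF xf_hist]) auto
 ultimately show ?thesis unfolding yf_def[abs_def] by (intro bm_add bm_matrix)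
qed

lemma gfield_subalgebra: "subalgebra M (gfield t)"
 by (rule obs_field_subalgebra) (auto intro!: L2_measurable[OF lin_gaussian(1)] vlin_nth yf_vlin)

lemma yf_gfield: "j < t ==> yf j : bm (gfield t)" proof - assume j: "j < t"
 have "(%s. yf j s $ i) : bm (gfield t)" for i
  using obs_field_measurable[of "(j, i)" "{..<t} \<times> UNIV" "%(j, i) s. yf j s $ i"] j by simp
 thus ?thesis by (subst borel_measurable_euclidean_space) (auto simp: Basis_vec_def inner_axis)
qed

lemma eta_gfield: "eta k : bm (gfield t)" proof (rule measurableI)
 fix E :: "real set" assume "E : sets borel"
 hence "eta k -` E Int space (hist chan_src) : sets (hist chan_src)"
  by (intro measurable_sets[OF eta_hist]) (auto simp: chan_src_def)
 thus "eta k -` E Int space (gfield t) : sets (gfield t)" using obs_field_chan by auto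
qed simp

lemma gfield_mono: "t <= t' ==> sets (gfield t) \<subseteq> sets (gfield t')" unfolding sets_obs_field
proof (rule sigma_sets_mono, safe)
 fix B :: "nat \<times> 'n => real set" and b assume t: "t <= t'" and *: "ALL j. B j : sets borel" "b : sets (hist chan_src)"
 let ?B = "%(j, i). if j < t then B (j, i) else UNIV"
 have "{s : space M. ALL j:{..<t} \<times> UNIV. (case j of (j, i) => %s. yf j s $ i) s : B j} Int b
   = {s : space M. ALL j:{..<t'} \<times> UNIV. (case j of (j, i) => %s. yf j s $ i) s : ?B j} Int b" using t by auto
 thus "{s : space M. ALL j:{..<t} \<times> UNIV. (case j of (j, i) => %s. yf j s $ i) s : B j} Int b
  : sigma_sets (space M) {{s : space M. ALL j:{..<t'} \<times> UNIV. (case j of (j, i) => %s. yf j s $ i) s : B j} Int b |B b.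
     (ALL j. B j : sets borel) & b : sets (hist chan_src)}"
  using * by (intro sigma_sets.Basic CollectI exI[of _ ?B] exI[of _ b]) auto
qed

lemma gfield_measurable_mono: "f : measurable (gfield t) N ==> t <= t' ==> f : measurable (gfield t') N"
 using measurable_mono[of N N "gfield t" "gfield t'"] gfield_mono[of t t'] by auto

lemma perp_L2: "perp t f ==> L2 f" and perp_vlin: "perp t f ==> vlin f" and perp_mean: "perp t f ==> EV M (%s. f s) = 0"
 by (auto simp: perp_def vlin_L2)

lemma perp_mono: "perp t f ==> t' <= t ==> perp t' f" by (auto simp: perp_def)

lemma perp_add: assumes "perp t f" "perp t g" shows "perp t (%s. f s+g s)"
 using assms L2_integrable[OF perp_L2[OF assms(1)]] L2_integrable[OF perp_L2[OF assms(2)]]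
  L2_mult[OF perp_L2[OF assms(1)] vlin_L2[OF yf_vlin]] L2_mult[OF perp_L2[OF assms(2)] vlin_L2[OF yf_vlin]]
 by (auto simp: perp_def vlin_add inner_add_right distrib_right)

lemma perp_matrix: assumes "perp t f" shows "perp t (%s. W *v f s)"
 using assms integral_bounded_linear[OF matrix_vector_mul_bounded_linear[of W] L2_integrable[OF perp_L2[OF assms]]]
 by (auto simp: perp_def vlin_matrix inner_tr[of _ W])

lemma perp_uminus: "perp t f ==> perp t (%s.-f s)" by (auto simp: perp_def vlin_uminus)

lemma perp_diff: "perp t f ==> perp t g ==> perp t (%s. f s-g s)" using perp_add[of t f "%s.-g s"] perp_uminus[of t g] by simp

lemma perp_hist: assumes f: "vlin f" "centred (hist I) f" and y: "!!j. j < t ==> yf j : bm (hist I)"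
 shows "perp t f" using f centred_cross[OF hist_subalgebra f(2) vlin_L2[OF f(1)] y vlin_L2[OF yf_vlin]]
  centred_expectation[OF hist_subalgebra f(2)] by (auto simp: perp_def)

lemma perp_w: "t <= Suc k ==> perp t (w k)"
 by (rule perp_hist[OF vlin_noise(2) w_centred[of k k "Suc k" 0]]) (auto intro: hist_past_mono[OF yf_hist])

lemma perp_v: "t <= k ==> perp t (v k)"
 by (rule perp_hist[OF vlin_noise(3) v_centred[of k k k 0]]) (auto intro: hist_past_mono[OF yf_hist])

lemma perp_cov: assumes "perp t f"
 shows "ALL j:{..<t} \<times> UNIV. EV M (%s. (a \<bullet> f s)*(case j of (j, i) => %s. yf j s $ i) s) = 0"
  "EV M (%s. a \<bullet> f s) = 0" "lin (%s. a \<bullet> f s)" proof -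
 have "EV M (%s. (a \<bullet> f s)*(axis i 1 \<bullet> yf j s)) = 0" if "j < t" for i j using assms that by (auto simp: perp_def)
 thus "ALL j:{..<t} \<times> UNIV. EV M (%s. (a \<bullet> f s)*(case j of (j, i) => %s. yf j s $ i) s) = 0"
  by (auto simp: inner_axis')
 show "EV M (%s. a \<bullet> f s) = 0" using perp_mean[OF assms] L2_integrable[OF perp_L2[OF assms]] by simp
 show "lin (%s. a \<bullet> f s)" using perp_vlin[OF assms] by (simp add: vlin_def)
qed

lemma perp_centred: assumes "perp t f" shows "centred (gfield t) f" proof (rule centred_nth[OF gfield_subalgebra])
 fix i have "centred (gfield t) (%s. axis i 1 \<bullet> f s)"
  by (rule obs_field_centred[OF perp_cov(3,2)[OF assms] _ _ perp_cov(1)[OF assms]]) (auto intro: vlin_nth yf_vlin)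
 thus "centred (gfield t) (%s. f s $ i)" by (simp add: inner_axis')
qed

lemma perp_atom: assumes "perp t f" and r: "r : bm (gfield t)" shows "AE s in M. f s+r s = 0 --> r s = 0" proof -
 have "AE s in M. axis i 1 \<bullet> f s+axis i 1 \<bullet> r s = 0 --> axis i 1 \<bullet> r s = 0" for i
  by (rule obs_field_atom[OF perp_cov(3,2)[OF assms(1)] _ _ perp_cov(1)[OF assms(1)] borel_measurable_comp[OF r]])
   (auto intro: vlin_nth yf_vlin)
 hence "AE s in M. ALL i:UNIV. f s $ i+r s $ i = 0 --> r s $ i = 0" by (intro AE_finite_allI) (auto simp: inner_axis')
 thus ?thesis by eventually_elim (simp add: vec_eq_iff)
qed

lemma filter_cov_pre: "filter_cov A C Qw Qv W0 k = posterior_cov C Qv (pre_cov k)" by (cases k) (simp_all add: pre_cov_def)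

lemma pre_cov_psd: "psd (pre_cov k)" by (cases k) (auto simp: pre_cov_def psd_noise filter_cov_psd predict_cov_psd)

lemma est_pre: "est k s = pre k s+H k *v (yf k s-C *v pre k s)" by (cases k) (simp_all add: pre_def)

lemma innov: "yf k s-C *v pre k s = C *v perr k s+v k s" by (simp add: yf_def perr_def mv_diff)

lemma err_perr: "err k s = (mat 1-H k**C) *v perr k s+- (H k *v v k s)" unfolding err_def est_pre innov
 by (simp add: perr_def mv_add mv_rdiff mv_assoc)

lemma perr_Suc: "perr (Suc k) s = A *v err k s+w k s" by (simp add: perr_def err_def pre_def mv_diff)

lemma v_cov: "has_cov (v k) Qv" and w_cov: "has_cov (w k) Qw"
 using has_cov_gaussian(1)[OF v_gaussian] has_cov_gaussian(1)[OF w_gaussian] by simp_all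

lemma hist_cross: fixes f :: "'a => real^'k" and g :: "'a => real^'m" assumes "f : bm (hist I)" "L2 f" "centred (hist I) g" "L2 g"
 shows "EV M (%s. (a \<bullet> f s)*(b \<bullet> g s)) = 0"
 using centred_cross[OF hist_subalgebra assms(3,4,1,2), of b a] by (simp add: mult.commute)

text \<open>The new error is uncorrelated with the new observation by the normal equation of the
  gain: the covariance \<open>P C'\<close> of the prediction error with the innovation is cancelled
  by the gain times the innovation covariance. The predictable part of the observation lies in
  \<open>gfield k\<close>, over which the error is centred already.\<close>

lemma err_step: assumes g: "perp k (perr k)" "has_cov (perr k) (pre_cov k)" "perr k : bm (hist (past k k 0))"
  and pre: "pre k : bm (gfield k)" "L2 (pre k)" shows "perp (Suc k) (err k)" "has_cov (err k) (filter_cov A C Qw Qv W0 k)"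
  "err k : bm (hist (past k (Suc k) 0))" "est k : bm (gfield (Suc k))" "L2 (est k)" proof - note Lg = perp_L2[OF g(1)]
 have gv: "EV M (%s. (a \<bullet> perr k s)*(b \<bullet> v k s)) = 0" for a b
  by (rule hist_cross[OF g(3) Lg v_centred noise_L2(3)]) simp
 have err: "err k = (%s. (mat 1-H k**C) *v perr k s+- (H k *v v k s))" by (rule ext) (rule err_perr)
 show cov: "has_cov (err k) (filter_cov A C Qw Qv W0 k)" unfolding err filter_cov_pre posterior_cov_def proof (rule has_cov_add)
  show "has_cov (%s. (mat 1-H k**C) *v perr k s) ((mat 1-H k**C)**pre_cov k**tp (mat 1-H k**C))" by (rule has_cov_matrix[OF g(2)])
  show "has_cov (%s.-(H k *v v k s)) (H k**Qv ** tp (H k))" by (rule has_cov_uminus[OF has_cov_matrix[OF v_cov]])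
  show "EV M (%s. (a \<bullet> ((mat 1-H k**C) *v perr k s))*(b \<bullet> - (H k *v v k s))) = 0" for a b
   using gv[of "tp (mat 1-H k**C) *v a" "tp (H k) *v b"] by (simp add: inner_tr[of a] inner_tr[of b])
 qed have "perr k : bm (hist (past k (Suc k) 0))" by (rule hist_past_mono[OF g(3)]) auto
 moreover have "v k : bm (hist (past k (Suc k) 0))" by (rule v_hist) (simp add: past_def)
 ultimately show "err k : bm (hist (past k (Suc k) 0))" unfolding err by (intro bm_add borel_measurable_uminus bm_matrix)
 have pk: "perp k (err k)" unfolding err by (intro perp_add perp_uminus perp_matrix g perp_v) simp
 have cpre: "pre k : bm (gfield (Suc k))" by (rule gfield_measurable_mono[OF pre(1)]) simp
 have est: "est k = (%s. pre k s+H k *v (yf k s-C *v pre k s))" by (rule ext) (rule est_pre)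
 show "est k : bm (gfield (Suc k))" unfolding est by (intro bm_add bm_diff bm_matrix cpre yf_gfield) simp
 show "L2 (est k)" unfolding est by (intro L2_add L2_diff L2_matrix pre(2) vlin_L2[OF yf_vlin])
 have new: "EV M (%s. (a \<bullet> err k s)*(b \<bullet> yf k s)) = 0" for a b proof - let ?i = "%s. C *v perr k s+v k s"
  have Li: "L2 ?i" by (intro L2_add L2_matrix Lg noise_L2)
  have ic: "has_cov ?i (innov_cov C Qv (pre_cov k))" unfolding innov_cov_def
   by (rule has_cov_add[OF has_cov_matrix[OF g(2)] v_cov]) (simp add: inner_tr[of _ C] gv)
  have gi: "EV M (%s. (a \<bullet> perr k s)*(c \<bullet> ?i s)) = a \<bullet> (pre_cov k *v (tp C *v c))" for c proof -
   have "EV M (%s. (a \<bullet> perr k s)*(c \<bullet> ?i s))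
    = EV M (%s. (a \<bullet> perr k s)*((tp C *v c) \<bullet> perr k s)+(a \<bullet> perr k s)*(c \<bullet> v k s))"
    by (simp add: inner_add_right inner_tr[of c] distrib_left)
   also have "... = a \<bullet> (pre_cov k *v (tp C *v c))"
    using L2_mult[OF Lg Lg] L2_mult[OF Lg noise_L2(3)] gv g(2) by (simp add: has_cov_def)
   finally show ?thesis .
  qed have e: "err k s = perr k s-H k *v ?i s" for s unfolding err_def est_pre innov by (simp add: perr_def)
  have "EV M (%s. (a \<bullet> err k s)*(b \<bullet> ?i s))
   = EV M (%s. (a \<bullet> perr k s)*(b \<bullet> ?i s)-((tp (H k) *v a) \<bullet> ?i s)*(b \<bullet> ?i s))"
   unfolding e by (simp add: inner_diff_right inner_tr[of a "H k"] left_diff_distrib)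
  also have "... = a \<bullet> (pre_cov k *v (tp C *v b))-(tp (H k) *v a) \<bullet> (innov_cov C Qv (pre_cov k) *v b)"
   using L2_mult[OF Lg Li] L2_mult[OF Li Li] ic gi by (subst Bochner_Integration.integral_diff) (auto simp: has_cov_def)
  also have "... = a \<bullet> ((pre_cov k**tp C) *v b)-a \<bullet> ((H k**innov_cov C Qv (pre_cov k)) *v b)"
   by (simp only: inner_tr[of a "H k", symmetric] mv_mult)
  also have "... = 0" by (simp add: kalman_gain_eq[OF pre_cov_psd psd_noise(3)])
  finally have 1: "EV M (%s. (a \<bullet> err k s)*(b \<bullet> ?i s)) = 0" .
  have Le: "L2 (err k)" using cov by (simp add: has_cov_def)
  have 2: "EV M (%s. (a \<bullet> err k s)*((tp C *v b) \<bullet> pre k s)) = 0"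
   by (rule centred_cross[OF gfield_subalgebra perp_centred[OF pk] Le pre])
  have "yf k s = ?i s+C *v pre k s" for s using innov[of k s] by (simp add: algebra_simps)
  hence "EV M (%s. (a \<bullet> err k s)*(b \<bullet> yf k s))
   = EV M (%s. (a \<bullet> err k s)*(b \<bullet> ?i s)+(a \<bullet> err k s)*((tp C *v b) \<bullet> pre k s))"
   by (simp add: inner_add_right inner_tr[of b] distrib_left)
  also have "... = 0" using L2_mult[OF Le Li] L2_mult[OF Le pre(2)] 1 2 by simp
  finally show ?thesis .
 qed thus "perp (Suc k) (err k)" using pk by (auto simp: perp_def less_Suc_eq)
qed

lemma perr_step: shows "perp k (perr k) & has_cov (perr k) (pre_cov k) & perr k : bm (hist (past k k 0)) &
  pre k : bm (gfield k) & L2 (pre k)" proof (induction k) case 0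
 have "perr 0 = (%s. x0 s-m0)" by (simp add: perr_def pre_def fun_eq_iff)
 moreover have "vlin (%s. x0 s-m0)" by (intro vlin_diff vlin_noise vlin_const)
 moreover have "EV M (%s. x0 s-m0) = 0" using L2_integrable[OF noise_L2(1)] noise_mean(1) by (simp add: prob_space)
 moreover have "x0 : bm (hist (past 0 0 0))" by (rule x0_hist) (simp add: past_def)
 ultimately show ?case using has_cov_gaussian(1)[OF x0_gaussian] by (simp add: perp_def pre_def pre_cov_def L2_const)
next case (Suc k) note IH = err_step[OF Suc[THEN conjunct1] Suc[THEN conjunct2, THEN conjunct1]
   Suc[THEN conjunct2, THEN conjunct2, THEN conjunct1] Suc[THEN conjunct2, THEN conjunct2, THEN conjunct2, THEN conjunct1]
   Suc[THEN conjunct2, THEN conjunct2, THEN conjunct2, THEN conjunct2]]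
 have perr: "perr (Suc k) = (%s. A *v err k s+w k s)" by (rule ext) (rule perr_Suc)
 have pre: "pre (Suc k) = (%s. A *v est k s)" by (simp add: pre_def)
 show ?case proof (intro conjI)
  show "perp (Suc k) (perr (Suc k))" unfolding perr by (intro perp_add perp_matrix IH perp_w) simp
  have "EV M (%s. (a \<bullet> (A *v err k s))*(b \<bullet> w k s)) = 0" for a b
   by (rule hist_cross[OF bm_matrix[OF IH(3)] L2_matrix[OF perp_L2[OF IH(1)]] w_centred noise_L2(2)]) simp
  thus "has_cov (perr (Suc k)) (pre_cov (Suc k))" unfolding perr pre_cov_def nat.case predict_cov_def
   by (rule has_cov_add[OF has_cov_matrix[OF IH(2)] w_cov])
  have "err k : bm (hist (past (Suc k) (Suc k) 0))" by (rule hist_past_mono[OF IH(3)]) auto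
  moreover have "w k : bm (hist (past (Suc k) (Suc k) 0))" by (rule w_hist) (simp add: past_def)
  ultimately show "perr (Suc k) : bm (hist (past (Suc k) (Suc k) 0))" unfolding perr by (intro bm_add bm_matrix)
  show "pre (Suc k) : bm (gfield (Suc k))" "L2 (pre (Suc k))" unfolding pre by (intro bm_matrix L2_matrix IH)+
 qed qed

lemma err_perp: "perp (Suc k) (err k)" and err_cov: "has_cov (err k) (filter_cov A C Qw Qv W0 k)"
 and err_hist: "err k : bm (hist (past k (Suc k) 0))" and est_gfield: "est k : bm (gfield (Suc k))" and est_L2: "L2 (est k)"
 using perr_step[of k] err_step[of k] by blast+

end

section \<open>Generated fields and weighted second moments\<close>

context prob_space begin

lemma generated_by_subset: "(UN f:fs. pre M f) \<subseteq> Pow (space M)" by auto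

lemma space_generated_by [simp]: "space (generated_by M fs) = space M"
 unfolding generated_by_def by (rule space_measure_of[OF generated_by_subset])

lemma sets_generated_by: "sets (generated_by M fs) = sigma_sets (space M) (UN f:fs. pre M f)"
 unfolding generated_by_def by (rule sets_measure_of[OF generated_by_subset])

lemma generated_by_member: fixes f :: "'a => real^'n" assumes "f : fs" shows "f : bm (generated_by M fs)" proof (rule measurableI)
 fix E :: "(real^'n) set" assume "E : sets borel"
 thus "f -` E Int space (generated_by M fs) : sets (generated_by M fs)"
  unfolding sets_generated_by space_generated_by using assms by (intro sigma_sets.Basic) blast
qed simp

lemma generated_by_least: assumes "!!f. f : fs ==> f : bm F" "space F = space M"
 shows "sets (generated_by M fs) \<subseteq> sets F" proof - have "(UN f:fs. pre F f) \<subseteq> sets F"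
  using measurable_sets[OF assms(1)] by blast
 hence "sigma_sets (space F) (UN f:fs. pre F f) \<subseteq> sets F" by (rule sets.sigma_sets_subset)
 thus ?thesis unfolding sets_generated_by assms(2) .
qed

lemma generated_by_subalgebra: "(!!f. f : fs ==> f : bm M) ==> subalgebra M (generated_by M fs)"
 unfolding subalgebra_def using generated_by_least[of fs M] by simp

lemma meas_coarser: "f : measurable F N ==> sets F \<subseteq> sets G ==> space F = space G ==> f : measurable G N"
 using measurable_mono[of N N F G] by auto

definition msq :: "real^'n^'n => ('a => real^'n) => real" where "msq W f = EV M (%s. qf W (f s))"

lemma msq_nonneg: "psd W ==> 0 <= msq W f" unfolding msq_def by (rule integral_nonneg_AE) (simp add: psd_def)

lemma msq_cong_AE: assumes "AE s in M. f s = g s" "f : bm M" "g : bm M" shows "msq W f = msq W g" unfolding msq_def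
 by (rule integral_cong_AE) (use assms in "auto intro!: borel_measurable_inner bm_matrix elim: eventually_mono")

lemma msq_add: assumes W: "tp W = W" and L: "L2 f" "L2 g" and o: "EV M (%s. f s \<bullet> (W *v g s)) = 0"
 shows "msq W (%s. f s+g s) = msq W f+msq W g" proof -
 have "msq W (%s. f s+g s) = EV M (%s. (qf W (f s)+qf W (g s))+2*(f s \<bullet> (W *v g s)))" unfolding msq_def by (intro EV_cong)
   (simp add: mv_add inner_add symmetric_inner[OF W, of "g _" "f _"])
 thus ?thesis using L2_quad[OF L(1) L(1), of W] L2_quad[OF L(2) L(2), of W] L2_quad[OF L(1) L(2), of W] o by (simp add: msq_def)
qed

lemma msq_centred: assumes "tp W = W" "subalgebra M F" "centred F f" "L2 f" "g : bm F" "L2 g"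
 shows "msq W (%s. f s+g s) = msq W f+msq W g" by (rule msq_add[OF assms(1,4,6)]) (rule centred_orthogonal_quad[OF assms(2-)])

lemma msq_const: "msq W (%_. c) = qf W c" by (simp add: msq_def prob_space)

lemma msq_le: "L2 f ==> (!!x. qf W x <= c*(x \<bullet> x)) ==> msq W f <= c*EV M (%s. f s \<bullet> f s)"
 unfolding msq_def by (subst Bochner_Integration.integral_mult_right_zero[symmetric], rule integral_mono)
  (auto intro!: L2_quad Bochner_Integration.integrable_mult_right simp: L2_def[of f])

lemma msq_plus: "L2 f ==> msq (W+V) f = msq W f+msq V f" unfolding msq_def matrix_vector_mult_add_rdistrib inner_add_right
 by (rule Bochner_Integration.integral_add) (auto intro: L2_quad)

lemma msq_scaleR: "msq (c *\<^sub>R W) f = c*msq W f" by (simp add: msq_def mv_scaleR)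

end

section \<open>The closed loop and its information fields\<close>

locale loop = plant M x0 w v eta m0 W0 Qw Qv p A C
 for M :: "'a measure" and x0 :: "'a => real^'n" and w v :: "nat => 'a => real^'n" and eta :: "nat => 'a => real"
  and m0 :: "real^'n" and W0 Qw Qv :: "real^'n^'n" and p :: real and A C :: "real^'n^'n" +
 fixes BL :: "real^'m1^'n" and BR :: "real^'m2^'n" and U :: "nat => 'a => real^('m1+'m2)" and ut :: "nat => 'a => real^'m1"
  and x yl yr :: "nat => 'a => real^'n" assumes x_0: "x 0 = x0"
  and x_Suc: "!!k. x (Suc k) = (%s. A *v x k s+hcat BL BR *v U k s+BL *v ut k s+w k s)"
  and yl_eq: "!!k. yl k = (%s. C *v x k s+v k s)" and yr_eq: "!!k. yr k = (%s. eta k s *\<^sub>R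
   vec_cond_exp M (generated_by M (yl ` {..k} Un yr ` {..<k})) (x k) s)" and U_FR: "!!k. U k : bm (generated_by M (yr ` {..k}))"
  and U_integrable: "!!k. integrable M (U k)" and ut_FL: "!!k. ut k : bm (generated_by M (yl ` {..k} Un yr ` {..k}))"
  and ut_integrable: "!!k. integrable M (ut k)"
  and ut_zero: "!!k. AE s in M. vec_cond_exp M (generated_by M (yr ` {..k})) (ut k) s = 0"
begin

abbreviation "B \<equiv> hcat BL BR"
abbreviation "FR k \<equiv> generated_by M (yr ` {..k})"
abbreviation "FL k \<equiv> generated_by M (yl ` {..k} Un yr ` {..k})"
text \<open>\<open>FM\<close> is the local information just before the packet of time
  \<open>k\<close> is sent, as in the definition of the channel output; \<open>FP\<close> is the
  information from all earlier times.\<close>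

abbreviation "FM k \<equiv> generated_by M (yl ` {..k} Un yr ` {..<k})"
abbreviation "FP k \<equiv> generated_by M (yl ` {..<k} Un yr ` {..<k})"

lemma FP_Suc: "FP (Suc k) = FL k" by (simp add: lessThan_Suc_atMost)

text \<open>The part of the state caused by the controls. It is known from \<open>FP k\<close>, so
  it drops out of the filter error, which is that of the uncontrolled plant.\<close>

primrec ctl where "ctl 0 = (%_. 0)"
| "ctl (Suc k) = (%s. A *v ctl k s+B *v U k s+BL *v ut k s)"

lemma x_split: "x k s = xf k s+ctl k s" proof (induction k) case (Suc k) thus ?case by (simp add: x_Suc mv_add add_ac)
qed (simp add: x_0)

lemma FR_FL: "sets (FR k) \<subseteq> sets (FL k)" by (rule generated_by_least) (auto intro: generated_by_member)

lemma FP_FM: "sets (FP k) \<subseteq> sets (FM k)" by (rule generated_by_least) (auto intro: generated_by_member)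

lemma FM_FL: "sets (FM k) \<subseteq> sets (FL k)" by (rule generated_by_least) (auto intro: generated_by_member)

lemma U_FL: "U k : bm (FL k)" by (rule meas_coarser[OF U_FR FR_FL]) simp

lemma ctl_FP: "ctl k : bm (FP k)" proof (induction k) case (Suc k)
 have "ctl k : bm (FL k)" by (rule meas_coarser[OF Suc subset_trans[OF FP_FM FM_FL]]) simp
 thus ?case unfolding FP_Suc ctl.simps by (intro bm_add bm_matrix U_FL ut_FL)
qed simp

text \<open>Shared induction step for two comparisons of the information fields: with the noise
  histories and with the Gaussian field \<open>gfield\<close>. Once \<open>FM k\<close> is contained
  in \<open>G\<close>, the packet \<open>yr k\<close> is measurable as soon as the channel variable
  is.\<close>

lemma fields_step: assumes F: "!!j. j < k ==> yl j : bm F" "!!j. j < k ==> yr j : bm F"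
  and sp: "space F = space M" and FG: "sets F \<subseteq> sets G" and GH: "sets G \<subseteq> sets G'"
  and spaces: "space G = space M" "space G' = space M" and yl: "yl k : bm G" and eta: "eta k : bm G'"
 shows "!!j. j < Suc k ==> yl j : bm G'" "!!j. j < Suc k ==> yr j : bm G'"
  "sets (FM k) \<subseteq> sets G" "sets (FL k) \<subseteq> sets G'" proof -
 have Fm: "!!j. j < k ==> yl j : bm G" "!!j. j < k ==> yr j : bm G"
  using meas_coarser[OF F(1) FG] meas_coarser[OF F(2) FG] sp spaces by auto
 show FM: "sets (FM k) \<subseteq> sets G" proof (rule generated_by_least)
  fix f assume "f : yl ` {..k} Un yr ` {..<k}"
  thus "f : bm G" using Fm yl by (auto simp: order.order_iff_strict)
 qed (simp add: spaces)
 have G': "f : bm G'" if "f : bm G" for f :: "'a => real^'n" by (rule meas_coarser[OF that GH]) (simp add: spaces)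
 have yr: "yr k : bm G'" proof (subst yr_eq, rule borel_measurable_scaleR[OF eta], rule G')
  show "vec_cond_exp M (FM k) (x k) : bm G" by (rule meas_coarser[OF vec_cond_exp_measurable FM]) (simp add: spaces)
 qed show L: "yl j : bm G'" if "j < Suc k" for j using G'[OF Fm(1)] G'[OF yl] that by (cases "j = k") auto
 show R: "yr j : bm G'" if "j < Suc k" for j using G'[OF Fm(2)] yr that by (cases "j = k") auto
 show "sets (FL k) \<subseteq> sets G'" proof (rule generated_by_least)
  fix f assume "f : yl ` {..k} Un yr ` {..k}"
  thus "f : bm G'" using L R by (auto simp: less_Suc_eq_le)
 qed (simp add: spaces)
qed

text \<open>Controls depend on outputs, outputs on the state, and the state on earlier controls, so
  all the measurability statements go through one induction.\<close>

lemma hist_facts: "x k : bm (hist (past k k k)) & (ALL j<k. yl j : bm (hist (past k k k)) & yr j : bm (hist (past k k k))) &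
 (ALL j<k. sets (FM j) \<subseteq> sets (hist (past j (Suc j) j)) & sets (FL j) \<subseteq> sets (hist (past j (Suc j) (Suc j))))"
proof (induction k) case 0 have "x0 : bm (hist (past 0 0 0))" by (rule x0_hist) (simp add: past_def)
 thus ?case by (simp add: x_0)
next case (Suc k) let ?G = "hist (past k (Suc k) k)" and ?H = "hist (upto k)"
 have x: "x k : bm ?G" by (rule hist_past_mono[of _ k k k]) (use Suc in auto)
 have "v k : bm ?G" by (rule v_hist) (simp add: past_def)
 hence yl: "yl k : bm ?G" unfolding yl_eq by (intro bm_add bm_matrix x)
 have e: "eta k : bm ?H" by (rule eta_hist) (simp add: past_def)
 note * = fields_step[of k "hist (past k k k)" ?G ?H, OF _ _ _ hist_mono[OF past_mono] hist_mono[OF past_mono] _ _ yl e]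
 have Y: "!!j. j < Suc k ==> yl j : bm ?H" "!!j. j < Suc k ==> yr j : bm ?H"
  "sets (FM k) \<subseteq> sets ?G" "sets (FL k) \<subseteq> sets ?H" by (rule *; use Suc in simp)+
 have N: "f : measurable (hist (past (Suc k) (Suc k) (Suc k))) N" if "f : measurable ?H N" for f and N :: "'k measure"
  by (rule hist_past_mono[OF that]) auto
 have L: "f : bm (hist (past (Suc k) (Suc k) (Suc k)))" if "f : bm (FL k)" for f :: "'a => real^'l"
  by (rule N, rule meas_coarser[OF that Y(4)]) simp
 have "w k : bm (hist (past (Suc k) (Suc k) (Suc k)))" by (rule w_hist) (simp add: past_def)
 moreover have "x k : bm (hist (past (Suc k) (Suc k) (Suc k)))" by (rule hist_past_mono[OF x]) auto
 ultimately have "x (Suc k) : bm (hist (past (Suc k) (Suc k) (Suc k)))"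
  unfolding x_Suc by (intro bm_add bm_matrix L[OF U_FL] L[OF ut_FL])
 moreover have "yl j : bm (hist (past (Suc k) (Suc k) (Suc k))) & yr j : bm (hist (past (Suc k) (Suc k) (Suc k)))"
  if "j < Suc k" for j using N[OF Y(1)[OF that]] N[OF Y(2)[OF that]] by blast
 moreover have "sets (FM j) \<subseteq> sets (hist (past j (Suc j) j)) & sets (FL j) \<subseteq> sets (hist (past j (Suc j) (Suc j)))" if "j < Suc k" for j
  using Suc Y(3,4) that by (cases "j = k") auto
 ultimately show ?case by blast
qed

lemma x_hist: "x k : bm (hist (past k k k))" and FM_hist: "sets (FM k) \<subseteq> sets (hist (past k (Suc k) k))"
 and FL_hist: "sets (FL k) \<subseteq> sets (hist (upto k))" using hist_facts[of k] hist_facts[of "Suc k"] by blast+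

lemma hist_events: "sets (hist I) \<subseteq> events" using hist_subalgebra by (simp add: subalgebra_def)

lemma FL_subalgebra: "subalgebra M (FL k)" and FM_subalgebra: "subalgebra M (FM k)" and FR_subalgebra: "subalgebra M (FR k)"
 unfolding subalgebra_def
 by (intro conjI space_generated_by order.trans[OF FL_hist hist_events] order.trans[OF FM_hist hist_events]
   order.trans[OF FR_FL order.trans[OF FL_hist hist_events]])+

lemma gfield_facts: "ctl k : bm (gfield k) & (ALL j<k. yl j : bm (gfield k) & yr j : bm (gfield k)) &
 (ALL j<k. sets (FL j) \<subseteq> sets (gfield (Suc j)))" proof (induction k) case (Suc k) let ?H = "gfield (Suc k)"
 have c: "ctl k : bm ?H" by (rule gfield_measurable_mono[of _ k]) (use Suc in auto)
 have yl: "yl k : bm ?H" proof - have "yl k = (%s. yf k s+C *v ctl k s)"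
   by (simp add: yl_eq x_split yf_def mv_add add_ac fun_eq_iff)
  moreover have "(%s. yf k s+C *v ctl k s) : bm ?H" by (intro bm_add bm_matrix c yf_gfield) simp
  ultimately show ?thesis by simp
 qed note * = fields_step[of k "gfield k" ?H ?H, OF _ _ _ gfield_mono order.refl _ _ yl eta_gfield]
 have Y: "!!j. j < Suc k ==> yl j : bm ?H" "!!j. j < Suc k ==> yr j : bm ?H"
  "sets (FL k) \<subseteq> sets ?H" by (rule *; use Suc in simp)+
 have "ctl (Suc k) : bm ?H" by (rule meas_coarser[OF ctl_FP[of "Suc k", unfolded FP_Suc] Y(3)]) simp
 thus ?case using Suc Y by (auto simp: less_Suc_eq)
qed simp

lemma FL_gfield: "sets (FL k) \<subseteq> sets (gfield (Suc k))" using gfield_facts[of "Suc k"] by blast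

lemma ctl_integrable: "integrable M (ctl k)" proof (induction k) case (Suc k)
 have *: "integrable M (%s. (W::real^'l^'n) *v f s)" if "integrable M f" for W f
  by (rule integrable_bounded_linear[OF matrix_vector_mul_bounded_linear that])
 show ?case unfolding ctl.simps by (intro Bochner_Integration.integrable_add *[OF Suc] *[OF U_integrable] *[OF ut_integrable])
qed simp

lemma xf_L2: "L2 (xf k)" by (rule vlin_L2[OF xf_vlin])

lemma x_integrable: "integrable M (x k)"
 unfolding x_split[abs_def] using L2_integrable[OF xf_L2[of k]] ctl_integrable[of k] by simp

text \<open>The free observations are recovered from the actual ones by subtracting the known term
  \<open>C ctl\<close>.\<close>

lemma est_FM: "est k : bm (FM k)" proof (induction k) have yf: "yf k : bm (FM k)" for k proof -
  have "yf k = (%s. yl k s-C *v ctl k s)" by (simp add: yl_eq x_split yf_def mv_add fun_eq_iff)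
  moreover have "yl k : bm (FM k)" by (rule generated_by_member) auto
  moreover have "ctl k : bm (FM k)" by (rule meas_coarser[OF ctl_FP FP_FM]) simp
  ultimately show ?thesis by (simp only:) (intro bm_diff bm_matrix)
 qed case 0 show ?case unfolding est.simps by (intro bm_add bm_diff bm_matrix borel_measurable_const yf)
 case (Suc k) have "est k : bm (FM (Suc k))" by (rule meas_coarser[OF Suc(1)])
   (rule generated_by_least, auto intro!: generated_by_member)
 thus ?case unfolding est.simps by (intro bm_add bm_diff bm_matrix yf)
qed

definition xl where "xl k s = est k s+ctl k s"

lemma xl_FM: "xl k : bm (FM k)" unfolding xl_def[abs_def] by (intro bm_add est_FM meas_coarser[OF ctl_FP FP_FM]) simp

lemma xl_FL: "xl k : bm (FL k)" by (rule meas_coarser[OF xl_FM FM_FL]) simp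

lemma x_xl: "x k s = xl k s+err k s" by (simp add: x_split xl_def err_def)

lemma err_centred_FL: "centred (FL k) (err k)" by (rule centred_mono[OF perp_centred[OF err_perp] FL_gfield])

text \<open>\<open>err k\<close> is centred over \<open>FL k\<close> and therefore over the smaller
  \<open>FM k\<close>, while \<open>xl k\<close> is measurable for both. Hence the estimate put on
  the channel and the local estimate agree almost surely.\<close>

lemma xl_estimate: "AE s in M. vec_cond_exp M (FL k) (x k) s = xl k s" "AE s in M. vec_cond_exp M (FM k) (x k) s = xl k s"
 using vec_cond_exp_eqI[OF FL_subalgebra x_integrable xl_FL] vec_cond_exp_eqI[OF FM_subalgebra x_integrable xl_FM]
  err_centred_FL[of k] centred_mono[OF err_centred_FL FM_FL, of k] by (auto simp: x_xl)

lemma yr_xl: "AE s in M. yr k s = eta k s *\<^sub>R xl k s"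
 using xl_estimate(2)[of k] by (subst yr_eq) (auto elim: eventually_mono)

definition xr where "xr k = vec_cond_exp M (FR k) (x k)"

lemma xr_FR: "xr k : bm (FR k)" unfolding xr_def by (rule vec_cond_exp_measurable)

lemma ut_centred: "centred (FR k) (ut k)"
 by (rule centred_cong_AE[OF FR_subalgebra vec_cond_exp_centred[OF FR_subalgebra ut_integrable[of k]]])
  (use ut_zero[of k] borel_measurable_integrable[OF ut_integrable] in "auto elim: eventually_mono")

definition dlt where "dlt k s = xl k s-xr k s"

lemma dlt_centred: "centred (FR k) (dlt k)" proof - have "centred (FR k) (%s. (x k s-xr k s)-err k s)" unfolding xr_def
  by (rule centred_diff[OF FR_subalgebra vec_cond_exp_centred[OF FR_subalgebra x_integrable]
     centred_mono[OF err_centred_FL FR_FL]])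
 thus ?thesis by (simp add: dlt_def[abs_def] x_xl algebra_simps)
qed

text \<open>\<open>pr\<close> is the remote prediction before the packet of time \<open>k\<close>,
  and \<open>dd\<close> is what it misses of the local estimate; \<open>dlt\<close> is the same
  after the packet. \<open>nu\<close> is the correction made by the local filter, the only fresh
  randomness entering \<open>dd\<close>.\<close>

definition pr where "pr k = (case k of 0 => %_. m0 | Suc j => %s. A *v xr j s+B *v U j s)"

definition dd where "dd k s = xl k s-pr k s"

definition nu where "nu k s = perr k s-err k s"

lemma nu_perp: "perp k (nu k)" unfolding nu_def[abs_def] using perr_step[of k] perp_mono[OF err_perp] by (intro perp_diff) auto

lemma dd_Suc: "dd (Suc k) s = A *v dlt k s+BL *v ut k s+nu (Suc k) s"
 by (simp add: dd_def pr_def xl_def dlt_def nu_def perr_def err_def pre_def mv_diff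
   mv_add algebra_simps)

lemma dd_0: "dd 0 s = nu 0 s" by (simp add: dd_def pr_def xl_def nu_def perr_def err_def pre_def)

end

section \<open>Necessity: bounds extracted from a bounded state\<close>

lemma matrix_generalized_inverse: "EX G::real^'n^'m. ALL z. W *v (G *v (W *v z)) = W *v z" for W :: "real^'m^'n" proof -
 obtain g :: "real^'n => real^'m" where g: "linear g" "!!y. y : range ((*v) W) ==> W *v g y = y"
  using linear_exists_right_inverse_on[OF matrix_vector_mul_linear[of W] subspace_UNIV] by blast
 show ?thesis by (rule exI[of _ "matrix g"]) (simp add: fun_cong[OF matrix_vector_mul(2)[OF g(1)]] g(2))
qed

lemma uminus_matrix_vector: "(- W) *v x = - (W *v x)" for W :: "real^'n^'m" using mv_rdiff[of 0 W x] by simp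

context prob_space begin

lemma msq_cov: "has_cov f P ==> msq W f = (SUM i:UNIV. SUM j:UNIV. W $ i $ j*P $ i $ j)" proof - assume f: "has_cov f P"
 hence L: "L2 f" by (simp add: has_cov_def)
 have I: "integrable M (%s. f s $ i*f s $ j)" for i j using L2_mult[OF L L, of "axis i 1" "axis j 1"] by (simp add: inner_axis')
 have c: "EV M (%s. f s $ i*f s $ j) = P $ i $ j" for i j proof -
  have "EV M (%s. (axis i 1 \<bullet> f s)*(axis j 1 \<bullet> f s)) = axis i 1 \<bullet> (P *v axis j 1)"
   using f by (simp add: has_cov_def)
  thus ?thesis unfolding axis_inner_matrix by (simp add: inner_axis')
 qed have "msq W f = EV M (%s. (SUM i:UNIV. SUM j:UNIV. W $ i $ j*(f s $ i*f s $ j)))" unfolding msq_def by (intro EV_cong)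
   (simp add: inner_vec_def mv_def sum_dl mult_ac)
 also have "... = (SUM i:UNIV. SUM j:UNIV. W $ i $ j*P $ i $ j)" using I by (simp add: Bochner_Integration.integral_sum c)
 finally show ?thesis .
qed

lemma msq_matrix: "msq W (%s. G *v f s) = msq (tp G**W**G) f" by (simp add: msq_def quad_congruence)

lemma msq_sum_bound: assumes "psd W" "L2 f" "L2 g" shows "msq W (%s. f s+g s) <= 2*msq W f+2*msq W g" proof -
 have "qf W (x+y) <= 2*qf W x+2*qf W y" for x y
  using psd_quad[OF assms(1), of "x-y"] symmetric_inner[OF psd_sym[OF assms(1)], of x y]
  by (simp add: mv_add mv_diff inner_add inner_diff)
 hence "msq W (%s. f s+g s) <= EV M (%s. 2*qf W (f s)+2*qf W (g s))" unfolding msq_def using assms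
  by (intro integral_mono L2_quad L2_add Bochner_Integration.integrable_add Bochner_Integration.integrable_mult_right) auto
 also have "... = 2*msq W f+2*msq W g" unfolding msq_def using L2_quad[OF assms(2,2), of W] L2_quad[OF assms(3,3), of W] by simp
 finally show ?thesis .
qed

lemma msq_three_bound: assumes "psd W" "L2 f" "L2 g" "L2 h" and "msq W f <= c" "msq W g <= d" "msq W h = t"
 shows "msq W (%s. (f s+g s)+h s) <= 4*c+4*d+2*t"
 using msq_sum_bound[OF assms(1) L2_add[OF assms(2,3)] assms(4)] msq_sum_bound[OF assms(1-3)] assms(5-7) by linarith

lemma msq_1: "msq (mat 1) f = EV M (%s. f s \<bullet> f s)" by (simp add: msq_def)

lemma msq_bound: "EX c>=0. ALL f. L2 f --> msq W f <= c*msq (mat 1) f" proof -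
 obtain c where c: "c >= 0" "!!x. \<bar>x \<bullet> (W *v x)\<bar> <= c*(x \<bullet> x)" using quad_upper_bound[of W] by blast
 have "msq W f <= c*msq (mat 1) f" if "L2 f" for f unfolding msq_1 by (rule msq_le[OF that]) (use c(2) abs_le_D1 in blast)
 with c(1) show ?thesis by blast
qed

lemma msq_stage_cost: assumes "L2 f" "L2 u"
 shows "msq Q f+msq R u+msq P (%s. A *v f s+B *v u s) = EV M (%s. stage_cost A B Q R P (f s) (u s))"
 unfolding msq_def stage_cost_def using L2_quad[OF assms(1,1), of Q] L2_quad[OF assms(2,2), of R]
  L2_quad[OF L2_add[OF L2_matrix[OF assms(1)] L2_matrix[OF assms(2)]] L2_add[OF L2_matrix[OF assms(1)] L2_matrix[OF assms(2)]], of A B P A B]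
 by simp

lemma msq_completion: assumes P: "tp P = P" and U: "pos_def (Upsilon_mat B R P)" and L: "L2 f" "L2 u"
 shows "msq Q f+msq R u+msq P (%s. A *v f s+B *v u s)
  = msq (riccati_map A B Q R P) f+msq (Upsilon_mat B R P) (%s. u s+K_gain A B R P *v f s)" proof -
 have Lc: "L2 (%s. u s+K_gain A B R P *v f s)" by (intro L2_add L2_matrix L)
 show ?thesis unfolding msq_stage_cost[OF L] stage_cost_completion[OF P U] unfolding msq_def
  by (rule Bochner_Integration.integral_add) (intro L2_quad L Lc)+
qed

end

text \<open>Along \<open>k + j\<close> constant the step inequality telescopes, so the first
  \<open>n\<close> values of \<open>t\<close> sum to at most \<open>n c\<close>. For
  \<open>n = 2 (j+1)\<close> and increasing \<open>t\<close>, the last \<open>j+1\<close> of them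
  are each at least \<open>t (Suc j)\<close>; hence the factor 2.\<close>

lemma telescoped_bound: fixes v :: "nat => nat => real" assumes v0: "!!k. v k 0 = 0" and vn: "!!k j. 0 <= v k j"
  and st: "!!k j. v k (Suc j)+t j <= c+v (Suc k) j" and mono: "!!i j. i <= j ==> t i <= t j" and t0: "0 <= t 0" shows "t j <= 2*c"
proof - have tel: "v k n+(SUM i<n. t i) <= real n*c" for k n proof (induction n arbitrary: k) case (Suc n)
  show ?case using st[of k n] Suc[of "Suc k"] by (simp add: algebra_simps)
 qed (simp add: v0)
 let ?j = "Suc j"
 have "(SUM i=?j..<2*?j. t ?j) <= (SUM i=?j..<2*?j. t i)" by (intro sum_mono mono) simp
 also have "... <= (SUM i<2*?j. t i)" by (rule sum_mono2) (use order.trans[OF t0 mono] in auto)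
 also have "... <= real (2*?j)*c" using tel[of 0 "2*?j"] vn[of 0 "2*?j"] by linarith
 finally have "real ?j*t ?j <= real ?j*(2*c)" by (simp add: algebra_simps)
 hence "t ?j <= 2*c" by (subst (asm) mult_le_cancel_left_pos) auto
 thus ?thesis using mono[of j ?j] by simp
qed

context noises begin

text \<open>With \<open>q = y' Qw W Qw y\<close> one has \<open>q = E[(W Qw y . w) (y . w)]\<close>.
  The first factor squared is at most \<open>q (w . W w)\<close> by Cauchy-Schwarz for
  \<open>W\<close>; weighting the two squares by \<open>1/c\<close> and \<open>c\<close> lets
  \<open>q/2\<close> be absorbed on the left. A bound on \<open>E (w . W w)\<close> thus controls
  \<open>W\<close> on the range of \<open>Qw\<close>.\<close>

lemma noise_weight_bound: assumes W: "psd W" and c: "msq W (w 0) <= c" "0 < c" shows "qf W (Qw *v y) <= c*qf Qw y" proof -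
 let ?y = "Qw *v y"
 define q where "q = qf W ?y"
 have q0: "0 <= q" unfolding q_def by (rule psd_quad[OF W])
 have hc: "has_cov (w 0) Qw" using has_cov_gaussian(1)[OF w_gaussian[of 0]] by simp
 note L = noise_L2(2)[of 0]
 have I: "integrable M (%s. ((W *v ?y) \<bullet> w 0 s)^2)" "integrable M (%s. (y \<bullet> w 0 s)^2)"
  using L2_mult[OF L L, of "W *v ?y" "W *v ?y"] L2_mult[OF L L, of y y] by (simp_all add: pow2)
 have "q = EV M (%s. ((W *v ?y) \<bullet> w 0 s)*(y \<bullet> w 0 s))"
  using hc unfolding has_cov_def q_def inner_commute[of ?y "W *v ?y"] by simp
 also have "... <= EV M (%s. (1/c*(q*qf W (w 0 s))+c*(y \<bullet> w 0 s)^2)/2)" proof (rule integral_mono)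
  show "integrable M (%s. ((W *v ?y) \<bullet> w 0 s)*(y \<bullet> w 0 s))" by (rule L2_mult[OF L L])
  show "integrable M (%s. (1/c*(q*qf W (w 0 s))+c*(y \<bullet> w 0 s)^2)/2)" using I(2) L2_quad[OF L L, of W] by simp
  fix s let ?a = "(W *v ?y) \<bullet> w 0 s" and ?b = "y \<bullet> w 0 s"
  have "?a = ?y \<bullet> (W *v w 0 s)" using inner_tr[of ?y W "w 0 s"] psd_sym[OF W] by simp
  hence a: "?a^2 <= q*qf W (w 0 s)" unfolding q_def using psd_cauchy_schwarz[OF W, of ?y "w 0 s"] by simp
  have "0 <= (?a-c*?b)^2/c" using c by simp
  also have "... = 1/c*?a^2+c*?b^2-2*(?a*?b)" using c by (simp add: pow2 field_simps)
  finally have "?a*?b <= (1/c*?a^2+c*?b^2)/2" by simp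
  also have "... <= (1/c*(q*qf W (w 0 s))+c*?b^2)/2" using a c by (simp add: divide_right_mono)
  finally show "?a*?b <= (1/c*(q*qf W (w 0 s))+c*?b^2)/2" .
 qed also have "... = (1/c*(q*msq W (w 0))+c*qf Qw y)/2"
  using I(2) L2_quad[OF L L, of W] hc by (simp add: msq_def has_cov_def pow2)
 also have "... <= (1/c*(q*c)+c*qf Qw y)/2" proof -
  have "1/c*(q*msq W (w 0)) <= 1/c*(q*c)" using c q0 by (intro mult_left_mono) auto
  thus ?thesis by (intro divide_right_mono add_right_mono) simp_all
 qed finally show ?thesis using c by (simp add: q_def)
qed

text \<open>A value iterate never exceeds the cost of the control actually used, and by
  \<open>step\<close> each transition injects at least \<open>r\<close> times the noise energy in
  the weight of the iterate. The telescoped bound then limits this energy uniformly in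
  \<open>j\<close>.\<close>

lemma value_iter_noise_bound: fixes \<xi> :: "nat => 'a => real^'n" and u :: "nat => 'a => real^'m"
 assumes Q: "psd Q" and R: "pos_def R" and r: "0 < r" and L: "!!k. L2 (\<xi> k)" "!!k. L2 (u k)"
  and bd: "!!k. msq Q (\<xi> k)+msq R (u k) <= c"
  and step: "!!k W. psd W ==> msq W (%s. F *v \<xi> k s+G *v u k s)+r*msq W (w 0) <= msq W (\<xi> (Suc k))"
 shows "EX c. ALL j. qf (value_iter F G Q R j) (Qw *v y) <= c" proof - let ?W = "value_iter F G Q R"
 have psd: "psd (?W j)" for j by (rule value_iter_psd[OF Q R])
 have t: "r*msq (?W j) (w 0) <= 2*c" for j
 proof (rule telescoped_bound[where v="%k j. msq (?W j) (\<xi> k)" and t="%j. r*msq (?W j) (w 0)" and c=c])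
  show "msq (?W 0) (\<xi> k) = 0" for k by (simp add: msq_def)
  show "0 <= msq (?W j) (\<xi> k)" for k j by (rule msq_nonneg[OF psd])
  show "msq (?W (Suc j)) (\<xi> k)+r*msq (?W j) (w 0) <= c+msq (?W j) (\<xi> (Suc k))" for k j proof -
   note U = Upsilon_pos_def[OF psd R, of G]
   have "msq (?W (Suc j)) (\<xi> k) <= msq Q (\<xi> k)+msq R (u k)+msq (?W j) (%s. F *v \<xi> k s+G *v u k s)"
    unfolding msq_completion[OF psd_sym[OF psd] U L] value_iter.simps using msq_nonneg[OF pd_psd[OF U]] by simp
   thus ?thesis using bd[of k] step[OF psd, of j k] by linarith
  qed show "r*msq (?W i) (w 0) <= r*msq (?W j) (w 0)" if "i <= j" for i j unfolding msq_def using r value_iter_mono[OF Q R that]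
   by (intro mult_left_mono integral_mono L2_quad noise_L2) auto
  show "0 <= r*msq (?W 0) (w 0)" by (intro mult_nonneg_nonneg less_imp_le[OF r] msq_nonneg[OF psd])
 qed define c' where "c' = max 1 (2*c/r)"
 have "msq (?W j) (w 0) <= c'" for j using t[of j] r by (simp add: c'_def field_simps le_max_iff_disj)
 moreover have "0 < c'" by (simp add: c'_def)
 ultimately have "qf (?W j) (Qw *v y) <= c'*qf Qw y" for j by (intro noise_weight_bound psd)
 thus ?thesis by (intro exI allI)
qed

end

context loop begin

abbreviation "FQ k \<equiv> generated_by M (yr ` {..<k})"

definition z0 :: "nat => 'a => real" where "z0 k s = (if eta k s = 0 then 1 else 0)"

lemma FQ_Suc: "FQ (Suc k) = FR k" by (simp add: lessThan_Suc_atMost)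

lemma FQ_FR: "sets (FQ k) \<subseteq> sets (FR k)" by (rule generated_by_least) (auto intro!: generated_by_member)

lemma FQ_hist: "sets (FQ k) \<subseteq> sets (hist (past k (Suc k) k))"
 by (rule order.trans[OF generated_by_least FM_hist]) (auto intro!: generated_by_member)

lemma FQ_subalgebra: "subalgebra M (FQ k)"
 unfolding subalgebra_def by (intro conjI space_generated_by order.trans[OF FQ_hist hist_events])

text \<open>\<open>yr k\<close> is 0 wherever \<open>eta k\<close> is, so on the event of a loss the
  remote field has the same trace before and after time \<open>k\<close>.\<close>

lemma eta_zero_trace: assumes "D : sets (FR k)"
 shows "EX D0:sets (FQ k). ALL s:space M. eta k s = 0 --> (s : D \<longleftrightarrow> s : D0)"
 using assms unfolding sets_generated_by[of "yr ` {..k}"] proof (induction rule: sigma_sets.induct) case (Basic a)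
 then obtain j E where j: "j <= k" and E: "E : sets borel" and a: "a = yr j -` E Int space M" by auto
 show ?case proof (cases "j = k")
  case True have "yr k s = 0" if "eta k s = 0" for s using that by (subst yr_eq) simp
  thus ?thesis using sets.top[of "FQ k"] by (intro bexI[of _ "if 0 : E then space M else {}"]) (auto simp: a True)
 next case False hence "yr j : bm (FQ k)" using j by (intro generated_by_member) auto
  hence "a : sets (FQ k)" unfolding a using measurable_sets[of "yr j" "FQ k" borel E] E by simp
  thus ?thesis by blast
 qed next case Empty thus ?case by blast
next case (Compl a)
 then obtain D0 where "D0 : sets (FQ k)" "ALL s:space M. eta k s = 0 --> (s : a \<longleftrightarrow> s : D0)" by blast
 thus ?case using sets.compl_sets[of D0 "FQ k"] by (intro bexI[of _ "space M-D0"]) auto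
next case (Union a)
 then obtain D0 where D0: "!!i. D0 i : sets (FQ k)" "!!i. ALL s:space M. eta k s = 0 --> (s : a i \<longleftrightarrow> s : D0 i)"
  by metis
 thus ?case by (intro bexI[of _ "\<Union>i. D0 i"] sets.countable_UN) auto
qed

lemma z0_measurable: "Some (Chan k) : I ==> z0 k : bm (hist I)" proof - assume "Some (Chan k) : I"
 hence [measurable]: "eta k : bm (hist I)" by (rule eta_hist)
 show ?thesis unfolding z0_def[abs_def] by measurable
qed

lemma z0_measurable': "z0 k : bm M" by (rule measurable_from_subalg[OF hist_subalgebra z0_measurable[of k UNIV]]) simp

lemma z0_independent: assumes "h : bm (hist (past k (Suc k) k))" "integrable M h" shows "EV M (%s. z0 k s*h s) = p*EV M (%s. h s)"
proof - let ?J = "{Some (Chan k)}"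
 have i: "integrable M (z0 k)" by (rule integrable_const_bound[of _ 1]) (auto simp: z0_def z0_measurable')
 have "EV M (%s. z0 k s) = EV M (%s. indicator {s : space M. eta k s = 0} s)"
  by (rule Bochner_Integration.integral_cong) (auto simp: z0_def)
 also have "... = p" using eta_0[of k] Int_absorb2[of "{s : space M. eta k s = 0}" "space M"] by auto
 finally have E: "EV M (%s. z0 k s) = p" .
 have d: "?J Int past k (Suc k) k = {}" by (auto simp: past_def)
 have z: "z0 k : bm (hist ?J)" by (rule z0_measurable) simp
 show ?thesis using indep_expectation(2)[OF hist_subalgebra hist_subalgebra hist_indep[OF d] z i assms] E by simp
qed

lemma z0_L2: "L2 h ==> L2 (%s. z0 k s *\<^sub>R h s)" by (rule L2_bounded_scale[OF _ z0_measurable']) (auto simp: z0_def)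

text \<open>On a loss, a set of \<open>FR k\<close> may be replaced by one of \<open>FQ k\<close>,
  and the indicator \<open>z0 k\<close> of the loss is independent of everything that happened
  before the channel was used.\<close>

lemma erasure: fixes h :: "'a => real^'l" assumes h: "centred (FQ k) h" "h : bm (hist (past k (Suc k) k))"
 shows "centred (FR k) (%s. z0 k s *\<^sub>R h s)" proof (rule centred_Basis[OF FR_subalgebra])
 fix b :: "real^'l"
 let ?h = "%s. h s \<bullet> b"
 have hb: "centred (FQ k) ?h" by (rule centred_linear[OF FQ_subalgebra h(1) bounded_linear_inner_left])
 note hi = centred_integrable[OF hb]
 show "centred (FR k) (%s. (z0 k s *\<^sub>R h s) \<bullet> b)" unfolding centred_def proof (intro conjI ballI)
  show "integrable M (%s. (z0 k s *\<^sub>R h s) \<bullet> b)" by (rule Bochner_Integration.integrable_bound[OF hi])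
    (use borel_measurable_times[OF z0_measurable'[of k] borel_measurable_integrable[OF hi]] in simp, simp add: z0_def)
  fix D assume "D : sets (FR k)"
  then obtain D0 where D0: "D0 : sets (FQ k)" "ALL s:space M. eta k s = 0 --> (s : D \<longleftrightarrow> s : D0)"
   using eta_zero_trace by blast
  have D0h: "D0 : sets (hist (past k (Suc k) k))" using D0(1) FQ_hist by blast
  have "EV M (%s. indicator D s *\<^sub>R ((z0 k s *\<^sub>R h s) \<bullet> b)) = EV M (%s. z0 k s*(indicator D0 s*?h s))"
   by (intro EV_cong) (use D0(2) in "auto simp: z0_def indicator_def")
  also have "... = p*EV M (%s. indicator D0 s*?h s)" proof (rule z0_independent)
   have "?h : bm (hist (past k (Suc k) k))" using h(2) by measurable
   thus "(%s. indicator D0 s*?h s) : bm (hist (past k (Suc k) k))" using D0h by measurable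
   show "integrable M (%s. indicator D0 s*?h s)" using centred_ind[OF FQ_subalgebra hi D0(1)] by simp
  qed also have "... = 0" using hb D0(1) by (simp add: centred_def)
  finally show "EV M (%s. indicator D s *\<^sub>R ((z0 k s *\<^sub>R h s) \<bullet> b)) = 0" .
 qed qed

lemma msq_z0: assumes "L2 h" "h : bm (hist (past k (Suc k) k))" shows "msq W (%s. z0 k s *\<^sub>R h s) = p*msq W h" proof -
 have "msq W (%s. z0 k s *\<^sub>R h s) = EV M (%s. z0 k s*qf W (h s))" unfolding msq_def by (intro EV_cong) (simp add: z0_def)
 also have "... = p*msq W h" unfolding msq_def
  by (rule z0_independent) (use assms in "auto intro!: L2_quad borel_measurable_inner bm_matrix")
 finally show ?thesis .
qed

text \<open>The estimate is made on the event of a loss, where \<open>z0 h\<close> is orthogonal to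
  any remote correction \<open>g\<close>; the energy on the complementary event is merely
  nonnegative.\<close>

lemma erasure_bound: assumes W: "psd W" and h: "centred (FQ k) h" "h : bm (hist (past k (Suc k) k))" "L2 h"
  and g: "g : bm (FR k)" "L2 g" shows "p*msq W h <= msq W (%s. h s+g s)" proof -
 let ?z = "%s. z0 k s *\<^sub>R h s" and ?y = "%s. z0 k s *\<^sub>R g s"
 have o: "EV M (%s. ?z s \<bullet> (W *v ?y s)) = 0" proof -
  have "EV M (%s. ?z s \<bullet> (W *v ?y s)) = EV M (%s. ?z s \<bullet> (W *v g s))" by (intro EV_cong) (simp add: z0_def)
  also have "... = 0" by (rule centred_orthogonal_quad[OF FR_subalgebra erasure[OF h(1,2)] z0_L2[OF h(3)] g])
  finally show ?thesis .
 qed have "p*msq W h <= msq W ?z+msq W ?y" using msq_z0[OF h(3,2)] msq_nonneg[OF W] by simp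
 also have "... = msq W (%s. ?z s+?y s)" by (rule msq_add[OF psd_sym[OF W] z0_L2[OF h(3)] z0_L2[OF g(2)] o, symmetric])
 also have "... <= msq W (%s. h s+g s)" unfolding msq_def proof (rule integral_mono)
  show "integrable M (%s. qf W (?z s+?y s))" "integrable M (%s. qf W (h s+g s))" using h g by (intro L2_quad L2_add z0_L2; simp)+
  show "qf W (?z s+?y s) <= qf W (h s+g s)" for s using psd_quad[OF W] by (simp add: z0_def)
 qed finally show ?thesis .
qed

lemma pr_FQ: "pr k : bm (FQ k)" proof (cases k)
 case (Suc j) thus ?thesis unfolding pr_def Suc FQ_Suc nat.case by (intro bm_add bm_matrix xr_FR U_FR)
qed (simp add: pr_def)

lemma pr_FR: "pr k : bm (FR k)" by (rule meas_coarser[OF pr_FQ FQ_FR]) simp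

lemma w_centred_FL: "centred (FL k) (w k)" by (rule centred_mono[OF w_centred FL_hist]) simp

lemma FR_xr_centred: "centred (FR k) (%s. x k s-xr k s)"
 unfolding xr_def by (rule vec_cond_exp_centred[OF FR_subalgebra x_integrable])

lemma x_pr_Suc: "x (Suc k) s-pr (Suc k) s = (A *v (x k s-xr k s)+BL *v ut k s)+w k s" by (simp add: x_Suc pr_def mv_diff)

lemma x_pr_centred: "centred (FQ k) (%s. x k s-pr k s)" proof (cases k)
 case 0 have "sets (FQ 0) = {{}, space M}" unfolding sets_generated_by by (simp add: sigma_sets_empty_eq)
 moreover have "EV M (%s. x0 s-m0) = 0" using L2_integrable[OF noise_L2(1)] noise_mean(1) by (simp add: prob_space)
 moreover have "EV M (%s. indicator (space M) s *\<^sub>R (x0 s-m0)) = EV M (%s. x0 s-m0)"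
  by (rule Bochner_Integration.integral_cong) auto
 ultimately show ?thesis using L2_integrable[OF noise_L2(1)] by (simp add: 0 x_0 pr_def centred_def)
next case (Suc j) show ?thesis unfolding Suc FQ_Suc x_pr_Suc
  by (intro centred_add[OF FR_subalgebra] centred_matrix[OF FR_subalgebra] FR_xr_centred ut_centred
    centred_mono[OF w_centred_FL FR_FL])
qed

lemma x_pr_hist: "(%s. x k s-pr k s) : bm (hist (past k (Suc k) k))"
 by (intro bm_diff hist_past_mono[OF x_hist] meas_coarser[OF pr_FQ FQ_hist]) auto

lemma pr_estimate: "AE s in M. vec_cond_exp M (FQ k) (x k) s = pr k s"
 by (rule vec_cond_exp_eqI[OF FQ_subalgebra x_integrable pr_FQ x_pr_centred])

lemma moments_L2: assumes "L2 (x k)" shows "L2 (xr k)" "L2 (xl k)" "L2 (dlt k)" "L2 (pr k)" "L2 (dd k)" proof -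
 show xr: "L2 (xr k)" unfolding xr_def by (rule vec_cond_exp_L2[OF FR_subalgebra assms])
 have "L2 (%s. x k s-err k s)" by (rule L2_diff[OF assms perp_L2[OF err_perp]])
 thus xl: "L2 (xl k)" by (simp add: x_xl)
 show "L2 (dlt k)" unfolding dlt_def[abs_def] by (rule L2_diff[OF xl xr])
 show pr: "L2 (pr k)"
  by (rule L2_cong_AE[OF vec_cond_exp_L2[OF FQ_subalgebra[of k] assms] measurable_from_subalg[OF FQ_subalgebra pr_FQ]])
   (use pr_estimate[of k] in "auto elim: eventually_mono")
 show "L2 (dd k)" unfolding dd_def[abs_def] by (rule L2_diff[OF xl pr])
qed

lemma msq_w: "msq W (w k) = msq W (w 0)" using msq_cov[OF w_cov[of k]] msq_cov[OF w_cov[of 0]] by simp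

lemma past_u: "u : bm (FL k) ==> u : bm (hist (upto k))" by (rule meas_coarser[OF _ FL_hist]) auto

lemma msq_noise_step: assumes "psd W" "g : bm (hist (upto k))" "L2 g" shows "msq W (%s. g s+w k s) = msq W g+msq W (w 0)"
 using msq_centred[OF psd_sym[OF assms(1)] hist_subalgebra w_centred[OF order.refl] noise_L2(2) assms(2,3)]
 unfolding msq_w[of W k] by (simp add: add.commute)

text \<open>Applied with \<open>q = 1\<close> to the state and with \<open>q = p\<close> to the
  remote errors. The input \<open>z\<close> itself may be unbounded, being free on the kernel of
  \<open>G\<close>. Its substitute \<open>u = H G z\<close>, with \<open>H\<close> a generalized
  inverse, has the same effect, and \<open>G z\<close> is a combination of terms with bounded
  energy. \<open>N\<close> shifts time to where the bounds are valid.\<close>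

lemma control_energy_bound: fixes G :: "real^'m^'n" and \<xi> e :: "nat => 'a => real^'n"
 assumes q: "0 < q" and Q: "psd Q" and R: "pos_def R" and L: "!!k. L2 (\<xi> k)" "!!k. L2 (e k)"
  and bd: "!!k. msq (mat 1) (\<xi> k) <= c" "!!k. msq (mat 1) (e k) <= c"
  and e: "!!k s. e (Suc k) s = (A *v \<xi> k s+G *v z k s)+w (k+N) s" and F: "!!k. \<xi> k : bm (hist (upto (k+N)))"
   "!!k. (%s. G *v z k s) : bm (hist (upto (k+N)))" and step: "!!k W. psd W ==> q*msq W (e (Suc k)) <= msq W (\<xi> (Suc k))"
 shows "EX c. ALL j. qf (value_iter (sqrt q *\<^sub>R A) (sqrt q *\<^sub>R G) Q R j) (Qw *v y) <= c" proof -
 have pm: "psd (mat 1 :: real^'n^'n)" by (rule psd_mat_1)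
 define t where "t = msq (mat 1) (w 0)"
 obtain H :: "real^'n^'m" where H: "!!z. G *v (H *v (G *v z)) = G *v z" using matrix_generalized_inverse[of G] by blast
 define g where "g k s = G *v z k s" for k s
 have gx: "g k s = (e (Suc k) s+(- A) *v \<xi> k s)+- w (k+N) s" for k s by (simp add: g_def e uminus_matrix_vector)
 have Lg: "L2 (g k)" for k unfolding gx by (intro L2_add L2_uminus L2_matrix L noise_L2)
 define u where "u k s = H *v g k s" for k s
 have Lu: "L2 (u k)" for k unfolding u_def[abs_def] by (rule L2_matrix[OF Lg])
 have Bu: "G *v u k s = g k s" for k s by (simp add: u_def g_def H)
 have gF: "g k : bm (hist (upto (k+N)))" for k unfolding g_def[abs_def] by (rule F)
 obtain a where a: "0 <= a" "!!f. L2 f ==> msq (tp (- A)**mat 1**(- A)) f <= a*msq (mat 1) f" using msq_bound by blast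
 have bg: "msq (mat 1) (g k) <= 4*c+4*(a*c)+2*t" for k proof - have "msq (mat 1) (%s. (- A) *v \<xi> k s) <= a*c"
   unfolding msq_matrix using a(2)[OF L(1), of k] mult_left_mono[OF bd(1) a(1), of k] by linarith
  moreover have "msq (mat 1) (%s.-w (k+N) s) = t" using msq_w[of "mat 1" "k+N"] by (simp add: t_def msq_1)
  ultimately show ?thesis unfolding gx by (intro msq_three_bound[OF pm] L2_uminus L2_matrix L noise_L2 bd)
 qed obtain b where b: "0 <= b" "!!f. L2 f ==> msq Q f <= b*msq (mat 1) f" using msq_bound by blast
 obtain r where r: "0 <= r" "!!f. L2 f ==> msq (tp H**R**H) f <= r*msq (mat 1) f" using msq_bound by blast
 show ?thesis proof (rule value_iter_noise_bound[OF Q R q, of \<xi> u])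
  show "msq Q (\<xi> k)+msq R (u k) <= b*c+r*(4*c+4*(a*c)+2*t)" for k unfolding u_def[abs_def] msq_matrix
   using b(2)[OF L(1), of k] r(2)[OF Lg, of k] mult_left_mono[OF bd(1) b(1), of k] mult_left_mono[OF bg r(1), of k] by linarith
  show "msq W (%s. (sqrt q *\<^sub>R A) *v \<xi> k s+(sqrt q *\<^sub>R G) *v u k s)+q*msq W (w 0) <= msq W (\<xi> (Suc k))"
   if W: "psd W" for k W proof -
   have "(sqrt q *\<^sub>R A) *v \<xi> k s+(sqrt q *\<^sub>R G) *v u k s = sqrt q *\<^sub>R (A *v \<xi> k s+g k s)" for s
    by (simp add: mv_scaleR Bu scaleR_add_right)
   hence "msq W (%s. (sqrt q *\<^sub>R A) *v \<xi> k s+(sqrt q *\<^sub>R G) *v u k s) = q*msq W (%s. A *v \<xi> k s+g k s)"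
    using q by (simp add: msq_def matrix_vector_mult_scaleR)
   moreover have "msq W (%s. (A *v \<xi> k s+g k s)+w (k+N) s) = msq W (%s. A *v \<xi> k s+g k s)+msq W (w 0)"
    by (rule msq_noise_step[OF W]) (intro bm_add bm_matrix F gF L2_add L2_matrix L Lg)+
   moreover have "e (Suc k) = (%s. (A *v \<xi> k s+g k s)+w (k+N) s)" by (simp add: e g_def fun_eq_iff)
   ultimately show ?thesis using step[OF W, of k] by (simp add: distrib_left)
  qed qed (use L Lu in auto)
qed

text \<open>The state is a controlled process with the full input matrix, which gives the first
  bound. For the second, the remote error \<open>x - xr\<close> evolves under \<open>ut\<close>
  alone, and \<open>erasure_bound\<close> supplies the factor \<open>p\<close> between the errors
  before and after a packet.\<close>

theorem necessity_bounds: assumes bd: "!!k. N <= k ==> L2 (x k) & msq (mat 1) (x k) <= c"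
  and RL: "pos_def RL" and RR: "pos_def RR" and Q: "psd Q"
 shows "EX c. ALL j. qf (value_iter A B Q (block_diag RL RR) j) (Qw *v y) <= c"
  and "psd Z ==> 0 < p ==> EX c. ALL j. qf (value_iter (sqrt p *\<^sub>R A) (sqrt p *\<^sub>R BL)
   ((1-p) *\<^sub>R Z+p *\<^sub>R Q) (p *\<^sub>R RL) j) (Qw *v y) <= c" proof -
 let ?x = "%k. x (k+N)" and ?\<xi> = "%k s. x (k+N) s-xr (k+N) s" and ?e = "%k s. x (k+N) s-pr (k+N) s"
 have Lx: "L2 (x (k+N))" and bx: "msq (mat 1) (x (k+N)) <= c" for k using bd by auto
 have pm: "psd (mat 1 :: real^'n^'n)" by (rule psd_mat_1)
 have xF: "x (k+N) : bm (hist (upto (k+N)))" for k by (rule hist_past_mono[OF x_hist]) auto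
 \<comment> \<open>The local correction acts through the first block of \<open>B\<close>, so both
   controls together form a single input of the block problem.\<close>
 have BU: "B *v (U k s+embed_inl (ut k s)) = B *v U k s+BL *v ut k s" for k s by (simp add: mv_add hcat_mult)
 have "EX c. ALL j. qf (value_iter (sqrt 1 *\<^sub>R A) (sqrt 1 *\<^sub>R B) Q (block_diag RL RR) j) (Qw *v y) <= c"
 proof (rule control_energy_bound[OF zero_less_one Q pos_def_block_diag[OF RL RR] Lx Lx bx bx _ xF])
  show "x (Suc k+N) s = A *v x (k+N) s+B *v (U (k+N) s+embed_inl (ut (k+N) s))+w (k+N) s" for k s by (simp add: BU x_Suc add_ac)
  show "(%s. B *v (U (k+N) s+embed_inl (ut (k+N) s))) : bm (hist (upto (k+N)))" for k
   by (rule past_u) (unfold BU, intro bm_add bm_matrix U_FL ut_FL)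
 qed simp
 thus "EX c. ALL j. qf (value_iter A B Q (block_diag RL RR) j) (Qw *v y) <= c" by simp
 assume Z: "psd Z" and p: "0 < p"
 have L: "L2 (?\<xi> k)" "L2 (?e k)" for k by (intro L2_diff Lx moments_L2)+
 have b\<xi>: "msq (mat 1) (?\<xi> k) <= c" for k proof -
  have "msq (mat 1) (%s. ?\<xi> k s+xr (k+N) s) = msq (mat 1) (?\<xi> k)+msq (mat 1) (xr (k+N))"
   by (rule msq_centred[OF psd_sym[OF pm] FR_subalgebra FR_xr_centred L(1) xr_FR moments_L2(1)[OF Lx]])
  thus ?thesis using bx[of k] msq_nonneg[OF pm, of "xr (k+N)"] by simp
 qed have be: "msq (mat 1) (?e k) <= c" for k proof -
  have "msq (mat 1) (%s. ?e k s+pr (k+N) s) = msq (mat 1) (?e k)+msq (mat 1) (pr (k+N))"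
   by (rule msq_centred[OF psd_sym[OF pm] FQ_subalgebra x_pr_centred L(2) pr_FQ moments_L2(4)[OF Lx]])
  thus ?thesis using bx[of k] msq_nonneg[OF pm, of "pr (k+N)"] by simp
 qed have pQ: "psd ((1-p) *\<^sub>R Z+p *\<^sub>R Q)" using p_range by (intro psd_add psd_scaleR Z Q) auto
 have pR: "pos_def (p *\<^sub>R RL)" using RL p by (simp add: pos_def_def transpose_scaleR mv_scaleR)
 show "EX c. ALL j. qf (value_iter (sqrt p *\<^sub>R A) (sqrt p *\<^sub>R BL) ((1-p) *\<^sub>R Z+p *\<^sub>R Q) (p *\<^sub>R RL) j) (Qw *v y) <= c"
 proof (rule control_energy_bound[OF p pQ pR L b\<xi> be])
  show "?e (Suc k) s = (A *v ?\<xi> k s+BL *v ut (k+N) s)+w (k+N) s" for k s by (simp add: x_pr_Suc)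
  show "?\<xi> k : bm (hist (upto (k+N)))" for k by (intro bm_diff xF past_u meas_coarser[OF xr_FR FR_FL]) simp
  show "(%s. BL *v ut (k+N) s) : bm (hist (upto (k+N)))" for k by (rule past_u) (intro bm_matrix ut_FL)
  show "p*msq W (?e (Suc k)) <= msq W (?\<xi> (Suc k))" if W: "psd W" for k W proof -
   have "p*msq W (?e (Suc k)) <= msq W (%s. ?e (Suc k) s+(pr (Suc k+N) s-xr (Suc k+N) s))"
    by (rule erasure_bound[OF W x_pr_centred x_pr_hist L(2)])
     (intro bm_diff pr_FR xr_FR L2_diff moments_L2 Lx)+
   thus ?thesis by simp
  qed qed qed

end

section \<open>Cost balance and lower bound\<close>

definition frob :: "real^'n^'n => real^'n^'n => real" where "frob W P = (SUM i:UNIV. SUM j:UNIV. W $ i $ j*P $ i $ j)"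

text \<open>With \<open>G = Q_mu\<close>, the cost of the filter error plus the
  \<open>Theta\<close>-energy of the next filter correction. Both depend on the filter covariances
  only, hence on no control.\<close>

definition filter_rate where "filter_rate A C Qw Qv W0 G \<Theta> k =
  frob (G+tp A**\<Theta> ** A) (filter_cov A C Qw Qv W0 k)+frob \<Theta> Qw -frob \<Theta> (filter_cov A C Qw Qv W0 (Suc k))"

context prob_space begin

lemma msq_mean: assumes W: "tp W = W" and f: "L2 f" shows "msq W f = msq W (%s. f s-EV M f)+qf W (EV M f)" proof -
 have "msq W (%s. (f s-EV M f)+EV M f) = msq W (%s. f s-EV M f)+msq W (%_. EV M f)"
 proof (rule msq_add[OF W L2_diff[OF f L2_const] L2_const])
  show "EV M (%s. (f s-EV M f) \<bullet> (W *v EV M f)) = 0" using L2_integrable[OF f] by (simp add: prob_space)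
 qed thus ?thesis by (simp add: msq_const)
qed

lemma msq_frob: "has_cov f P ==> msq W f = frob W P" unfolding frob_def by (rule msq_cov)

lemma expectation_matrix: "integrable M f ==> EV M (%s. (W::real^'n^'m) *v f s) = W *v (EV M (%s. f s))"
 by (rule integral_bounded_linear[OF matrix_vector_mul_bounded_linear])

end

context loop begin

definition mn where "mn k = EV M (%s. x k s)"

lemma xr_integrable: "integrable M (xr k)" unfolding xr_def by (rule vec_cond_exp_integrable[OF FR_subalgebra x_integrable])

lemma xr_mean: "EV M (%s. xr k s) = mn k"
 using centred_expectation[OF FR_subalgebra FR_xr_centred, of k] x_integrable[of k] xr_integrable[of k] by (simp add: mn_def)

lemma mn_Suc: "mn (Suc k) = A *v mn k+B *v EV M (U k)" proof -
 have i: "integrable M (%s. (W::real^'l^'n) *v f s)" if "integrable M f" for W f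
  by (rule integrable_bounded_linear[OF matrix_vector_mul_bounded_linear that])
 have "mn (Suc k) = A *v mn k+B *v EV M (U k)+BL *v EV M (ut k)+EV M (w k)" unfolding mn_def x_Suc
  using i[OF x_integrable[of k], of A] i[OF U_integrable[of k], of B] i[OF ut_integrable[of k], of BL] L2_integrable[OF noise_L2(2)[of k]]
  by (simp add: expectation_matrix x_integrable U_integrable ut_integrable)
 thus ?thesis using centred_expectation[OF FR_subalgebra ut_centred, of k] noise_mean(2)[of k] by simp
qed

lemma dd_centred: "centred (FQ k) (dd k)" proof -
 have "centred (FQ k) (%s. (x k s-pr k s)-err k s)" by (intro centred_diff[OF FQ_subalgebra] x_pr_centred
    centred_mono[OF err_centred_FL order.trans[OF FQ_FR FR_FL]])
 thus ?thesis by (simp add: dd_def[abs_def] x_xl algebra_simps)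
qed

lemma dd_hist: "dd k : bm (hist (past k (Suc k) k))" unfolding dd_def[abs_def]
 by (intro bm_diff meas_coarser[OF xl_FM FM_hist] meas_coarser[OF pr_FQ FQ_hist]) simp_all

lemma dlt_dd: "dlt k s = dd k s+(pr k s-xr k s)" by (simp add: dlt_def dd_def)

lemma err_cov_msq: "msq W (err k) = frob W (filter_cov A C Qw Qv W0 k)" by (rule msq_frob[OF err_cov])

lemma msq_dlt_bound: "psd W ==> L2 (x k) ==> p*msq W (dd k) <= msq W (dlt k)" unfolding dlt_dd[abs_def]
 by (rule erasure_bound) (auto intro!: dd_centred dd_hist bm_diff pr_FR xr_FR L2_diff moments_L2)

lemma FR_field_measurable: "f : bm (FR k) ==> f : bm (FL k)" by (erule meas_coarser[OF _ FR_FL]) simp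

lemma dlt_FL: "dlt k : bm (FL k)" unfolding dlt_def[abs_def] by (intro bm_diff xl_FL FR_field_measurable xr_FR)

lemma xl_split_r: assumes W: "tp W = W" and L: "L2 (x k)" shows "msq W (%s. xl k s-c) = msq W (dlt k)+msq W (%s. xr k s-c)"
  "msq W (%s. xl k s-c) = msq W (dd k)+msq W (%s. pr k s-c)" proof - note m = moments_L2[OF L]
 have "msq W (%s. dlt k s+(xr k s-c)) = msq W (dlt k)+msq W (%s. xr k s-c)"
  by (rule msq_centred[OF W FR_subalgebra dlt_centred m(3)]) (intro bm_diff borel_measurable_const L2_diff L2_const m xr_FR)+
 thus "msq W (%s. xl k s-c) = msq W (dlt k)+msq W (%s. xr k s-c)" by (simp add: dlt_def)
 have "msq W (%s. dd k s+(pr k s-c)) = msq W (dd k)+msq W (%s. pr k s-c)"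
  by (rule msq_centred[OF W FQ_subalgebra dd_centred m(5)]) (intro bm_diff borel_measurable_const L2_diff L2_const m pr_FQ)+
 thus "msq W (%s. xl k s-c) = msq W (dd k)+msq W (%s. pr k s-c)" by (simp add: dd_def)
qed

lemma msq_x_split: assumes W: "tp W = W" and L: "L2 (x k)"
 shows "msq W (x k) = qf W (mn k)+msq W (%s. xr k s-mn k)+msq W (dlt k)+msq W (err k)" proof - note m = moments_L2[OF L]
 have "msq W (x k) = msq W (%s. err k s+xl k s)" by (simp add: x_xl[abs_def] add.commute)
 also have "... = msq W (err k)+msq W (xl k)"
  by (rule msq_centred[OF W FL_subalgebra err_centred_FL perp_L2[OF err_perp] xl_FL m(2)])
 also have "msq W (xl k) = msq W (dlt k)+msq W (xr k)" using xl_split_r(1)[OF W L, of 0] by simp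
 also have "msq W (xr k) = msq W (%s. xr k s-mn k)+qf W (mn k)" using msq_mean[OF W m(1)] by (simp add: xr_mean)
 finally show ?thesis by simp
qed

lemma nu_gfield: "nu (Suc k) : bm (gfield (Suc (Suc k)))" proof -
 have e: "est k : bm (gfield (Suc (Suc k)))" by (rule gfield_measurable_mono[OF est_gfield]) simp
 have "nu (Suc k) = (%s. est (Suc k) s-A *v est k s)" by (simp add: nu_def perr_def err_def pre_def fun_eq_iff)
 also have "... : bm (gfield (Suc (Suc k)))" by (intro bm_diff bm_matrix e est_gfield)
 finally show ?thesis .
qed

text \<open>\<open>err\<close> and \<open>nu\<close> are orthogonal with sum \<open>perr\<close>, so
  the energy of the correction is that of the prediction error minus that of the filter
  error.\<close>

lemma msq_nu: assumes W: "psd W" shows "msq W (nu (Suc k)) = frob (tp A**W**A) (filter_cov A C Qw Qv W0 k)+frob W Qw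
 -frob W (filter_cov A C Qw Qv W0 (Suc k))" proof - note Ws = psd_sym[OF W]
 note Lnu = perp_L2[OF nu_perp] and Le = perp_L2[OF err_perp]
 have "msq W (%s. err (Suc k) s+nu (Suc k) s) = msq W (err (Suc k))+msq W (nu (Suc k))"
  by (rule msq_centred[OF Ws gfield_subalgebra perp_centred[OF err_perp] Le nu_gfield Lnu])
 hence "msq W (nu (Suc k)) = msq W (perr (Suc k))-msq W (err (Suc k))" by (simp add: nu_def)
 also have "msq W (perr (Suc k)) = msq W (%s. A *v err k s+w k s)" by (simp add: perr_Suc[abs_def])
 also have "... = msq W (%s. A *v err k s)+msq W (w 0)"
  by (rule msq_noise_step[OF W]) (intro bm_matrix hist_past_mono[OF err_hist] L2_matrix Le; simp)+
 also have "... = frob (tp A**W**A) (filter_cov A C Qw Qv W0 k)+frob W Qw" unfolding msq_matrix err_cov_msq msq_frob[OF w_cov] ..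
 finally show ?thesis unfolding err_cov_msq .
qed

lemma msq_dd_Suc: assumes W: "psd W" and L: "L2 (x k)" "L2 (ut k)"
 shows "msq W (dd (Suc k)) = msq W (%s. A *v dlt k s+BL *v ut k s)+msq W (nu (Suc k))" proof -
 have g: "(%s. A *v dlt k s+BL *v ut k s) : bm (gfield (Suc k))" by (rule meas_coarser[OF _ FL_gfield])
   (auto intro!: bm_add bm_matrix dlt_FL ut_FL)
 have "msq W (%s. nu (Suc k) s+(A *v dlt k s+BL *v ut k s)) = msq W (nu (Suc k))+msq W (%s. A *v dlt k s+BL *v ut k s)"
  by (rule msq_centred[OF psd_sym[OF W] gfield_subalgebra perp_centred[OF nu_perp] perp_L2[OF nu_perp] g])
   (intro L2_add L2_matrix L moments_L2)
 thus ?thesis by (simp add: dd_Suc[abs_def] add.commute)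
qed

end

locale lqg = loop M x0 w v eta m0 W0 Qw Qv p A C BL BR U ut x yl yr
 for M :: "'a measure" and x0 :: "'a => real^'n" and w v :: "nat => 'a => real^'n" and eta :: "nat => 'a => real"
  and m0 :: "real^'n" and W0 Qw Qv :: "real^'n^'n" and p :: real and A C :: "real^'n^'n"
  and BL :: "real^'m1^'n" and BR :: "real^'m2^'n" and U :: "nat => 'a => real^('m1+'m2)" and ut :: "nat => 'a => real^'m1"
  and x yl yr :: "nat => 'a => real^'n" +
 fixes Q :: "real^'n^'n" and RL :: "real^'m1^'m1" and RR :: "real^'m2^'m2" and \<mu> :: real and Z P X :: "real^'n^'n"
 assumes Q: "psd Q" and mu: "0 <= \<mu>" and RL: "pos_def RL" and RR: "pos_def RR"
  and Z: "pos_def Z" and P: "pos_def P" and \<Theta>: "pos_def (Theta_mat p Z X)"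
  and ric_Z: "riccati_map A (hcat BL BR) (Q_mu \<mu> Q) (block_diag RL RR) Z = Z"
  and ric_P: "riccati_map A (hcat BL BR) Q (block_diag RL RR) P = P"
  and ric_X: "X = riccati_map A BL (Q_mu \<mu> Q) RL (Theta_mat p Z X)" and X_sym: "tp X = X" and Z_le_X: "!!z. qf Z z <= qf X z"
begin

abbreviation "T \<equiv> Theta_mat p Z X"
abbreviation "R \<equiv> block_diag RL RR"
abbreviation "QM \<equiv> Q_mu \<mu> Q"

lemma R: "pos_def R" by (rule pos_def_block_diag[OF RL RR])
lemma QM: "psd QM" by (rule Q_mu_psd[OF mu Q])
lemma syms: "tp Z = Z" "tp P = P" "tp T = T" "tp QM = QM" "tp R = R" using Z P \<Theta> QM R by (auto simp: pos_def_def psd_def)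

lemma X_psd: "psd X" using X_sym Z_le_X pd_psd[OF Z] unfolding psd_def by (meson order.trans)

lemma XZ_psd: "psd (X-Z)" using X_sym syms(1) Z_le_X by (simp add: psd_def transpose_diff mv_rdiff inner_diff_right)

lemma T_eq: "T = Z+p *\<^sub>R (X-Z)" by (simp add: Theta_mat_def algebra_simps)

definition V where "V k = qf P (mn k)+msq Z (%s. xr k s-mn k)+msq X (dlt k)"

definition stage where "stage k = msq QM (x k)+msq R (U k)+msq RL (ut k)-\<mu> * qf Q (mn k)"

text \<open>The three squares left by completion, for the mean, for the deviation of the remote
  estimate and for the local correction; the stated feedback makes each of them vanish.\<close>

definition gap where "gap k = qf (Upsilon_mat B R P) (EV M (U k)+K_gain A B R P *v mn k)
 +msq (Upsilon_mat B R Z) (%s. (U k s-EV M (U k))+K_gain A B R Z *v (xr k s-mn k))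
 +msq (Upsilon_mat BL RL T) (%s. ut k s+K_gain A BL RL T *v dlt k s)"

abbreviation "rate \<equiv> filter_rate A C Qw Qv W0 QM T"

text \<open>The counterpart of \<open>V\<close> before the packet of time \<open>k\<close>:
  prediction instead of estimate, and \<open>T\<close> instead of \<open>X\<close> as the weight of
  the part unknown to the remote side.\<close>

definition Vp where "Vp k = qf P (mn k)+msq Z (%s. pr k s-mn k)+msq T (dd k)"

lemma Upsilons: "pos_def (Upsilon_mat B R P)" "pos_def (Upsilon_mat B R Z)" "pos_def (Upsilon_mat BL RL T)"
 using Upsilon_pos_def[OF pd_psd[OF P] R, of B] Upsilon_pos_def[OF pd_psd[OF Z] R, of B]
  Upsilon_pos_def[OF pd_psd[OF \<Theta>] RL, of BL] by auto

lemma gap_nonneg: "0 <= gap k" unfolding gap_def by (intro add_nonneg_nonneg msq_nonneg psd_quad pd_psd Upsilons)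

text \<open>One completion of squares for each orthogonal component, with weight \<open>Q\<close>
  for the mean and \<open>Q_mu\<close> for the other two. The filter error and the new correction
  \<open>nu\<close> are left over and form the rate.\<close>

lemma stage_balance: assumes L: "L2 (x k)" "L2 (U k)" "L2 (ut k)" shows "stage k+Vp (Suc k) = V k+rate k+gap k" proof -
 note m = moments_L2[OF L(1)]
 let ?u = "EV M (U k)" and ?m = "mn k"
 let ?b = "%s. xr k s-?m" and ?c = "%s. U k s-?u"
 have Lb: "L2 ?b" "L2 ?c" by (intro L2_diff L2_const m L)+
 have 1: "qf Q ?m+qf R ?u+qf P (mn (Suc k)) = qf P ?m+qf (Upsilon_mat B R P) (?u+K_gain A B R P *v ?m)"
  using stage_cost_completion[OF syms(2) Upsilons(1), of A Q ?m ?u] unfolding ric_P stage_cost_def mn_Suc by simp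
 have "pr (Suc k) s-mn (Suc k) = A *v ?b s+B *v ?c s" for s by (simp add: pr_def mn_Suc mv_diff)
 hence 2: "msq QM ?b+msq R ?c+msq Z (%s. pr (Suc k) s-mn (Suc k))
  = msq Z ?b+msq (Upsilon_mat B R Z) (%s. ?c s+K_gain A B R Z *v ?b s)"
  using msq_completion[OF syms(1) Upsilons(2) Lb, of QM A] unfolding ric_Z by simp
 have 3: "msq QM (dlt k)+msq RL (ut k)+msq T (%s. A *v dlt k s+BL *v ut k s)
  = msq X (dlt k)+msq (Upsilon_mat BL RL T) (%s. ut k s+K_gain A BL RL T *v dlt k s)"
  using msq_completion[OF syms(3) Upsilons(3) m(3) L(3), of QM A] unfolding ric_X[symmetric] .
 have 4: "msq T (dd (Suc k)) = msq T (%s. A *v dlt k s+BL *v ut k s)+msq T (nu (Suc k))"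
  by (rule msq_dd_Suc[OF pd_psd[OF \<Theta>] L(1,3)])
 have 5: "msq QM (err k)+msq T (nu (Suc k)) = rate k"
  unfolding msq_nu[OF pd_psd[OF \<Theta>]] err_cov_msq filter_rate_def frob_def by (simp add: sum.distrib distrib_right)
 have 6: "msq R (U k) = msq R ?c+qf R ?u" by (rule msq_mean[OF syms(5) L(2)])
 have 7: "qf QM ?m-\<mu> * qf Q ?m = qf Q ?m" by (simp add: Q_mu_eq mv_scaleR algebra_simps)
 show ?thesis unfolding stage_def Vp_def V_def gap_def msq_x_split[OF syms(4) L(1)] using 1 2 3 4 5 6 7 by linarith
qed

text \<open>The \<open>Z\<close>-energy of \<open>xl - mn\<close> can be split either at the remote
  estimate or at the remote prediction. Since \<open>T = Z + p (X - Z)\<close>, the two values then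
  differ only in the weight \<open>X - Z\<close>.\<close>

lemma V_split: assumes L: "L2 (x k)" shows "V k = Vp k+(msq (X-Z) (dlt k)-p*msq (X-Z) (dd k))" proof -
 have "msq (Z+(X-Z)) (dlt k) = msq Z (dlt k)+msq (X-Z) (dlt k)" by (rule msq_plus[OF moments_L2(3)[OF L]])
 moreover have "msq T (dd k) = msq Z (dd k)+p*msq (X-Z) (dd k)" unfolding T_eq msq_plus[OF moments_L2(5)[OF L]] msq_scaleR ..
 ultimately show ?thesis using xl_split_r[OF syms(1) L, of "mn k"] by (simp add: V_def Vp_def)
qed

lemma V_ge: "L2 (x k) ==> Vp k <= V k" using V_split msq_dlt_bound[OF XZ_psd] by simp

lemma V_nonneg: "0 <= V k" unfolding V_def by (intro add_nonneg_nonneg msq_nonneg psd_quad pd_psd Z P X_psd)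

lemma x_L2: assumes "!!j. j < k ==> L2 (U j)" "!!j. j < k ==> L2 (ut j)" shows "L2 (x k)" using assms proof (induction k)
 case (Suc k) thus ?case unfolding x_Suc by (intro L2_add L2_matrix noise_L2) auto
qed (simp add: x_0 noise_L2)

lemma cost_lower_bound: assumes L: "!!k. L2 (U k)" "!!k. L2 (ut k)"
 shows "(SUM k<=N. rate k)+V 0-V (Suc N) <= (SUM k<=N. stage k)" proof (induction N)
 have Lx: "L2 (x k)" for k by (rule x_L2) (rule L)+
 have step: "rate k+V k <= stage k+V (Suc k)" for k
  using stage_balance[OF Lx L, of k] V_ge[OF Lx, of "Suc k"] gap_nonneg[of k] by linarith
 case 0 show ?case using step[of 0] by simp
 case (Suc N) thus ?case using step[of "Suc N"] by simp
qed

lemma V_le_msq: "EX c>=0. ALL k. L2 (x k) --> V k <= c*msq (mat 1) (x k)" proof -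
 obtain c1 where c1: "0 <= c1" "!!z. \<bar>z \<bullet> (P *v z)\<bar> <= c1*(z \<bullet> z)" using quad_upper_bound[of P] by blast
 obtain c2 where c2: "0 <= c2" "!!f. L2 f ==> msq Z f <= c2*msq (mat 1) f" using msq_bound by blast
 obtain c3 where c3: "0 <= c3" "!!f. L2 f ==> msq X f <= c3*msq (mat 1) f" using msq_bound by blast
 define c where "c = c1+c2+c3"
 have "V k <= c*msq (mat 1) (x k)" if L: "L2 (x k)" for k proof - note m = moments_L2[OF L]
  have I: "psd (mat 1 :: real^'n^'n)" by (rule psd_mat_1)
  have a: "qf P (mn k) <= c*(mn k \<bullet> mn k)"
   using c1(2)[of "mn k"] c2(1) c3(1) mult_right_mono[of c1 c "mn k \<bullet> mn k"] unfolding c_def by fastforce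
  have Lb: "L2 (%s. xr k s-mn k)" by (intro L2_diff L2_const m)
  have b: "msq Z (%s. xr k s-mn k) <= c*msq (mat 1) (%s. xr k s-mn k)"
   using c2(2)[OF Lb] c1(1) c3(1) mult_right_mono[OF _ msq_nonneg[OF I], of c2 c "%s. xr k s-mn k"] unfolding c_def by fastforce
  have d: "msq X (dlt k) <= c*msq (mat 1) (dlt k)"
   using c3(2)[OF m(3)] c1(1) c2(1) mult_right_mono[OF _ msq_nonneg[OF I], of c3 c "dlt k"] unfolding c_def by fastforce
  have "0 <= c*msq (mat 1) (err k)" using c1(1) c2(1) c3(1) msq_nonneg[OF I] by (simp add: c_def)
  thus ?thesis using a b d unfolding V_def msq_x_split[OF psd_sym[OF I] L] distrib_left by simp
 qed moreover have "0 <= c" using c1(1) c2(1) c3(1) by (simp add: c_def)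
 ultimately show ?thesis by blast
qed

end

section \<open>The optimal feedback: admissibility, exactness and boundedness\<close>

lemma contraction_bounded: fixes u :: "nat => real"
 assumes "!!k. u (Suc k) <= (1-e)*u k+c" "0 < e" "e <= 1" shows "EX b. ALL k. u k <= b" proof (intro exI allI)
 fix k show "u k <= max (u 0) (c/e)" proof (induction k) case (Suc k) have "u (Suc k) <= (1-e)*max (u 0) (c/e)+c"
   using assms(1)[of k] mult_left_mono[OF Suc, of "1-e"] assms(3) by linarith
  also have "... = max (u 0) (c/e)-e*max (u 0) (c/e)+c" by (simp add: algebra_simps)
  also have "... <= max (u 0) (c/e)" using mult_left_mono[of "c/e" "max (u 0) (c/e)" e] assms(2) by simp
  finally show ?case .
 qed simp
qed

lemma lyapunov_contraction: fixes F :: "real^'n^'n" assumes "schur_stable F"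
 obtains P e where "pos_def P" "0 < e" "e <= 1" "!!x. qf P (F *v x) <= (1-e)*qf P x" "!!x. x \<bullet> x <= qf P x" proof -
 obtain P where P: "pos_def P" "!!x. qf P (F *v x) = qf P x-x \<bullet> x" using lyapunov_solution[OF assms] by blast
 obtain c where c: "!!x. \<bar>x \<bullet> (P *v x)\<bar> <= c*(x \<bullet> x)" using quad_upper_bound[of P] by blast
 \<comment> \<open>The maximum with 1 puts the contraction constant \<open>1/C\<close> into the
   interval (0,1].\<close>
 define C where "C = max 1 c"
 have C: "1 <= C" "qf P x <= C*(x \<bullet> x)" for x
  using abs_le_D1[OF c[of x]] mult_right_mono[of c C "x \<bullet> x"] by (auto simp: C_def)
 show ?thesis proof (rule that[OF P(1), of "1/C"])
  show "0 < 1/C" "1/C <= 1" using C(1) by auto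
  show "x \<bullet> x <= qf P x" for x using P(2)[of x] psd_quad[OF pd_psd[OF P(1)], of "F *v x"] by simp
  show "qf P (F *v x) <= (1-1/C)*qf P x" for x using C(1) C(2)[of x] by (simp add: P(2) field_simps)
 qed qed

context prob_space begin

lemma msq_mono: "L2 f ==> (!!x. qf W x <= qf W' x) ==> msq W f <= msq W' f"
 unfolding msq_def by (rule integral_mono) (auto intro: L2_quad)

lemma msq_contraction: assumes "L2 f" "!!x. qf P (F *v x) <= (1-e)*qf P x" shows "msq P (%s. F *v f s) <= (1-e)*msq P f" proof -
 have "msq P (%s. F *v f s) <= EV M (%s. (1-e)*qf P (f s))" unfolding msq_def
  by (rule integral_mono) (use assms in "auto intro!: L2_quad L2_matrix Bochner_Integration.integrable_mult_right")
 thus ?thesis by (simp add: msq_def)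
qed

end

context plant begin

text \<open>This precedes any use of the closed-loop locale, whose assumptions include
  admissibility. Square integrability of the state and measurability of the outputs are built up
  together in time.\<close>

lemma feedback_admissible: fixes BL :: "real^'m1^'n" and BR :: "real^'m2^'n" and x yl yr :: "nat => 'a => real^'n"
 assumes x_0: "x 0 = x0" and x_Suc: "!!k. x (Suc k) = (%s. A *v x k s+hcat BL BR *v U k s+BL *v ut k s+w k s)"
  and yl_eq: "!!k. yl k = (%s. C *v x k s+v k s)" and yr_eq: "!!k. yr k = (%s. eta k s *\<^sub>R
   vec_cond_exp M (generated_by M (yl ` {..k} Un yr ` {..<k})) (x k) s)"
  and U: "!!k s. s : space M ==> U k s = - (K *v vec_cond_exp M (generated_by M (yr ` {..k})) (x k) s)-c k"
  and ut: "!!k s. s : space M ==> ut k s = - (G *v (vec_cond_exp M (generated_by M (yl ` {..k} Un yr ` {..k})) (x k) s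
   -vec_cond_exp M (generated_by M (yr ` {..k})) (x k) s))"
 shows "L2 (x k) & L2 (U k) & L2 (ut k) & U k : bm (generated_by M (yr ` {..k})) &
  ut k : bm (generated_by M (yl ` {..k} Un yr ` {..k})) & (AE s in M. vec_cond_exp M (generated_by M (yr ` {..k})) (ut k) s = 0)"
proof - let ?FR = "%k. generated_by M (yr ` {..k})" and ?FL = "%k. generated_by M (yl ` {..k} Un yr ` {..k})"
 let ?xl = "%k. vec_cond_exp M (?FL k) (x k)" and ?xr = "%k. vec_cond_exp M (?FR k) (x k)"
 have RL: "sets (?FR k) \<subseteq> sets (?FL k)" for k by (rule generated_by_least) (auto intro: generated_by_member)
 have xr: "?xr k : bm (?FR k)" for k by (rule vec_cond_exp_measurable)
 have xl: "?xl k : bm (?FL k)" for k by (rule vec_cond_exp_measurable)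
 have xr': "?xr k : bm (?FL k)" for k by (rule meas_coarser[OF xr RL]) simp
 have Um: "U k : bm (?FR k)" for k proof - have "(%s.-(K *v ?xr k s)-c k) : bm (?FR k)"
   by (intro bm_diff borel_measurable_uminus bm_matrix xr borel_measurable_const)
  thus ?thesis by (subst measurable_cong[of _ _ "%s.-(K *v ?xr k s)-c k"]) (simp_all add: U)
 qed have um: "ut k : bm (?FL k)" for k proof - have "(%s.-(G *v (?xl k s-?xr k s))) : bm (?FL k)"
   by (intro bm_diff borel_measurable_uminus bm_matrix xr' xl)
  thus ?thesis by (subst measurable_cong[of _ _ "%s.-(G *v (?xl k s-?xr k s))"]) (simp_all add: ut)
 qed have step: "L2 (U k) & L2 (ut k) & (ALL j<=k. yl j : bm M & yr j : bm M) & (AE s in M. vec_cond_exp M (?FR k) (ut k) s = 0)"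
  if Lx: "L2 (x k)" and y: "ALL j<k. yl j : bm M & yr j : bm M" for k proof - have yl: "yl k : bm M"
   unfolding yl_eq by (intro bm_add bm_matrix L2_measurable[OF Lx] L2_measurable[OF noise_L2(3)])
  have FM: "subalgebra M (generated_by M (yl ` {..k} Un yr ` {..<k}))"
   using y yl by (intro generated_by_subalgebra) (auto simp: order.order_iff_strict)
  have yr: "yr k : bm M" by (subst yr_eq) (intro borel_measurable_scaleR eta_measurable vec_cond_exp_measurable'[OF FM])
  have ys: "ALL j<=k. yl j : bm M & yr j : bm M" using y yl yr by (auto simp: order.order_iff_strict)
  hence FL: "subalgebra M (?FL k)" and FR: "subalgebra M (?FR k)" by (auto intro!: generated_by_subalgebra)
  note Lr = vec_cond_exp_L2[OF FR Lx] and Ll = vec_cond_exp_L2[OF FL Lx]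
  have "L2 (%s.-(K *v ?xr k s)-c k)" by (intro L2_diff L2_uminus L2_matrix Lr L2_const)
  hence LU: "L2 (U k)" by (rule L2_cong_AE[OF _ measurable_from_subalg[OF FR Um]]) (simp add: U)
  have "L2 (%s.-(G *v (?xl k s-?xr k s)))" by (intro L2_diff L2_uminus L2_matrix Lr Ll)
  hence Lu: "L2 (ut k)" by (rule L2_cong_AE[OF _ measurable_from_subalg[OF FL um]]) (simp add: ut)
  note xi = L2_integrable[OF Lx]
  have "centred (?FR k) (%s. (x k s-?xr k s)-(x k s-?xl k s))"
   by (rule centred_diff[OF FR vec_cond_exp_centred[OF FR xi] centred_mono[OF vec_cond_exp_centred[OF FL xi] RL]])
  hence "centred (?FR k) (%s.-(G *v (?xl k s-?xr k s)))" by (intro centred_uminus[OF FR] centred_matrix[OF FR]) simp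
  hence "centred (?FR k) (%s. ut k s-0)" by (rule centred_cong_AE[OF FR]) (simp_all add: ut L2_measurable[OF Lu])
  hence "AE s in M. vec_cond_exp M (?FR k) (ut k) s = 0" by (intro vec_cond_exp_eqI[OF FR L2_integrable[OF Lu]]) simp_all
  thus ?thesis using LU Lu ys by blast
 qed have "L2 (x k) & (ALL j<k. yl j : bm M & yr j : bm M)" for k proof (induction k) case (Suc k)
  have "L2 (x (Suc k))" unfolding x_Suc using Suc step[of k] by (intro L2_add L2_matrix noise_L2) auto
  thus ?case using step[of k] Suc by (auto simp: less_Suc_eq_le)
 qed (simp add: x_0 noise_L2)
 thus ?thesis using step[of k] Um um by blast
qed

end

context loop begin

text \<open>The receiver cannot tell a lost packet from a received zero, and \<open>\<phi>\<close>
  reads every zero as a loss. Under the hypothesis this misreading is harmless, because a received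
  zero then coincides with the prediction; so \<open>\<phi>\<close> is the remote estimate.\<close>

lemma dlt_exact: assumes z: "AE s in M. xl k s = 0 --> pr k s = 0" shows "AE s in M. dlt k s = z0 k s *\<^sub>R dd k s" proof -
 define \<phi> where "\<phi> s = (if yr k s = 0 then pr k s else yr k s)" for s
 have yr: "yr k : bm (FR k)" by (rule generated_by_member) auto
 have \<phi>: "\<phi> : bm (FR k)" unfolding \<phi>_def[abs_def] by (rule measurable_If[OF pr_FR yr]) (use yr in measurable)
 have ae: "AE s in M. xl k s-\<phi> s = z0 k s *\<^sub>R dd k s"
  using z yr_xl[of k] eta_AE[of k] by eventually_elim (auto simp: \<phi>_def z0_def dd_def)
 have c: "centred (FR k) (%s. err k s+z0 k s *\<^sub>R dd k s)"
  by (intro centred_add[OF FR_subalgebra] erasure[OF dd_centred dd_hist] centred_mono[OF err_centred_FL FR_FL])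
 have "centred (FR k) (%s. x k s-\<phi> s)" proof (rule centred_cong_AE[OF FR_subalgebra c])
  show "(%s. x k s-\<phi> s) : bm M"
   by (intro bm_diff borel_measurable_integrable[OF x_integrable] measurable_from_subalg[OF FR_subalgebra \<phi>])
  show "AE s in M. x k s-\<phi> s = err k s+z0 k s *\<^sub>R dd k s" using ae by eventually_elim (simp add: x_xl algebra_simps)
 qed hence "AE s in M. xr k s = \<phi> s" unfolding xr_def by (rule vec_cond_exp_eqI[OF FR_subalgebra x_integrable \<phi>])
 with ae show ?thesis by eventually_elim (simp add: dlt_def)
qed

lemma msq_dlt_exact: assumes "AE s in M. xl k s = 0 --> pr k s = 0" and L: "L2 (x k)" shows "msq W (dlt k) = p*msq W (dd k)"
proof - note m = moments_L2[OF L]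
 have "msq W (dlt k) = msq W (%s. z0 k s *\<^sub>R dd k s)"
  by (rule msq_cong_AE[OF dlt_exact[OF assms(1)] L2_measurable[OF m(3)] L2_measurable[OF z0_L2[OF m(5)]]])
 thus ?thesis using msq_z0[OF m(5) dd_hist] by simp
qed

lemma msq_err_bounded: assumes "detectable A C" shows "EX b. ALL k. msq (mat 1) (err k) <= b" proof -
 have "EX c. ALL k. qf (filter_cov A C Qw Qv W0 k) (axis i 1) <= c" for i
  by (rule filter_cov_cesaro(2)[OF psd_noise(2,3,1) assms])
 then obtain c where c: "!!i k. filter_cov A C Qw Qv W0 k $ i $ i <= c i" unfolding axis_inner_matrix by metis
 have "msq (mat 1) (err k) = (SUM i:UNIV. filter_cov A C Qw Qv W0 k $ i $ i)" for k
  unfolding err_cov_msq frob_def mat_def by (simp add: if_distrib[of "%a. a*_"] cong: if_cong)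
 hence "msq (mat 1) (err k) <= (SUM i:UNIV. c i)" for k using c by (simp add: sum_mono)
 thus ?thesis by blast
qed

lemma msq_nu_bounded: assumes "detectable A C" "psd W" shows "EX b. ALL k. msq W (nu (Suc k)) <= b" proof -
 obtain b where b: "!!k. msq (mat 1) (err k) <= b" using msq_err_bounded[OF assms(1)] by blast
 obtain c where c: "0 <= c" "!!f. L2 f ==> msq (tp A**W**A) f <= c*msq (mat 1) f" using msq_bound by blast
 have "msq W (nu (Suc k)) <= c*b+frob W Qw" for k
  using msq_nu[OF assms(2), of k] c(2)[OF perp_L2[OF err_perp], of k] mult_left_mono[OF b[of k] c(1)]
   msq_nonneg[OF assms(2), of "err (Suc k)"] unfolding err_cov_msq by linarith
 thus ?thesis by blast
qed

end

locale feedback = lqg M x0 w v eta m0 W0 Qw Qv p A C BL BR U ut x yl yr Q RL RR \<mu> Z P X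
 for M :: "'a measure" and x0 :: "'a => real^'n" and w v :: "nat => 'a => real^'n" and eta :: "nat => 'a => real"
  and m0 :: "real^'n" and W0 Qw Qv :: "real^'n^'n" and p :: real and A C :: "real^'n^'n"
  and BL :: "real^'m1^'n" and BR :: "real^'m2^'n" and U :: "nat => 'a => real^('m1+'m2)" and ut :: "nat => 'a => real^'m1"
  and x yl yr :: "nat => 'a => real^'n" and Q :: "real^'n^'n" and RL :: "real^'m1^'m1" and RR :: "real^'m2^'m2" and \<mu> :: real
  and Z P X :: "real^'n^'n" + fixes K :: "real^'n^('m1+'m2)" and Kb :: "real^'n^('m1+'m2)" and G :: "real^'n^'m1"
 assumes K: "K = K_gain A (hcat BL BR) (block_diag RL RR) Z"
  and Kb: "K_gain A (hcat BL BR) (block_diag RL RR) P = K+Kb" and G: "G = K_gain A BL RL (Theta_mat p Z X)"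
  and U_law: "!!k s. s : space M ==> U k s = - (K *v xr k s)-Kb *v (EV M (%s. xr k s))"
  and ut_law: "!!k s. s : space M ==> ut k s =
   -(G *v (vec_cond_exp M (generated_by M (yl ` {..k} Un yr ` {..k})) (x k) s-xr k s))"
  and L2_controls: "!!k. L2 (U k)" "!!k. L2 (ut k)" and stable_Z: "schur_stable (A-hcat BL BR**K)"
  and stable_P: "schur_stable (A-hcat BL BR**(K+Kb))"
  and stable_T: "schur_stable (sqrt p *\<^sub>R (A-BL**G))" and det: "detectable A C"
begin

lemma Lx: "L2 (x k)" by (rule x_L2) (rule L2_controls)+

lemmas L2s = moments_L2[OF Lx]

abbreviation "AK \<equiv> A-B**K"
abbreviation "F \<equiv> A-BL**G"

lemma U_eq: "s : space M ==> U k s = - (K *v xr k s)-Kb *v mn k" using U_law xr_mean by simp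

lemma U_mean: "EV M (U k) = - ((K+Kb) *v mn k)" proof - have "EV M (U k) = EV M (%s. (- K) *v xr k s-Kb *v mn k)"
  by (rule Bochner_Integration.integral_cong) (simp_all add: U_eq uminus_matrix_vector)
 also have "... = (- K) *v mn k-Kb *v mn k"
  using integrable_bounded_linear[OF matrix_vector_mul_bounded_linear xr_integrable[of k], of "- K"]
  by (simp add: expectation_matrix xr_integrable xr_mean prob_space)
 finally show ?thesis by (simp add: uminus_matrix_vector matrix_vector_mult_add_rdistrib)
qed

lemma ut_eq: "AE s in M. ut k s = - (G *v dlt k s)"
 using xl_estimate(1)[of k] AE_space by eventually_elim (simp add: ut_law dlt_def)

lemma gap_zero: "gap k = 0" proof -
 have "msq (Upsilon_mat B R Z) (%s. (U k s-EV M (U k))+K_gain A B R Z *v (xr k s-mn k)) = msq (Upsilon_mat B R Z) (%_. 0)"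
  unfolding msq_def by (rule Bochner_Integration.integral_cong)
   (simp_all add: U_eq U_mean K[symmetric] matrix_vector_mult_add_rdistrib mv_diff)
 moreover have "msq (Upsilon_mat BL RL T) (%s. ut k s+K_gain A BL RL T *v dlt k s) = msq (Upsilon_mat BL RL T) (%_. 0)"
  by (rule msq_cong_AE) (use ut_eq[of k] in "auto elim!: eventually_mono simp: G[symmetric]
    intro!: L2_measurable[OF L2_add[OF L2_controls(2) L2_matrix[OF L2s(3)]]]")
 ultimately show ?thesis by (simp add: gap_def U_mean Kb msq_const)
qed

lemma dd_feedback: "AE s in M. dd (Suc k) s = F *v dlt k s+nu (Suc k) s" using ut_eq[of k]
 by eventually_elim (simp add: dd_Suc mv_rdiff mv_mult matrix_vector_neg)

lemma pr_feedback: "s : space M ==> pr (Suc k) s = AK *v xr k s-B *v (Kb *v mn k)" by (simp add: pr_def U_eq mv_rdiff mv_diff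
   mv_mult matrix_vector_neg)

text \<open>One branch for each possible time of the last reception, and one for none: its first
  component is the Gaussian noise accumulated since then, the second the prediction from the data
  available then. The mixture over channel outcomes need not be Gaussian, but each of these finitely
  many branches is covered by \<open>perp_atom\<close>.\<close>

primrec branches :: "nat => (('a => real^'n) \<times> ('a => real^'n)) set" where "branches 0 = {(nu 0, %_. m0)}"
| "branches (Suc k) = insert (nu (Suc k), %s. AK *v xl k s-B *v (Kb *v mn k))
  ((%(N, r). (%s. F *v N s+nu (Suc k) s, %s. AK *v r s-B *v (Kb *v mn k))) ` branches k)"

lemma finite_branches: "finite (branches k)" by (induction k) auto

lemma xl_gfield: "xl k : bm (gfield (Suc k))" by (rule meas_coarser[OF xl_FL FL_gfield]) simp

lemma branches_perp: "(N, r) : branches k ==> EX t<=k. perp t N & r : bm (gfield t)" proof (induction k arbitrary: N r) case 0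
 thus ?case using nu_perp[of 0] by auto
next case (Suc k) have lift: "(%s. AK *v f s-B *v (Kb *v mn k)) : bm (gfield t)" if "f : bm (gfield t)" for f t
  by (intro bm_diff bm_matrix that borel_measurable_const)
 consider "N = nu (Suc k)" "r = (%s. AK *v xl k s-B *v (Kb *v mn k))"
  | N' r' where "(N', r') : branches k" "N = (%s. F *v N' s+nu (Suc k) s)" "r = (%s. AK *v r' s-B *v (Kb *v mn k))"
  using Suc.prems by auto
 thus ?case proof cases
  case 1 thus ?thesis using nu_perp[of "Suc k"] lift[OF xl_gfield] by blast
 next case 2 obtain t where t: "t <= k" "perp t N'" "r' : bm (gfield t)" using Suc.IH[OF 2(1)] by blast
  have "perp t N" unfolding 2 by (intro perp_add perp_matrix t(2) perp_mono[OF nu_perp]) (use t(1) in simp)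
  thus ?thesis using t lift[OF t(3)] 2 by (intro exI[of _ t]) simp
 qed qed

lemma branches_zero: "AE s in M. ALL (N, r):branches k. N s+r s = 0 --> r s = 0"
proof (rule AE_finite_allI[OF finite_branches], safe)
 fix N r assume "(N, r) : branches k"
 then obtain t where "perp t N" "r : bm (gfield t)" using branches_perp by blast
 thus "AE s in M. N s+r s = 0 --> r s = 0" by (rule perp_atom)
qed

lemma xl_zero_of_cover: assumes "AE s in M. EX (N, r):branches k. dd k s = N s & pr k s = r s"
 shows "AE s in M. xl k s = 0 --> pr k s = 0" using assms branches_zero[of k] proof eventually_elim
 case (elim s) then obtain N r where *: "dd k s = N s" "pr k s = r s" "N s+r s = 0 --> r s = 0" by blast
 hence "xl k s = N s+r s" using dd_def[of k s] by (simp add: algebra_simps)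
 with * show ?case by simp
qed

text \<open>The cover at time \<open>k\<close> excludes misread zeros, which yields the exact
  formula for \<open>dlt k\<close>. That formula decides the next step: after a loss the current
  branch is continued, after a reception a new one starts.\<close>

lemma branches_cover: "AE s in M. EX (N, r):branches k. dd k s = N s & pr k s = r s" proof (induction k) case 0
 show ?case by (simp add: dd_0 pr_def)
next case (Suc k) from dlt_exact[OF xl_zero_of_cover[OF Suc]] Suc dd_feedback[of k] eta_AE[of k] AE_space
 show ?case proof eventually_elim
  case (elim s) then obtain N r where Nr: "(N, r) : branches k" "dd k s = N s" "pr k s = r s" by blast
  have pr: "pr (Suc k) s = AK *v xr k s-B *v (Kb *v mn k)" using elim pr_feedback by blast
  show ?case proof (cases "eta k s = 0")
   case True hence d: "dlt k s = N s" "xr k s = r s" using elim(1) Nr by (auto simp: z0_def dlt_def dd_def algebra_simps)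
   show ?thesis by (rule bexI[of _ "(%s. F *v N s+nu (Suc k) s, %s. AK *v r s-B *v (Kb *v mn k))"])
     (use elim(3) pr d Nr(1) in \<open>auto intro!: image_eqI[of _ _ "(N, r)"]\<close>)
  next case False hence d: "dlt k s = 0" "xr k s = xl k s" using elim(1) by (auto simp: z0_def dlt_def)
   show ?thesis by (rule bexI[of _ "(nu (Suc k), %s. AK *v xl k s-B *v (Kb *v mn k))"]) (use elim(3) pr d in auto)
  qed qed qed

lemma xl_zero: "AE s in M. xl k s = 0 --> pr k s = 0" by (rule xl_zero_of_cover[OF branches_cover])

lemma dlt_scale: "msq W (dlt k) = p*msq W (dd k)" by (rule msq_dlt_exact[OF xl_zero Lx])

lemma cost_exact: "(SUM k<=N. stage k) = (SUM k<=N. rate k)+V 0-V (Suc N)" proof (induction N)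
 have step: "stage k+V (Suc k) = rate k+V k" for k
  using stage_balance[OF Lx L2_controls, of k] V_split[OF Lx, of "Suc k"] gap_zero[of k] dlt_scale by simp
 case 0 show ?case using step[of 0] by simp
 case (Suc N) thus ?case using step[of "Suc N"] by simp
qed

lemma msq_dd_feedback: "psd W ==> msq W (dd (Suc k)) = msq W (%s. F *v dlt k s)+msq W (nu (Suc k))" proof - assume W: "psd W"
 have "msq W (%s. A *v dlt k s+BL *v ut k s) = msq W (%s. F *v dlt k s)" proof (rule msq_cong_AE)
  show "AE s in M. A *v dlt k s+BL *v ut k s = F *v dlt k s" using ut_eq[of k] by eventually_elim
    (simp add: mv_rdiff mv_mult matrix_vector_neg)
 qed (intro L2_measurable L2_add L2_matrix L2s L2_controls)+
 thus ?thesis using msq_dd_Suc[OF W Lx L2_controls(2)] by simp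
qed

lemma I_psd: "psd (mat 1 :: real^'n^'n)" by (rule psd_mat_1)

text \<open>Only the fraction \<open>p\<close> of the energy of \<open>dd\<close> survives a packet
  slot, so the recursion contracts through \<open>sqrt p F\<close>; the input is the bounded energy
  of the filter corrections.\<close>

lemma dlt_bounded: "EX b. ALL k. msq (mat 1) (dlt k) <= b" proof - obtain Y e where Y: "pos_def Y" "0 < e" "e <= 1"
  "!!x. qf Y ((sqrt p *\<^sub>R F) *v x) <= (1-e)*qf Y x" "!!x. x \<bullet> x <= qf Y x"
  using lyapunov_contraction[OF stable_T] by metis
 note Yp = pd_psd[OF Y(1)]
 obtain c where c: "!!k. msq Y (nu (Suc k)) <= c" using msq_nu_bounded[OF det Yp] by blast
 have s: "msq Y (%s. (sqrt p *\<^sub>R F) *v dlt k s) = p*msq Y (%s. F *v dlt k s)" for k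
  using p_range(1) by (simp add: msq_def mv_scaleR matrix_vector_mult_scaleR)
 have "msq Y (dlt (Suc k)) <= (1-e)*msq Y (dlt k)+p*c" for k
  using dlt_scale[of Y "Suc k"] msq_dd_feedback[OF Yp, of k] msq_contraction[OF L2s(3) Y(4), of k] s[of k]
   mult_left_mono[OF c p_range(1), of k] by (simp add: distrib_left)
 then obtain b where "!!k. msq Y (dlt k) <= b" using contraction_bounded[of "%k. msq Y (dlt k)", OF _ Y(2,3)] by blast
 hence "msq (mat 1) (dlt k) <= b" for k using msq_mono[OF L2s(3), of "mat 1" Y k] Y(5) by (auto intro: order.trans)
 thus ?thesis by blast
qed

text \<open>The deviation of the remote estimate from the mean follows the stable \<open>AK\<close>
  and receives the delivered fraction \<open>1-p\<close> of \<open>dd\<close>, whose energy is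
  bounded by that of \<open>dlt\<close> and \<open>nu\<close>.\<close>

lemma spread_bounded: "EX b. ALL k. msq (mat 1) (%s. xr k s-mn k) <= b" proof - obtain Y e where Y: "pos_def Y" "0 < e" "e <= 1"
  "!!x. qf Y (AK *v x) <= (1-e)*qf Y x" "!!x. x \<bullet> x <= qf Y x" using lyapunov_contraction[OF stable_Z] by metis
 note Yp = pd_psd[OF Y(1)]
 let ?b = "%k s. xr k s-mn k"
 have Lb: "L2 (?b k)" for k by (intro L2_diff L2_const L2s)
 obtain c where c: "!!k. msq Y (nu (Suc k)) <= c" using msq_nu_bounded[OF det Yp] by blast
 obtain d where d: "!!k. msq (mat 1) (dlt k) <= d" using dlt_bounded by blast
 obtain a where a: "0 <= a" "!!f. L2 f ==> msq (tp F**Y**F) f <= a*msq (mat 1) f" using msq_bound by blast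
 have dd: "msq Y (dd (Suc k)) <= a*d+c" for k
  using msq_dd_feedback[OF Yp, of k] c[of k] a(2)[OF L2s(3), of k] mult_left_mono[OF d[of k] a(1)]
  unfolding msq_matrix by linarith
 have pr: "msq Y (%s. pr (Suc k) s-mn (Suc k)) = msq Y (%s. AK *v ?b k s)" for k unfolding msq_def
 proof (rule Bochner_Integration.integral_cong[OF refl])
  fix s assume s: "s : space M"
  have "pr (Suc k) s-mn (Suc k) = AK *v ?b k s" unfolding pr_feedback[OF s] mn_Suc U_mean
   by (simp add: mv_rdiff matrix_vector_mult_add_rdistrib mv_diff
     mv_add mv_mult matrix_vector_neg)
  thus "(pr (Suc k) s-mn (Suc k)) \<bullet> (Y *v (pr (Suc k) s-mn (Suc k))) = qf Y (AK *v ?b k s)" by simp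
 qed have "msq Y (?b (Suc k)) <= (1-e)*msq Y (?b k)+(1-p)*(a*d+c)" for k proof -
  have "msq Y (?b (Suc k)) = msq Y (%s. AK *v ?b k s)+(1-p)*msq Y (dd (Suc k))"
   using xl_split_r[OF psd_sym[OF Yp] Lx, of "Suc k" "mn (Suc k)"] dlt_scale[of Y "Suc k"] pr[of k]
   by (simp add: left_diff_distrib)
  thus ?thesis using msq_contraction[OF Lb Y(4), of k] mult_left_mono[OF dd[of k], of "1-p"] p_range(2) by linarith
 qed then obtain b where "!!k. msq Y (?b k) <= b" using contraction_bounded[of "%k. msq Y (?b k)", OF _ Y(2,3)] by blast
 hence "msq (mat 1) (?b k) <= b" for k using msq_mono[OF Lb, of "mat 1" Y k] Y(5) by (auto intro: order.trans)
 thus ?thesis by blast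
qed

lemma mean_bounded: "EX b. ALL k. mn k \<bullet> mn k <= b" proof - obtain Y e where Y: "pos_def Y" "0 < e" "e <= 1"
  "!!x. qf Y ((A-B**(K+Kb)) *v x) <= (1-e)*qf Y x" "!!x. x \<bullet> x <= qf Y x" using lyapunov_contraction[OF stable_P] by metis
 have "mn (Suc k) = (A-B**(K+Kb)) *v mn k" for k by (simp add: mn_Suc U_mean mv_rdiff mv_mult matrix_vector_neg)
 hence "qf Y (mn (Suc k)) <= (1-e)*qf Y (mn k)+0" for k using Y(4)[of "mn k"] by simp
 then obtain b where "!!k. qf Y (mn k) <= b" using contraction_bounded[of "%k. qf Y (mn k)", OF _ Y(2,3)] by blast
 hence "mn k \<bullet> mn k <= b" for k using Y(5) order.trans by blast
 thus ?thesis by blast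
qed

theorem state_bounded: "EX b. ALL k. msq (mat 1) (x k) <= b" proof -
 obtain b1 where b1: "!!k. mn k \<bullet> mn k <= b1" using mean_bounded by blast
 obtain b2 where b2: "!!k. msq (mat 1) (%s. xr k s-mn k) <= b2" using spread_bounded by blast
 obtain b3 where b3: "!!k. msq (mat 1) (dlt k) <= b3" using dlt_bounded by blast
 obtain b4 where b4: "!!k. msq (mat 1) (err k) <= b4" using msq_err_bounded[OF det] by blast
 have "msq (mat 1) (x k) <= b1+b2+b3+b4" for k
  unfolding msq_x_split[OF psd_sym[OF I_psd] Lx] using b1[of k] b2[of k] b3[of k] b4[of k] by simp
 thus ?thesis by blast
qed

end

section \<open>Averages of the filter rate and of the cost\<close>

lemma cesaro_term_null: fixes f :: "nat => real" assumes "cesaro f" shows "(%N. f N/real N) ----> 0" proof -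
 let ?S = "%N. (SUM k<N. f k)/real N"
 obtain L where L: "?S ----> L" using assms by (auto simp: cesaro_def convergent_def divide_inverse mult.commute)
 have r: "(%N. real (Suc N)/real N) ----> 1" by (rule LIMSEQ_Suc_n_over_n)
 have "(%N. ?S (Suc N)*(real (Suc N)/real N)-?S N) ----> L*1-L" by (intro tendsto_diff tendsto_mult LIMSEQ_Suc[OF L] r L)
 moreover have "EVT N. ?S (Suc N)*(real (Suc N)/real N)-?S N = f N/real N"
  using ev_gt[of 0] by eventually_elim (simp add: divide_simps)
 ultimately show ?thesis by (simp add: tendsto_cong)
qed

text \<open>The cost sums \<open>N+1\<close> terms but divides by \<open>N\<close>; the extra term
  is negligible by \<open>cesaro_term_null\<close>.\<close>

lemma cesaro_average_atMost: fixes f :: "nat => real" assumes "cesaro f" shows "EX L. (%N. (SUM k<=N. f k)/real N) ----> L"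
proof - obtain L where L: "(%N. (SUM k<N. f k)/real N) ----> L"
  using assms by (auto simp: cesaro_def convergent_def divide_inverse mult.commute)
 have "(%N. (SUM k<N. f k)/real N+f N/real N) ----> L+0" by (intro tendsto_add L cesaro_term_null assms)
 thus ?thesis by (auto simp: add_divide_distrib[symmetric] lessThan_Suc_atMost[symmetric])
qed

lemma cesaro_Suc: fixes f :: "nat => real" assumes "cesaro f" shows "cesaro (%k. f (Suc k))" proof -
 obtain L where L: "(%N. (SUM k<=N. f k)/real N) ----> L" using cesaro_average_atMost[OF assms] by blast
 have "(%N. (SUM k<=N. f k)/real N-f 0/real N) ----> L-0" by (intro tendsto_diff L lim_const_over_n)
 moreover have "(SUM k<=N. f k)/real N-f 0/real N = (SUM k<N. f (Suc k)) /\<^sub>R real N" for N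
  by (simp add: lessThan_Suc_atMost[symmetric] sum.lessThan_Suc_shift divide_inverse algebra_simps del: sum.lessThan_Suc)
 ultimately show ?thesis unfolding cesaro_def by (auto intro: convergentI)
qed

lemma cesaro_const: "cesaro (%_. c :: real)" unfolding cesaro_def proof (rule convergentI, rule lim_cong)
 show "(%_. c) ----> c" by simp
 show "EVT N. c = (SUM k<N. c) /\<^sub>R real N" using ev_gt[of 0] by eventually_elim simp
qed

lemma filter_rate_average: fixes A C Qw Qv W0 :: "real^'n^'n" assumes "psd Qw" "psd Qv" "psd W0" "detectable A C"
 shows "EX J. (%N. (SUM k<=N. filter_rate A C Qw Qv W0 G \<Theta> k)/real N) ----> J" proof (rule cesaro_average_atMost)
 have f: "cesaro (%k. frob W (filter_cov A C Qw Qv W0 k))" for W unfolding frob_def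
  by (intro cesaro_sum finite cesaro_linear[OF bounded_linear_mult_right] filter_cov_cesaro(1)[OF assms])
 have "cesaro (%k. (frob (G+tp A**\<Theta> ** A) (filter_cov A C Qw Qv W0 k)+frob \<Theta> Qw)
  +- frob \<Theta> (filter_cov A C Qw Qv W0 (Suc k)))"
  by (intro cesaro_add f cesaro_const cesaro_linear[OF bounded_linear_minus[OF bounded_linear_ident]] cesaro_Suc)
 thus "cesaro (filter_rate A C Qw Qv W0 G \<Theta>)" by (simp add: filter_rate_def[abs_def])
qed

context lqg begin

definition running :: "nat => 'a => real" where "running k s = qf QM (x k s)+qf R (U k s)+qf RL (ut k s)"

lemma running_nonneg: "0 <= running k s"
 unfolding running_def using psd_quad[OF QM] psd_quad[OF pd_psd[OF R]] psd_quad[OF pd_psd[OF RL]]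
 by (intro add_nonneg_nonneg) auto

lemma controls_measurable: "U k : bm M" "ut k : bm M" "x k : bm M"
 using U_integrable ut_integrable x_integrable by (auto intro: borel_measurable_integrable)

lemma running_measurable: "running k : bm M" unfolding running_def[abs_def]
 by (intro bm_add borel_measurable_inner bm_matrix controls_measurable)

lemma running_integral: assumes "!!k. L2 (U k)" "!!k. L2 (ut k)"
 shows "(\<integral>\<^sup>+ s. ennreal (SUM k<=N. running k s) \<partial>M)
  = ennreal (SUM k<=N. msq QM (x k)+msq R (U k)+msq RL (ut k))" proof - have Lx: "L2 (x k)" for k by (rule x_L2) (rule assms)+
 note I = L2_quad[OF Lx Lx] L2_quad[OF assms(1) assms(1)] L2_quad[OF assms(2) assms(2)]
 have r: "integrable M (running k)" for k unfolding running_def[abs_def] by (intro Bochner_Integration.integrable_add I)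
 have "(\<integral>\<^sup>+ s. ennreal (SUM k<=N. running k s) \<partial>M) = ennreal (EV M (%s. (SUM k<=N. running k s)))"
  by (rule nn_integral_eq_integral) (use r in "auto intro!: sum_nonneg running_nonneg")
 also have "EV M (%s. (SUM k<=N. running k s)) = (SUM k<=N. \<integral>s. running k s \<partial>M)"
  using r by (intro Bochner_Integration.integral_sum) auto
 also have "... = (SUM k<=N. msq QM (x k)+msq R (U k)+msq RL (ut k))"
  unfolding running_def msq_def by (intro sum.cong refl) (simp add: I)
 finally show ?thesis .
qed

text \<open>The control weights are positive definite, hence bounded below by a multiple of the
  identity. A finite integral would therefore give both controls of time \<open>j\<close> a second
  moment.\<close>

lemma running_integral_infinite: assumes "~ (L2 (U j) & L2 (ut j))" "j <= N"
 shows "(\<integral>\<^sup>+ s. ennreal (SUM k<=N. running k s) \<partial>M) = \<infinity>" proof (rule ccontr)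
 assume *: "~ ?thesis"
 have "integrable M (%s. SUM k<=N. running k s)" using * running_measurable
  by (intro integrableI_bounded) (auto simp: sum_nonneg running_nonneg less_top[symmetric])
 hence r: "integrable M (running j)" proof (rule Bochner_Integration.integrable_bound[OF _ running_measurable])
  show "AE s in M. norm (running j s) <= norm (SUM k<=N. running k s)"
   using member_le_sum[of j "{..N}" "%k. running k _"] assms(2) running_nonneg
   by (auto simp: sum_nonneg running_nonneg intro!: AE_I2)
 qed have lower: "L2 f" if f: "f : bm M" and W: "pos_def W" and le: "!!s. qf W (f s) <= running j s"
  for f :: "'a => real^'l" and W proof -
  obtain c where c: "0 < c" "!!y. c*(y \<bullet> y) <= qf W y" using pos_def_lower_bound[OF W] by blast
  have "f s \<bullet> f s <= inverse c*running j s" for s using c(2)[of "f s"] le[of s] c(1) by (simp add: field_simps)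
  thus ?thesis using r by (intro L2_bound[OF f, of "%s. inverse c*running j s"]) auto
 qed have "L2 (U j)" "L2 (ut j)" using psd_quad[OF QM] psd_quad[OF pd_psd[OF R]] psd_quad[OF pd_psd[OF RL]]
  by (auto intro!: lower[OF _ R] lower[OF _ RL] controls_measurable add_nonneg_nonneg simp: running_def)
 thus False using assms(1) by simp
qed

end

lemma gaussian_law_return: "gaussian_law (return borel 0) 0 0"
 unfolding gaussian_law_def by (auto simp: prob_space_return psd_def transpose_zero distr_return)

lemma (in prob_space) gaussian_rv_distr: assumes T: "T : measurable N M" and d: "distr N M T = M" and X: "gaussian_rv M X m W"
 shows "gaussian_rv N (%s. X (T s)) m W" proof - have Xm: "X : bm M" using X by (simp add: gaussian_rv_def)
 have "distr N borel (%s. X (T s)) = distr (distr N M T) borel X" by (subst distr_distr[OF Xm T]) (simp add: comp_def)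
 thus ?thesis using X measurable_compose[OF T Xm] unfolding d gaussian_rv_def by simp
qed

text \<open>In the product space every noise event is a cylinder over \<open>space \<mu>0\<close>. A
  product of events over an index set is computed by separating the index \<open>None\<close> of the
  initial state from the noise indices.\<close>

lemma (in ncs_noise) noises_Prob: assumes \<mu>0: "gaussian_law \<mu>0 m W"
 shows "noises (\<mu>0 \<Otimes>\<^sub>M M) fst (%k s. w k (snd s)) (%k s. v k (snd s)) (%k s. eta k (snd s)) m W Qw Qv p" proof -
 have s0: "sets \<mu>0 = sets borel" and g0: "prob_space \<mu>0" using \<mu>0 by (auto simp: gaussian_law_def)
 interpret N: prob_space \<mu>0 by (rule g0)
 interpret NM: pair_prob_space \<mu>0 M ..
 let ?P = "\<mu>0 \<Otimes>\<^sub>M M"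
 have fstm: "fst : bm ?P" using measurable_fst[of \<mu>0 M] by (simp add: measurable_cong_sets[OF refl s0])
 have sndm: "snd : measurable ?P M" by (rule measurable_snd)
 have df: "distr ?P borel fst = \<mu>0" proof -
  have "distr ?P borel fst = distr ?P \<mu>0 fst" by (rule distr_cong) (simp_all add: s0)
  thus ?thesis by (simp add: distr_pair_fst)
 qed have meas: "measure ?P (E \<times> F) = measure \<mu>0 E*prob F" if "E : sets \<mu>0" "F : events" for E F
  using that by (simp add: measure_def emeasure_pair_measure_Times enn2real_mult)
 have ds: "distr ?P M snd = M" proof (rule measure_eqI)
  fix F assume "F : sets (distr ?P M snd)"
  hence F: "F : events" by simp
  hence "snd -` F Int space ?P = space \<mu>0 \<times> F" using sets.sets_into_space[OF F] by (auto simp: space_pair_measure)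
  thus "emeasure (distr ?P M snd) F = emeasure M F"
   using F by (simp add: emeasure_distr emeasure_pair_measure_Times N.emeasure_space_1)
 qed simp
 have em: "(%s. eta k (snd s)) : bm ?P" for k by (rule measurable_compose[OF sndm eta_measurable])
 have ep: "measure ?P {s : space ?P. eta k (snd s) = a} = prob {s : space M. eta k s = a}" for k a proof -
  have "{s : space ?P. eta k (snd s) = a} = space \<mu>0 \<times> {s : space M. eta k s = a}" by (auto simp: space_pair_measure)
  moreover have "{s : space M. eta k s = a} : events" using eta_measurable[of k] by simp
  ultimately show ?thesis using meas[of "space \<mu>0"] by (simp add: N.prob_space)
 qed let ?S = "%i. case i of Proc k => pre M (w k) | Obs k => pre M (v k) | Chan k => pre M (eta k)"
 let ?T = "noise_field ?P fst (%k s. w k (snd s)) (%k s. v k (snd s)) (%k s. eta k (snd s))"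
 have TS: "EX F:?S i. a = space \<mu>0 \<times> F" if "a : ?T (Some i)" for a i proof -
  have "(%s. f (snd s)) -` E Int space ?P = space \<mu>0 \<times> (f -` E Int space M)" for f :: "'w => real" and E
   by (auto simp: space_pair_measure)
  moreover have "(%s. f (snd s)) -` E Int space ?P = space \<mu>0 \<times> (f -` E Int space M)" for f :: "'w => real^'n" and E
   by (auto simp: space_pair_measure)
  ultimately show ?thesis using that by (cases i) (auto simp: noise_field_def)
 qed have T0: "EX E:sets \<mu>0. a = E \<times> space M" if aN: "a : ?T None" for a proof -
  obtain E where E: "E : sets \<mu>0" "a = fst -` E Int space ?P" using aN s0 by (auto simp: noise_field_def)
  hence "a = E \<times> space M" using sets.sets_into_space[OF E(1)] by (auto simp: space_pair_measure)
  with E(1) show ?thesis by blast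
 qed have Sev: "?S i \<subseteq> events" for i using noise_indep by (simp add: indep_sets_def)
 have indep: "NM.indep_sets ?T UNIV" proof (rule NM.indep_setsI)
  fix i show "?T i \<subseteq> sets ?P" proof
   fix a assume a: "a : ?T i"
   show "a : sets ?P" proof (cases i)
    case None obtain E where "E : sets \<mu>0" "a = E \<times> space M" using T0[OF a[unfolded None]] by blast
    thus ?thesis by (simp add: pair_measureI)
   next case (Some j) obtain F where "F : ?S j" "a = space \<mu>0 \<times> F" using TS[OF a[unfolded Some]] by blast
    thus ?thesis using Sev[of j] by (auto intro!: pair_measureI)
   qed qed next fix a J assume J: "J ~= {}" "finite J" and a: "ALL j:J. a j : ?T j"
  define I where "I = {i. Some i : J}"
  have fI: "finite I" unfolding I_def using finite_vimageI[OF J(2), of Some] by (simp add: vimage_def)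
  have "ALL i:I. EX F. F : ?S i & a (Some i) = space \<mu>0 \<times> F" using a TS unfolding I_def by blast
  from bchoice[OF this] obtain F where F': "ALL i:I. F i : ?S i & a (Some i) = space \<mu>0 \<times> F i" by (elim exE)
  have F: "F i : ?S i" "a (Some i) = space \<mu>0 \<times> F i" if "i : I" for i
   by (rule bspec[OF F' that, THEN conjunct1] bspec[OF F' that, THEN conjunct2])+
  have Fev: "F i : events" if "i : I" for i using F(1)[OF that] Sev by blast
  \<comment> \<open>Intersecting with \<open>space M\<close> gives the correct event also when no
    noise index occurs.\<close>
  let ?F = "space M Int (INT i:I. F i)"
  have FF: "?F : events" using fI Fev by (cases "I = {}") (auto intro!: sets.Int sets.finite_INT)
  have "prob ?F = (PROD i:I. prob (F i))" proof (cases "I = {}")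
   case False hence "?F = (INT i:I. F i)" using Fev sets.sets_into_space by blast
   moreover have "prob (INT i:I. F i) = (PROD i:I. prob (F i))" by (rule indep_setsD[OF noise_indep]) (use F(1) False fI in auto)
   ultimately show ?thesis by simp
  qed (simp add: prob_space)
  moreover have "measure ?P (a (Some i)) = prob (F i)" if "i : I" for i
   using meas[OF sets.top Fev[OF that]] F(2)[OF that] by (simp add: N.prob_space)
  ultimately have PF: "(PROD j:Some ` I. measure ?P (a j)) = prob ?F" by (simp add: prod.reindex)
  have SI: "space ?P Int (INT j:Some ` I. a j) = space \<mu>0 \<times> ?F" using F(2) by (auto simp: space_pair_measure)
  have JI: "J-{None} = Some ` I" unfolding I_def by (auto simp: image_iff) (metis not_None_eq)
  show "measure ?P (INT j:J. a j) = (PROD j:J. measure ?P (a j))" proof (cases "None : J")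
   case True hence J': "J = insert None (Some ` I)" using JI by blast
   obtain E where E: "E : sets \<mu>0" "a None = E \<times> space M" using T0 a True by blast
   have Es: "E \<subseteq> space \<mu>0" by (rule sets.sets_into_space[OF E(1)])
   hence "(INT j:J. a j) = a None Int (space ?P Int (INT j:Some ` I. a j))" unfolding J' by (auto simp: space_pair_measure E(2))
   also have "... = E \<times> ?F" using Es unfolding SI E(2) by blast
   finally have "measure ?P (INT j:J. a j) = measure ?P (a None)*prob ?F"
    using meas[OF E(1) FF] meas[OF E(1) sets.top] by (simp add: E(2) prob_space)
   thus ?thesis unfolding J' PF[symmetric] using fI by (subst prod.insert) auto
  next case False hence J': "J = Some ` I" using JI by blast
   then obtain i where i: "i : I" using J(1) by blast
   have "a (Some i) \<subseteq> space ?P" using F(2)[OF i] sets.sets_into_space[OF Fev[OF i]] by (auto simp: space_pair_measure)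
   hence "(INT j:J. a j) = space ?P Int (INT j:Some ` I. a j)" using i unfolding J' by blast
   thus ?thesis using meas[OF sets.top FF] unfolding SI by (simp add: N.prob_space PF J')
  qed qed show ?thesis proof (unfold_locales)
  show "gaussian_rv ?P fst m W" unfolding gaussian_rv_def df using fstm \<mu>0 by simp
  show "gaussian_rv ?P (%s. w k (snd s)) 0 Qw" "gaussian_rv ?P (%s. v k (snd s)) 0 Qv" for k
   by (rule gaussian_rv_distr[OF sndm ds w_gaussian] gaussian_rv_distr[OF sndm ds v_gaussian])+
  show "(%s. eta k (snd s)) : bm ?P" for k by (rule em)
  show "measure ?P {s : space ?P. eta k (snd s) = 0} = p" "measure ?P {s : space ?P. eta k (snd s) = 1} = 1-p" for k
   unfolding ep by (rule eta_0 eta_1)+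
  show "NM.indep_sets ?T UNIV" by (rule indep)
 qed qed

context lqg begin

definition avg :: "nat => ereal" where
 "avg N = ereal (1/real N)*(enn2ereal (\<integral>\<^sup>+ s. ennreal (SUM k<=N. running k s) \<partial>M)
 -ereal (SUM k<=N. \<mu> * qf Q (mn k)))"

lemma avg_L2: assumes "!!k. L2 (U k)" "!!k. L2 (ut k)" shows "avg N = ereal ((SUM k<=N. stage k)/real N)" proof -
 let ?S = "SUM k<=N. msq QM (x k)+msq R (U k)+msq RL (ut k)"
 have "0 <= ?S" by (intro sum_nonneg add_nonneg_nonneg msq_nonneg QM pd_psd[OF R] pd_psd[OF RL])
 hence "enn2ereal (ennreal ?S) = ereal ?S" by simp
 thus ?thesis unfolding avg_def running_integral[OF assms] by (simp add: stage_def sum_subtractf)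
qed

lemma avg_infinite: assumes "~ (L2 (U j) & L2 (ut j))" "j <= N" "0 < N" shows "avg N = \<infinity>"
 unfolding avg_def running_integral_infinite[OF assms(1,2)] using assms(3) by simp

lemma avg_lower: assumes L: "!!k. L2 (U k)" "!!k. L2 (ut k)" and J: "(%N. (SUM k<=N. rate k)/real N) ----> J"
  and b: "!!k. N0 <= k ==> V k <= b" and c: "avg ----> c" shows "ereal J <= c" proof (rule tendsto_le[OF _ c])
 have "(%N. (SUM k<=N. rate k)/real N-b/real N) ----> J-0" by (intro tendsto_diff J lim_const_over_n)
 thus "(%N. ereal ((SUM k<=N. rate k)/real N-b/real N)) ----> ereal J" by simp
 show "EVT N. ereal ((SUM k<=N. rate k)/real N-b/real N) <= avg N" using eventually_ge_at_top[of N0] proof eventually_elim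
  case (elim N) have "(SUM k<=N. rate k)-b <= (SUM k<=N. stage k)"
   using cost_lower_bound[OF L, of N] V_nonneg[of 0] b[of "Suc N"] elim by simp
  thus ?case unfolding avg_L2[OF L] by (simp add: diff_divide_distrib[symmetric] divide_right_mono)
 qed qed simp

end

context feedback begin

lemma avg_limit: assumes J: "(%N. (SUM k<=N. rate k)/real N) ----> J" shows "avg ----> ereal J" proof -
 obtain b where b: "!!k. msq (mat 1) (x k) <= b" using state_bounded by blast
 obtain c where c: "0 <= c" "!!k. L2 (x k) ==> V k <= c*msq (mat 1) (x k)" using V_le_msq by blast
 have Vb: "V k <= c*b" for k using c(2)[OF Lx, of k] mult_left_mono[OF b[of k] c(1)] by linarith
 have "(%N. V (Suc N)/real N) ----> 0" proof (rule tendsto_sandwich[of "%_. 0" _ _ "%N. (c*b)/real N"])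
  show "(%N. (c*b)/real N) ----> 0" by (rule lim_const_over_n)
 qed (use Vb V_nonneg in "auto intro!: always_eventually divide_right_mono")
 hence "(%N. (SUM k<=N. rate k)/real N+V 0/real N-V (Suc N)/real N) ----> J+0-0"
  by (intro tendsto_diff tendsto_add J lim_const_over_n)
 hence "(%N. ereal ((SUM k<=N. stage k)/real N)) ----> ereal J"
  unfolding cost_exact by (simp add: add_divide_distrib diff_divide_distrib)
 thus ?thesis unfolding avg_L2[OF L2_controls, abs_def] .
qed

end

context prob_space begin

lemma second_moment_L2:
 assumes f: "f : bm M" and le: "(\<integral>\<^sup>+ s. ennreal (f s \<bullet> f s) \<partial>M) <= ennreal c" and c: "0 <= c"
 shows "L2 f" "msq (mat 1) f <= c" proof -
 have "(\<integral>\<^sup>+ s. ennreal (f s \<bullet> f s) \<partial>M) < \<infinity>" using le ennreal_less_top[of c] by (auto intro: order.strict_trans1)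
 thus L: "L2 f" unfolding L2_def using f by (auto intro!: integrableI_nonneg)
 have e: "ennreal (msq (mat 1) f) = (\<integral>\<^sup>+ s. ennreal (f s \<bullet> f s) \<partial>M)"
  unfolding msq_1 using L by (intro nn_integral_eq_integral[symmetric]) (auto simp: L2_def)
 show "msq (mat 1) f <= c" using le unfolding e[symmetric] ennreal_le_iff[OF c] .
qed

lemma second_moment_eq: "L2 f ==> (\<integral>\<^sup>+ s. ennreal (f s \<bullet> f s) \<partial>M) = ennreal (msq (mat 1) f)"
 unfolding msq_1 by (rule nn_integral_eq_integral) (auto simp: L2_def)

text \<open>A finite upper limit bounds the moments only from some time on; earlier ones may be
  infinite, hence the threshold \<open>N\<close>.\<close>

lemma limsup_second_moment: assumes m: "!!k. f k : bm M"
  and l: "limsup (%k. \<integral>\<^sup>+ s. ennreal (f k s \<bullet> f k s) \<partial>M) < \<infinity>"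
 shows "EX N c. ALL k>=N. L2 (f k) & msq (mat 1) (f k) <= c" proof -
 obtain d where d: "limsup (%k. \<integral>\<^sup>+ s. ennreal (f k s \<bullet> f k s) \<partial>M) < d" "d < \<infinity>" using dense[OF l] by blast
 then obtain c where c: "d = ennreal c" "0 <= c" by (cases d) auto
 have "EVT k. (\<integral>\<^sup>+ s. ennreal (f k s \<bullet> f k s) \<partial>M) < ennreal c"
  using Limsup_lessD[OF d(1)] c by simp
 then obtain N where "!!k. N <= k ==> (\<integral>\<^sup>+ s. ennreal (f k s \<bullet> f k s) \<partial>M) < ennreal c"
  by (auto simp: eventually_sequentially)
 hence "ALL k>=N. L2 (f k) & msq (mat 1) (f k) <= c" using second_moment_L2[OF m _ c(2)] by (auto intro: less_imp_le)
 thus ?thesis by blast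
qed

end

section \<open>The stated problem on the product space\<close>

locale ncs_problem = ncs_noise M p Qw Qv w v eta for M :: "'w measure" and p :: real and Qw Qv :: "real^'n^'n"
  and w v :: "nat => 'w => real^'n" and eta :: "nat => 'w => real" +
 fixes A C Q :: "real^'n^'n" and BL :: "real^'m1^'n" and BR :: "real^'m2^'n"
  and RL :: "real^'m1^'m1" and RR :: "real^'m2^'m2" and \<mu> :: real
 assumes mu: "0 <= \<mu>" and Q: "psd Q" and RL: "pos_def RL" and RR: "pos_def RR"
  and obs: "!!x. (!!k. Q *v (matpow A k *v x) = 0) ==> x = 0" and det: "detectable A C" and stab: "stabilizable A Qw"
begin

sublocale ncs A BL BR C M w v eta .

abbreviation "wP \<equiv> %k (s :: (real^'n) \<times> 'w). w k (snd s)"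
abbreviation "vP \<equiv> %k (s :: (real^'n) \<times> 'w). v k (snd s)"
abbreviation "eP \<equiv> %k (s :: (real^'n) \<times> 'w). eta k (snd s)"

lemma noises_run: "gaussian_law \<mu>0 m W ==> noises (Prob \<mu>0) fst wP vP eP m W Qw Qv p"
 unfolding Prob_def by (rule noises_Prob)

lemma p01: "0 <= p" "p <= 1" using noises.p_range[OF noises_run[OF gaussian_law_return]] by auto

lemma loop_run: assumes g: "gaussian_law \<mu>0 m W" and a: "admissible \<mu>0 U ut"
 shows "loop (Prob \<mu>0) fst wP vP eP m W Qw Qv p A C BL BR U ut (state U ut) (yL U ut) (yR \<mu>0 U ut)" proof -
 interpret N: noises "Prob \<mu>0" fst wP vP eP m W Qw Qv p by (rule noises_run[OF g])
 show ?thesis proof unfold_locales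
  show "state U ut 0 = fst" by simp
  show "state U ut (Suc k) = (%s. A *v state U ut k s+hcat BL BR *v U k s+BL *v ut k s+w k (snd s))" for k by simp
  show "yL U ut k = (%s. C *v state U ut k s+v k (snd s))" for k by (simp add: yL_def fun_eq_iff)
  show "yR \<mu>0 U ut k = (%s. eta k (snd s) *\<^sub>R vec_cond_exp (Prob \<mu>0)
    (generated_by (Prob \<mu>0) (yL U ut ` {..k} Un yR \<mu>0 U ut ` {..<k})) (state U ut k) s)" for k by (rule yR.simps)
 qed (use a in "auto simp: admissible_def FL_def FR_def")
qed

text \<open>Boundedness is evaluated at a single initial law, the point mass at 0, which counts as
  Gaussian with covariance 0.\<close>

lemma necessity: assumes "ms_bounded" shows "EX Z X S. stabilizing_solution A BL BR Q RL RR \<mu> p Z X S" proof -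
 obtain U ut where st: "stabilizing U ut" using assms unfolding ms_bounded_def by (elim exE)
 let ?\<mu> = "return borel 0 :: (real^'n) measure"
 let ?U = "U ?\<mu>" and ?ut = "ut ?\<mu>"
 note g = gaussian_law_return
 have ad: "admissible ?\<mu> ?U ?ut"
  and l: "limsup (%k. \<integral>\<^sup>+ s. ennreal (state ?U ?ut k s \<bullet> state ?U ?ut k s) \<partial>Prob ?\<mu>) < \<infinity>"
  using st g unfolding stabilizing_def by blast+
 interpret L: loop "Prob ?\<mu>" fst wP vP eP 0 0 Qw Qv p A C BL BR ?U ?ut "state ?U ?ut" "yL ?U ?ut" "yR ?\<mu> ?U ?ut"
  by (rule loop_run[OF g ad])
 obtain N c where b: "!!k. N <= k ==> L.L2 (state ?U ?ut k) & L.msq (mat 1) (state ?U ?ut k) <= c"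
  using L.limsup_second_moment[OF borel_measurable_integrable[OF L.x_integrable] l] by blast
 note QM = Q_mu_psd[OF mu Q]
 show ?thesis proof (rule stabilizing_solution_exists[OF RL RR Q p01 mu _ stab])
  show "x = 0" if "!!k. Q *v (matpow A k *v x) = 0" for x by (rule obs) (rule that)
  show "EX c. ALL j. qf (value_iter A (hcat BL BR) (Q_mu \<mu> Q) (block_diag RL RR) j) (Qw *v y) <= c" for y
   by (rule L.necessity_bounds(1)[OF _ RL RR QM]) (rule b)
  show "EX c. ALL j. qf (value_iter (sqrt p *\<^sub>R A) (sqrt p *\<^sub>R BL)
    ((1-p) *\<^sub>R Z+p *\<^sub>R Q_mu \<mu> Q) (p *\<^sub>R RL) j) (Qw *v y) <= c" if "psd Z" "0 < p" for Z y
   by (rule L.necessity_bounds(2)[OF _ RL RR QM that]) (rule b)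
 qed qed

lemma feedback_law_eq: assumes f: "feedback_law K Kbar G U ut" and g: "gaussian_law \<mu>0 m W" and s: "s : space (Prob \<mu>0)"
 shows "U \<mu>0 k s = - (K *v vec_cond_exp (Prob \<mu>0) (generated_by (Prob \<mu>0) (yR \<mu>0 (U \<mu>0) (ut \<mu>0) ` {..k})) (state (U \<mu>0) (ut \<mu>0) k) s)
   -Kbar *v integral\<^sup>L (Prob \<mu>0) (vec_cond_exp (Prob \<mu>0) (generated_by (Prob \<mu>0) (yR \<mu>0 (U \<mu>0) (ut \<mu>0) ` {..k})) (state (U \<mu>0) (ut \<mu>0) k))"
  and "ut \<mu>0 k s = - (G *v (vec_cond_exp (Prob \<mu>0) (generated_by (Prob \<mu>0) (yL (U \<mu>0) (ut \<mu>0) ` {..k} Un yR \<mu>0 (U \<mu>0) (ut \<mu>0) ` {..k})) (state (U \<mu>0) (ut \<mu>0) k) s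
   -vec_cond_exp (Prob \<mu>0) (generated_by (Prob \<mu>0) (yR \<mu>0 (U \<mu>0) (ut \<mu>0) ` {..k})) (state (U \<mu>0) (ut \<mu>0) k) s))"
 using f g s unfolding feedback_law_def xhatR_def xhatL_def FR_def FL_def by blast+

lemma feedback_run: assumes f: "feedback_law K Kbar G U ut" and g: "gaussian_law \<mu>0 m W"
 shows "admissible \<mu>0 (U \<mu>0) (ut \<mu>0)"
  "prob_space.L2 (Prob \<mu>0) (U \<mu>0 k)" "prob_space.L2 (Prob \<mu>0) (ut \<mu>0 k)" proof -
 interpret N: noises "Prob \<mu>0" fst wP vP eP m W Qw Qv p by (rule noises_run[OF g])
 interpret Pl: plant "Prob \<mu>0" fst wP vP eP m W Qw Qv p A C ..
 let ?U = "U \<mu>0" and ?ut = "ut \<mu>0"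
 note * = Pl.feedback_admissible[of "state ?U ?ut" BL BR ?U ?ut "yL ?U ?ut" "yR \<mu>0 ?U ?ut" K
   "%k. Kbar *v integral\<^sup>L (Prob \<mu>0) (vec_cond_exp (Prob \<mu>0) (generated_by (Prob \<mu>0) (yR \<mu>0 ?U ?ut ` {..k})) (state ?U ?ut k))" G]
 have a: "N.L2 (state ?U ?ut k) & N.L2 (?U k) & N.L2 (?ut k) & ?U k : bm (generated_by (Prob \<mu>0) (yR \<mu>0 ?U ?ut ` {..k})) &
  ?ut k : bm (generated_by (Prob \<mu>0) (yL ?U ?ut ` {..k} Un yR \<mu>0 ?U ?ut ` {..k})) &
  (AE s in Prob \<mu>0. vec_cond_exp (Prob \<mu>0) (generated_by (Prob \<mu>0) (yR \<mu>0 ?U ?ut ` {..k})) (?ut k) s = 0)" for k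
 proof (rule *)
  show "state ?U ?ut 0 = fst" by simp
  show "state ?U ?ut (Suc k) = (%s. A *v state ?U ?ut k s+hcat BL BR *v ?U k s+BL *v ?ut k s+w k (snd s))" for k by simp
  show "yL ?U ?ut k = (%s. C *v state ?U ?ut k s+v k (snd s))" for k by (simp add: yL_def fun_eq_iff)
  show "yR \<mu>0 ?U ?ut k = (%s. eta k (snd s) *\<^sub>R vec_cond_exp (Prob \<mu>0)
    (generated_by (Prob \<mu>0) (yL ?U ?ut ` {..k} Un yR \<mu>0 ?U ?ut ` {..<k})) (state ?U ?ut k) s)" for k by (rule yR.simps)
 qed (rule feedback_law_eq[OF f g]; assumption)+
 show "N.L2 (?U k)" "N.L2 (?ut k)" using a by blast+
 show "admissible \<mu>0 ?U ?ut" unfolding admissible_def FR_def FL_def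
  by (intro allI conjI N.L2_integrable a[THEN conjunct2, THEN conjunct1]
    a[THEN conjunct2, THEN conjunct2, THEN conjunct1]
    a[THEN conjunct2, THEN conjunct2, THEN conjunct2, THEN conjunct1]
    a[THEN conjunct2, THEN conjunct2, THEN conjunct2, THEN conjunct2, THEN conjunct1]
    a[THEN conjunct2, THEN conjunct2, THEN conjunct2, THEN conjunct2, THEN conjunct2])
qed

text \<open>A competitor either has a control without second moment, and then infinite cost, or its
  cost is bounded below by the limiting average of the filter rate. Both loops share this average
  because the filter covariances do not depend on the controls.\<close>

theorem feedback_optimal: assumes sol: "stabilizing_solution A BL BR Q RL RR \<mu> p Z X S"
  and f: "feedback_law (K_gain A (hcat BL BR) (block_diag RL RR) Z) (Kbar_gain A (hcat BL BR) (block_diag RL RR) Z S)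
   (K_gain A BL RL (Theta_mat p Z X)) U ut" shows "optimal_stabilizing Q RL RR \<mu> U ut" proof -
 let ?B = "hcat BL BR" and ?R = "block_diag RL RR"
 let ?K = "K_gain A ?B ?R Z" and ?Kb = "Kbar_gain A ?B ?R Z S"
 let ?G = "K_gain A BL RL (Theta_mat p Z X)"
 let ?x = "%\<mu>0. state (U \<mu>0) (ut \<mu>0)" and ?yl = "%\<mu>0. yL (U \<mu>0) (ut \<mu>0)" and ?yr = "%\<mu>0. yR \<mu>0 (U \<mu>0) (ut \<mu>0)"
 have ob: "x = 0" if "!!k. Q *v (matpow A k *v x) = 0" for x by (rule obs) (rule that)
 have fac: "schur_stable (A-?B**?K)" "schur_stable (A-?B**K_gain A ?B ?R (Z+S))" "K_gain A ?B ?R (Z+S) = ?K+?Kb"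
  "tp X = X" "qf Z z <= qf X z" for z by (rule stabilizing_solution_facts[OF RL RR Q p01 mu _ sol], rule ob, assumption)+
 have iff: "pos_def Z & pos_def (Z+S) & pos_def (Theta_mat p Z X) & riccati_map A ?B (Q_mu \<mu> Q) ?R Z = Z &
  riccati_map A ?B Q ?R (Z+S) = Z+S &
  X = riccati_map A BL (Q_mu \<mu> Q) RL (Theta_mat p Z X) & schur_stable (sqrt p *\<^sub>R (A-BL**?G))"
  using sol unfolding stabilizing_solution_iff[OF RL RR Q p01(1)] .
 have lqg: "lqg (Prob \<mu>0) fst wP vP eP m W Qw Qv p A C BL BR U' ut' (state U' ut') (yL U' ut') (yR \<mu>0 U' ut') Q RL RR \<mu> Z (Z+S) X"
  if "gaussian_law \<mu>0 m W" "admissible \<mu>0 U' ut'" for \<mu>0 m W U' ut'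
  using loop_run[OF that] iff fac(4,5) Q mu RL RR unfolding lqg_def lqg_axioms_def by blast
 have fb: "feedback (Prob \<mu>0) fst wP vP eP m W Qw Qv p A C BL BR (U \<mu>0) (ut \<mu>0) (?x \<mu>0) (?yl \<mu>0) (?yr \<mu>0) Q RL RR \<mu> Z (Z+S) X ?K ?Kb ?G"
  if g: "gaussian_law \<mu>0 m W" for \<mu>0 m W proof -
  interpret L: lqg "Prob \<mu>0" fst wP vP eP m W Qw Qv p A C BL BR "U \<mu>0" "ut \<mu>0" "?x \<mu>0" "?yl \<mu>0" "?yr \<mu>0" Q RL RR \<mu> Z "Z+S" X
   by (rule lqg[OF g feedback_run(1)[OF f g]])
  show ?thesis proof unfold_locales
   show "K_gain A ?B ?R (Z+S) = ?K+?Kb" by (rule fac(3))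
   show "schur_stable (A-?B**?K)" by (rule fac(1))
   show "schur_stable (A-?B**(?K+?Kb))" using fac(2) unfolding fac(3) .
   show "schur_stable (sqrt p *\<^sub>R (A-BL**?G))" using iff by blast
   show "detectable A C" by (rule det)
   show "L.L2 (U \<mu>0 k)" "L.L2 (ut \<mu>0 k)" for k by (rule feedback_run(2,3)[OF f g])+
  qed (simp_all add: L.xr_def, (rule feedback_law_eq[OF f g]; assumption)+)
 qed have "stabilizing U ut" unfolding stabilizing_def proof (intro allI impI conjI)
  fix \<mu>0 and m :: "real^'n" and W assume g: "gaussian_law \<mu>0 m W"
  show "admissible \<mu>0 (U \<mu>0) (ut \<mu>0)" by (rule feedback_run(1)[OF f g])
  interpret F: feedback "Prob \<mu>0" fst wP vP eP m W Qw Qv p A C BL BR "U \<mu>0" "ut \<mu>0" "?x \<mu>0" "?yl \<mu>0" "?yr \<mu>0" Q RL RR \<mu> Z "Z+S" X ?K ?Kb ?G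
   by (rule fb[OF g])
  obtain b where b: "!!k. F.msq (mat 1) (?x \<mu>0 k) <= b" using F.state_bounded by blast
  have "limsup (%k. \<integral>\<^sup>+ s. ennreal (?x \<mu>0 k s \<bullet> ?x \<mu>0 k s) \<partial>Prob \<mu>0) <= ennreal b"
   unfolding F.second_moment_eq[OF F.Lx] by (rule Limsup_bounded) (simp add: b ennreal_leI)
  thus "limsup (%k. \<integral>\<^sup>+ s. ennreal (?x \<mu>0 k s \<bullet> ?x \<mu>0 k s) \<partial>Prob \<mu>0) < \<infinity>"
   using ennreal_less_top[of b] by (auto intro: order.strict_trans1)
 qed moreover have "EX J::real. average_cost Q RL RR \<mu> \<mu>0 (U \<mu>0) (ut \<mu>0) ----> ereal J &
   (ALL U' ut' J'. stabilizing U' ut' & average_cost Q RL RR \<mu> \<mu>0 (U' \<mu>0) (ut' \<mu>0) ----> J' --> ereal J <= J')"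
  if g: "gaussian_law \<mu>0 m W" for \<mu>0 m W proof -
  interpret F: feedback "Prob \<mu>0" fst wP vP eP m W Qw Qv p A C BL BR "U \<mu>0" "ut \<mu>0" "?x \<mu>0" "?yl \<mu>0" "?yr \<mu>0" Q RL RR \<mu> Z "Z+S" X ?K ?Kb ?G
   by (rule fb[OF g])
  obtain J where J: "(%N. (SUM k<=N. filter_rate A C Qw Qv W (Q_mu \<mu> Q) (Theta_mat p Z X) k)/real N) ----> J"
   using filter_rate_average[OF F.psd_noise(2,3,1) det] by blast
  show ?thesis proof (intro exI conjI allI impI)
   have "average_cost Q RL RR \<mu> \<mu>0 (U \<mu>0) (ut \<mu>0) = F.avg"
    by (rule ext) (simp add: average_cost_def F.avg_def F.running_def F.mn_def)
   thus "average_cost Q RL RR \<mu> \<mu>0 (U \<mu>0) (ut \<mu>0) ----> ereal J" using F.avg_limit[OF J] by simp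
   fix U' ut' J' assume *: "stabilizing U' ut' & average_cost Q RL RR \<mu> \<mu>0 (U' \<mu>0) (ut' \<mu>0) ----> J'"
   let ?U = "U' \<mu>0" and ?ut = "ut' \<mu>0"
   have ad: "admissible \<mu>0 ?U ?ut"
    and l: "limsup (%k. \<integral>\<^sup>+ s. ennreal (state ?U ?ut k s \<bullet> state ?U ?ut k s) \<partial>Prob \<mu>0) < \<infinity>"
    using * g unfolding stabilizing_def by blast+
   interpret L: lqg "Prob \<mu>0" fst wP vP eP m W Qw Qv p A C BL BR ?U ?ut "state ?U ?ut"
    "yL ?U ?ut" "yR \<mu>0 ?U ?ut" Q RL RR \<mu> Z "Z+S" X by (rule lqg[OF g ad])
   have "average_cost Q RL RR \<mu> \<mu>0 ?U ?ut = L.avg"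
    by (rule ext) (simp add: average_cost_def L.avg_def L.running_def L.mn_def)
   hence c: "L.avg ----> J'" using * by simp
   show "ereal J <= J'" proof (cases "ALL k. F.L2 (?U k) & F.L2 (?ut k)")
    case True obtain N b where b: "!!k. N <= k ==> F.L2 (state ?U ?ut k) & F.msq (mat 1) (state ?U ?ut k) <= b"
     using F.limsup_second_moment[OF borel_measurable_integrable[OF L.x_integrable] l] by blast
    obtain d where d: "0 <= d" "!!k. F.L2 (state ?U ?ut k) ==> L.V k <= d*F.msq (mat 1) (state ?U ?ut k)"
     using L.V_le_msq by blast
    have "L.V k <= d*b" if "N <= k" for k
     using d(2)[of k] b[OF that] mult_left_mono[of "F.msq (mat 1) (state ?U ?ut k)" b d] d(1) by linarith
    with True show ?thesis by (intro L.avg_lower[OF _ _ J _ c, of N "d*b"]) auto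
   next case False then obtain j where j: "~ (F.L2 (?U j) & F.L2 (?ut j))" by blast
    have "EVT N. L.avg N = \<infinity>"
     using eventually_ge_at_top[of "Suc j"] by eventually_elim (rule L.avg_infinite[OF j]; simp)
    hence "(%_. \<infinity>) ----> J'" using c by (simp add: tendsto_cong)
    hence "J' = \<infinity>" using tendsto_unique[OF _ _ tendsto_const] by (metis sequentially_bot)
    thus ?thesis by simp
   qed qed qed ultimately show ?thesis unfolding optimal_stabilizing_def by blast
qed

lemma causality: assumes "!!j. j < k ==> U j = U' j" "!!j. j < k ==> ut j = ut' j"
 shows "i <= k ==> state U ut i = state U' ut' i" "i <= k ==> yL U ut i = yL U' ut' i"
  "i <= k ==> yR \<mu>0 U ut i = yR \<mu>0 U' ut' i" proof -
 have st: "i <= k ==> state U ut i = state U' ut' i" for i by (induction i) (auto simp: assms)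
 have yl: "i <= k ==> yL U ut i = yL U' ut' i" for i by (rule ext) (simp add: yL_def st)
 have yr: "i <= k ==> yR \<mu>0 U ut i = yR \<mu>0 U' ut' i" for i proof (induction i rule: less_induct) case (less i)
  have "yL U ut ` {..i} = yL U' ut' ` {..i}" using yl less.prems by (intro image_cong) auto
  moreover have "yR \<mu>0 U ut ` {..<i} = yR \<mu>0 U' ut' ` {..<i}" using less by (intro image_cong) auto
  ultimately show ?case unfolding yR.simps[of \<mu>0 U ut i] yR.simps[of \<mu>0 U' ut' i] using st[OF less.prems] by simp
 qed show "i <= k ==> state U ut i = state U' ut' i" "i <= k ==> yL U ut i = yL U' ut' i"
  "i <= k ==> yR \<mu>0 U ut i = yR \<mu>0 U' ut' i" by (rule st yl yr; assumption)+
qed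

lemma causality_estimates: assumes "!!j. j < k ==> U j = U' j" "!!j. j < k ==> ut j = ut' j"
 shows "xhatR \<mu>0 U ut k = xhatR \<mu>0 U' ut' k" "xhatL \<mu>0 U ut k = xhatL \<mu>0 U' ut' k" proof -
 note c = causality[OF assms]
 have "yL U ut ` {..k} = yL U' ut' ` {..k}" "yR \<mu>0 U ut ` {..k} = yR \<mu>0 U' ut' ` {..k}"
  using c(2,3) by (auto intro!: image_cong)
 thus "xhatR \<mu>0 U ut k = xhatR \<mu>0 U' ut' k" "xhatL \<mu>0 U ut k = xhatL \<mu>0 U' ut' k"
  using c(1)[of k] by (simp_all add: xhatR_def xhatL_def FR_def FL_def)
qed

text \<open>The law refers to estimates formed in the very loop that it defines. By causality these
  depend on earlier controls only, so \<open>sched\<close> fixes the controls one time after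
  another, with zero controls as placeholders for the times still open.\<close>

lemma feedback_law_exists: "EX U ut. feedback_law K Kbar G U ut" proof -
 define next_U where "next_U \<mu>0 k c = (%s.-(K *v xhatR \<mu>0 (fst c) (snd c) k s)
 -Kbar *v integral\<^sup>L (Prob \<mu>0) (xhatR \<mu>0 (fst c) (snd c) k))" for \<mu>0 k c
 define next_ut where "next_ut \<mu>0 k c = (%s.-(G *v (xhatL \<mu>0 (fst c) (snd c) k s-xhatR \<mu>0 (fst c) (snd c) k s)))" for \<mu>0 k c
 define sched where "sched \<mu>0 = rec_nat ((%_ _. 0, %_ _. 0))
  (%k c. ((fst c)(k := next_U \<mu>0 k c), (snd c)(k := next_ut \<mu>0 k c)))" for \<mu>0
 have sSuc: "sched \<mu>0 (Suc k) = ((fst (sched \<mu>0 k))(k := next_U \<mu>0 k (sched \<mu>0 k)), (snd (sched \<mu>0 k))(k := next_ut \<mu>0 k (sched \<mu>0 k)))" for \<mu>0 k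
  by (simp add: sched_def)
 define U where "U \<mu>0 k = fst (sched \<mu>0 (Suc k)) k" for \<mu>0 k
 define ut where "ut \<mu>0 k = snd (sched \<mu>0 (Suc k)) k" for \<mu>0 k
 have agree: "j < k ==> U \<mu>0 j = fst (sched \<mu>0 k) j & ut \<mu>0 j = snd (sched \<mu>0 k) j" for \<mu>0 j k
  by (induction k) (auto simp: less_Suc_eq sSuc U_def ut_def)
 have "feedback_law K Kbar G U ut" unfolding feedback_law_def proof (intro allI impI ballI)
  fix \<mu>0 :: "(real^'n) measure" and k s
  have e: "xhatR \<mu>0 (U \<mu>0) (ut \<mu>0) k = xhatR \<mu>0 (fst (sched \<mu>0 k)) (snd (sched \<mu>0 k)) k"
   "xhatL \<mu>0 (U \<mu>0) (ut \<mu>0) k = xhatL \<mu>0 (fst (sched \<mu>0 k)) (snd (sched \<mu>0 k)) k"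
   by (rule causality_estimates; simp add: agree)+
  have "U \<mu>0 k = next_U \<mu>0 k (sched \<mu>0 k)" "ut \<mu>0 k = next_ut \<mu>0 k (sched \<mu>0 k)"
   unfolding U_def[of \<mu>0 k] ut_def[of \<mu>0 k] sSuc by simp_all
  thus "U \<mu>0 k s = - (K *v xhatR \<mu>0 (U \<mu>0) (ut \<mu>0) k s)-Kbar *v integral\<^sup>L (Prob \<mu>0) (xhatR \<mu>0 (U \<mu>0) (ut \<mu>0) k) &
   ut \<mu>0 k s = - (G *v (xhatL \<mu>0 (U \<mu>0) (ut \<mu>0) k s-xhatR \<mu>0 (U \<mu>0) (ut \<mu>0) k s))"
   unfolding e by (simp add: next_U_def next_ut_def)
 qed thus ?thesis by blast
qed

end

theorem theorem3:
  fixes A C Q Qw Qv :: "real^'n^'n"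
    and BL :: "real^'m1^'n" and BR :: "real^'m2^'n"
    and RL :: "real^'m1^'m1" and RR :: "real^'m2^'m2"
    and D :: "real^('n + 'n)^'d"
    and \<mu> p :: real
    and M :: "'w measure"
    and w v :: "nat \<Rightarrow> 'w \<Rightarrow> real^'n" and eta :: "nat \<Rightarrow> 'w \<Rightarrow> real"
  assumes "ncs_noise M p Qw Qv w v eta"
    and "0 \<le> \<mu>"
    and "psd Q" "pos_def RL" "pos_def RR"
    and "block_diag (Q_mu \<mu> Q) Q = transpose D ** D" "psd (block_diag (Q_mu \<mu> Q) Q)"
    and "observable (block_diag A A) (psd_sqrt (block_diag (Q_mu \<mu> Q) Q))"
    and "detectable A C"
    and "stabilizable A Qw"
  shows "(ncs.ms_bounded A BL BR C M w v eta \<longleftrightarrow> (\<exists>Z X S. stabilizing_solution A BL BR Q RL RR \<mu> p Z X S)) \<and>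
    (\<forall>Z X S. stabilizing_solution A BL BR Q RL RR \<mu> p Z X S \<longrightarrow>
       (let B = hcat BL BR; R = block_diag RL RR;
            K = K_gain A B R Z; Kbar = Kbar_gain A B R Z S;
            G = matrix_inv (Lambda_mat BL RL (Theta_mat p Z X)) ** L_mat A BL (Theta_mat p Z X)
        in (\<exists>U ut. ncs.feedback_law A BL BR C M w v eta K Kbar G U ut) \<and>
           (\<forall>U ut. ncs.feedback_law A BL BR C M w v eta K Kbar G U ut \<longrightarrow>
              ncs.optimal_stabilizing A BL BR C M w v eta Q RL RR \<mu> U ut)))"
proof - interpret N: ncs_noise M p Qw Qv w v eta by (rule assms(1))
 have obs: "x = 0" if "!!k. Q *v (matpow A k *v x) = 0" for x by (rule observable_from_block[OF assms(8,7)]) (rule that)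
 interpret P: ncs_problem M p Qw Qv w v eta A C Q BL BR RL RR \<mu> by unfold_locales (use assms obs in blast)+
 let ?B = "hcat BL BR" and ?R = "block_diag RL RR"
 have G: "matrix_inv (Lambda_mat BL RL (Theta_mat p Z X))**L_mat A BL (Theta_mat p Z X) = K_gain A BL RL (Theta_mat p Z X)"
  for Z X :: "real^'n^'n" by (simp add: K_gain_def L_mat_def Lambda_mat_def Upsilon_mat_def mm_assoc)
 have opt: "P.optimal_stabilizing Q RL RR \<mu> U ut"
  if "stabilizing_solution A BL BR Q RL RR \<mu> p Z X S"
   "P.feedback_law (K_gain A ?B ?R Z) (Kbar_gain A ?B ?R Z S) (K_gain A BL RL (Theta_mat p Z X)) U ut" for Z X S U ut
  by (rule P.feedback_optimal[OF that])
 have "P.ms_bounded" if sol: "stabilizing_solution A BL BR Q RL RR \<mu> p Z X S" for Z X S proof -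
  obtain U ut where "P.feedback_law (K_gain A ?B ?R Z) (Kbar_gain A ?B ?R Z S) (K_gain A BL RL (Theta_mat p Z X)) U ut"
   using P.feedback_law_exists by blast
  hence "P.stabilizing U ut" using opt[OF sol] unfolding P.optimal_stabilizing_def by blast
  thus ?thesis unfolding P.ms_bounded_def by blast
 qed thus ?thesis unfolding Let_def G using P.necessity P.feedback_law_exists opt by blast
qed

end
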